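(* Let $\alpha\in(0,1)$, let $d\in\{2,3,4\}$, let $\Omega\subset\mathbb{R}^d$ be a bounded domain with sufficiently smooth boundary, let $\eta\in\mathbb{R}^d$ be a constant vector, and let $H(u)=(\eta\cdot\nabla)u+\nabla\cdot F(u)$ with $F(u)=(u^2,u^2,\dots,u^2)\in\mathbb{R}^d$. Let $u_0\in D^1(\Omega)$ and let $u$ be the unique mild solution of the problem $$\partial_t^\alpha u-\partial_t^\alpha\Delta u-\Delta u=H(u)\ \text{ in }\Omega\times(0,\infty),\qquad u=0\ \text{ on }\partial\Omega\times(0,\infty),\qquad u(\cdot,0)=u_0\ \text{ in }\Omega.$$ Define $$\mathscr{T}_{\max}:=\sup\{\mathscr{T}>0 : u\text{ exists uniquely on }[0,\mathscr{T}]\},$$ i.e. the supremum of those $\mathscr{T}>0$ for which the problem has a unique mild solution in $C([0,\mathscr{T}]\to D^1(\Omega))$. Then either $\mathscr{T}_{\max}=\infty$ or $\lim_{t\to\mathscr{T}_{\max}^-}\|u(t)\|_{D^1(\Omega)}=\infty$.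
   Context: $\partial_t^\alpha$ is the Caputo time derivative of order $\alpha$. Let $0<\theta_1\le\theta_2\le\dots$ be the eigenvalues of $-\Delta$ on $\Omega$ with homogeneous Dirichlet condition, and $\{\phi_k\}_{k\in\mathbb{N}}$ corresponding eigenfunctions forming a complete orthonormal system of $L^2(\Omega)$. For $\nu\ge 0$, $D^\nu(\Omega)=\{w\in L^2(\Omega): \|w\|_{D^\nu(\Omega)}^2=\sum_{k}\theta_k^\nu\langle w,\phi_k\rangle^2<\infty\}$, and $D^{-\nu}(\Omega)$ is its dual space with norm $\big(\sum_k\theta_k^{-\nu}\langle w,\phi_k\rangle^2\big)^{1/2}$, where the duality pairing $\langle w,v\rangle$ equals $\int_\Omega wv\,dz$ when $w\in L^2(\Omega)$. For $u\in D^1(\Omega)$, $H(u)$ is regarded as an element of $D^{-1}(\Omega)$. For a Banach space $X$ and a compact interval $I$, $C(I\to X)$ is the space of continuous functions $w:I\to X$ with the sup norm. The Mittag-Leffler functions are $E_{\alpha,\zeta}(z)=\sum_{k=0}^\infty z^k/\Gamma(\alpha k+\zeta)$ and $E_\alpha=E_{\alpha,1}$. Define $$\mathscr{S}(t)w=\sum_{k=1}^\infty E_\alpha\Big(\frac{-\theta_kt^\alpha}{1+\theta_k}\Big)\langle w,\phi_k\rangle\phi_k,\qquad \mathscr{R}(t)w=\sum_{k=1}^\infty\frac{t^{\alpha-1}}{1+\theta_k}E_{\alpha,\alpha}\Big(\frac{-\theta_kt^\alpha}{1+\theta_k}\Big)\langle w,\phi_k\rangle\phi_k .$$ A mild solution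 on $[0,\mathscr{T}]$ is a function $u$ satisfying, for $t\in[0,\mathscr{T}]$, $$u(t)=\mathscr{S}(t)u_0+\int_0^t\mathscr{R}(t-\tau)H(u(\tau))\,d\tau .$$ *)

theory Defs
  imports "HOL-Analysis.Analysis"
begin

text \<open>Elements of function spaces over \<open>\<Omega>\<close> are represented by functions on the whole space; their
  values outside \<open>\<Omega>\<close> are irrelevant, and equality means equality almost everywhere in \<open>\<Omega>\<close>.\<close>

definition gradient :: "(real ^ 'n \<Rightarrow> real) \<Rightarrow> real ^ 'n \<Rightarrow> real ^ 'n" where
  "gradient f x = (\<chi> i. frechet_derivative f (at x) (axis i 1))"

text \<open>Only meaningful for open \<open>S\<close>.\<close>
fun C_k_on :: "nat \<Rightarrow> (real ^ 'n) set \<Rightarrow> (real ^ 'n \<Rightarrow> real) \<Rightarrow> bool" where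
  "C_k_on 0 S f \<longleftrightarrow> continuous_on S f"
| "C_k_on (Suc k) S f \<longleftrightarrow> f differentiable_on S \<and> (\<forall>i. C_k_on k S (\<lambda>x. gradient f x $ i))"

text \<open>Near every boundary point, \<open>\<Omega>\<close> is a strict sublevel set of a \<open>C\<^sup>k\<close> defining function with
  nonvanishing gradient, so that \<open>\<Omega>\<close> lies locally on one side of its boundary.\<close>
definition has_C_k_boundary :: "nat \<Rightarrow> (real ^ 'n) set \<Rightarrow> bool" where
  "has_C_k_boundary k \<Omega> \<longleftrightarrow>
     (\<forall>p \<in> frontier \<Omega>. \<exists>U \<rho>. open U \<and> p \<in> U \<and> C_k_on k U \<rho> \<and>
        (\<forall>x\<in>U. gradient \<rho> x \<noteq> 0) \<and> \<Omega> \<inter> U = {x \<in> U. \<rho> x < 0} \<and> frontier \<Omega> \<inter> U = {x \<in> U. \<rho> x = 0})"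

definition bounded_domain :: "(real ^ 'n) set \<Rightarrow> bool" where
  "bounded_domain \<Omega> \<longleftrightarrow> open \<Omega> \<and> connected \<Omega> \<and> \<Omega> \<noteq> {} \<and> bounded \<Omega>"


subsection \<open>Lebesgue and Sobolev spaces\<close>

definition L2 :: "(real ^ 'n) set \<Rightarrow> (real ^ 'n \<Rightarrow> real) set" where
  "L2 \<Omega> = {w \<in> borel_measurable (lebesgue_on \<Omega>). integrable (lebesgue_on \<Omega>) (\<lambda>x. (w x)\<^sup>2)}"

definition L2_inner :: "(real ^ 'n) set \<Rightarrow> (real ^ 'n \<Rightarrow> real) \<Rightarrow> (real ^ 'n \<Rightarrow> real) \<Rightarrow> real" where
  "L2_inner \<Omega> w v = (LINT x|lebesgue_on \<Omega>. w x * v x)"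

definition L2_norm :: "(real ^ 'n) set \<Rightarrow> (real ^ 'n \<Rightarrow> real) \<Rightarrow> real" where
  "L2_norm \<Omega> w = sqrt (L2_inner \<Omega> w w)"

text \<open>The sum in \<open>L\<^sup>2(\<Omega>)\<close> of a convergent series of functions (some representative of it).\<close>
definition L2_suminf :: "(real ^ 'n) set \<Rightarrow> (nat \<Rightarrow> real ^ 'n \<Rightarrow> real) \<Rightarrow> real ^ 'n \<Rightarrow> real" where
  "L2_suminf \<Omega> f =
     (SOME s. s \<in> L2 \<Omega> \<and> (\<lambda>n. L2_norm \<Omega> (\<lambda>x. (\<Sum>k<n. f k x) - s x)) \<longlonglongrightarrow> 0)"

definition test_functions :: "(real ^ 'n) set \<Rightarrow> (real ^ 'n \<Rightarrow> real) set" where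
  "test_functions \<Omega> =
     {\<psi>. (\<forall>k. C_k_on k UNIV \<psi>) \<and> compact (closure {x. \<psi> x \<noteq> 0}) \<and> closure {x. \<psi> x \<noteq> 0} \<subseteq> \<Omega>}"

definition has_weak_gradient ::
    "(real ^ 'n) set \<Rightarrow> (real ^ 'n \<Rightarrow> real) \<Rightarrow> (real ^ 'n \<Rightarrow> real ^ 'n) \<Rightarrow> bool" where
  "has_weak_gradient \<Omega> w g \<longleftrightarrow>
     (\<forall>K. compact K \<and> K \<subseteq> \<Omega> \<longrightarrow> w absolutely_integrable_on K \<and> g absolutely_integrable_on K) \<and>
     (\<forall>\<psi> \<in> test_functions \<Omega>.
        (LINT x|lebesgue_on \<Omega>. w x *\<^sub>R gradient \<psi> x) = - (LINT x|lebesgue_on \<Omega>. \<psi> x *\<^sub>R g x))"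

text \<open>The weak gradient is determined almost everywhere in \<open>\<Omega>\<close>.\<close>
definition weak_gradient :: "(real ^ 'n) set \<Rightarrow> (real ^ 'n \<Rightarrow> real) \<Rightarrow> real ^ 'n \<Rightarrow> real ^ 'n" where
  "weak_gradient \<Omega> w = (SOME g. has_weak_gradient \<Omega> w g)"

definition H1 :: "(real ^ 'n) set \<Rightarrow> (real ^ 'n \<Rightarrow> real) set" where
  "H1 \<Omega> = {w \<in> L2 \<Omega>. \<exists>g. has_weak_gradient \<Omega> w g \<and> (\<forall>i. (\<lambda>x. g x $ i) \<in> L2 \<Omega>)}"

definition H1_norm :: "(real ^ 'n) set \<Rightarrow> (real ^ 'n \<Rightarrow> real) \<Rightarrow> real" where
  "H1_norm \<Omega> w =
     sqrt ((LINT x|lebesgue_on \<Omega>. (w x)\<^sup>2) + (LINT x|lebesgue_on \<Omega>. (norm (weak_gradient \<Omega> w x))\<^sup>2))"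

definition H1_0 :: "(real ^ 'n) set \<Rightarrow> (real ^ 'n \<Rightarrow> real) set" where
  "H1_0 \<Omega> = {w \<in> H1 \<Omega>. \<exists>\<psi>. (\<forall>n. \<psi> n \<in> test_functions \<Omega>) \<and>
                            (\<lambda>n. H1_norm \<Omega> (\<lambda>x. \<psi> n x - w x)) \<longlonglongrightarrow> 0}"


subsection \<open>Dirichlet eigenvalues and the spaces \<open>D\<^sup>\<nu>(\<Omega>)\<close>\<close>

definition dirichlet_eigenfunction ::
    "(real ^ 'n) set \<Rightarrow> real \<Rightarrow> (real ^ 'n \<Rightarrow> real) \<Rightarrow> bool" where
  "dirichlet_eigenfunction \<Omega> \<mu> \<phi> \<longleftrightarrow>
     \<phi> \<in> H1_0 \<Omega> \<and> L2_norm \<Omega> \<phi> \<noteq> 0 \<and>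
     (\<forall>v \<in> H1_0 \<Omega>. (LINT x|lebesgue_on \<Omega>. weak_gradient \<Omega> \<phi> x \<bullet> weak_gradient \<Omega> v x)
                      = \<mu> * L2_inner \<Omega> \<phi> v)"

definition complete_orthonormal_system ::
    "(real ^ 'n) set \<Rightarrow> (nat \<Rightarrow> real ^ 'n \<Rightarrow> real) \<Rightarrow> bool" where
  "complete_orthonormal_system \<Omega> \<phi> \<longleftrightarrow>
     (\<forall>k. \<phi> k \<in> L2 \<Omega>) \<and>
     (\<forall>j k. L2_inner \<Omega> (\<phi> j) (\<phi> k) = (if j = k then 1 else 0)) \<and>
     (\<forall>w \<in> L2 \<Omega>. (\<forall>k. L2_inner \<Omega> w (\<phi> k) = 0) \<longrightarrow> (AE x in lebesgue_on \<Omega>. w x = 0))"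

text \<open>Eigenvalues are enumerated from index 0; completeness of the eigenfunctions forces every
  eigenvalue to be listed as often as its multiplicity.\<close>
definition dirichlet_eigensystem ::
    "(real ^ 'n) set \<Rightarrow> (nat \<Rightarrow> real) \<Rightarrow> (nat \<Rightarrow> real ^ 'n \<Rightarrow> real) \<Rightarrow> bool" where
  "dirichlet_eigensystem \<Omega> \<theta> \<phi> \<longleftrightarrow>
     0 < \<theta> 0 \<and> mono \<theta> \<and> (\<forall>k. dirichlet_eigenfunction \<Omega> (\<theta> k) (\<phi> k)) \<and>
     complete_orthonormal_system \<Omega> \<phi>"

definition D_space ::
    "(real ^ 'n) set \<Rightarrow> (nat \<Rightarrow> real) \<Rightarrow> (nat \<Rightarrow> real ^ 'n \<Rightarrow> real) \<Rightarrow> real \<Rightarrow> (real ^ 'n \<Rightarrow> real) set" where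
  "D_space \<Omega> \<theta> \<phi> \<nu> = {w \<in> L2 \<Omega>. summable (\<lambda>k. \<theta> k powr \<nu> * (L2_inner \<Omega> w (\<phi> k))\<^sup>2)}"

definition D_norm ::
    "(real ^ 'n) set \<Rightarrow> (nat \<Rightarrow> real) \<Rightarrow> (nat \<Rightarrow> real ^ 'n \<Rightarrow> real) \<Rightarrow> real \<Rightarrow> (real ^ 'n \<Rightarrow> real) \<Rightarrow> real" where
  "D_norm \<Omega> \<theta> \<phi> \<nu> w = sqrt (\<Sum>k. \<theta> k powr \<nu> * (L2_inner \<Omega> w (\<phi> k))\<^sup>2)"


subsection \<open>The nonlinearity\<close>

definition flux :: "(real ^ 'n \<Rightarrow> real) \<Rightarrow> real ^ 'n \<Rightarrow> real ^ 'n" where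
  "flux u x = (\<chi> i. (u x)\<^sup>2)"

text \<open>Elements of the dual space \<open>D\<^sup>-\<^sup>1(\<Omega>)\<close> are represented by their duality pairing \<open>v \<mapsto> \<langle>w, v\<rangle>\<close> with
  functions \<open>v\<close> in \<open>D\<^sup>1(\<Omega>)\<close>; a function \<open>w\<close> in \<open>L\<^sup>2(\<Omega>)\<close> is the functional \<^term>\<open>L2_inner \<Omega> w\<close>, and
  the divergence of a vector field is understood in the sense of distributions.\<close>
type_synonym 'n functional = "(real ^ 'n \<Rightarrow> real) \<Rightarrow> real"

definition weak_divergence :: "(real ^ 'n) set \<Rightarrow> (real ^ 'n \<Rightarrow> real ^ 'n) \<Rightarrow> 'n functional" where
  "weak_divergence \<Omega> G = (\<lambda>v. - (LINT x|lebesgue_on \<Omega>. G x \<bullet> weak_gradient \<Omega> v x))"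

definition H_op :: "(real ^ 'n) set \<Rightarrow> real ^ 'n \<Rightarrow> (real ^ 'n \<Rightarrow> real) \<Rightarrow> 'n functional" where
  "H_op \<Omega> \<eta> u =
     (\<lambda>v. L2_inner \<Omega> (\<lambda>x. \<eta> \<bullet> weak_gradient \<Omega> u x) v + weak_divergence \<Omega> (flux u) v)"


subsection \<open>Solution operators\<close>

definition mittag_leffler :: "real \<Rightarrow> real \<Rightarrow> real \<Rightarrow> real" where
  "mittag_leffler \<alpha> \<zeta> z = (\<Sum>k. z ^ k / Gamma (\<alpha> * real k + \<zeta>))"

definition S_op ::
    "(real ^ 'n) set \<Rightarrow> (nat \<Rightarrow> real) \<Rightarrow> (nat \<Rightarrow> real ^ 'n \<Rightarrow> real) \<Rightarrow> real \<Rightarrow>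
     real \<Rightarrow> (real ^ 'n \<Rightarrow> real) \<Rightarrow> real ^ 'n \<Rightarrow> real" where
  "S_op \<Omega> \<theta> \<phi> \<alpha> t w =
     L2_suminf \<Omega> (\<lambda>k x. mittag_leffler \<alpha> 1 (- \<theta> k * t powr \<alpha> / (1 + \<theta> k)) * L2_inner \<Omega> w (\<phi> k) * \<phi> k x)"

definition R_op ::
    "(real ^ 'n) set \<Rightarrow> (nat \<Rightarrow> real) \<Rightarrow> (nat \<Rightarrow> real ^ 'n \<Rightarrow> real) \<Rightarrow> real \<Rightarrow>
     real \<Rightarrow> 'n functional \<Rightarrow> real ^ 'n \<Rightarrow> real" where
  "R_op \<Omega> \<theta> \<phi> \<alpha> t w =
     L2_suminf \<Omega> (\<lambda>k x. t powr (\<alpha> - 1) / (1 + \<theta> k)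
        * mittag_leffler \<alpha> \<alpha> (- \<theta> k * t powr \<alpha> / (1 + \<theta> k)) * w (\<phi> k) * \<phi> k x)"


subsection \<open>Functions of time with values in a function space\<close>

text \<open>A normed function space is given by a carrier \<open>X\<close> and a seminorm \<open>N\<close> that identifies functions equal
  almost everywhere. The Bochner integral is defined as in \<open>has_bochner_integral\<close>, which
  is not applicable since \<open>X\<close> is not a type; the measure \<open>M\<close> is meant to be finite.\<close>

definition simple_integral_fun :: "real measure \<Rightarrow> (real \<Rightarrow> 'a \<Rightarrow> real) \<Rightarrow> 'a \<Rightarrow> real" where
  "simple_integral_fun M s = (\<lambda>x. \<Sum>y \<in> s ` space M. measure M (s -` {y} \<inter> space M) * y x)"

definition has_bochner_integral_in ::
    "('a \<Rightarrow> real) set \<Rightarrow> (('a \<Rightarrow> real) \<Rightarrow> real) \<Rightarrow> real measure \<Rightarrow> (real \<Rightarrow> 'a \<Rightarrow> real) \<Rightarrow> ('a \<Rightarrow> real) \<Rightarrow> bool"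
  where
  "has_bochner_integral_in X N M f I \<longleftrightarrow>
     I \<in> X \<and> (\<forall>\<tau> \<in> space M. f \<tau> \<in> X) \<and>
     (\<exists>s. (\<forall>i. simple_function M (s i) \<and> s i ` space M \<subseteq> X) \<and>
          (\<forall>i. (\<lambda>\<tau>. N (\<lambda>x. f \<tau> x - s i \<tau> x)) \<in> borel_measurable M) \<and>
          (\<lambda>i. \<integral>\<^sup>+ \<tau>. ennreal (N (\<lambda>x. f \<tau> x - s i \<tau> x)) \<partial>M) \<longlonglongrightarrow> 0 \<and>
          (\<lambda>i. N (\<lambda>x. simple_integral_fun M (s i) x - I x)) \<longlonglongrightarrow> 0)"

definition continuous_into ::
    "('a \<Rightarrow> real) set \<Rightarrow> (('a \<Rightarrow> real) \<Rightarrow> real) \<Rightarrow> real set \<Rightarrow> (real \<Rightarrow> 'a \<Rightarrow> real) \<Rightarrow> bool" where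
  "continuous_into X N J u \<longleftrightarrow>
     (\<forall>t\<in>J. u t \<in> X \<and> ((\<lambda>s. N (\<lambda>x. u s x - u t x)) \<longlongrightarrow> 0) (at t within J))"


subsection \<open>Mild solutions\<close>

definition mild_solution ::
    "(real ^ 'n) set \<Rightarrow> (nat \<Rightarrow> real) \<Rightarrow> (nat \<Rightarrow> real ^ 'n \<Rightarrow> real) \<Rightarrow> real \<Rightarrow> real ^ 'n \<Rightarrow>
     (real ^ 'n \<Rightarrow> real) \<Rightarrow> real \<Rightarrow> (real \<Rightarrow> real ^ 'n \<Rightarrow> real) \<Rightarrow> bool" where
  "mild_solution \<Omega> \<theta> \<phi> \<alpha> \<eta> u\<^sub>0 T u \<longleftrightarrow>
     continuous_into (D_space \<Omega> \<theta> \<phi> 1) (D_norm \<Omega> \<theta> \<phi> 1) {0..T} u \<and>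
     (\<forall>t\<in>{0..T}. \<exists>I.
        has_bochner_integral_in (D_space \<Omega> \<theta> \<phi> 1) (D_norm \<Omega> \<theta> \<phi> 1) (lebesgue_on {0<..<t})
          (\<lambda>\<tau>. R_op \<Omega> \<theta> \<phi> \<alpha> (t - \<tau>) (H_op \<Omega> \<eta> (u \<tau>))) I \<and>
        (AE x in lebesgue_on \<Omega>. u t x = S_op \<Omega> \<theta> \<phi> \<alpha> t u\<^sub>0 x + I x))"

definition unique_mild_solution_exists ::
    "(real ^ 'n) set \<Rightarrow> (nat \<Rightarrow> real) \<Rightarrow> (nat \<Rightarrow> real ^ 'n \<Rightarrow> real) \<Rightarrow> real \<Rightarrow> real ^ 'n \<Rightarrow>
     (real ^ 'n \<Rightarrow> real) \<Rightarrow> real \<Rightarrow> bool" where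
  "unique_mild_solution_exists \<Omega> \<theta> \<phi> \<alpha> \<eta> u\<^sub>0 T \<longleftrightarrow>
     (\<exists>u. mild_solution \<Omega> \<theta> \<phi> \<alpha> \<eta> u\<^sub>0 T u \<and>
        (\<forall>v. mild_solution \<Omega> \<theta> \<phi> \<alpha> \<eta> u\<^sub>0 T v \<longrightarrow>
           (\<forall>t\<in>{0..T}. AE x in lebesgue_on \<Omega>. v t x = u t x)))"

definition T_max ::
    "(real ^ 'n) set \<Rightarrow> (nat \<Rightarrow> real) \<Rightarrow> (nat \<Rightarrow> real ^ 'n \<Rightarrow> real) \<Rightarrow> real \<Rightarrow> real ^ 'n \<Rightarrow>
     (real ^ 'n \<Rightarrow> real) \<Rightarrow> ereal" where
  "T_max \<Omega> \<theta> \<phi> \<alpha> \<eta> u\<^sub>0 =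
     (SUP T \<in> {T. 0 < T \<and> unique_mild_solution_exists \<Omega> \<theta> \<phi> \<alpha> \<eta> u\<^sub>0 T}. ereal T)"

end

theory Submission
  imports Defs "HOL-Real_Asymp.Real_Asymp"
begin

text \<open>The nonlinearity is energy neutral: \<open>\<langle>H(u), u\<rangle> = 0\<close>, as \<open>H(u)\<close> is the divergence of a polynomial in
  \<open>u\<close>, and in dimension at most four the embedding of \<open>D\<^sup>1\<close> into \<open>L\<^sup>4\<close> makes \<open>H\<close> locally Lipschitz
  from \<open>D\<^sup>1\<close> to \<open>D\<^sup>-\<^sup>1\<close>. In terms of the sequence \<open>y\<^sub>k = (1 + \<theta>\<^sub>k)\<^sup>1\<^sup>/\<^sup>2 \<langle>u, \<phi>\<^sub>k\<rangle>\<close> the equation becomes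
  \<open>\<partial>\<^sub>t\<^sup>\<alpha> y = A(y)\<close> with a locally Lipschitz field \<open>A\<close> on \<open>\<ell>\<^sup>2\<close>, because the factor \<open>1 - \<Delta>\<close> in front of the
  time derivative turns \<open>-\<Delta>\<close> into a bounded operator. The field is dissipative, \<open>y \<bullet> A(y) \<le> 0\<close>, which
  bounds the norm of a solution by that of its initial value. Hence unique solutions exist on every
  interval \<open>[0, T]\<close>, and the first alternative always holds.\<close>

subsection \<open>The space \<open>L\<^sup>2\<close>\<close>

text \<open>A solution is only known to be continuous in time, so dissipativity cannot be exploited
  by differentiating |y|^2. The norm bound is read off the integral equation instead: adding and
  subtracting \<kappa> y rewrites it with the resolvent kernel of parameter \<kappa>, and \<kappa>
  may be taken as large as one likes. This rests on the positivity of that kernel, which is proved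
  from its resolvent equation. Existence is obtained on all of [0, T] at once, without continuing
  local solutions: the field is cut off radially, the cut-off multiplies by a positive number and so
  keeps the sign of the inner product, and the norm bound shows afterwards that it was never active.
  Dimension four is critical for L^4, so the embedding comes from a Loomis-Whitney inequality with
  four factors; lower dimensions are padded with dummy variables at the price of the diameter of
  \<Omega>. The mild equation is compared with the differential equation coefficient by coefficient:
  the kernel of mode k is the resolvent for \<kappa> = \<theta>_k / (1 + \<theta>_k).\<close>

lemma L2_measurable: "w \<in> L2 \<Omega> \<Longrightarrow> w \<in> borel_measurable (lebesgue_on \<Omega>)"
  by (simp add: L2_def)

lemma L2_square_integrable: "w \<in> L2 \<Omega> \<Longrightarrow> integrable (lebesgue_on \<Omega>) (\<lambda>x. (w x)\<^sup>2)"
  by (simp add: L2_def)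

lemma L2_mult_integrable:
  assumes "w \<in> L2 \<Omega>" "v \<in> L2 \<Omega>"
  shows "integrable (lebesgue_on \<Omega>) (\<lambda>x. w x * v x)"
proof (rule Bochner_Integration.integrable_bound)
  show "integrable (lebesgue_on \<Omega>) (\<lambda>x. (w x)\<^sup>2 + (v x)\<^sup>2)"
    using assms by (intro Bochner_Integration.integrable_add L2_square_integrable)
  show "(\<lambda>x. w x * v x) \<in> borel_measurable (lebesgue_on \<Omega>)"
    using assms by (intro borel_measurable_times L2_measurable)
  have "\<bar>a * b\<bar> \<le> a\<^sup>2 + b\<^sup>2" for a b :: real
  proof -
    have "2 * (\<bar>a\<bar> * \<bar>b\<bar>) \<le> \<bar>a\<bar>\<^sup>2 + \<bar>b\<bar>\<^sup>2"
      using sum_squares_bound[of "\<bar>a\<bar>" "\<bar>b\<bar>"] by (simp add: mult.assoc)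
    moreover have "0 \<le> \<bar>a\<bar> * \<bar>b\<bar>" by simp
    ultimately have "\<bar>a\<bar> * \<bar>b\<bar> \<le> \<bar>a\<bar>\<^sup>2 + \<bar>b\<bar>\<^sup>2" by linarith
    then show ?thesis by (simp add: abs_mult)
  qed
  then show "AE x in lebesgue_on \<Omega>. norm (w x * v x) \<le> norm ((w x)\<^sup>2 + (v x)\<^sup>2)"
    by (auto intro!: AE_I2)
qed

lemma L2_zero: "(\<lambda>x. 0) \<in> L2 \<Omega>"
  by (simp add: L2_def)

lemma L2_scale: "w \<in> L2 \<Omega> \<Longrightarrow> (\<lambda>x. c * w x) \<in> L2 \<Omega>"
  by (auto simp: L2_def power_mult_distrib)

lemma L2_add:
  assumes "w \<in> L2 \<Omega>" "v \<in> L2 \<Omega>"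
  shows "(\<lambda>x. w x + v x) \<in> L2 \<Omega>"
proof -
  have "integrable (lebesgue_on \<Omega>) (\<lambda>x. (w x)\<^sup>2 + (v x)\<^sup>2 + 2 * (w x * v x))"
    using assms by (intro Bochner_Integration.integrable_add L2_square_integrable
        integrable_mult_right L2_mult_integrable)
  then show ?thesis
    using assms by (auto simp: L2_def power2_sum mult.assoc)
qed

lemma L2_diff:
  assumes "w \<in> L2 \<Omega>" "v \<in> L2 \<Omega>"
  shows "(\<lambda>x. w x - v x) \<in> L2 \<Omega>"
  using L2_add[OF assms(1) L2_scale[OF assms(2), of "-1"]] by simp

lemma L2_sum:
  assumes "\<And>k. k \<in> A \<Longrightarrow> f k \<in> L2 \<Omega>"
  shows "(\<lambda>x. \<Sum>k\<in>A. f k x) \<in> L2 \<Omega>"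
  using assms
  by (induction A rule: infinite_finite_induct) (auto simp: L2_zero intro: L2_add)

lemma L2_lincomb: "(\<And>k. f k \<in> L2 \<Omega>) \<Longrightarrow> (\<lambda>x. \<Sum>k\<in>A. c k * f k x) \<in> L2 \<Omega>"
  by (intro L2_sum L2_scale)

lemma L2_inner_commute: "L2_inner \<Omega> w v = L2_inner \<Omega> v w"
  by (simp add: L2_inner_def mult.commute)

lemma L2_inner_scale_left: "L2_inner \<Omega> (\<lambda>x. c * w x) v = c * L2_inner \<Omega> w v"
  by (simp add: L2_inner_def mult.assoc)

lemma L2_inner_add_left:
  assumes "w \<in> L2 \<Omega>" "v \<in> L2 \<Omega>" "z \<in> L2 \<Omega>"
  shows "L2_inner \<Omega> (\<lambda>x. w x + v x) z = L2_inner \<Omega> w z + L2_inner \<Omega> v z"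
  unfolding L2_inner_def
  using assms by (simp add: distrib_right L2_mult_integrable)

lemma L2_inner_diff_left:
  assumes "w \<in> L2 \<Omega>" "v \<in> L2 \<Omega>" "z \<in> L2 \<Omega>"
  shows "L2_inner \<Omega> (\<lambda>x. w x - v x) z = L2_inner \<Omega> w z - L2_inner \<Omega> v z"
  unfolding L2_inner_def
  using assms by (simp add: left_diff_distrib L2_mult_integrable)

lemma L2_inner_lincomb_left:
  assumes "\<And>k. f k \<in> L2 \<Omega>" "z \<in> L2 \<Omega>" "finite A"
  shows "L2_inner \<Omega> (\<lambda>x. \<Sum>k\<in>A. c k * f k x) z = (\<Sum>k\<in>A. c k * L2_inner \<Omega> (f k) z)"
  using assms(3)
proof (induction A rule: finite_induct)
  case empty
  then show ?case by (simp add: L2_inner_def)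
next
  case (insert a F)
  then show ?case
    using assms by (simp add: L2_inner_add_left L2_scale L2_lincomb L2_inner_scale_left)
qed

lemma L2_inner_lincomb_right:
  assumes "\<And>k. f k \<in> L2 \<Omega>" "z \<in> L2 \<Omega>" "finite A"
  shows "L2_inner \<Omega> z (\<lambda>x. \<Sum>k\<in>A. c k * f k x) = (\<Sum>k\<in>A. c k * L2_inner \<Omega> z (f k))"
  using L2_inner_lincomb_left[OF assms, of c] by (simp add: L2_inner_commute)

lemma L2_inner_self_nonneg: "0 \<le> L2_inner \<Omega> w w"
  by (simp add: L2_inner_def)

lemma L2_norm_nonneg: "0 \<le> L2_norm \<Omega> w"
  by (simp add: L2_norm_def L2_inner_self_nonneg)

lemma L2_norm_square: "(L2_norm \<Omega> w)\<^sup>2 = L2_inner \<Omega> w w"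
  by (simp add: L2_norm_def L2_inner_self_nonneg)

lemma L2_norm_power2: "(L2_norm \<Omega> w)\<^sup>2 = (LINT x|lebesgue_on \<Omega>. (w x)\<^sup>2)"
  unfolding L2_norm_square L2_inner_def by (simp add: power2_eq_square)

lemma L2_norm_scale: "L2_norm \<Omega> (\<lambda>x. c * w x) = \<bar>c\<bar> * L2_norm \<Omega> w"
proof -
  have "(\<lambda>x. c * w x * (c * w x)) = (\<lambda>x. c\<^sup>2 * (w x * w x))"
    by (simp add: fun_eq_iff power2_eq_square)
  then have "L2_inner \<Omega> (\<lambda>x. c * w x) (\<lambda>x. c * w x) = c\<^sup>2 * L2_inner \<Omega> w w"
    unfolding L2_inner_def by (simp only: integral_mult_right_zero)
  then show ?thesis by (simp add: L2_norm_def real_sqrt_mult)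
qed

lemma L2_norm_minus_commute: "L2_norm \<Omega> (\<lambda>x. w x - v x) = L2_norm \<Omega> (\<lambda>x. v x - w x)"
  using L2_norm_scale[of \<Omega> "-1" "\<lambda>x. w x - v x"] by simp

text \<open>Nonnegativity of |s w - t v|^2 as a quadratic form in two parameters. Keeping both s and
  t avoids normalising by |v|, which may vanish.\<close>

lemma L2_inner_bound:
  assumes w: "w \<in> L2 \<Omega>" and v: "v \<in> L2 \<Omega>"
  shows "\<bar>L2_inner \<Omega> w v\<bar> \<le> L2_norm \<Omega> w * L2_norm \<Omega> v"
proof -
  define a b c where "a = L2_inner \<Omega> w w" and "b = L2_inner \<Omega> w v" and "c = L2_inner \<Omega> v v"
  have quad: "0 \<le> s\<^sup>2 * a - 2 * s * t * b + t\<^sup>2 * c" for s t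
  proof -
    define z where "z = (\<lambda>x. s * w x - t * v x)"
    have z: "z \<in> L2 \<Omega>" unfolding z_def by (intro L2_diff L2_scale w v)
    have e: "L2_inner \<Omega> z y = s * L2_inner \<Omega> w y - t * L2_inner \<Omega> v y" if "y \<in> L2 \<Omega>" for y
      unfolding z_def using that w v by (simp add: L2_inner_diff_left L2_scale L2_inner_scale_left)
    have "L2_inner \<Omega> z z = s * L2_inner \<Omega> z w - t * L2_inner \<Omega> z v"
      using e[OF z] by (simp add: L2_inner_commute)
    also have "\<dots> = s\<^sup>2 * a - 2 * s * t * b + t\<^sup>2 * c"
      by (simp add: e w v a_def b_def c_def L2_inner_commute[of \<Omega> v w] algebra_simps power2_eq_square)
    finally show ?thesis using L2_inner_self_nonneg[of \<Omega> z] by simp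
  qed
  have a0: "0 \<le> a" "0 \<le> c" by (simp_all add: a_def c_def L2_inner_self_nonneg)
  have "b\<^sup>2 \<le> a * c"
  proof (cases "c = 0")
    case True
    have "b = 0"
    proof (rule ccontr)
      assume "b \<noteq> 0"
      \<comment> \<open>For c = 0 and s = 1 the form is a - 2 t b, and this t makes it -1.\<close>
      with quad[of 1 "(a + 1) / (2 * b)"] True show False by (simp add: field_simps)
    qed
    then show ?thesis using True by simp
  next
    case False
    \<comment> \<open>Up to scaling, s = c and t = b is the minimiser.\<close>
    have "0 \<le> c * (a * c - b\<^sup>2)"
      using quad[of c b] by (simp add: algebra_simps power2_eq_square)
    then show ?thesis using False a0 by (simp add: zero_le_mult_iff)
  qed
  then have "sqrt (b\<^sup>2) \<le> sqrt (a * c)" by (rule real_sqrt_le_mono)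
  then show ?thesis by (simp add: L2_norm_def a_def b_def c_def real_sqrt_mult)
qed

lemma L2_norm_triangle:
  assumes w: "w \<in> L2 \<Omega>" and v: "v \<in> L2 \<Omega>"
  shows "L2_norm \<Omega> (\<lambda>x. w x + v x) \<le> L2_norm \<Omega> w + L2_norm \<Omega> v"
proof (rule power2_le_imp_le)
  have wv: "(\<lambda>x. w x + v x) \<in> L2 \<Omega>" by (intro L2_add w v)
  have e: "L2_inner \<Omega> (\<lambda>x. w x + v x) y = L2_inner \<Omega> w y + L2_inner \<Omega> v y" if "y \<in> L2 \<Omega>" for y
    by (rule L2_inner_add_left[OF w v that])
  have "L2_inner \<Omega> (\<lambda>x. w x + v x) (\<lambda>x. w x + v x)
      = L2_inner \<Omega> w (\<lambda>x. w x + v x) + L2_inner \<Omega> v (\<lambda>x. w x + v x)"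
    by (rule e[OF wv])
  also have "\<dots> = L2_inner \<Omega> (\<lambda>x. w x + v x) w + L2_inner \<Omega> (\<lambda>x. w x + v x) v"
    by (simp only: L2_inner_commute)
  also have "\<dots> = L2_inner \<Omega> w w + L2_inner \<Omega> v w + (L2_inner \<Omega> w v + L2_inner \<Omega> v v)"
    by (simp only: e[OF w] e[OF v])
  finally have "L2_inner \<Omega> (\<lambda>x. w x + v x) (\<lambda>x. w x + v x)
      = L2_inner \<Omega> w w + 2 * L2_inner \<Omega> w v + L2_inner \<Omega> v v"
    using L2_inner_commute[of \<Omega> v w] by simp
  then have "(L2_norm \<Omega> (\<lambda>x. w x + v x))\<^sup>2 = (L2_norm \<Omega> w)\<^sup>2 + 2 * L2_inner \<Omega> w v + (L2_norm \<Omega> v)\<^sup>2"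
    by (simp add: L2_norm_square)
  then show "(L2_norm \<Omega> (\<lambda>x. w x + v x))\<^sup>2 \<le> (L2_norm \<Omega> w + L2_norm \<Omega> v)\<^sup>2"
    using L2_inner_bound[OF w v] by (simp add: power2_sum)
qed (simp add: L2_norm_nonneg)

lemma L2_norm_triangle_diff:
  assumes "w \<in> L2 \<Omega>" "v \<in> L2 \<Omega>" "z \<in> L2 \<Omega>"
  shows "L2_norm \<Omega> (\<lambda>x. w x - z x) \<le> L2_norm \<Omega> (\<lambda>x. w x - v x) + L2_norm \<Omega> (\<lambda>x. v x - z x)"
  using L2_norm_triangle[OF L2_diff[OF assms(1,2)] L2_diff[OF assms(2,3)]] by simp

lemma L2_norm_le_add:
  assumes "w \<in> L2 \<Omega>" "v \<in> L2 \<Omega>"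
  shows "L2_norm \<Omega> w \<le> L2_norm \<Omega> v + L2_norm \<Omega> (\<lambda>x. w x - v x)"
  using L2_norm_triangle[OF assms(2) L2_diff[OF assms]] by simp

lemma L2_norm_tendsto:
  assumes "\<And>n. f n \<in> L2 \<Omega>" "w \<in> L2 \<Omega>" "(\<lambda>n. L2_norm \<Omega> (\<lambda>x. f n x - w x)) \<longlonglongrightarrow> 0"
  shows "(\<lambda>n. L2_norm \<Omega> (f n)) \<longlonglongrightarrow> L2_norm \<Omega> w"
proof (rule LIM_zero_cancel, rule tendsto_rabs_zero_cancel, rule tendsto_sandwich[OF _ _ tendsto_const assms(3)])
  show "\<forall>\<^sub>F n in sequentially. \<bar>L2_norm \<Omega> (f n) - L2_norm \<Omega> w\<bar> \<le> L2_norm \<Omega> (\<lambda>x. f n x - w x)"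
  proof (rule always_eventually, rule allI)
    fix n
    show "\<bar>L2_norm \<Omega> (f n) - L2_norm \<Omega> w\<bar> \<le> L2_norm \<Omega> (\<lambda>x. f n x - w x)"
      using L2_norm_le_add[OF assms(1)[of n] assms(2)] L2_norm_le_add[OF assms(2) assms(1)[of n]]
      by (simp add: L2_norm_minus_commute[of \<Omega> w])
  qed
qed simp

lemma L2_inner_tendsto:
  assumes "\<And>n. f n \<in> L2 \<Omega>" "w \<in> L2 \<Omega>" "(\<lambda>n. L2_norm \<Omega> (\<lambda>x. f n x - w x)) \<longlonglongrightarrow> 0"
    and "\<And>n. g n \<in> L2 \<Omega>" "v \<in> L2 \<Omega>" "(\<lambda>n. L2_norm \<Omega> (\<lambda>x. g n x - v x)) \<longlonglongrightarrow> 0"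
  shows "(\<lambda>n. L2_inner \<Omega> (f n) (g n)) \<longlonglongrightarrow> L2_inner \<Omega> w v"
proof (rule LIM_zero_cancel, rule tendsto_rabs_zero_cancel, rule tendsto_sandwich[OF _ _ tendsto_const])
  let ?B = "\<lambda>n. L2_norm \<Omega> (\<lambda>x. f n x - w x) * L2_norm \<Omega> (g n) + L2_norm \<Omega> w * L2_norm \<Omega> (\<lambda>x. g n x - v x)"
  have "?B \<longlonglongrightarrow> 0 * L2_norm \<Omega> v + L2_norm \<Omega> w * 0"
    by (intro tendsto_intros assms L2_norm_tendsto[OF assms(4-6)])
  then show "?B \<longlonglongrightarrow> 0" by simp
  show "\<forall>\<^sub>F n in sequentially. \<bar>L2_inner \<Omega> (f n) (g n) - L2_inner \<Omega> w v\<bar> \<le> ?B n"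
  proof (rule always_eventually, rule allI)
    fix n
    have "L2_inner \<Omega> (f n) (g n) - L2_inner \<Omega> w v
        = L2_inner \<Omega> (\<lambda>x. f n x - w x) (g n) + L2_inner \<Omega> (\<lambda>x. g n x - v x) w"
      using L2_inner_diff_left[OF assms(1)[of n] assms(2) assms(4)[of n]] L2_inner_diff_left[OF assms(4)[of n] assms(5) assms(2)]
        L2_inner_commute[of \<Omega> v w] L2_inner_commute[of \<Omega> "g n" w] by linarith
    then show "\<bar>L2_inner \<Omega> (f n) (g n) - L2_inner \<Omega> w v\<bar> \<le> ?B n"
      using L2_inner_bound[OF L2_diff[OF assms(1)[of n] assms(2)] assms(4)[of n]]
        L2_inner_bound[OF L2_diff[OF assms(4)[of n] assms(5)] assms(2)]
      by (simp add: mult.commute[of "L2_norm \<Omega> w"])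
  qed
qed simp

text \<open>Restricting the complete measure \<open>lebesgue\<close> to a measurable set keeps it
  complete, so changing a function on a null set keeps it measurable. This makes the arbitrary
  representatives picked by \<open>SOME\<close> harmless.\<close>

lemma borel_measurable_lebesgue_on_AE:
  fixes f g :: "real ^ 'n \<Rightarrow> 'b :: {second_countable_topology, t2_space}"
  assumes \<Omega>: "\<Omega> \<in> sets lebesgue" and f: "f \<in> borel_measurable (lebesgue_on \<Omega>)"
    and ae: "AE x in lebesgue_on \<Omega>. f x = g x"
  shows "g \<in> borel_measurable (lebesgue_on \<Omega>)"
proof -
  interpret complete_measure "lebesgue_on \<Omega>"
  proof
    fix A B assume "B \<subseteq> A" "A \<in> null_sets (lebesgue_on \<Omega>)"
    then have BA: "A \<subseteq> \<Omega>" "A \<in> null_sets lebesgue" "B \<subseteq> A"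
      using \<Omega> by (simp_all add: null_sets_restrict_space)
    then have "B \<in> sets lebesgue" by (intro completion.complete)
    then show "B \<in> sets (lebesgue_on \<Omega>)"
      using \<Omega> BA by (simp add: sets_restrict_space_iff subset_trans)
  qed
  show ?thesis
  proof (rule measurableI)
    fix S :: "'b set" assume "S \<in> sets borel"
    then have m: "f -` S \<inter> space (lebesgue_on \<Omega>) \<in> sets (lebesgue_on \<Omega>)"
      using f by (rule measurable_sets[rotated])
    have "AE x in lebesgue_on \<Omega>. x \<in> f -` S \<inter> space (lebesgue_on \<Omega>) \<longleftrightarrow> x \<in> g -` S \<inter> space (lebesgue_on \<Omega>)"
      using ae by eventually_elim simp
    then show "g -` S \<inter> space (lebesgue_on \<Omega>) \<in> sets (lebesgue_on \<Omega>)"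
      by (rule in_sets_AE[OF _ m]) simp
  qed simp
qed

lemma L2_cong_AE:
  assumes "\<Omega> \<in> sets lebesgue" "w \<in> L2 \<Omega>" "AE x in lebesgue_on \<Omega>. w x = v x"
  shows "v \<in> L2 \<Omega>"
proof -
  have m: "v \<in> borel_measurable (lebesgue_on \<Omega>)"
    using borel_measurable_lebesgue_on_AE[OF assms(1) L2_measurable[OF assms(2)] assms(3)] .
  have "integrable (lebesgue_on \<Omega>) (\<lambda>x. (v x)\<^sup>2)"
    using L2_square_integrable[OF assms(2)]
    by (rule integrable_cong_AE_imp) (use m assms(3) in auto)
  then show ?thesis using m by (simp add: L2_def)
qed

lemma L2_inner_cong_AE:
  assumes "\<Omega> \<in> sets lebesgue" "w \<in> L2 \<Omega>" "v \<in> L2 \<Omega>"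
    "AE x in lebesgue_on \<Omega>. w x = w' x" "AE x in lebesgue_on \<Omega>. v x = v' x"
  shows "L2_inner \<Omega> w' v' = L2_inner \<Omega> w v"
  unfolding L2_inner_def
proof (rule integral_cong_AE)
  show "(\<lambda>x. w' x * v' x) \<in> borel_measurable (lebesgue_on \<Omega>)"
    using L2_cong_AE[OF assms(1,2,4)] L2_cong_AE[OF assms(1,3,5)]
    by (intro borel_measurable_times L2_measurable)
  show "(\<lambda>x. w x * v x) \<in> borel_measurable (lebesgue_on \<Omega>)"
    using assms by (intro borel_measurable_times L2_measurable)
  show "AE x in lebesgue_on \<Omega>. w' x * v' x = w x * v x"
    using assms(4,5) by eventually_elim simp
qed

section \<open>Finite measure of the domain, Fatou's lemma and completeness\<close>

lemma bounded_domain_lmeasurable: "bounded_domain \<Omega> \<Longrightarrow> \<Omega> \<in> lmeasurable"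
  unfolding bounded_domain_def by (blast intro: lmeasurable_open)

lemma bounded_domain_finite_measure: "bounded_domain \<Omega> \<Longrightarrow> finite_measure (lebesgue_on \<Omega>)"
  by (rule finite_measure_lebesgue_on[OF bounded_domain_lmeasurable])

lemma bounded_domain_sets: "bounded_domain \<Omega> \<Longrightarrow> \<Omega> \<in> sets lebesgue"
  by (rule fmeasurableD[OF bounded_domain_lmeasurable])

lemma L2_const:
  assumes "bounded_domain \<Omega>"
  shows "(\<lambda>x. c) \<in> L2 \<Omega>"
proof -
  interpret finite_measure "lebesgue_on \<Omega>" by (rule bounded_domain_finite_measure[OF assms])
  show ?thesis by (simp add: L2_def)
qed

lemma L2_integrable:
  assumes "bounded_domain \<Omega>" "w \<in> L2 \<Omega>"
  shows "integrable (lebesgue_on \<Omega>) w"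
  using L2_mult_integrable[OF assms(2) L2_const[OF assms(1), of 1]] by simp

lemma L2_abs: "w \<in> L2 \<Omega> \<Longrightarrow> (\<lambda>x. \<bar>w x\<bar>) \<in> L2 \<Omega>"
  by (auto simp: L2_def)

lemma L2_norm_abs: "L2_norm \<Omega> (\<lambda>x. \<bar>w x\<bar>) = L2_norm \<Omega> w"
  by (simp add: L2_norm_def L2_inner_def)

text \<open>Fatou's lemma for the squares. Since the bound is assumed only eventually, it serves
  both for tails of Cauchy sequences and for bounds that hold up to an epsilon.\<close>

lemma L2_Fatou:
  fixes f :: "nat \<Rightarrow> real ^ 'n \<Rightarrow> real"
  assumes f: "\<And>n. f n \<in> L2 \<Omega>" and s: "s \<in> borel_measurable (lebesgue_on \<Omega>)"
    and lim: "AE x in lebesgue_on \<Omega>. (\<lambda>n. f n x) \<longlonglongrightarrow> s x"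
    and bd: "eventually (\<lambda>n. L2_norm \<Omega> (f n) \<le> C) sequentially"
  shows "s \<in> L2 \<Omega> \<and> L2_norm \<Omega> s \<le> C"
proof -
  have C0: "0 \<le> C"
    using eventually_happens'[OF _ bd] L2_norm_nonneg[of \<Omega>] by (meson order_trans sequentially_bot)
  have nn: "(\<integral>\<^sup>+x. ennreal ((w x)\<^sup>2) \<partial>lebesgue_on \<Omega>) = ennreal ((L2_norm \<Omega> w)\<^sup>2)" if "w \<in> L2 \<Omega>" for w
    using that by (simp add: L2_norm_power2 nn_integral_eq_integral L2_square_integrable)
  have "(\<integral>\<^sup>+x. ennreal ((s x)\<^sup>2) \<partial>lebesgue_on \<Omega>) = (\<integral>\<^sup>+x. liminf (\<lambda>n. ennreal ((f n x)\<^sup>2)) \<partial>lebesgue_on \<Omega>)"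
  proof (rule nn_integral_cong_AE, use lim in eventually_elim)
    fix x assume "(\<lambda>n. f n x) \<longlonglongrightarrow> s x"
    then have "(\<lambda>n. ennreal ((f n x)\<^sup>2)) \<longlonglongrightarrow> ennreal ((s x)\<^sup>2)"
      by (intro tendsto_ennrealI tendsto_power)
    then show "ennreal ((s x)\<^sup>2) = liminf (\<lambda>n. ennreal ((f n x)\<^sup>2))"
      by (intro lim_imp_Liminf[symmetric]) auto
  qed
  also have "\<dots> \<le> liminf (\<lambda>n. \<integral>\<^sup>+x. ennreal ((f n x)\<^sup>2) \<partial>lebesgue_on \<Omega>)"
    using L2_measurable[OF f] by (intro nn_integral_liminf) simp
  also have "\<dots> = liminf (\<lambda>n. ennreal ((L2_norm \<Omega> (f n))\<^sup>2))"
    using f by (simp add: nn)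
  also have "\<dots> \<le> ennreal (C\<^sup>2)"
  proof (rule Liminf_le)
    show "\<forall>\<^sub>F n in sequentially. ennreal ((L2_norm \<Omega> (f n))\<^sup>2) \<le> ennreal (C\<^sup>2)"
      using bd by eventually_elim (auto intro!: ennreal_leI power_mono L2_norm_nonneg)
  qed simp
  finally have le: "(\<integral>\<^sup>+x. ennreal ((s x)\<^sup>2) \<partial>lebesgue_on \<Omega>) \<le> ennreal (C\<^sup>2)" .
  then have "integrable (lebesgue_on \<Omega>) (\<lambda>x. (s x)\<^sup>2)"
    using s by (intro integrableI_bounded) (auto intro: le_less_trans)
  then have L2: "s \<in> L2 \<Omega>" using s by (simp add: L2_def)
  have "(L2_norm \<Omega> s)\<^sup>2 \<le> C\<^sup>2" using le nn[OF L2] C0 by (simp add: ennreal_le_iff)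
  then show ?thesis using L2 C0 by (auto intro: power2_le_imp_le)
qed

text \<open>On a finite measure the L^1 norm is at most a multiple of the L^2 norm, so the sequence
  is Cauchy in L^1 and has an almost everywhere convergent subsequence.\<close>

lemma L2_convergent_AE_subseq:
  fixes f :: "nat \<Rightarrow> real ^ 'n \<Rightarrow> real"
  assumes \<Omega>: "bounded_domain \<Omega>" and f: "\<And>n. f n \<in> L2 \<Omega>"
    and cauchy: "\<And>e. e > 0 \<Longrightarrow> \<exists>N. \<forall>m\<ge>N. \<forall>n\<ge>N. L2_norm \<Omega> (\<lambda>x. f m x - f n x) < e"
  obtains r where "strict_mono r" "AE x in lebesgue_on \<Omega>. Cauchy (\<lambda>i. f (r i) x)"
proof (rule cauchy_L1_AE_cauchy_subseq[of "lebesgue_on \<Omega>" f])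
  show "integrable (lebesgue_on \<Omega>) (f n)" for n by (intro L2_integrable \<Omega> f)
  fix e :: real assume e: "e > 0"
  \<comment> \<open>The added 1 makes K positive at no cost.\<close>
  define K where "K = L2_norm \<Omega> (\<lambda>x. 1) + 1"
  have K: "K > 0" unfolding K_def using L2_norm_nonneg[of \<Omega> "\<lambda>x. 1"] by linarith
  obtain N where N: "\<And>m n. m \<ge> N \<Longrightarrow> n \<ge> N \<Longrightarrow> L2_norm \<Omega> (\<lambda>x. f m x - f n x) < e / K"
    using cauchy[of "e / K"] e K by auto
  show "\<exists>N. \<forall>i\<ge>N. \<forall>j\<ge>N. LINT x|lebesgue_on \<Omega>. norm (f i x - f j x) < e"
  proof (intro exI allI impI)
    fix i j assume ij: "i \<ge> N" "j \<ge> N"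
    have d: "(\<lambda>x. \<bar>f i x - f j x\<bar>) \<in> L2 \<Omega>" by (intro L2_abs L2_diff f)
    have "(LINT x|lebesgue_on \<Omega>. norm (f i x - f j x)) \<le> L2_norm \<Omega> (\<lambda>x. f i x - f j x) * L2_norm \<Omega> (\<lambda>x. 1)"
      using L2_inner_bound[OF d L2_const[OF \<Omega>, of 1]] by (simp add: L2_norm_abs L2_inner_def)
    also have "\<dots> \<le> L2_norm \<Omega> (\<lambda>x. f i x - f j x) * K"
      by (intro mult_left_mono) (auto simp: K_def L2_norm_nonneg)
    also have "\<dots> < e" using N[OF ij] K by (simp add: field_simps)
    finally show "LINT x|lebesgue_on \<Omega>. norm (f i x - f j x) < e" .
  qed
qed (use that in blast)

theorem L2_complete:
  fixes f :: "nat \<Rightarrow> real ^ 'n \<Rightarrow> real"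
  assumes \<Omega>: "bounded_domain \<Omega>" and f: "\<And>n. f n \<in> L2 \<Omega>"
    and cauchy: "\<And>e. e > 0 \<Longrightarrow> \<exists>N. \<forall>m\<ge>N. \<forall>n\<ge>N. L2_norm \<Omega> (\<lambda>x. f m x - f n x) < e"
  shows "\<exists>s\<in>L2 \<Omega>. (\<lambda>n. L2_norm \<Omega> (\<lambda>x. f n x - s x)) \<longlonglongrightarrow> 0"
proof -
  obtain r where r: "strict_mono r" and ae: "AE x in lebesgue_on \<Omega>. Cauchy (\<lambda>i. f (r i) x)"
    using L2_convergent_AE_subseq[OF \<Omega> f cauchy] by metis
  define s where "s = (\<lambda>x. lim (\<lambda>i. f (r i) x))"
  have s: "s \<in> borel_measurable (lebesgue_on \<Omega>)"
    unfolding s_def by (rule borel_measurable_lim_metric) (rule L2_measurable[OF f])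
  have lim: "AE x in lebesgue_on \<Omega>. (\<lambda>i. f (r i) x) \<longlonglongrightarrow> s x"
    using ae by eventually_elim (simp add: s_def Cauchy_convergent_iff convergent_LIMSEQ_iff)
  \<comment> \<open>Fatou along the subsequence in the second index: the Cauchy bound survives as a
    bound on the distance of every late \<open>f n\<close> to the limit.\<close>
  have key: "(\<lambda>x. f n x - s x) \<in> L2 \<Omega> \<and> L2_norm \<Omega> (\<lambda>x. f n x - s x) \<le> e"
    if N: "\<And>m n. m \<ge> N \<Longrightarrow> n \<ge> N \<Longrightarrow> L2_norm \<Omega> (\<lambda>x. f m x - f n x) < e" and n: "n \<ge> N" for n N e
  proof (rule L2_Fatou[where f="\<lambda>i x. f n x - f (r i) x"])
    show "AE x in lebesgue_on \<Omega>. (\<lambda>i. f n x - f (r i) x) \<longlonglongrightarrow> f n x - s x"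
      using lim by eventually_elim (intro tendsto_intros)
    have "L2_norm \<Omega> (\<lambda>x. f n x - f (r i) x) \<le> e" if "i \<ge> N" for i
      using N[OF n, of "r i"] that seq_suble[OF r, of i] by simp
    then show "\<forall>\<^sub>F i in sequentially. L2_norm \<Omega> (\<lambda>x. f n x - f (r i) x) \<le> e"
      using eventually_sequentially by blast
  qed (use s f L2_measurable[OF f] in \<open>auto intro: L2_diff\<close>)
  obtain N where N: "\<And>m n. m \<ge> N \<Longrightarrow> n \<ge> N \<Longrightarrow> L2_norm \<Omega> (\<lambda>x. f m x - f n x) < 1"
    using cauchy[of 1] by auto
  have "(\<lambda>x. f N x - s x) \<in> L2 \<Omega>" using key[OF N, of N] by simp
  from L2_diff[OF f[of N] this] have sL2: "s \<in> L2 \<Omega>" by simp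
  have "(\<lambda>n. L2_norm \<Omega> (\<lambda>x. f n x - s x)) \<longlonglongrightarrow> 0"
  proof (rule LIMSEQ_I)
    fix e :: real assume e: "e > 0"
    obtain N where N: "\<And>m n. m \<ge> N \<Longrightarrow> n \<ge> N \<Longrightarrow> L2_norm \<Omega> (\<lambda>x. f m x - f n x) < e / 2"
      using cauchy[of "e / 2"] e by auto
    have "norm (L2_norm \<Omega> (\<lambda>x. f n x - s x) - 0) < e" if "n \<ge> N" for n
      using key[OF N that] e by (simp add: L2_norm_nonneg)
    then show "\<exists>no. \<forall>n\<ge>no. norm (L2_norm \<Omega> (\<lambda>x. f n x - s x) - 0) < e" by blast
  qed
  then show ?thesis using sL2 by blast
qed

subsection \<open>The Hilbert space of square summable sequences\<close>

text \<open>Functions modulo null sets are here a set with a seminorm and not a type. Coefficient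
  sequences do form a type, so that Henstock-Kurzweil integrals, bounded continuous functions and
  Banach's fixed point theorem apply to them.\<close>

typedef ell2 = "{x :: nat \<Rightarrow> real. summable (\<lambda>k. (x k)\<^sup>2)}"
  morphisms coord Abs_ell2
  by (rule exI[of _ "\<lambda>_. 0"]) simp

lemma ell2_eqI: "(\<And>k. coord x k = coord y k) \<Longrightarrow> x = y"
  by (metis coord_inject ext)

lemma summable_coord_square: "summable (\<lambda>k. (coord x k)\<^sup>2)"
  using coord[of x] by simp

lemma coord_Abs_ell2: "summable (\<lambda>k. (f k)\<^sup>2) \<Longrightarrow> coord (Abs_ell2 f) k = f k"
  by (simp add: Abs_ell2_inverse)

lemma summable_mult_of_squares:
  fixes f g :: "nat \<Rightarrow> real"
  assumes "summable (\<lambda>k. (f k)\<^sup>2)" "summable (\<lambda>k. (g k)\<^sup>2)"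
  shows "summable (\<lambda>k. f k * g k)"
proof (rule summable_comparison_test')
  show "summable (\<lambda>k. (f k)\<^sup>2 + (g k)\<^sup>2)" by (intro summable_add assms)
  fix k :: nat assume "k \<ge> 0"
  have "0 \<le> \<bar>f k\<bar> * \<bar>g k\<bar>" by simp
  moreover have "2 * (\<bar>f k\<bar> * \<bar>g k\<bar>) \<le> (f k)\<^sup>2 + (g k)\<^sup>2"
    using sum_squares_bound[of "\<bar>f k\<bar>" "\<bar>g k\<bar>"] by (simp add: mult.assoc)
  ultimately have "\<bar>f k\<bar> * \<bar>g k\<bar> \<le> (f k)\<^sup>2 + (g k)\<^sup>2" by linarith
  then show "norm (f k * g k) \<le> (f k)\<^sup>2 + (g k)\<^sup>2" by (simp add: abs_mult)
qed

lemma summable_square_add: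
  fixes f g :: "nat \<Rightarrow> real"
  assumes "summable (\<lambda>k. (f k)\<^sup>2)" "summable (\<lambda>k. (g k)\<^sup>2)"
  shows "summable (\<lambda>k. (f k + g k)\<^sup>2)"
proof -
  have "summable (\<lambda>k. (f k)\<^sup>2 + (g k)\<^sup>2 + 2 * (f k * g k))"
    by (intro summable_add summable_mult summable_mult_of_squares assms)
  then show ?thesis by (simp add: power2_sum mult.assoc)
qed

instantiation ell2 :: real_inner
begin

definition zero_ell2 :: ell2 where "0 = Abs_ell2 (\<lambda>_. 0)"
definition plus_ell2 :: "ell2 \<Rightarrow> ell2 \<Rightarrow> ell2" where "x + y = Abs_ell2 (\<lambda>k. coord x k + coord y k)"
definition scaleR_ell2 :: "real \<Rightarrow> ell2 \<Rightarrow> ell2" where "c *\<^sub>R x = Abs_ell2 (\<lambda>k. c * coord x k)"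
definition uminus_ell2 :: "ell2 \<Rightarrow> ell2" where "- x = Abs_ell2 (\<lambda>k. - coord x k)"
definition minus_ell2 :: "ell2 \<Rightarrow> ell2 \<Rightarrow> ell2" where "(x :: ell2) - y = x + - y"
definition inner_ell2 :: "ell2 \<Rightarrow> ell2 \<Rightarrow> real" where "x \<bullet> y = (\<Sum>k. coord x k * coord y k)"
definition norm_ell2 :: "ell2 \<Rightarrow> real" where "norm (x :: ell2) = sqrt (x \<bullet> x)"
definition sgn_ell2 :: "ell2 \<Rightarrow> ell2" where "sgn (x :: ell2) = inverse (norm x) *\<^sub>R x"
definition dist_ell2 :: "ell2 \<Rightarrow> ell2 \<Rightarrow> real" where "dist (x :: ell2) y = norm (x - y)"
definition uniformity_ell2 :: "(ell2 \<times> ell2) filter" where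
  "uniformity_ell2 = (INF e\<in>{0<..}. principal {(x :: ell2, y). dist x y < e})"
definition open_ell2 :: "ell2 set \<Rightarrow> bool" where
  "open_ell2 U = (\<forall>x\<in>U. eventually (\<lambda>(x', y). x' = x \<longrightarrow> y \<in> U) (uniformity :: (ell2 \<times> ell2) filter))"

lemma coord_zero [simp]: "coord 0 k = 0"
  by (simp add: zero_ell2_def coord_Abs_ell2)

lemma coord_plus [simp]: "coord (x + y) k = coord x k + coord y k"
  by (simp add: plus_ell2_def coord_Abs_ell2 summable_square_add summable_coord_square)

lemma coord_scaleR [simp]: "coord (c *\<^sub>R x) k = c * coord x k"
  by (simp add: scaleR_ell2_def coord_Abs_ell2 power_mult_distrib summable_mult summable_coord_square)

lemma coord_uminus [simp]: "coord (- x) k = - coord x k"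
  by (simp add: uminus_ell2_def coord_Abs_ell2 summable_coord_square)

lemma coord_minus [simp]: "coord (x - y) k = coord x k - coord y k"
  by (simp add: minus_ell2_def)

lemma summable_coord_mult: "summable (\<lambda>k. coord x k * coord y k)"
  by (intro summable_mult_of_squares summable_coord_square)

instance
proof
  fix x y z :: ell2 and a b :: real
  show "x + y + z = x + (y + z)" "x + y = y + x" "0 + x = x" "- x + x = 0" "x - y = x + - y"
    by (auto intro: ell2_eqI)
  show "a *\<^sub>R (x + y) = a *\<^sub>R x + a *\<^sub>R y" "(a + b) *\<^sub>R x = a *\<^sub>R x + b *\<^sub>R x"
    "a *\<^sub>R b *\<^sub>R x = (a * b) *\<^sub>R x" "1 *\<^sub>R x = x"
    by (auto intro!: ell2_eqI simp: algebra_simps)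
  show "x \<bullet> y = y \<bullet> x" by (simp add: inner_ell2_def mult.commute)
  show "(x + y) \<bullet> z = x \<bullet> z + y \<bullet> z"
    by (simp add: inner_ell2_def distrib_right suminf_add summable_coord_mult)
  show "(a *\<^sub>R x) \<bullet> y = a * (x \<bullet> y)"
    by (simp add: inner_ell2_def mult.assoc suminf_mult summable_coord_mult)
  show "0 \<le> x \<bullet> x"
    by (simp add: inner_ell2_def suminf_nonneg summable_coord_mult)
  show "(x \<bullet> x = 0) = (x = 0)"
  proof
    assume "x \<bullet> x = 0"
    then have "\<forall>k. coord x k * coord x k = 0"
      unfolding inner_ell2_def by (subst (asm) suminf_eq_zero_iff) (auto simp: summable_coord_mult)
    then show "x = 0" by (auto intro: ell2_eqI)
  qed (simp add: inner_ell2_def)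
qed (simp_all add: norm_ell2_def sgn_ell2_def dist_ell2_def uniformity_ell2_def open_ell2_def)

end

lemma norm_ell2_power2: "(norm (x :: ell2))\<^sup>2 = (\<Sum>k. (coord x k)\<^sup>2)"
  by (simp add: power2_norm_eq_inner) (simp add: inner_ell2_def power2_eq_square)

lemma sum_coord_square_le: "finite A \<Longrightarrow> (\<Sum>k\<in>A. (coord x k)\<^sup>2) \<le> (norm x)\<^sup>2"
  unfolding norm_ell2_power2 by (intro sum_le_suminf summable_coord_square) auto

lemma abs_coord_le_norm: "\<bar>coord x k\<bar> \<le> norm x"
proof (rule power2_le_imp_le)
  show "\<bar>coord x k\<bar>\<^sup>2 \<le> (norm x)\<^sup>2" using sum_coord_square_le[of "{k}" x] by simp
qed simp

lemma norm_ell2_le: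
  assumes "\<And>n. (\<Sum>k<n. (coord x k)\<^sup>2) \<le> C\<^sup>2" "0 \<le> C"
  shows "norm x \<le> C"
proof (rule power2_le_imp_le)
  show "(norm x)\<^sup>2 \<le> C\<^sup>2"
    unfolding norm_ell2_power2 by (intro suminf_le_const summable_coord_square assms)
qed (fact assms)

lemma summable_square_bounded:
  fixes f :: "nat \<Rightarrow> real"
  assumes "\<And>n. (\<Sum>k<n. (f k)\<^sup>2) \<le> C"
  shows "summable (\<lambda>k. (f k)\<^sup>2)"
  by (rule summableI_nonneg_bounded[OF _ assms]) simp

lemma bounded_linear_coord: "bounded_linear (\<lambda>x. coord x k)"
  by (rule bounded_linear_intro[of _ 1]) (auto simp: abs_coord_le_norm)

lemmas coord_continuous_on = bounded_linear.continuous_on[OF bounded_linear_coord]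

lemma inner_ell2_sums: "(\<lambda>k. coord x k * coord y k) sums (x \<bullet> y)"
  unfolding inner_ell2_def by (intro summable_sums summable_coord_mult)

instance ell2 :: complete_space
proof
  fix X :: "nat \<Rightarrow> ell2" assume X: "Cauchy X"
  have "Cauchy (\<lambda>n. coord (X n) k)" for k
    by (rule bounded_linear.Cauchy[OF bounded_linear_coord X])
  then have "\<exists>l. (\<lambda>n. coord (X n) k) \<longlonglongrightarrow> l" for k
    by (auto simp: Cauchy_convergent_iff convergent_def)
  then obtain l where l: "\<And>k. (\<lambda>n. coord (X n) k) \<longlonglongrightarrow> l k" by metis
  \<comment> \<open>Only finitely many coordinates are summed while \<open>m\<close> tends to
    infinity; K is released afterwards.\<close>
  have part: "(\<Sum>k<K. (coord (X n) k - l k)\<^sup>2) \<le> e\<^sup>2"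
    if "\<And>m. m \<ge> N \<Longrightarrow> dist (X n) (X m) \<le> e" for N n K e
  proof (rule LIMSEQ_le_const2)
    show "(\<lambda>m. \<Sum>k<K. (coord (X n) k - coord (X m) k)\<^sup>2) \<longlonglongrightarrow> (\<Sum>k<K. (coord (X n) k - l k)\<^sup>2)"
      by (intro tendsto_intros l)
    show "\<exists>M. \<forall>m\<ge>M. (\<Sum>k<K. (coord (X n) k - coord (X m) k)\<^sup>2) \<le> e\<^sup>2"
    proof (intro exI allI impI)
      fix m assume "m \<ge> N"
      then have "norm (X n - X m) \<le> e" using that by (simp add: dist_norm)
      then have "(norm (X n - X m))\<^sup>2 \<le> e\<^sup>2" by (intro power_mono) auto
      then show "(\<Sum>k<K. (coord (X n) k - coord (X m) k)\<^sup>2) \<le> e\<^sup>2"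
        using sum_coord_square_le[of "{..<K}" "X n - X m"] by simp
    qed
  qed
  obtain N0 where N0: "\<And>m. m \<ge> N0 \<Longrightarrow> dist (X N0) (X m) \<le> 1"
    using X unfolding Cauchy_def by (meson le_refl less_imp_le zero_less_one)
  \<comment> \<open>The limit is square summable because it differs from a member of the sequence by
    a square summable sequence.\<close>
  have "summable (\<lambda>k. (coord (X N0) k - l k)\<^sup>2)"
    using part[OF N0] by (intro summable_square_bounded[of _ "1\<^sup>2"]) auto
  then have "summable (\<lambda>k. (coord (X N0) k - l k + - coord (X N0) k)\<^sup>2)"
    by (intro summable_square_add) (simp_all add: summable_coord_square)
  then have "summable (\<lambda>k. (l k)\<^sup>2)" by (simp add: algebra_simps)
  then have L: "\<And>k. coord (Abs_ell2 l) k = l k" by (simp add: coord_Abs_ell2)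
  have "X \<longlonglongrightarrow> Abs_ell2 l"
  proof (rule metric_LIMSEQ_I)
    fix e :: real assume e: "e > 0"
    obtain N where N: "\<And>m n. m \<ge> N \<Longrightarrow> n \<ge> N \<Longrightarrow> dist (X n) (X m) < e / 2"
      using X e by (meson Cauchy_def half_gt_zero)
    have "dist (X n) (Abs_ell2 l) < e" if "n \<ge> N" for n
    proof -
      have "norm (X n - Abs_ell2 l) \<le> e / 2"
      proof (rule norm_ell2_le)
        show "(\<Sum>k<K. (coord (X n - Abs_ell2 l) k)\<^sup>2) \<le> (e / 2)\<^sup>2" for K
          using part[of N n "e / 2" K] N[OF _ that] by (simp add: L less_imp_le)
      qed (use e in simp)
      then show ?thesis using e by (simp add: dist_norm)
    qed
    then show "\<exists>no. \<forall>n\<ge>no. dist (X n) (Abs_ell2 l) < e" by blast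
  qed
  then show "convergent X" by (auto simp: convergent_def)
qed

instance ell2 :: banach ..

subsection \<open>Fractional kernels\<close>

text \<open>The kernel of the Riemann-Liouville integral of order \<beta>; these kernels form a
  convolution semigroup in \<beta>.\<close>

definition pow_kernel :: "real \<Rightarrow> real \<Rightarrow> real" where
  "pow_kernel \<beta> t = t powr (\<beta> - 1) / Gamma \<beta>"

text \<open>Two members matter most: \<gamma> = 1 is the relaxation function, and \<gamma> =
  \<alpha> is the solution r of r = a - \<kappa> a * r, where a is the Riemann-Liouville kernel of
  order \<alpha>.\<close>

definition ml_kernel :: "real \<Rightarrow> real \<Rightarrow> real \<Rightarrow> real \<Rightarrow> real" where
  "ml_kernel \<alpha> \<kappa> \<gamma> t = t powr (\<gamma> - 1) * mittag_leffler \<alpha> \<gamma> (- \<kappa> * t powr \<alpha>)"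

text \<open>Log-convexity of the Gamma function at the point \<open>x + 1\<close>, which lies between \<open>x + \<alpha>\<close> and
  \<open>x + \<alpha> + 1\<close>.\<close>
lemma Gamma_ratio_bound:
  fixes \<alpha> x :: real
  assumes "0 < \<alpha>" "\<alpha> < 1" "0 < x"
  shows "Gamma x / Gamma (x + \<alpha>) \<le> (x + \<alpha>) powr (1 - \<alpha>) / x"
proof -
  have "(ln \<circ> Gamma) ((1 - (1 - \<alpha>)) *\<^sub>R (x + \<alpha>) + (1 - \<alpha>) *\<^sub>R (x + \<alpha> + 1))
      \<le> (1 - (1 - \<alpha>)) * (ln \<circ> Gamma) (x + \<alpha>) + (1 - \<alpha>) * (ln \<circ> Gamma) (x + \<alpha> + 1)"
    using assms by (intro convex_onD[OF log_convex_Gamma_real]) auto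
  also have "(1 - (1 - \<alpha>)) *\<^sub>R (x + \<alpha>) + (1 - \<alpha>) *\<^sub>R (x + \<alpha> + 1) = x + 1"
    by (simp add: algebra_simps)
  finally have le: "ln (Gamma (x + 1)) \<le> \<alpha> * ln (Gamma (x + \<alpha>)) + (1 - \<alpha>) * ln (Gamma (x + \<alpha> + 1))"
    by simp
  have g: "Gamma (x + 1) = x * Gamma x" "Gamma (x + \<alpha> + 1) = (x + \<alpha>) * Gamma (x + \<alpha>)"
    using assms by (auto intro!: Gamma_plus1 simp: nonpos_Ints_def)
  have pos: "0 < Gamma x" "0 < Gamma (x + \<alpha>)" "0 < x + \<alpha>" using assms by auto
  have "ln (x * Gamma x) \<le> ln ((x + \<alpha>) powr (1 - \<alpha>) * Gamma (x + \<alpha>))"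
  proof -
    have "ln ((x + \<alpha>) powr (1 - \<alpha>) * Gamma (x + \<alpha>)) = (1 - \<alpha>) * ln (x + \<alpha>) + ln (Gamma (x + \<alpha>))"
      using pos by (subst ln_mult_pos) (auto simp: ln_powr)
    moreover have "ln ((x + \<alpha>) * Gamma (x + \<alpha>)) = ln (x + \<alpha>) + ln (Gamma (x + \<alpha>))"
      using pos by (intro ln_mult_pos)
    ultimately show ?thesis using le unfolding g by (simp add: algebra_simps)
  qed
  then have "x * Gamma x \<le> (x + \<alpha>) powr (1 - \<alpha>) * Gamma (x + \<alpha>)"
    using pos assms by (subst (asm) ln_le_cancel_iff) auto
  then show ?thesis using pos assms by (simp add: field_simps)
qed

section \<open>Convergence of the Mittag-Leffler series and convolutions with power kernels\<close>

context
  fixes \<alpha> :: real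
  assumes \<alpha>: "0 < \<alpha>" "\<alpha> < 1"
begin

text \<open>Ratio test: by \<open>Gamma_ratio_bound\<close>, Gamma(x) / Gamma(x + \<alpha>) is at
  most of order x^(-\<alpha>), so it tends to 0 along x = \<alpha> k + \<zeta>.\<close>

lemma summable_mittag_leffler:
  assumes "0 < \<zeta>"
  shows "summable (\<lambda>k. z ^ k / Gamma (\<alpha> * real k + \<zeta>))"
proof -
  have "((\<lambda>x. (x + \<alpha>) powr (1 - \<alpha>) / x) \<longlongrightarrow> 0) at_top"
    using \<alpha> by real_asymp
  moreover have "filterlim (\<lambda>k. \<alpha> * real k + \<zeta>) at_top sequentially"
    using \<alpha> by real_asymp
  ultimately have "(\<lambda>k. (\<alpha> * real k + \<zeta> + \<alpha>) powr (1 - \<alpha>) / (\<alpha> * real k + \<zeta>)) \<longlonglongrightarrow> 0"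
    by (rule filterlim_compose)
  \<comment> \<open>This threshold times |z| is at most 1/2; the added 1 covers z = 0.\<close>
  then have "\<forall>\<^sub>F k in sequentially. (\<alpha> * real k + \<zeta> + \<alpha>) powr (1 - \<alpha>) / (\<alpha> * real k + \<zeta>) < 1 / (2 * (\<bar>z\<bar> + 1))"
    by (rule order_tendstoD) simp
  then obtain N where N: "\<And>k. k \<ge> N \<Longrightarrow>
      (\<alpha> * real k + \<zeta> + \<alpha>) powr (1 - \<alpha>) / (\<alpha> * real k + \<zeta>) < 1 / (2 * (\<bar>z\<bar> + 1))"
    by (auto simp: eventually_sequentially)
  show ?thesis
  proof (rule summable_ratio_test[where c="1/2" and N=N])
    fix k assume k: "k \<ge> N"
    define x where "x = \<alpha> * real k + \<zeta>"
    have x: "0 < x" using \<alpha> assms by (simp add: x_def add_nonneg_pos)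
    have pos: "0 < Gamma x" "0 < Gamma (x + \<alpha>)" using x \<alpha> by auto
    have "Gamma x / Gamma (x + \<alpha>) \<le> 1 / (2 * (\<bar>z\<bar> + 1))"
      using Gamma_ratio_bound[OF \<alpha> x] N[OF k] by (simp add: x_def)
    then have "\<bar>z\<bar> * (Gamma x / Gamma (x + \<alpha>)) \<le> \<bar>z\<bar> * (1 / (2 * (\<bar>z\<bar> + 1)))"
      by (intro mult_left_mono) auto
    also have "\<dots> \<le> 1 / 2" by (simp add: field_simps)
    finally have "\<bar>z\<bar> / Gamma (x + \<alpha>) \<le> 1 / 2 * (1 / Gamma x)"
      using pos by (simp add: field_simps)
    then have "\<bar>z\<bar> ^ k * (\<bar>z\<bar> / Gamma (x + \<alpha>)) \<le> \<bar>z\<bar> ^ k * (1 / 2 * (1 / Gamma x))"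
      by (intro mult_left_mono) auto
    moreover have "\<alpha> * real (Suc k) + \<zeta> = x + \<alpha>" by (simp add: x_def algebra_simps)
    ultimately show "norm (z ^ Suc k / Gamma (\<alpha> * real (Suc k) + \<zeta>))
        \<le> 1/2 * norm (z ^ k / Gamma (\<alpha> * real k + \<zeta>))"
      using pos by (simp add: abs_mult power_abs x_def[symmetric] mult_ac)
  qed simp
qed

lemma mittag_leffler_sums:
  "0 < \<zeta> \<Longrightarrow> (\<lambda>k. z ^ k / Gamma (\<alpha> * real k + \<zeta>)) sums mittag_leffler \<alpha> \<zeta> z"
  unfolding mittag_leffler_def by (intro summable_sums summable_mittag_leffler)

lemma isCont_mittag_leffler:
  assumes "0 < \<zeta>"
  shows "isCont (mittag_leffler \<alpha> \<zeta>) z"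
proof -
  have "isCont (\<lambda>z. \<Sum>k. (1 / Gamma (\<alpha> * real k + \<zeta>)) * z ^ k) z"
    by (rule isCont_powser_converges_everywhere) (use summable_mittag_leffler[OF assms] in simp)
  then show ?thesis by (simp add: mittag_leffler_def[abs_def])
qed

lemma continuous_on_mittag_leffler: "0 < \<zeta> \<Longrightarrow> continuous_on S (mittag_leffler \<alpha> \<zeta>)"
  by (intro continuous_at_imp_continuous_on ballI isCont_mittag_leffler)

lemma borel_measurable_mittag_leffler [measurable]:
  "0 < \<zeta> \<Longrightarrow> mittag_leffler \<alpha> \<zeta> \<in> borel_measurable borel"
  by (intro borel_measurable_continuous_onI continuous_on_mittag_leffler)

lemma mittag_leffler_0: "0 < \<zeta> \<Longrightarrow> mittag_leffler \<alpha> \<zeta> 0 = 1 / Gamma \<zeta>"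
proof -
  assume \<zeta>: "0 < \<zeta>"
  have "(\<lambda>k. 0 ^ k / Gamma (\<alpha> * real k + \<zeta>)) sums (1 / Gamma \<zeta>)"
    using sums_single[of 0 "\<lambda>k. 1 / Gamma (\<alpha> * real k + \<zeta>)"] by (simp add: power_0_left if_distrib[of "\<lambda>x. x / _"] cong: if_cong)
  then show ?thesis using mittag_leffler_sums[OF \<zeta>, of 0] sums_unique2 by blast
qed

text \<open>All terms of the series are nonnegative, and the bound is the term k = 0. It keeps the
  weights of the Gronwall arguments away from 0.\<close>

lemma mittag_leffler_ge:
  assumes "0 < \<zeta>" "0 \<le> z"
  shows "1 / Gamma \<zeta> \<le> mittag_leffler \<alpha> \<zeta> z"
proof -
  have "(\<Sum>k\<in>{0}. z ^ k / Gamma (\<alpha> * real k + \<zeta>)) \<le> mittag_leffler \<alpha> \<zeta> z"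
    unfolding mittag_leffler_def
  proof (intro sum_le_suminf summable_mittag_leffler ballI)
    fix n assume "n \<in> - {0 :: nat}"
    have "0 < \<alpha> * real n + \<zeta>" using \<alpha> assms by (simp add: add_nonneg_pos)
    then show "0 \<le> z ^ n / Gamma (\<alpha> * real n + \<zeta>)"
      using assms Gamma_real_pos[of "\<alpha> * real n + \<zeta>"] by simp
  qed (use assms in auto)
  then show ?thesis by simp
qed

text \<open>The Neumann series behind the kernel: term n is \<open>pow_kernel \<gamma>\<close>
  convolved n times with -\<kappa> times \<open>pow_kernel \<alpha>\<close>. Convolution identities
  are proved on this series term by term.\<close>

lemma ml_kernel_sums:
  assumes "0 < \<gamma>" "0 < t"
  shows "(\<lambda>n. (- \<kappa>) ^ n * pow_kernel (\<alpha> * real n + \<gamma>) t) sums ml_kernel \<alpha> \<kappa> \<gamma> t"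
proof -
  have "(\<lambda>n. t powr (\<gamma> - 1) * ((- \<kappa> * t powr \<alpha>) ^ n / Gamma (\<alpha> * real n + \<gamma>))) sums ml_kernel \<alpha> \<kappa> \<gamma> t"
    unfolding ml_kernel_def by (intro sums_mult mittag_leffler_sums assms)
  moreover have "t powr (\<gamma> - 1) * ((- \<kappa> * t powr \<alpha>) ^ n / Gamma (\<alpha> * real n + \<gamma>))
      = (- \<kappa>) ^ n * pow_kernel (\<alpha> * real n + \<gamma>) t" for n
  proof -
    have "t powr (\<gamma> - 1) * (t powr \<alpha>) ^ n = t powr (\<alpha> * real n + \<gamma> - 1)"
      using assms(2) by (simp add: powr_power powr_add[symmetric] algebra_simps)
    moreover have "(- \<kappa> * t powr \<alpha>) ^ n = (- \<kappa>) ^ n * (t powr \<alpha>) ^ n"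
      by (rule power_mult_distrib)
    ultimately show ?thesis by (simp add: pow_kernel_def flip: mult.assoc)
  qed
  ultimately show ?thesis by simp
qed

text \<open>Splitting off the term n = 0 of the Neumann series and shifting the index raises
  \<gamma> by \<alpha>.\<close>

lemma ml_kernel_recurrence:
  assumes "0 < \<gamma>" "0 < t"
  shows "ml_kernel \<alpha> \<kappa> \<gamma> t = pow_kernel \<gamma> t - \<kappa> * ml_kernel \<alpha> \<kappa> (\<gamma> + \<alpha>) t"
proof -
  have "(\<lambda>n. (- \<kappa>) * ((- \<kappa>) ^ n * pow_kernel (\<alpha> * real n + (\<gamma> + \<alpha>)) t)) sums (- \<kappa> * ml_kernel \<alpha> \<kappa> (\<gamma> + \<alpha>) t)"
    using assms \<alpha> by (intro sums_mult ml_kernel_sums) auto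
  then have "(\<lambda>n. (- \<kappa>) ^ Suc n * pow_kernel (\<alpha> * real (Suc n) + \<gamma>) t) sums (- \<kappa> * ml_kernel \<alpha> \<kappa> (\<gamma> + \<alpha>) t)"
    by (simp add: algebra_simps)
  from sums_Suc[OF this] have "(\<lambda>n. (- \<kappa>) ^ n * pow_kernel (\<alpha> * real n + \<gamma>) t) sums (- \<kappa> * ml_kernel \<alpha> \<kappa> (\<gamma> + \<alpha>) t + pow_kernel \<gamma> t)"
    by simp
  from sums_unique2[OF ml_kernel_sums[OF assms] this] show ?thesis by simp
qed

lemma pow_kernel_measurable [measurable]: "pow_kernel \<beta> \<in> borel_measurable borel"
  unfolding pow_kernel_def[abs_def] by measurable

lemma ml_kernel_measurable [measurable]: "0 < \<gamma> \<Longrightarrow> ml_kernel \<alpha> \<kappa> \<gamma> \<in> borel_measurable borel"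
  unfolding ml_kernel_def[abs_def] by measurable

lemma pow_kernel_pos: "0 < \<beta> \<Longrightarrow> 0 < t \<Longrightarrow> 0 < pow_kernel \<beta> t"
  by (simp add: pow_kernel_def)

lemma pow_kernel_nonneg: "0 < \<beta> \<Longrightarrow> 0 \<le> pow_kernel \<beta> t"
  by (simp add: pow_kernel_def less_imp_le)

text \<open>Euler's Beta integral after the rescaling \<sigma> = t s; the Beta value cancels against
  the Gamma factors of the kernels.\<close>

lemma has_bochner_integral_pow_kernel_conv:
  assumes "0 < \<beta>" "0 < \<gamma>" "0 < t"
  shows "has_bochner_integral lborel (\<lambda>\<sigma>. indicator {0<..<t} \<sigma> * (pow_kernel \<beta> \<sigma> * pow_kernel \<gamma> (t - \<sigma>)))
           (pow_kernel (\<beta> + \<gamma>) t)"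
proof -
  let ?g = "\<lambda>s::real. s powr (\<beta> - 1) * (1 - s) powr (\<gamma> - 1)"
  let ?f = "\<lambda>s::real. indicator {0<..<1} s * ?g s"
  have i01: "set_integrable lborel {0..1} ?g" by (rule integrable_Beta[OF assms(1,2)])
  have "(LINT s:{0..1}|lborel. ?g s) = Beta \<beta> \<gamma>"
    using set_borel_integral_eq_integral(2)[OF i01] has_integral_Beta_real[OF assms(1,2)]
    by (simp add: integral_unique)
  then have "has_bochner_integral lborel (\<lambda>s. indicator {0..1} s *\<^sub>R ?g s) (Beta \<beta> \<gamma>)"
    using i01 by (simp add: has_bochner_integral_iff set_integrable_def set_lebesgue_integral_def)
  moreover have "(\<lambda>s. indicator {0..1} s *\<^sub>R ?g s) = ?f"
    by (auto simp: fun_eq_iff indicator_def)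
  ultimately have "has_bochner_integral lborel ?f (Beta \<beta> \<gamma>)" by simp
  moreover have "1 / t \<noteq> 0" using assms(3) by simp
  ultimately have "has_bochner_integral lborel (\<lambda>\<sigma>. ?f (0 + 1 / t * \<sigma>)) (Beta \<beta> \<gamma> /\<^sub>R \<bar>1 / t\<bar>)"
    using lborel_has_bochner_integral_real_affine_iff[of "1 / t" ?f "Beta \<beta> \<gamma>" 0] by blast
  \<comment> \<open>The factor collects t^(\<beta>-1) t^(\<gamma>-1) from the rescaled powers; the
    Jacobian t supplies the missing exponent 1.\<close>
  then have "has_bochner_integral lborel (\<lambda>\<sigma>. t powr (\<beta> + \<gamma> - 2) / (Gamma \<beta> * Gamma \<gamma>) * ?f (0 + 1 / t * \<sigma>))
     (t powr (\<beta> + \<gamma> - 2) / (Gamma \<beta> * Gamma \<gamma>) * (Beta \<beta> \<gamma> /\<^sub>R \<bar>1 / t\<bar>))"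
    by (rule has_bochner_integral_mult_right)
  moreover have "t powr (\<beta> + \<gamma> - 2) / (Gamma \<beta> * Gamma \<gamma>) * ?f (0 + 1 / t * \<sigma>)
      = indicator {0<..<t} \<sigma> * (pow_kernel \<beta> \<sigma> * pow_kernel \<gamma> (t - \<sigma>))" for \<sigma>
  proof (cases "0 < \<sigma> \<and> \<sigma> < t")
    case True
    have "(\<sigma> / t) powr (\<beta> - 1) = \<sigma> powr (\<beta> - 1) / t powr (\<beta> - 1)"
      by (rule powr_divide)
    moreover have "(1 - \<sigma> / t) powr (\<gamma> - 1) = (t - \<sigma>) powr (\<gamma> - 1) / t powr (\<gamma> - 1)"
    proof -
      have "1 - \<sigma> / t = (t - \<sigma>) / t" using assms(3) by (simp add: field_simps)
      then show ?thesis using True by (simp add: powr_divide)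
    qed
    moreover have "t powr (\<beta> + \<gamma> - 2) = t powr (\<beta> - 1) * t powr (\<gamma> - 1)"
      by (simp add: powr_add[symmetric])
    ultimately show ?thesis using True assms(3) by (simp add: pow_kernel_def)
  next
    case False
    then have "indicator {0<..<1} (0 + 1 / t * \<sigma>) = (0 :: real)"
      using assms(3) by (auto simp: indicator_def zero_less_divide_iff)
    moreover have "indicator {0<..<t} \<sigma> = (0 :: real)" using False by auto
    ultimately show ?thesis by (simp only: mult_zero_left mult_zero_right)
  qed
  moreover have "t powr (\<beta> + \<gamma> - 2) / (Gamma \<beta> * Gamma \<gamma>) * (Beta \<beta> \<gamma> /\<^sub>R \<bar>1 / t\<bar>) = pow_kernel (\<beta> + \<gamma>) t"
  proof -
    have "t powr (\<beta> + \<gamma> - 2) * t = t powr (\<beta> + \<gamma> - 2 + 1)"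
      using assms(3) by (simp only: powr_add powr_one)
    also have "\<beta> + \<gamma> - 2 + 1 = \<beta> + \<gamma> - 1" by simp
    finally have pw: "t powr (\<beta> + \<gamma> - 2) * t = t powr (\<beta> + \<gamma> - 1)" .
    have "Gamma \<beta> * Gamma \<gamma> \<noteq> 0" using Gamma_real_pos[OF assms(1)] Gamma_real_pos[OF assms(2)] by simp
    then show ?thesis using assms(3) pw by (simp add: pow_kernel_def Beta_def field_simps)
  qed
  ultimately show ?thesis by simp
qed

text \<open>Termwise integration of the Neumann series. The integrated absolute values are the terms
  of the same series for the parameter -|\<kappa>|, so the convergence of that series is the
  domination that allows sum and integral to be exchanged.\<close>

lemma has_bochner_integral_ml_kernel_conv:
  assumes "0 < \<beta>" "0 < \<gamma>" "0 < t"
  shows "has_bochner_integral lborel (\<lambda>\<sigma>. indicator {0<..<t} \<sigma> * (pow_kernel \<beta> \<sigma> * ml_kernel \<alpha> \<kappa> \<gamma> (t - \<sigma>)))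
           (ml_kernel \<alpha> \<kappa> (\<beta> + \<gamma>) t)"
proof -
  define F where "F = (\<lambda>n \<sigma>. (- \<kappa>) ^ n * (indicator {0<..<t} \<sigma> * (pow_kernel \<beta> \<sigma> * pow_kernel (\<alpha> * real n + \<gamma>) (t - \<sigma>))))"
  have pos: "0 < \<alpha> * real n + \<gamma>" for n using \<alpha> assms by (simp add: add_nonneg_pos)
  have hb: "has_bochner_integral lborel (F n) ((- \<kappa>) ^ n * pow_kernel (\<alpha> * real n + (\<beta> + \<gamma>)) t)" for n
    using has_bochner_integral_mult_right[OF has_bochner_integral_pow_kernel_conv[OF assms(1) pos[of n] assms(3)], of "(- \<kappa>) ^ n"]
    unfolding F_def by (simp add: add_ac)
  have nF: "norm (F n \<sigma>) = \<bar>\<kappa>\<bar> ^ n * (indicator {0<..<t} \<sigma> * (pow_kernel \<beta> \<sigma> * pow_kernel (\<alpha> * real n + \<gamma>) (t - \<sigma>)))" for n \<sigma>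
    using pow_kernel_nonneg[OF assms(1), of \<sigma>] pow_kernel_nonneg[OF pos[of n], of "t - \<sigma>"]
    by (simp add: F_def abs_mult power_abs)
  have FS: "(\<lambda>n. F n \<sigma>) sums (indicator {0<..<t} \<sigma> * (pow_kernel \<beta> \<sigma> * ml_kernel \<alpha> \<kappa> \<gamma> (t - \<sigma>)))" for \<sigma>
  proof (cases "0 < \<sigma> \<and> \<sigma> < t")
    case True
    then show ?thesis
      using sums_mult[OF ml_kernel_sums[OF assms(2), of "t - \<sigma>" \<kappa>], of "pow_kernel \<beta> \<sigma>"]
      by (simp add: F_def mult_ac)
  next
    case False
    then have "indicator {0<..<t} \<sigma> = (0 :: real)" by auto
    then show ?thesis by (simp add: F_def)
  qed
  have S: "summable (\<lambda>n. norm (F n \<sigma>))" for \<sigma>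
  proof (cases "0 < \<sigma> \<and> \<sigma> < t")
    case True
    have "norm (F n \<sigma>) = pow_kernel \<beta> \<sigma> * ((- (- \<bar>\<kappa>\<bar>)) ^ n * pow_kernel (\<alpha> * real n + \<gamma>) (t - \<sigma>))" for n
      using True unfolding nF by (simp add: mult_ac)
    moreover have "0 < t - \<sigma>" using True by simp
    ultimately show ?thesis
      using sums_summable[OF sums_mult[OF ml_kernel_sums[OF assms(2)]]] by presburger
  next
    case False
    then have "indicator {0<..<t} \<sigma> = (0 :: real)" by auto
    then show ?thesis by (simp add: F_def)
  qed
  have int_norm: "(LINT \<sigma>|lborel. norm (F n \<sigma>)) = \<bar>\<kappa>\<bar> ^ n * pow_kernel (\<alpha> * real n + (\<beta> + \<gamma>)) t" for n
    using has_bochner_integral_integral_eq[OF has_bochner_integral_mult_right[OF has_bochner_integral_pow_kernel_conv[OF assms(1) pos[of n] assms(3)], of "\<bar>\<kappa>\<bar> ^ n"]]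
    unfolding nF by (simp add: add_ac)
  have SI: "summable (\<lambda>n. LINT \<sigma>|lborel. norm (F n \<sigma>))"
    unfolding int_norm using sums_summable[OF ml_kernel_sums[of "\<beta> + \<gamma>" t "- \<bar>\<kappa>\<bar>"]] assms by simp
  have I: "integrable lborel (F n)" "integral\<^sup>L lborel (F n) = (- \<kappa>) ^ n * pow_kernel (\<alpha> * real n + (\<beta> + \<gamma>)) t" for n
    using hb[of n] by (auto simp: has_bochner_integral_iff)
  have eq: "(\<lambda>\<sigma>. \<Sum>n. F n \<sigma>) = (\<lambda>\<sigma>. indicator {0<..<t} \<sigma> * (pow_kernel \<beta> \<sigma> * ml_kernel \<alpha> \<kappa> \<gamma> (t - \<sigma>)))"
    using FS by (simp add: fun_eq_iff sums_iff)
  have "(\<lambda>n. integral\<^sup>L lborel (F n)) sums (\<integral>\<sigma>. (\<Sum>n. F n \<sigma>) \<partial>lborel)"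
    by (rule sums_integral) (use I S SI in auto)
  moreover have "(\<lambda>n. integral\<^sup>L lborel (F n)) sums ml_kernel \<alpha> \<kappa> (\<beta> + \<gamma>) t"
    unfolding I using ml_kernel_sums[of "\<beta> + \<gamma>" t \<kappa>] assms by simp
  ultimately have "(\<integral>\<sigma>. (\<Sum>n. F n \<sigma>) \<partial>lborel) = ml_kernel \<alpha> \<kappa> (\<beta> + \<gamma>) t"
    by (rule sums_unique2)
  moreover have "integrable lborel (\<lambda>\<sigma>. \<Sum>n. F n \<sigma>)"
    by (rule integrable_suminf) (use I S SI in auto)
  ultimately show ?thesis by (simp add: has_bochner_integral_iff eq)
qed

end

subsection \<open>Convolutions with weakly singular kernels\<close>

text \<open>Over the open interval the arguments of both factors stay strictly between 0 and t, away
  from singularities at 0; for t \<le> 0 the value is 0.\<close>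

definition conv :: "(real \<Rightarrow> real) \<Rightarrow> (real \<Rightarrow> real) \<Rightarrow> real \<Rightarrow> real" where
  "conv K f t = (LINT \<sigma>|lborel. indicator {0<..<t} \<sigma> * (K \<sigma> * f (t - \<sigma>)))"

definition loc_kernel :: "(real \<Rightarrow> real) \<Rightarrow> bool" where
  "loc_kernel K \<longleftrightarrow> K \<in> borel_measurable borel \<and>
     (\<forall>T. integrable lborel (\<lambda>\<sigma>. indicator {0<..<T} \<sigma> * K \<sigma>))"

lemma loc_kernelD:
  assumes "loc_kernel K"
  shows "K \<in> borel_measurable borel" "integrable lborel (\<lambda>\<sigma>. indicator {0<..<T} \<sigma> * K \<sigma>)"
  using assms by (auto simp: loc_kernel_def)

lemma continuous_bounded_Icc:
  fixes f :: "real \<Rightarrow> real"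
  assumes "continuous_on UNIV f"
  obtains M where "0 \<le> M" "\<And>x. 0 \<le> x \<Longrightarrow> x \<le> B \<Longrightarrow> \<bar>f x\<bar> \<le> M"
proof -
  have "compact (f ` {0..B})"
    by (intro compact_continuous_image continuous_on_subset[OF assms]) auto
  then obtain M where M: "\<forall>y\<in>f ` {0..B}. norm y \<le> M"
    using compact_imp_bounded bounded_iff by metis
  show ?thesis by (rule that[of "max 0 M"]) (use M in force)+
qed

lemma continuous_measurable_real: "continuous_on UNIV f \<Longrightarrow> f \<in> borel_measurable (borel :: real measure)"
  for f :: "real \<Rightarrow> real"
  by (rule borel_measurable_continuous_onI)

lemma conv_integrable:
  assumes K: "loc_kernel K" and f: "continuous_on UNIV f"
  shows "integrable lborel (\<lambda>\<sigma>. indicator {0<..<t} \<sigma> * (K \<sigma> * f (t - \<sigma>)))"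
proof -
  obtain M where M: "0 \<le> M" "\<And>x. 0 \<le> x \<Longrightarrow> x \<le> t \<Longrightarrow> \<bar>f x\<bar> \<le> M"
    using continuous_bounded_Icc[OF f] by blast
  note [measurable] = loc_kernelD(1)[OF K] continuous_measurable_real[OF f]
  show ?thesis
  proof (rule Bochner_Integration.integrable_bound)
    show "integrable lborel (\<lambda>\<sigma>. M * (indicator {0<..<t} \<sigma> * K \<sigma>))"
      by (intro integrable_mult_right loc_kernelD K)
    show "AE \<sigma> in lborel. norm (indicator {0<..<t} \<sigma> * (K \<sigma> * f (t - \<sigma>))) \<le> norm (M * (indicator {0<..<t} \<sigma> * K \<sigma>))"
    proof (rule AE_I2)
      fix \<sigma> :: real
      show "norm (indicator {0<..<t} \<sigma> * (K \<sigma> * f (t - \<sigma>))) \<le> norm (M * (indicator {0<..<t} \<sigma> * K \<sigma>))"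
      proof (cases "\<sigma> \<in> {0<..<t}")
        case True
        then have "\<bar>f (t - \<sigma>)\<bar> \<le> M" by (intro M) auto
        then show ?thesis using True M by (simp add: abs_mult mult.commute[of M] mult_left_mono)
      qed simp
    qed
  qed measurable
qed

lemma conv_cong:
  assumes "\<And>x. 0 < x \<Longrightarrow> x < t \<Longrightarrow> K x = L x" "\<And>x. 0 < x \<Longrightarrow> x < t \<Longrightarrow> f x = g x"
  shows "conv K f t = conv L g t"
  unfolding conv_def
proof (rule Bochner_Integration.integral_cong[OF refl])
  fix \<sigma> :: real
  show "indicator {0<..<t} \<sigma> * (K \<sigma> * f (t - \<sigma>)) = indicator {0<..<t} \<sigma> * (L \<sigma> * g (t - \<sigma>))"
    using assms by (cases "\<sigma> \<in> {0<..<t}") auto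
qed

lemma conv_nonpos: "t \<le> 0 \<Longrightarrow> conv K f t = 0"
  by (simp add: conv_def)

lemma conv_commute: "conv K f t = conv f K t"
proof -
  have "conv K f t = (LINT \<sigma>|lborel. indicator {0<..<t} (t + (-1) * \<sigma>) * (K (t + (-1) * \<sigma>) * f (t - (t + (-1) * \<sigma>))))"
    unfolding conv_def by (subst lborel_integral_real_affine[where c="-1" and t=t]) auto
  also have "\<dots> = conv f K t"
    unfolding conv_def
    by (rule Bochner_Integration.integral_cong[OF refl]) (auto simp: indicator_def)
  finally show ?thesis .
qed

lemma conv_scale: "conv K (\<lambda>x. c * f x) t = c * conv K f t"
proof -
  have "(\<lambda>\<sigma>. indicator {0<..<t} \<sigma> * (K \<sigma> * (c * f (t - \<sigma>)))) = (\<lambda>\<sigma>. c * (indicator {0<..<t} \<sigma> * (K \<sigma> * f (t - \<sigma>))))"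
    by (auto simp: fun_eq_iff)
  then show ?thesis unfolding conv_def by simp
qed

lemma conv_add:
  assumes "loc_kernel K" "continuous_on UNIV f" "continuous_on UNIV g"
  shows "conv K (\<lambda>x. f x + g x) t = conv K f t + conv K g t"
  unfolding conv_def
  using conv_integrable[OF assms(1,2)] conv_integrable[OF assms(1,3)] by (simp add: distrib_left)

lemma conv_diff:
  assumes "loc_kernel K" "continuous_on UNIV f" "continuous_on UNIV g"
  shows "conv K (\<lambda>x. f x - g x) t = conv K f t - conv K g t"
  unfolding conv_def
  using conv_integrable[OF assms(1,2)] conv_integrable[OF assms(1,3)] by (simp add: right_diff_distrib)

lemma conv_mono:
  assumes K: "loc_kernel K" "\<And>x. 0 < x \<Longrightarrow> 0 \<le> K x"
    and f: "continuous_on UNIV f" and g: "continuous_on UNIV g"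
    and le: "\<And>x. 0 \<le> x \<Longrightarrow> x \<le> t \<Longrightarrow> f x \<le> g x"
  shows "conv K f t \<le> conv K g t"
  unfolding conv_def
proof (rule integral_mono[OF conv_integrable[OF K(1) f] conv_integrable[OF K(1) g]])
  fix \<sigma> :: real
  show "indicator {0<..<t} \<sigma> * (K \<sigma> * f (t - \<sigma>)) \<le> indicator {0<..<t} \<sigma> * (K \<sigma> * g (t - \<sigma>))"
  proof (cases "\<sigma> \<in> {0<..<t}")
    case True
    then have "K \<sigma> * f (t - \<sigma>) \<le> K \<sigma> * g (t - \<sigma>)" by (intro mult_left_mono K(2) le) auto
    then show ?thesis using True by simp
  qed simp
qed

lemma conv_abs_le:
  assumes K: "loc_kernel K" "\<And>x. 0 < x \<Longrightarrow> 0 \<le> K x" and f: "continuous_on UNIV f"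
  shows "\<bar>conv K f t\<bar> \<le> conv K (\<lambda>x. \<bar>f x\<bar>) t"
proof -
  have c: "continuous_on UNIV (\<lambda>x. \<bar>f x\<bar>)" by (intro continuous_intros f)
  have "conv K f t \<le> conv K (\<lambda>x. \<bar>f x\<bar>) t" by (rule conv_mono[OF K f c]) auto
  moreover have "conv K (\<lambda>x. -1 * f x) t \<le> conv K (\<lambda>x. \<bar>f x\<bar>) t"
    by (rule conv_mono[OF K _ c]) (auto intro!: continuous_intros f)
  ultimately show ?thesis using conv_scale[of K "-1" f t] by simp
qed

text \<open>Dominated convergence along u_n tending to t: the indicators of (0, u_n) converge except
  at the single point \<sigma> = t, and one bound B for all u_n fixes the dominating
  function.\<close>

lemma conv_continuous:
  assumes K: "loc_kernel K" and f: "continuous_on UNIV f"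
  shows "continuous_on UNIV (conv K f)"
proof (rule continuous_at_imp_continuous_on, rule ballI)
  fix t :: real
  show "isCont (conv K f) t"
    unfolding continuous_at_sequentially comp_def
  proof (intro allI impI)
    fix u :: "nat \<Rightarrow> real" assume u: "u \<longlonglongrightarrow> t"
    then obtain B where B: "\<And>n. \<bar>u n\<bar> \<le> B"
      using convergent_imp_Bseq[of u] by (auto simp: convergent_def Bseq_def)
    obtain M where M: "0 \<le> M" "\<And>x. 0 \<le> x \<Longrightarrow> x \<le> B \<Longrightarrow> \<bar>f x\<bar> \<le> M"
      using continuous_bounded_Icc[OF f] by blast
    note [measurable] = loc_kernelD(1)[OF K] continuous_measurable_real[OF f]
    show "(\<lambda>n. conv K f (u n)) \<longlonglongrightarrow> conv K f t"
      unfolding conv_def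
    proof (rule integral_dominated_convergence[where w="\<lambda>\<sigma>. \<bar>M * (indicator {0<..<B} \<sigma> * K \<sigma>)\<bar>"])
      show "integrable lborel (\<lambda>\<sigma>. \<bar>M * (indicator {0<..<B} \<sigma> * K \<sigma>)\<bar>)"
        by (intro integrable_abs integrable_mult_right loc_kernelD K)
      show "AE \<sigma> in lborel. (\<lambda>n. indicator {0<..<u n} \<sigma> * (K \<sigma> * f (u n - \<sigma>))) \<longlonglongrightarrow> indicator {0<..<t} \<sigma> * (K \<sigma> * f (t - \<sigma>))"
        using AE_lborel_singleton[of t]
      proof eventually_elim
        fix \<sigma> :: real assume "\<sigma> \<noteq> t"
        then have "\<sigma> < t \<or> t < \<sigma>" by auto
        then have "\<forall>\<^sub>F n in sequentially. indicator {0<..<u n} \<sigma> = (indicator {0<..<t} \<sigma> :: real)"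
        proof
          assume "\<sigma> < t"
          from order_tendstoD(1)[OF u this] show ?thesis
            by eventually_elim (use \<open>\<sigma> < t\<close> in \<open>auto simp: indicator_def\<close>)
        next
          assume "t < \<sigma>"
          from order_tendstoD(2)[OF u this] show ?thesis
            by eventually_elim (use \<open>t < \<sigma>\<close> in \<open>auto simp: indicator_def\<close>)
        qed
        then have "(\<lambda>n. indicator {0<..<u n} \<sigma> :: real) \<longlonglongrightarrow> indicator {0<..<t} \<sigma>"
          by (rule tendsto_eventually)
        moreover have "isCont f (t - \<sigma>)" using f by (simp add: continuous_on_eq_continuous_at)
        then have "(\<lambda>n. f (u n - \<sigma>)) \<longlonglongrightarrow> f (t - \<sigma>)"
          by (rule isCont_tendsto_compose) (intro tendsto_intros u)
        ultimately show "(\<lambda>n. indicator {0<..<u n} \<sigma> * (K \<sigma> * f (u n - \<sigma>))) \<longlonglongrightarrow> indicator {0<..<t} \<sigma> * (K \<sigma> * f (t - \<sigma>))"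
          by (intro tendsto_intros)
      qed
      show "AE \<sigma> in lborel. norm (indicator {0<..<u n} \<sigma> * (K \<sigma> * f (u n - \<sigma>))) \<le> \<bar>M * (indicator {0<..<B} \<sigma> * K \<sigma>)\<bar>" for n
      proof (rule AE_I2)
        fix \<sigma> :: real
        show "norm (indicator {0<..<u n} \<sigma> * (K \<sigma> * f (u n - \<sigma>))) \<le> \<bar>M * (indicator {0<..<B} \<sigma> * K \<sigma>)\<bar>"
        proof (cases "\<sigma> \<in> {0<..<u n}")
          case True
          have uB: "u n \<le> B" using B[of n] by linarith
          with True have "\<bar>f (u n - \<sigma>)\<bar> \<le> M" by (intro M) auto
          moreover have "\<sigma> \<in> {0<..<B}" using True uB by auto
          ultimately show ?thesis using True M by (simp add: abs_mult mult.commute[of M] mult_left_mono)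
        qed simp
      qed
    qed measurable
  qed
qed

text \<open>Fubini over the triangle 0 < \<sigma> < \<tau> < t, with the integrand written once
  around \<tau> - \<sigma> and once around \<tau>. Only h is continuous; both kernels may be
  singular.\<close>

lemma conv_assoc:
  assumes K: "loc_kernel K" and L: "loc_kernel L" and h: "continuous_on UNIV h"
  shows "conv K (conv L h) t = conv (conv K L) h t"
proof -
  note [measurable] = loc_kernelD(1)[OF K] loc_kernelD(1)[OF L] continuous_measurable_real[OF h]
  define F where "F = (\<lambda>\<sigma> \<tau>. indicator {0<..<t} \<sigma> * K \<sigma> * (indicator {\<sigma><..<t} \<tau> * (L (\<tau> - \<sigma>) * h (t - \<tau>))))"
  have F_alt: "F \<sigma> \<tau> = indicator {0<..<t} \<sigma> * K \<sigma> * (indicator {0<..<t - \<sigma>} (\<tau> - \<sigma>) * (L (\<tau> - \<sigma>) * h (t - \<sigma> - (\<tau> - \<sigma>))))" for \<sigma> \<tau>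
    by (auto simp: F_def indicator_def)
  have F_alt': "F \<sigma> \<tau> = indicator {0<..<t} \<tau> * h (t - \<tau>) * (indicator {0<..<\<tau>} \<sigma> * (K \<sigma> * L (\<tau> - \<sigma>)))" for \<sigma> \<tau>
    by (auto simp: F_def indicator_def)
  have Fm: "case_prod F \<in> borel_measurable (lborel \<Otimes>\<^sub>M lborel)"
  proof -
    have "case_prod F = (\<lambda>p. (if 0 < fst p \<and> fst p < snd p \<and> snd p < t then K (fst p) * (L (snd p - fst p) * h (t - snd p)) else 0))"
      by (auto simp: fun_eq_iff F_def indicator_def)
    also have "\<dots> \<in> borel_measurable (lborel \<Otimes>\<^sub>M lborel)" by measurable
    finally show ?thesis .
  qed
  have shift: "(LINT \<tau>|lborel. g (\<tau> - \<sigma>)) = (LINT \<tau>|lborel. g \<tau>)"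
       "integrable lborel (\<lambda>\<tau>. g (\<tau> - \<sigma>)) \<longleftrightarrow> integrable lborel g" for g :: "real \<Rightarrow> real" and \<sigma>
    using lborel_integral_real_affine[of 1 g "-\<sigma>"] lborel_integrable_real_affine_iff[of 1 g "-\<sigma>"]
    by (simp_all add: algebra_simps)
  have inner: "(LINT \<tau>|lborel. F \<sigma> \<tau>) = indicator {0<..<t} \<sigma> * (K \<sigma> * conv L h (t - \<sigma>))" for \<sigma>
    unfolding F_alt conv_def
    using shift(1)[of "\<lambda>\<rho>. indicator {0<..<t} \<sigma> * K \<sigma> * (indicator {0<..<t - \<sigma>} \<rho> * (L \<rho> * h (t - \<sigma> - \<rho>)))" \<sigma>]
    by (simp add: mult.assoc)
  have int1: "integrable lborel (F \<sigma>)" for \<sigma>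
    unfolding F_alt
    using shift(2)[of "\<lambda>\<rho>. indicator {0<..<t} \<sigma> * K \<sigma> * (indicator {0<..<t - \<sigma>} \<rho> * (L \<rho> * h (t - \<sigma> - \<rho>)))" \<sigma>]
      integrable_mult_right[OF conv_integrable[OF L h, of "t - \<sigma>"], of "indicator {0<..<t} \<sigma> * K \<sigma>"]
    by simp
  have Kabs: "loc_kernel (\<lambda>x. \<bar>L x\<bar>)"
  proof -
    have "integrable lborel (\<lambda>\<sigma>. indicator {0<..<T} \<sigma> * \<bar>L \<sigma>\<bar>)" for T
      using integrable_abs[OF loc_kernelD(2)[OF L, of T]] by (simp add: abs_mult)
    then show ?thesis by (simp add: loc_kernel_def)
  qed
  have habs: "continuous_on UNIV (\<lambda>x. \<bar>h x\<bar>)" by (intro continuous_intros h)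
  have norm_inner: "(LINT \<tau>|lborel. norm (F \<sigma> \<tau>)) = \<bar>indicator {0<..<t} \<sigma> * (K \<sigma> * conv (\<lambda>x. \<bar>L x\<bar>) (\<lambda>x. \<bar>h x\<bar>) (t - \<sigma>))\<bar>" for \<sigma>
  proof -
    have nn: "0 \<le> conv (\<lambda>x. \<bar>L x\<bar>) (\<lambda>x. \<bar>h x\<bar>) (t - \<sigma>)"
      unfolding conv_def by (intro Bochner_Integration.integral_nonneg) auto
    have "(LINT \<tau>|lborel. norm (F \<sigma> \<tau>)) = indicator {0<..<t} \<sigma> * \<bar>K \<sigma>\<bar> * conv (\<lambda>x. \<bar>L x\<bar>) (\<lambda>x. \<bar>h x\<bar>) (t - \<sigma>)"
      unfolding F_alt conv_def
      using shift(1)[of "\<lambda>\<rho>. indicator {0<..<t} \<sigma> * \<bar>K \<sigma>\<bar> * (indicator {0<..<t - \<sigma>} \<rho> * (\<bar>L \<rho>\<bar> * \<bar>h (t - \<sigma> - \<rho>)\<bar>))" \<sigma>]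
      by (simp add: abs_mult)
    then show ?thesis using nn by (simp add: abs_mult)
  qed
  \<comment> \<open>By \<open>norm_inner\<close> the iterated integral of |F| is that of |K| against
    the convolution of |L| and |h|. The latter is continuous, so the integral is finite.\<close>
  have int: "integrable (lborel \<Otimes>\<^sub>M lborel) (case_prod F)"
  proof (rule lborel_pair.Fubini_integrable[OF Fm])
    show "integrable lborel (\<lambda>\<sigma>. LINT \<tau>|lborel. norm (case_prod F (\<sigma>, \<tau>)))"
      using integrable_abs[OF conv_integrable[OF K conv_continuous[OF Kabs habs], of t]]
      by (simp add: norm_inner[unfolded real_norm_def])
    show "AE \<sigma> in lborel. integrable lborel (\<lambda>\<tau>. case_prod F (\<sigma>, \<tau>))"
      using int1 by simp
  qed
  have "conv K (conv L h) t = (LINT \<sigma>|lborel. LINT \<tau>|lborel. F \<sigma> \<tau>)"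
    by (simp add: inner conv_def)
  also have "\<dots> = (LINT \<tau>|lborel. LINT \<sigma>|lborel. F \<sigma> \<tau>)"
    by (rule lborel_pair.Fubini_integral[OF int, symmetric])
  also have "\<dots> = conv (conv K L) h t"
    unfolding conv_def F_alt' by (simp only: integral_mult_right_zero) (simp add: mult_ac)
  finally show ?thesis .
qed

subsection \<open>Mittag-Leffler kernels as resolvents\<close>

lemma has_bochner_integral_mono_AE:
  fixes f g :: "'a \<Rightarrow> real"
  assumes "has_bochner_integral M f x" "has_bochner_integral M g y" "AE z in M. f z \<le> g z"
  shows "x \<le> y"
  using assms integral_mono_AE[of M f g] by (auto simp: has_bochner_integral_iff)

context
  fixes \<alpha> :: real
  assumes \<alpha>: "0 < \<alpha>" "\<alpha> < 1"
begin

lemma pow_kernel_1: "0 < t \<Longrightarrow> pow_kernel 1 t = 1"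
  by (simp add: pow_kernel_def)

text \<open>Integration is convolution with \<open>pow_kernel 1\<close>, so it raises \<gamma> by
  one.\<close>

lemma has_bochner_integral_ml_kernel:
  assumes "0 < \<gamma>" "0 < t"
  shows "has_bochner_integral lborel (\<lambda>\<sigma>. indicator {0<..<t} \<sigma> * ml_kernel \<alpha> \<kappa> \<gamma> (t - \<sigma>)) (ml_kernel \<alpha> \<kappa> (\<gamma> + 1) t)"
proof -
  have "(\<lambda>\<sigma>. indicator {0<..<t} \<sigma> * (pow_kernel 1 \<sigma> * ml_kernel \<alpha> \<kappa> \<gamma> (t - \<sigma>)))
      = (\<lambda>\<sigma>. indicator {0<..<t} \<sigma> * ml_kernel \<alpha> \<kappa> \<gamma> (t - \<sigma>))"
    by (auto simp: fun_eq_iff indicator_def pow_kernel_1)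
  then show ?thesis
    using has_bochner_integral_ml_kernel_conv[OF \<alpha>, of 1 \<gamma> t \<kappa>] assms by (simp add: add.commute)
qed

lemma loc_kernel_ml_kernel:
  assumes "0 < \<gamma>"
  shows "loc_kernel (ml_kernel \<alpha> \<kappa> \<gamma>)"
  unfolding loc_kernel_def
proof (intro conjI allI)
  show "ml_kernel \<alpha> \<kappa> \<gamma> \<in> borel_measurable borel" by (rule ml_kernel_measurable[OF \<alpha> assms])
  fix T :: real
  show "integrable lborel (\<lambda>\<sigma>. indicator {0<..<T} \<sigma> * ml_kernel \<alpha> \<kappa> \<gamma> \<sigma>)"
  proof (cases "0 < T")
    case True
    have "integrable lborel (\<lambda>\<sigma>. indicator {0<..<T} \<sigma> * ml_kernel \<alpha> \<kappa> \<gamma> (T - \<sigma>))"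
      using has_bochner_integral_ml_kernel[OF assms True] by (simp add: has_bochner_integral_iff)
    from lborel_integrable_real_affine[OF this, of "-1" T]
    have "integrable lborel (\<lambda>\<sigma>. indicator {0<..<T} (T - \<sigma>) * ml_kernel \<alpha> \<kappa> \<gamma> \<sigma>)" by simp
    moreover have "(\<lambda>\<sigma>. indicator {0<..<T} (T - \<sigma>) * ml_kernel \<alpha> \<kappa> \<gamma> \<sigma>) = (\<lambda>\<sigma>. indicator {0<..<T} \<sigma> * ml_kernel \<alpha> \<kappa> \<gamma> \<sigma>)"
      by (auto simp: fun_eq_iff indicator_def)
    ultimately show ?thesis by simp
  qed simp
qed

text \<open>The power kernel is the member \<kappa> = 0 of the Mittag-Leffler family, so its local
  integrability is a special case.\<close>

lemma pow_kernel_eq_ml_kernel: "0 < \<gamma> \<Longrightarrow> pow_kernel \<gamma> = ml_kernel \<alpha> 0 \<gamma>"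
  by (simp add: fun_eq_iff pow_kernel_def ml_kernel_def mittag_leffler_0[OF \<alpha>])

lemma loc_kernel_pow_kernel: "0 < \<gamma> \<Longrightarrow> loc_kernel (pow_kernel \<gamma>)"
  by (simp add: pow_kernel_eq_ml_kernel loc_kernel_ml_kernel)

text \<open>The relaxation function E_\<alpha>(-\<kappa> t^\<alpha>), continued by the constant 1 to
  negative times so that it is continuous on the whole line.\<close>

definition ml_relax :: "real \<Rightarrow> real \<Rightarrow> real" where
  "ml_relax \<kappa> t = mittag_leffler \<alpha> 1 (- \<kappa> * max 0 t powr \<alpha>)"

lemma ml_relax_0: "t \<le> 0 \<Longrightarrow> ml_relax \<kappa> t = 1"
  by (simp add: ml_relax_def mittag_leffler_0[OF \<alpha>])

lemma ml_relax_eq: "0 < t \<Longrightarrow> ml_relax \<kappa> t = ml_kernel \<alpha> \<kappa> 1 t"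
  by (simp add: ml_relax_def ml_kernel_def)

lemma continuous_on_max_powr: "continuous_on UNIV (\<lambda>t::real. max 0 t powr \<alpha>)"
  using \<alpha> by (intro continuous_on_powr') (auto intro!: continuous_intros)

lemma ml_relax_continuous: "continuous_on UNIV (ml_relax \<kappa>)"
  unfolding ml_relax_def[abs_def]
  by (rule continuous_on_compose2[OF continuous_on_mittag_leffler[OF \<alpha>, of 1 UNIV]])
    (auto intro!: continuous_intros continuous_on_max_powr)

lemma conv_pow_ml_kernel:
  assumes "0 < \<beta>" "0 < \<gamma>" "0 < t"
  shows "conv (pow_kernel \<beta>) (ml_kernel \<alpha> \<kappa> \<gamma>) t = ml_kernel \<alpha> \<kappa> (\<beta> + \<gamma>) t"
  unfolding conv_def by (rule has_bochner_integral_integral_eq[OF has_bochner_integral_ml_kernel_conv[OF \<alpha> assms]])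

text \<open>The recurrence for \<gamma> = 1, whose remainder of index 1 + \<alpha> is the
  convolution of \<open>pow_kernel \<alpha>\<close> with the relaxation function.\<close>

lemma ml_relax_equation: "ml_relax \<kappa> t = 1 - \<kappa> * conv (pow_kernel \<alpha>) (ml_relax \<kappa>) t"
proof (cases "0 < t")
  case True
  have "conv (pow_kernel \<alpha>) (ml_relax \<kappa>) t = conv (pow_kernel \<alpha>) (ml_kernel \<alpha> \<kappa> 1) t"
    by (rule conv_cong) (simp_all add: ml_relax_eq)
  also have "\<dots> = ml_kernel \<alpha> \<kappa> (1 + \<alpha>) t"
    using conv_pow_ml_kernel[of \<alpha> 1 t \<kappa>] \<alpha> True by (simp add: add.commute)
  finally show ?thesis
    using ml_kernel_recurrence[OF \<alpha>, of 1 t \<kappa>] True by (simp add: ml_relax_eq pow_kernel_1)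
qed (simp add: ml_relax_0 conv_nonpos)

text \<open>The resolvent equation. It is the recurrence for \<gamma> = \<alpha>, whose remainder of
  index 2 \<alpha> is again a convolution with \<open>pow_kernel \<alpha>\<close>.\<close>

lemma ml_kernel_equation:
  assumes "0 < t"
  shows "ml_kernel \<alpha> \<kappa> \<alpha> t = pow_kernel \<alpha> t - \<kappa> * conv (pow_kernel \<alpha>) (ml_kernel \<alpha> \<kappa> \<alpha>) t"
  using ml_kernel_recurrence[OF \<alpha>, of \<alpha> t \<kappa>] conv_pow_ml_kernel[of \<alpha> \<alpha> t \<kappa>] \<alpha> assms by simp

lemma ml_relax_ge_1: "\<kappa> \<le> 0 \<Longrightarrow> 1 \<le> ml_relax \<kappa> t"
  using mittag_leffler_ge[OF \<alpha>, of 1 "- \<kappa> * max 0 t powr \<alpha>"]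
  by (simp add: ml_relax_def mult_nonpos_nonneg)

text \<open>A Gronwall lemma: the quotient of \<open>D\<close> by the weight \<open>E\<^sub>\<alpha>(\<mu> t\<^sup>\<alpha>)\<close> with large \<open>\<mu>\<close> is contracted.\<close>
lemma fractional_Gronwall:
  assumes D: "continuous_on UNIV D" and L: "0 \<le> L"
    and le: "\<And>t. 0 \<le> t \<Longrightarrow> t \<le> T \<Longrightarrow> D t \<le> L * conv (pow_kernel \<alpha>) D t"
    and t: "0 \<le> t" "t \<le> T"
  shows "D t \<le> 0"
proof -
  \<comment> \<open>L / \<mu> < 1/2 makes the contraction strict; the added 1 keeps \<mu> positive
    for L = 0.\<close>
  define \<mu> where "\<mu> = 2 * L + 1"
  define w where "w = ml_relax (- \<mu>)"
  have \<mu>: "0 < \<mu>" using L by (simp add: \<mu>_def)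
  have w1: "1 \<le> w x" for x unfolding w_def using \<mu> by (intro ml_relax_ge_1) simp
  have wc: "continuous_on UNIV w" unfolding w_def by (rule ml_relax_continuous)
  have weq: "\<mu> * conv (pow_kernel \<alpha>) w x = w x - 1" for x
    unfolding w_def using ml_relax_equation[of "- \<mu>" x] by simp
  have wn: "w x \<noteq> 0" for x using w1[of x] by linarith
  \<comment> \<open>At a maximum of D / w with value m, D \<le> m w also holds at all earlier times,
    the only ones the convolution sees.\<close>
  have "\<exists>x\<in>{0..T}. \<forall>y\<in>{0..T}. D y / w y \<le> D x / w x"
    using t wn by (intro continuous_attains_sup)
      (auto intro!: continuous_intros continuous_on_subset[OF D] continuous_on_subset[OF wc])
  then obtain x where x: "0 \<le> x" "x \<le> T" and max: "\<And>y. 0 \<le> y \<Longrightarrow> y \<le> T \<Longrightarrow> D y / w y \<le> D x / w x"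
    by auto
  define m where "m = D x / w x"
  have Dm: "D y \<le> m * w y" if "0 \<le> y" "y \<le> T" for y
    using max[OF that] w1[of y] by (simp add: m_def[symmetric] divide_le_eq)
  have "m \<le> 0"
  proof (rule ccontr)
    assume m: "\<not> m \<le> 0"
    have "m * w x = D x" using wn by (simp add: m_def)
    also have "\<dots> \<le> L * conv (pow_kernel \<alpha>) D x" by (rule le[OF x])
    also have "\<dots> \<le> L * conv (pow_kernel \<alpha>) (\<lambda>y. m * w y) x"
      using x \<alpha> by (intro mult_left_mono L conv_mono loc_kernel_pow_kernel pow_kernel_nonneg D Dm)
        (auto intro!: continuous_intros wc)
    also have "\<dots> = L * m * conv (pow_kernel \<alpha>) w x" by (simp add: conv_scale)
    also have "2 * (L * m * conv (pow_kernel \<alpha>) w x) \<le> m * (\<mu> * conv (pow_kernel \<alpha>) w x)"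
    proof -
      have "0 \<le> conv (pow_kernel \<alpha>) w x"
      proof -
        have "0 \<le> \<mu> * conv (pow_kernel \<alpha>) w x" unfolding weq using w1[of x] by simp
        then show ?thesis using \<mu> by (simp add: zero_le_mult_iff)
      qed
      then have "0 \<le> m * conv (pow_kernel \<alpha>) w x" using m by simp
      then show ?thesis by (simp add: \<mu>_def algebra_simps)
    qed
    finally have "2 * (m * w x) \<le> m * (w x - 1)"
      unfolding weq by linarith
    then have "m * (w x + 1) \<le> 0" by (simp add: algebra_simps)
    moreover have "0 < m * (w x + 1)" using m w1[of x] by (intro mult_pos_pos) auto
    ultimately show False by simp
  qed
  then have "m * w t \<le> 0" using w1[of t] by (simp add: mult_nonpos_nonneg)
  then show ?thesis using Dm[OF t] by linarith
qed

text \<open>The formula is substituted into the equation: with a the power kernel and r the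
  resolvent, associativity turns a * (r * f) into (a * r) * f, and the resolvent equation replaces
  \<kappa> (a * r) by a - r.\<close>

lemma resolvent_solves:
  assumes f: "continuous_on UNIV f"
  shows "ml_relax \<kappa> t * y0 + conv (ml_kernel \<alpha> \<kappa> \<alpha>) f t
       = y0 + conv (pow_kernel \<alpha>) (\<lambda>x. f x - \<kappa> * (ml_relax \<kappa> x * y0 + conv (ml_kernel \<alpha> \<kappa> \<alpha>) f x)) t"
proof -
  let ?a = "pow_kernel \<alpha>" and ?r = "ml_kernel \<alpha> \<kappa> \<alpha>"
  have a: "loc_kernel ?a" and r: "loc_kernel ?r"
    using \<alpha> by (auto intro: loc_kernel_pow_kernel loc_kernel_ml_kernel)
  have rf: "continuous_on UNIV (conv ?r f)" by (rule conv_continuous[OF r f])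
  have "conv ?a (\<lambda>x. f x - (\<kappa> * y0 * ml_relax \<kappa> x + \<kappa> * conv ?r f x)) t
      = conv ?a f t - (\<kappa> * y0 * conv ?a (ml_relax \<kappa>) t + \<kappa> * conv ?a (conv ?r f) t)"
    using a f rf ml_relax_continuous
    by (simp add: conv_diff conv_add conv_scale continuous_on_add continuous_on_mult)
  also have "conv ?a (conv ?r f) t = conv (conv ?a ?r) f t"
    by (rule conv_assoc[OF a r f])
  also have "\<kappa> * conv (conv ?a ?r) f t = conv ?a f t - conv ?r f t"
  proof -
    have "\<kappa> * conv (conv ?a ?r) f t = \<kappa> * conv f (conv ?a ?r) t" by (simp add: conv_commute[of f])
    also have "\<dots> = conv f (\<lambda>x. \<kappa> * conv ?a ?r x) t" by (simp add: conv_scale)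
    also have "\<dots> = conv f (\<lambda>x. ?a x - ?r x) t"
      by (rule conv_cong) (use ml_kernel_equation in auto)
    also have "\<dots> = conv (\<lambda>x. ?a x - ?r x) f t" by (rule conv_commute)
    also have "\<dots> = conv ?a f t - conv ?r f t"
      unfolding conv_def
      using conv_integrable[OF a f] conv_integrable[OF r f] by (simp add: left_diff_distrib right_diff_distrib)
    finally show ?thesis .
  qed
  also have "\<kappa> * y0 * conv ?a (ml_relax \<kappa>) t = y0 * (1 - ml_relax \<kappa> t)"
    using ml_relax_equation[of \<kappa> t] by simp
  finally show ?thesis by (simp add: algebra_simps)
qed

text \<open>Variation of constants. The formula solves the equation by
  \<open>resolvent_solves\<close>, and a second solution on [0, T] coincides with it by Gronwall
  with L = |\<kappa>|. The parameter \<kappa> is free: the values \<open>lam k\<close> will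
  translate the mild formulation, large ones will drive the norm bound.\<close>

theorem resolvent_equation_iff:
  assumes f: "continuous_on UNIV f" and y: "continuous_on UNIV y"
  shows "(\<forall>t\<in>{0..T}. y t = ml_relax \<kappa> t * y0 + conv (ml_kernel \<alpha> \<kappa> \<alpha>) f t) \<longleftrightarrow>
         (\<forall>t\<in>{0..T}. y t = y0 + conv (pow_kernel \<alpha>) (\<lambda>x. f x - \<kappa> * y x) t)"
proof -
  let ?a = "pow_kernel \<alpha>"
  define z where "z = (\<lambda>t. ml_relax \<kappa> t * y0 + conv (ml_kernel \<alpha> \<kappa> \<alpha>) f t)"
  have a: "loc_kernel ?a" using \<alpha> by (auto intro: loc_kernel_pow_kernel)
  have z: "continuous_on UNIV z" unfolding z_def
    using \<alpha> by (intro continuous_intros ml_relax_continuous conv_continuous loc_kernel_ml_kernel f)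
  have zeq: "z t = y0 + conv ?a (\<lambda>x. f x - \<kappa> * z x) t" for t
    unfolding z_def by (rule resolvent_solves[OF f])
  have "(\<forall>t\<in>{0..T}. y t = z t) \<longleftrightarrow> (\<forall>t\<in>{0..T}. y t = y0 + conv ?a (\<lambda>x. f x - \<kappa> * y x) t)"
  proof
    assume yz: "\<forall>t\<in>{0..T}. y t = z t"
    show "\<forall>t\<in>{0..T}. y t = y0 + conv ?a (\<lambda>x. f x - \<kappa> * y x) t"
    proof
      fix t assume t: "t \<in> {0..T}"
      have "conv ?a (\<lambda>x. f x - \<kappa> * y x) t = conv ?a (\<lambda>x. f x - \<kappa> * z x) t"
        by (rule conv_cong) (use t yz in auto)
      then show "y t = y0 + conv ?a (\<lambda>x. f x - \<kappa> * y x) t" using zeq[of t] yz t by simp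
    qed
  next
    assume yeq: "\<forall>t\<in>{0..T}. y t = y0 + conv ?a (\<lambda>x. f x - \<kappa> * y x) t"
    show "\<forall>t\<in>{0..T}. y t = z t"
    proof
      fix t assume t: "t \<in> {0..T}"
      have "\<bar>y t - z t\<bar> \<le> 0"
      proof (rule fractional_Gronwall[where D="\<lambda>t. \<bar>y t - z t\<bar>" and L="\<bar>\<kappa>\<bar>" and T=T])
        show "continuous_on UNIV (\<lambda>t. \<bar>y t - z t\<bar>)" by (intro continuous_intros y z)
        fix s assume s: "0 \<le> s" "s \<le> T"
        have "y s - z s = conv ?a (\<lambda>x. f x - \<kappa> * y x) s - conv ?a (\<lambda>x. f x - \<kappa> * z x) s"
          using yeq zeq[of s] s by auto
        also have "\<dots> = conv ?a (\<lambda>x. (f x - \<kappa> * y x) - (f x - \<kappa> * z x)) s"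
          by (rule conv_diff[symmetric, OF a]) (intro continuous_intros f y z)+
        also have "(\<lambda>x. (f x - \<kappa> * y x) - (f x - \<kappa> * z x)) = (\<lambda>x. - \<kappa> * (y x - z x))"
          by (simp add: fun_eq_iff algebra_simps)
        finally have "\<bar>y s - z s\<bar> = \<bar>\<kappa>\<bar> * \<bar>conv ?a (\<lambda>x. y x - z x) s\<bar>"
          by (simp only: conv_scale abs_mult abs_minus_cancel)
        also have "\<dots> \<le> \<bar>\<kappa>\<bar> * conv ?a (\<lambda>x. \<bar>y x - z x\<bar>) s"
          using \<alpha> by (intro mult_left_mono conv_abs_le a pow_kernel_nonneg continuous_intros y z) auto
        finally show "\<bar>y s - z s\<bar> \<le> \<bar>\<kappa>\<bar> * conv ?a (\<lambda>x. \<bar>y x - z x\<bar>) s" .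
      qed (use t in auto)
      then show "y t = z t" by simp
    qed
  qed
  then show ?thesis by (simp only: z_def)
qed

section \<open>Sign and size of the resolvent\<close>

lemma continuous_on_ml_kernel: "0 < \<gamma> \<Longrightarrow> continuous_on {0<..} (ml_kernel \<alpha> \<kappa> \<gamma>)"
  unfolding ml_kernel_def[abs_def]
  by (intro continuous_intros continuous_on_compose2[OF continuous_on_mittag_leffler[OF \<alpha>, of \<gamma> UNIV]]) auto

lemma integral_ml_kernel:
  assumes "0 < \<gamma>" "0 < t"
  shows "(LINT \<sigma>|lborel. indicator {0<..<t} \<sigma> * ml_kernel \<alpha> \<kappa> \<gamma> \<sigma>) = ml_kernel \<alpha> \<kappa> (\<gamma> + 1) t"
proof -
  have "conv (\<lambda>_. 1) (ml_kernel \<alpha> \<kappa> \<gamma>) t = ml_kernel \<alpha> \<kappa> (\<gamma> + 1) t"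
    using has_bochner_integral_integral_eq[OF has_bochner_integral_ml_kernel[OF assms]] by (simp add: conv_def)
  moreover have "conv (\<lambda>_. 1) (ml_kernel \<alpha> \<kappa> \<gamma>) t = conv (ml_kernel \<alpha> \<kappa> \<gamma>) (\<lambda>_. 1) t"
    by (rule conv_commute)
  ultimately show ?thesis by (simp add: conv_def)
qed

text \<open>At a first zero \<open>t0\<close> of the resolvent \<open>r\<close> compare the equation \<open>r = a - \<kappa> a * r\<close> at \<open>t0\<close> with the
  one at a nearby earlier point, using that \<open>a(x + h) / a(x)\<close> is nondecreasing in \<open>x\<close>.\<close>
lemma ml_kernel_pos:
  assumes \<kappa>: "0 < \<kappa>" and t: "0 < t"
  shows "0 < ml_kernel \<alpha> \<kappa> \<alpha> t"
proof (rule ccontr)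
  let ?a = "pow_kernel \<alpha>" and ?r = "ml_kernel \<alpha> \<kappa> \<alpha>"
  assume neg: "\<not> 0 < ?r t"
  \<comment> \<open>The kernel without its singular power: it is continuous up to 0 and positive
    there, so the set where it is nonpositive is closed and has a least element t0 > 0.\<close>
  define q where "q = (\<lambda>x::real. mittag_leffler \<alpha> \<alpha> (- \<kappa> * max 0 x powr \<alpha>))"
  have rq: "?r x = x powr (\<alpha> - 1) * q x" if "0 < x" for x
    using that by (simp add: ml_kernel_def q_def)
  have qc: "continuous_on UNIV q" unfolding q_def
    by (rule continuous_on_compose2[OF continuous_on_mittag_leffler[OF \<alpha> \<alpha>(1), of UNIV]])
      (auto intro!: continuous_intros continuous_on_max_powr)
  define Z where "Z = {0..t} \<inter> q -` {..0}"
  have "closed Z" unfolding Z_def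
    by (intro continuous_closed_preimage continuous_on_subset[OF qc]) auto
  then have "compact Z"
    by (auto simp: compact_eq_bounded_closed Z_def intro: bounded_subset[of "{0..t}"])
  have "q t \<le> 0" using neg rq[OF t] t by (simp add: zero_less_mult_iff not_less)
  then have "t \<in> Z" using t by (simp add: Z_def)
  obtain t0 where t0Z: "t0 \<in> Z" and t0min: "\<And>x. x \<in> Z \<Longrightarrow> t0 \<le> x"
    using compact_attains_inf[OF \<open>compact Z\<close>] \<open>t \<in> Z\<close> by blast
  have q0: "0 < q 0" using \<alpha> by (simp add: q_def mittag_leffler_0[OF \<alpha>])
  have t0: "0 < t0" using t0Z q0 by (cases "t0 = 0") (auto simp: Z_def)
  have rpos: "0 < ?r x" if "0 < x" "x < t0" for x
  proof -
    have "x \<notin> Z" using t0min that by force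
    then have "0 < q x" using that t0Z by (auto simp: Z_def)
    then show ?thesis using rq that by simp
  qed
  have rt0: "?r t0 \<le> 0" using rq[OF t0] t0Z t0 by (auto simp: Z_def mult_nonneg_nonpos)
  \<comment> \<open>A d is the integral of a over (0, d).\<close>
  define A where "A = ml_kernel \<alpha> 0 (\<alpha> + 1)"
  have Aeq: "A x = x powr \<alpha> / Gamma (\<alpha> + 1)" for x
    using \<alpha> by (simp add: A_def ml_kernel_def mittag_leffler_0[OF \<alpha>])
  have "((\<lambda>x. \<kappa> * (x powr \<alpha> / Gamma (\<alpha> + 1))) \<longlongrightarrow> 0) (at_right 0)"
  proof -
    have "((\<lambda>x::real. x powr \<alpha>) \<longlongrightarrow> 0) (at_right 0)" using \<alpha> by real_asymp
    then have "((\<lambda>x. \<kappa> * (x powr \<alpha> / Gamma (\<alpha> + 1))) \<longlongrightarrow> \<kappa> * (0 / Gamma (\<alpha> + 1))) (at_right 0)"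
      using less_imp_neq[OF Gamma_real_pos[of "\<alpha> + 1"]] \<alpha> by (intro tendsto_intros) auto
    then show ?thesis by simp
  qed
  then have "\<forall>\<^sub>F x in at_right 0. \<kappa> * (x powr \<alpha> / Gamma (\<alpha> + 1)) < 1 / 2"
    by (rule order_tendstoD) simp
  then obtain \<delta> where \<delta>: "0 < \<delta>" and small: "\<And>x. 0 < x \<Longrightarrow> x < \<delta> \<Longrightarrow> \<kappa> * A x < 1 / 2"
    unfolding eventually_at_right_field Aeq by auto
  \<comment> \<open>Two demands on points s of [t1, t0): t0 - t1 < \<delta> gives \<kappa> A(t0 - s)
    < 1/2, and t1 \<ge> t0 / 2 gives a(t0) / a(s) \<ge> 1/2.\<close>
  define t1 where "t1 = max (t0 / 2) (t0 - \<delta> / 2)"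
  have t1: "t0 / 2 \<le> t1" "t1 < t0" "t0 - t1 < \<delta>" using t0 \<delta> by (auto simp: t1_def)
  \<comment> \<open>The earlier point is a maximiser s of r on [t1, t0]. On (s, t0) the kernel r is
    then at most r(s), and on (0, s) the values of a at the two times compare with the constant
    c.\<close>
  have "\<exists>x\<in>{t1..t0}. \<forall>y\<in>{t1..t0}. ?r y \<le> ?r x"
    using t0 t1 \<alpha> by (intro continuous_attains_sup continuous_on_subset[OF continuous_on_ml_kernel]) auto
  then obtain s where s: "t1 \<le> s" "s \<le> t0" and smax: "\<And>y. t1 \<le> y \<Longrightarrow> y \<le> t0 \<Longrightarrow> ?r y \<le> ?r s" by auto
  have rt1: "0 < ?r t1" using rpos t1 t0 by simp
  then have rs: "0 < ?r s" using smax[of t1] t1 by simp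
  then have st0: "s < t0" using s rt0 by (cases "s = t0") auto
  have spos: "0 < s" using s t1 t0 by linarith
  define c where "c = ?a t0 / ?a s"
  have a_pos: "0 < ?a x" if "0 < x" for x using pow_kernel_pos \<alpha> that by blast
  have c_eq: "c = (t0 / s) powr (\<alpha> - 1)"
    using \<alpha> less_imp_neq[OF Gamma_real_pos[OF \<alpha>(1)]] by (simp add: c_def pow_kernel_def powr_divide)
  have c_half: "1 / 2 \<le> c"
  proof -
    note c_eq
    moreover have "(2::real) powr (- 1) \<le> 2 powr (\<alpha> - 1)" using \<alpha> by (intro powr_mono) auto
    moreover have "2 powr (\<alpha> - 1) \<le> (t0 / s) powr (\<alpha> - 1)"
      using s t1 t0 spos \<alpha> by (intro powr_mono2') (auto simp: field_simps)
    ultimately show ?thesis by (simp add: powr_minus_divide)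
  qed
  have ratio: "?a (t0 - x) \<le> c * ?a (s - x)" if "0 < x" "x < s" for x
  proof -
    have "(t0 - x) powr (\<alpha> - 1) = ((t0 - x) / (s - x)) powr (\<alpha> - 1) * (s - x) powr (\<alpha> - 1)"
      using that by (simp add: powr_divide)
    also have "\<dots> \<le> (t0 / s) powr (\<alpha> - 1) * (s - x) powr (\<alpha> - 1)"
    proof (rule mult_right_mono)
      have "t0 / s \<le> (t0 - x) / (s - x)"
        using that st0 spos by (simp add: field_simps)
      then show "((t0 - x) / (s - x)) powr (\<alpha> - 1) \<le> (t0 / s) powr (\<alpha> - 1)"
        using \<alpha> t0 spos by (intro powr_mono2') auto
    qed simp
    finally have "(t0 - x) powr (\<alpha> - 1) \<le> (t0 / s) powr (\<alpha> - 1) * (s - x) powr (\<alpha> - 1)" .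
    then show ?thesis
      using divide_right_mono[of _ _ "Gamma \<alpha>"] Gamma_real_pos[OF \<alpha>(1)]
      by (fastforce simp: pow_kernel_def c_eq)
  qed
  have rK: "loc_kernel ?r" and aK: "loc_kernel ?a" using \<alpha> by (auto intro: loc_kernel_ml_kernel loc_kernel_pow_kernel)
  have conv_r: "has_bochner_integral lborel (\<lambda>x. indicator {0<..<\<tau>} x * (?r x * ?a (\<tau> - x))) (conv ?a ?r \<tau>)"
    if "0 < \<tau>" for \<tau>
  proof -
    have "integrable lborel (\<lambda>\<sigma>. indicator {0<..<\<tau>} \<sigma> * (?a \<sigma> * ?r (\<tau> - \<sigma>)))"
      using has_bochner_integral_ml_kernel_conv[OF \<alpha> \<alpha>(1) \<alpha>(1) that] by (simp add: has_bochner_integral_iff)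
    from lborel_integrable_real_affine[OF this, of "-1" \<tau>]
    have "integrable lborel (\<lambda>x. indicator {0<..<\<tau>} (\<tau> - x) * (?a (\<tau> - x) * ?r x))" by simp
    moreover have "(\<lambda>x. indicator {0<..<\<tau>} (\<tau> - x) * (?a (\<tau> - x) * ?r x)) = (\<lambda>x. indicator {0<..<\<tau>} x * (?r x * ?a (\<tau> - x)))"
      by (auto simp: fun_eq_iff indicator_def)
    ultimately have "integrable lborel (\<lambda>x. indicator {0<..<\<tau>} x * (?r x * ?a (\<tau> - x)))" by simp
    then show ?thesis using conv_commute[of ?a ?r \<tau>] by (simp add: has_bochner_integral_iff conv_def)
  qed
  define d where "d = t0 - s"
  have d: "0 < d" "\<kappa> * A d < 1 / 2" using st0 small[of d] s t1 by (auto simp: d_def)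
  have tail: "has_bochner_integral lborel (\<lambda>x. indicator {s<..<t0} x * ?a (t0 - x)) (A d)"
  proof -
    have "has_bochner_integral lborel (\<lambda>\<sigma>. indicator {0<..<d} \<sigma> * ml_kernel \<alpha> 0 \<alpha> (d - \<sigma>)) (A d)"
      unfolding A_def by (rule has_bochner_integral_ml_kernel[OF \<alpha>(1) d(1)])
    then have "has_bochner_integral lborel (\<lambda>x. indicator {0<..<d} (- s + 1 * x) * ml_kernel \<alpha> 0 \<alpha> (d - (- s + 1 * x))) (A d /\<^sub>R \<bar>1\<bar>)"
      by (subst (asm) lborel_has_bochner_integral_real_affine_iff[of 1 _ _ "- s"]) simp_all
    moreover have "(\<lambda>x. indicator {0<..<d} (- s + 1 * x) * ml_kernel \<alpha> 0 \<alpha> (d - (- s + 1 * x))) = (\<lambda>x. indicator {s<..<t0} x * ?a (t0 - x))"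
      using \<alpha> by (auto simp: fun_eq_iff indicator_def d_def pow_kernel_eq_ml_kernel)
    ultimately show ?thesis by simp
  qed
  have "conv ?a ?r t0 \<le> c * conv ?a ?r s + ?r s * A d"
  proof -
    have R: "has_bochner_integral lborel (\<lambda>x. c * (indicator {0<..<s} x * (?r x * ?a (s - x))) + ?r s * (indicator {s<..<t0} x * ?a (t0 - x)))
       (c * conv ?a ?r s + ?r s * A d)"
      by (intro has_bochner_integral_add has_bochner_integral_mult_right conv_r tail spos)
    show ?thesis
    proof (rule has_bochner_integral_mono_AE[OF conv_r[OF t0] R])
      show "AE x in lborel. indicator {0<..<t0} x * (?r x * ?a (t0 - x))
         \<le> c * (indicator {0<..<s} x * (?r x * ?a (s - x))) + ?r s * (indicator {s<..<t0} x * ?a (t0 - x))"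
        using AE_lborel_singleton[of s]
      proof eventually_elim
        fix x assume "x \<noteq> s"
        then consider "x \<le> 0" | "0 < x" "x < s" | "s < x" "x < t0" | "t0 \<le> x" by linarith
        then show "indicator {0<..<t0} x * (?r x * ?a (t0 - x))
         \<le> c * (indicator {0<..<s} x * (?r x * ?a (s - x))) + ?r s * (indicator {s<..<t0} x * ?a (t0 - x))"
        proof cases
          case 2
          have "?r x * ?a (t0 - x) \<le> ?r x * (c * ?a (s - x))"
            using 2 st0 rpos[of x] by (intro mult_left_mono ratio) auto
          then show ?thesis using 2 st0 by (simp add: mult.left_commute)
        next
          case 3
          have "?r x * ?a (t0 - x) \<le> ?r s * ?a (t0 - x)"
            using 3 s a_pos[of "t0 - x"] by (intro mult_right_mono smax) auto
          then show ?thesis using 3 spos by simp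
        qed (use spos st0 in auto)
      qed
    qed
  qed
  then have "\<kappa> * conv ?a ?r t0 \<le> c * (\<kappa> * conv ?a ?r s) + ?r s * (\<kappa> * A d)"
    using mult_left_mono[of _ _ \<kappa>] \<kappa> by (fastforce simp: algebra_simps)
  also have "\<kappa> * conv ?a ?r s = ?a s - ?r s"
    using ml_kernel_equation[OF spos, of \<kappa>] by simp
  finally have "\<kappa> * conv ?a ?r t0 \<le> c * ?a s - ?r s * (c - \<kappa> * A d)"
    by (simp add: algebra_simps)
  moreover have "c * ?a s = ?a t0" using a_pos[OF spos] by (simp add: c_def)
  moreover have "?r t0 = ?a t0 - \<kappa> * conv ?a ?r t0" by (rule ml_kernel_equation[OF t0])
  \<comment> \<open>Since c a(s) = a(t0), these terms cancel and leave a positive lower bound for r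
    at a point where it is nonpositive.\<close>
  ultimately have "?r s * (c - \<kappa> * A d) \<le> ?r t0" by linarith
  moreover have "0 < ?r s * (c - \<kappa> * A d)" using rs c_half d by (intro mult_pos_pos) linarith+
  ultimately show False using rt0 by linarith
qed

lemma ml_relax_eq_integral:
  assumes "0 < t"
  shows "ml_relax \<kappa> t = 1 - \<kappa> * (LINT \<sigma>|lborel. indicator {0<..<t} \<sigma> * ml_kernel \<alpha> \<kappa> \<alpha> \<sigma>)"
  using assms \<alpha> ml_kernel_recurrence[OF \<alpha>, of 1 t \<kappa>]
  by (simp add: ml_relax_eq pow_kernel_1 integral_ml_kernel add.commute)

text \<open>With \<open>b = t\<^sup>-\<^sup>\<alpha> / \<Gamma>(1 - \<alpha>)\<close> one has \<open>s = b * r \<ge> b(t) \<integral> r = b(t) (1 - s) / \<kappa>\<close>.\<close>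
lemma ml_relax_lower_bound:
  assumes \<kappa>: "0 < \<kappa>" and t: "0 < t"
  shows "pow_kernel (1 - \<alpha>) t / (\<kappa> + pow_kernel (1 - \<alpha>) t) \<le> ml_relax \<kappa> t"
proof -
  let ?b = "pow_kernel (1 - \<alpha>)" and ?r = "ml_kernel \<alpha> \<kappa> \<alpha>"
  have b: "0 < ?b t" using \<alpha> t by (intro pow_kernel_pos) auto
  have 1: "has_bochner_integral lborel (\<lambda>\<sigma>. indicator {0<..<t} \<sigma> * (?b \<sigma> * ?r (t - \<sigma>))) (ml_kernel \<alpha> \<kappa> 1 t)"
    using has_bochner_integral_ml_kernel_conv[OF \<alpha>, of "1 - \<alpha>" \<alpha> t \<kappa>] \<alpha> t by simp
  have 2: "has_bochner_integral lborel (\<lambda>\<sigma>. ?b t * (indicator {0<..<t} \<sigma> * ?r (t - \<sigma>))) (?b t * ml_kernel \<alpha> \<kappa> (\<alpha> + 1) t)"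
    using \<alpha> t by (intro has_bochner_integral_mult_right has_bochner_integral_ml_kernel) auto
  have "?b t * ml_kernel \<alpha> \<kappa> (\<alpha> + 1) t \<le> ml_kernel \<alpha> \<kappa> 1 t"
  proof (rule has_bochner_integral_mono_AE[OF 2 1], rule AE_I2)
    fix \<sigma> :: real
    show "?b t * (indicator {0<..<t} \<sigma> * ?r (t - \<sigma>)) \<le> indicator {0<..<t} \<sigma> * (?b \<sigma> * ?r (t - \<sigma>))"
    proof (cases "\<sigma> \<in> {0<..<t}")
      case True
      have "?b t \<le> ?b \<sigma>" unfolding pow_kernel_def
        using True \<alpha> by (intro divide_right_mono powr_mono2') (auto simp: less_imp_le)
      moreover have "0 < ?r (t - \<sigma>)" using True by (intro ml_kernel_pos \<kappa>) auto
      ultimately show ?thesis using True by simp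
    qed simp
  qed
  moreover have "\<kappa> * ml_kernel \<alpha> \<kappa> (\<alpha> + 1) t = 1 - ml_relax \<kappa> t"
    using ml_kernel_recurrence[OF \<alpha>, of 1 t \<kappa>] t by (simp add: ml_relax_eq pow_kernel_1 add.commute)
  then have "ml_kernel \<alpha> \<kappa> (\<alpha> + 1) t = (1 - ml_relax \<kappa> t) / \<kappa>"
    using \<kappa> by (simp add: field_simps)
  ultimately have "?b t * ((1 - ml_relax \<kappa> t) / \<kappa>) \<le> ml_relax \<kappa> t"
    using t by (simp add: ml_relax_eq)
  then show ?thesis using \<kappa> b by (simp add: field_simps)
qed

end

subsection \<open>Fractional integral equations in Hilbert space\<close>

text \<open>The Riemann-Liouville integral after the substitution \<open>\<sigma> = t \<rho>\<^sup>1\<^sup>/\<^sup>\<alpha>\<close>, which removes the singularity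
  and makes the integrand continuous.\<close>
definition frac_int :: "real \<Rightarrow> (real \<Rightarrow> 'a :: banach) \<Rightarrow> real \<Rightarrow> 'a" where
  "frac_int \<alpha> g t = (max 0 t powr \<alpha> / Gamma (\<alpha> + 1)) *\<^sub>R
     integral {0..1} (\<lambda>\<rho>. g (max 0 t * (1 - \<rho> powr (1 / \<alpha>))))"

text \<open>The map is the identity on the ball of radius R and projects onto the sphere outside.
  Varying the vector and the scalar factor one at a time gives the constant 2.\<close>

lemma radial_projection_Lipschitz:
  fixes x y :: "'a :: real_normed_vector"
  assumes R: "0 < R"
  shows "norm ((R / max R (norm x)) *\<^sub>R x - (R / max R (norm y)) *\<^sub>R y) \<le> 2 * norm (x - y)"
proof -
  define mx my where "mx = max R (norm x)" and "my = max R (norm y)"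
  have m: "R \<le> mx" "R \<le> my" "norm x \<le> mx" "norm y \<le> my" "0 < mx" "0 < my"
    using R by (auto simp: mx_def my_def)
  have "\<bar>my - mx\<bar> \<le> \<bar>norm x - norm y\<bar>" by (auto simp: mx_def my_def)
  also have "\<dots> \<le> norm (x - y)" by (rule norm_triangle_ineq3)
  finally have mm: "\<bar>my - mx\<bar> \<le> norm (x - y)" .
  have "(R / mx) *\<^sub>R x - (R / my) *\<^sub>R y = (R / mx) *\<^sub>R (x - y) + ((R / mx) * ((my - mx) / my)) *\<^sub>R y"
    using m by (simp add: algebra_simps diff_divide_distrib)
  also have "norm \<dots> \<le> norm ((R / mx) *\<^sub>R (x - y)) + norm (((R / mx) * ((my - mx) / my)) *\<^sub>R y)"
    by (rule norm_triangle_ineq)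
  also have "\<dots> = (R / mx) * norm (x - y) + (R / mx) * \<bar>my - mx\<bar> * (norm y / my)"
    using m R by (simp add: abs_mult)
  also have "\<dots> \<le> 1 * norm (x - y) + 1 * norm (x - y) * 1"
    using m R mm by (intro add_mono mult_mono) auto
  finally show ?thesis by (simp add: mx_def my_def)
qed

lemma locally_Lipschitz_continuous:
  fixes F :: "'a :: real_normed_vector \<Rightarrow> 'b :: real_normed_vector"
  assumes "\<And>R. \<exists>L\<ge>0. \<forall>x y. norm x \<le> R \<longrightarrow> norm y \<le> R \<longrightarrow> norm (F x - F y) \<le> L * norm (x - y)"
  shows "continuous_on UNIV F"
proof (rule continuous_at_imp_continuous_on, rule ballI)
  fix x :: 'a
  obtain L where L: "0 \<le> L" "\<And>y z. norm y \<le> norm x + 1 \<Longrightarrow> norm z \<le> norm x + 1 \<Longrightarrow> norm (F y - F z) \<le> L * norm (y - z)"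
    using assms[of "norm x + 1"] by metis
  have "((\<lambda>y. L * norm (y - x)) \<longlongrightarrow> L * norm (x - x)) (at x)" by (intro tendsto_intros)
  then have "((\<lambda>y. L * norm (y - x)) \<longlongrightarrow> 0) (at x)" by simp
  moreover have "\<forall>\<^sub>F y in at x. norm (F y - F x) \<le> L * norm (y - x)"
    unfolding eventually_at
  proof (intro exI[of _ 1] conjI ballI impI)
    fix y assume "y \<noteq> x \<and> dist y x < 1"
    then have "norm y \<le> norm x + 1" using norm_triangle_sub[of y x] by (simp add: dist_norm)
    then show "norm (F y - F x) \<le> L * norm (y - x)" by (intro L) auto
  qed simp
  ultimately have "((\<lambda>y. F y - F x) \<longlongrightarrow> 0) (at x)"
    by (rule Lim_null_comparison[rotated])
  then show "isCont F x" by (simp add: isCont_def LIM_zero_iff)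
qed

context
  fixes \<alpha> :: real
  assumes \<alpha>: "0 < \<alpha>" "\<alpha> < 1"
begin

lemma frac_int_integrand_continuous:
  fixes g :: "real \<Rightarrow> 'a :: banach"
  assumes "continuous_on UNIV g"
  shows "continuous_on {0..1} (\<lambda>\<rho>. g (s * (1 - \<rho> powr (1 / \<alpha>))))"
  using \<alpha> by (intro continuous_on_compose2[OF assms] continuous_intros continuous_on_powr') auto

lemma frac_int_integrable:
  fixes g :: "real \<Rightarrow> 'a :: banach"
  assumes "continuous_on UNIV g"
  shows "(\<lambda>\<rho>. g (s * (1 - \<rho> powr (1 / \<alpha>)))) integrable_on {0..1}"
  by (rule integrable_continuous_real[OF frac_int_integrand_continuous[OF assms]])

text \<open>The domain of integration is fixed and the integrand is jointly continuous in t and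
  \<rho>, so t enters only as a parameter.\<close>

lemma frac_int_continuous:
  fixes g :: "real \<Rightarrow> 'a :: banach"
  assumes g: "continuous_on UNIV g"
  shows "continuous_on UNIV (frac_int \<alpha> g)"
proof -
  have "continuous_on (UNIV \<times> cbox 0 1) (\<lambda>p::real \<times> real. g (max 0 (fst p) * (1 - snd p powr (1 / \<alpha>))))"
    using \<alpha> by (intro continuous_on_compose2[OF g] continuous_intros continuous_on_powr') auto
  then have "continuous_on UNIV (\<lambda>t. integral (cbox 0 1) (\<lambda>\<rho>. g (max 0 t * (1 - \<rho> powr (1 / \<alpha>)))))"
    by (intro integral_continuous_on_param) (simp add: case_prod_beta')
  then show ?thesis
    unfolding frac_int_def[abs_def] using less_imp_neq[OF Gamma_real_pos[of "\<alpha> + 1"]] \<alpha>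
    by (auto intro!: continuous_intros continuous_on_max_powr[OF \<alpha>])
qed

text \<open>The change of variables \<rho> = (\<sigma> / t)^\<alpha> in the scalar case. It links
  \<open>frac_int\<close> to the Lebesgue convolutions, for which the kernel identities are
  known.\<close>

lemma frac_int_eq_conv:
  fixes f :: "real \<Rightarrow> real"
  assumes f: "continuous_on UNIV f"
  shows "frac_int \<alpha> f t = conv (pow_kernel \<alpha>) f t"
proof (cases "0 < t")
  case t: True
  define q where "q = (\<lambda>\<sigma>::real. (\<sigma> / t) powr \<alpha>)"
  define h where "h = (\<lambda>\<rho>. f (t * (1 - \<rho> powr (1 / \<alpha>))))"
  define q' where "q' = (\<lambda>\<sigma>::real. \<alpha> * (\<sigma> / t) powr (\<alpha> - 1) / t)"
  have "((\<lambda>\<sigma>. q' \<sigma> *\<^sub>R h (q \<sigma>)) has_integral (integral {q 0..q t} h - integral {q t..q 0} h)) {0..t}"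
  \<comment> \<open>The derivative of q is unbounded at 0, hence the exceptional point.\<close>
  proof (rule has_integral_substitution_general[where s="{0}" and c=0 and d=1])
    show "continuous_on {0..t} q" unfolding q_def
      using t \<alpha> by (intro continuous_on_powr' continuous_intros) auto
    show "q ` {0..t} \<subseteq> {0..1}"
      using t \<alpha> by (auto simp: q_def powr_le1)
    show "continuous_on {0..1} h" unfolding h_def by (rule frac_int_integrand_continuous[OF f])
    fix \<sigma> assume "\<sigma> \<in> {0..t} - {0}"
    then show "(q has_real_derivative q' \<sigma>) (at \<sigma> within {0..t})"
      unfolding q_def q'_def using t
      by (auto intro!: derivative_eq_intros simp: powr_diff field_simps)
  qed (use t in auto)
  then have sub: "((\<lambda>\<sigma>. q' \<sigma> * h (q \<sigma>)) has_integral integral {0..1} h) {0..t}"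
    using t \<alpha> by (simp add: q_def)
  define C where "C = t powr \<alpha> / Gamma (\<alpha> + 1)"
  have G: "Gamma (\<alpha> + 1) = \<alpha> * Gamma \<alpha>" "0 < Gamma \<alpha>"
    using \<alpha> by (auto intro!: Gamma_plus1 simp: nonpos_Ints_def)
  have eq: "C * (q' \<sigma> * h (q \<sigma>)) = pow_kernel \<alpha> \<sigma> * f (t - \<sigma>)" if "0 < \<sigma>" for \<sigma>
  proof -
    have "h (q \<sigma>) = f (t - \<sigma>)"
      using that t \<alpha> by (simp add: h_def q_def powr_powr algebra_simps)
    moreover have "t powr \<alpha> = t powr (\<alpha> - 1) * t" using t by (simp add: powr_diff)
    then have "C * q' \<sigma> = pow_kernel \<alpha> \<sigma>"
      using that t \<alpha> G by (simp add: C_def q'_def pow_kernel_def powr_divide field_simps)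
    ultimately show ?thesis by (simp add: mult.assoc[symmetric])
  qed
  have "((\<lambda>\<sigma>. C * (q' \<sigma> * h (q \<sigma>))) has_integral C * integral {0..1} h) {0..t}"
    by (rule has_integral_mult_right[OF sub])
  then have 1: "((\<lambda>\<sigma>. pow_kernel \<alpha> \<sigma> * f (t - \<sigma>)) has_integral C * integral {0..1} h) {0<..<t}"
    by (subst (asm) has_integral_Icc_iff_Ioo, subst has_integral_cong[of "{0<..<t}" _ "\<lambda>\<sigma>. C * (q' \<sigma> * h (q \<sigma>))"])
      (auto simp: eq)
  have "set_integrable lborel {0<..<t} (\<lambda>\<sigma>. pow_kernel \<alpha> \<sigma> * f (t - \<sigma>))"
    using conv_integrable[OF loc_kernel_pow_kernel[OF \<alpha> \<alpha>(1)] f] by (simp add: set_integrable_def)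
  from set_borel_integral_eq_integral(2)[OF this] integral_unique[OF 1]
  have "conv (pow_kernel \<alpha>) f t = C * integral {0..1} h"
    by (simp add: conv_def set_lebesgue_integral_def)
  then show ?thesis using t by (simp add: frac_int_def C_def h_def)
qed (simp add: frac_int_def conv_nonpos)

text \<open>Inner products with a fixed vector commute with the integral; this brings the scalar
  resolvent theory to bear on vector-valued equations.\<close>

lemma frac_int_inner:
  fixes g :: "real \<Rightarrow> 'a :: {real_inner, banach}"
  assumes g: "continuous_on UNIV g"
  shows "w \<bullet> frac_int \<alpha> g t = conv (pow_kernel \<alpha>) (\<lambda>x. w \<bullet> g x) t"
proof -
  have "w \<bullet> frac_int \<alpha> g t = frac_int \<alpha> (\<lambda>x. w \<bullet> g x) t"
    unfolding frac_int_def
    using integral_linear[OF frac_int_integrable[OF g] bounded_linear_inner_right[of w]]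
    by (simp add: comp_def)
  also have "\<dots> = conv (pow_kernel \<alpha>) (\<lambda>x. w \<bullet> g x) t"
    by (intro frac_int_eq_conv continuous_intros g)
  finally show ?thesis .
qed

lemma frac_int_diff:
  fixes g h :: "real \<Rightarrow> 'a :: banach"
  assumes g: "continuous_on UNIV g" and h: "continuous_on UNIV h"
  shows "frac_int \<alpha> g t - frac_int \<alpha> h t = frac_int \<alpha> (\<lambda>x. g x - h x) t"
  unfolding frac_int_def
  by (simp add: integral_diff frac_int_integrable g h scaleR_diff_right)

lemma norm_frac_int_le:
  fixes g :: "real \<Rightarrow> 'a :: banach"
  assumes g: "continuous_on UNIV g"
  shows "norm (frac_int \<alpha> g t) \<le> conv (pow_kernel \<alpha>) (\<lambda>x. norm (g x)) t"
proof -
  have ng: "continuous_on UNIV (\<lambda>x. norm (g x))" by (intro continuous_intros g)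
  have "norm (integral {0..1} (\<lambda>\<rho>. g (max 0 t * (1 - \<rho> powr (1 / \<alpha>)))))
     \<le> integral {0..1} (\<lambda>\<rho>. norm (g (max 0 t * (1 - \<rho> powr (1 / \<alpha>)))))"
    by (intro integral_norm_bound_integral frac_int_integrable g ng) auto
  then have "norm (frac_int \<alpha> g t) \<le> frac_int \<alpha> (\<lambda>x. norm (g x)) t"
    unfolding frac_int_def using \<alpha> Gamma_real_pos[of "\<alpha> + 1"] by (simp add: mult_left_mono divide_right_mono)
  then show ?thesis by (simp add: frac_int_eq_conv[OF ng])
qed

lemma frac_int_cong:
  fixes g h :: "real \<Rightarrow> 'a :: banach"
  assumes "\<And>x. 0 \<le> x \<Longrightarrow> x \<le> t \<Longrightarrow> g x = h x" "0 \<le> t"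
  shows "frac_int \<alpha> g t = frac_int \<alpha> h t"
proof -
  have "integral {0..1} (\<lambda>\<rho>. g (t * (1 - \<rho> powr (1 / \<alpha>)))) = integral {0..1} (\<lambda>\<rho>. h (t * (1 - \<rho> powr (1 / \<alpha>))))"
  proof (rule Henstock_Kurzweil_Integration.integral_cong)
    fix \<rho> :: real assume "\<rho> \<in> {0..1}"
    then have "0 \<le> 1 - \<rho> powr (1 / \<alpha>)" "1 - \<rho> powr (1 / \<alpha>) \<le> 1" using \<alpha> by (auto simp: powr_le1)
    then show "g (t * (1 - \<rho> powr (1 / \<alpha>))) = h (t * (1 - \<rho> powr (1 / \<alpha>)))"
      using assms(2) by (intro assms(1)) (auto intro: mult_left_le)
  qed
  then show ?thesis using assms(2) by (simp add: frac_int_def)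
qed

text \<open>Existence for globally Lipschitz right-hand sides: Banach's fixed point theorem for the unknown
  divided by the weight \<open>E\<^sub>\<alpha>(\<mu> t\<^sup>\<alpha>)\<close>.\<close>
lemma frac_equation_exists_Lipschitz:
  fixes F :: "'a :: banach \<Rightarrow> 'a"
  assumes L: "0 \<le> L" and F: "\<And>x y. norm (F x - F y) \<le> L * norm (x - y)" and T: "0 \<le> T"
  obtains y where "continuous_on UNIV y" "\<And>t. 0 \<le> t \<Longrightarrow> t \<le> T \<Longrightarrow> y t = y0 + frac_int \<alpha> (\<lambda>x. F (y x)) t"
proof -
  define \<mu> where "\<mu> = 2 * L + 1"
  define w where "w = ml_relax \<alpha> (- \<mu>)"
  \<comment> \<open>Clamping time to [0, T] turns continuous functions on the interval into bounded
    continuous functions on the line, where the sup metric is complete.\<close>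
  define cl where "cl = (\<lambda>t::real. max 0 (min t T))"
  have \<mu>: "0 < \<mu>" using L by (simp add: \<mu>_def)
  have w1: "1 \<le> w x" for x unfolding w_def using \<mu> by (intro ml_relax_ge_1[OF \<alpha>]) simp
  then have w0: "0 < w x" for x by (rule less_le_trans[OF zero_less_one])
  have wc: "continuous_on UNIV w" unfolding w_def by (rule ml_relax_continuous[OF \<alpha>])
  have weq: "\<mu> * conv (pow_kernel \<alpha>) w x = w x - 1" for x
    unfolding w_def using ml_relax_equation[OF \<alpha>, of "- \<mu>" x] by simp
  have clT: "cl t \<in> {0..T}" for t using T by (auto simp: cl_def)
  have clc: "continuous_on UNIV cl" unfolding cl_def by (intro continuous_intros)
  have Fc: "continuous_on UNIV F"
    by (rule locally_Lipschitz_continuous) (use L F in blast)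
  \<comment> \<open>The unknown z is y / w. The fractional integral of w is (w - 1) / \<mu>, so two
    images of points at distance d differ by at most L d (w - 1) / (\<mu> w) \<le> d / 2.\<close>
  define \<Phi> where "\<Phi> = (\<lambda>(z :: real \<Rightarrow>\<^sub>C 'a) t. (1 / w t) *\<^sub>R (y0 + frac_int \<alpha> (\<lambda>x. F (w x *\<^sub>R z x)) t))"
  have zc: "continuous_on UNIV (apply_bcontfun z)" for z :: "real \<Rightarrow>\<^sub>C 'a"
    using continuous_on_apply_bcontfun by blast
  have Fzc: "continuous_on UNIV (\<lambda>x. F (w x *\<^sub>R z x))" for z :: "real \<Rightarrow>\<^sub>C 'a"
    by (rule continuous_on_compose2[OF Fc]) (auto intro!: continuous_intros wc zc)
  have \<Phi>c: "continuous_on UNIV (\<Phi> z)" for z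
    unfolding \<Phi>_def using w0 by (intro continuous_intros frac_int_continuous Fzc wc) (simp add: less_imp_neq[symmetric])
  have bc: "(\<lambda>t. \<Phi> z (cl t)) \<in> bcontfun" for z
  proof -
    have c: "continuous_on UNIV (\<lambda>t. \<Phi> z (cl t))"
      by (rule continuous_on_compose2[OF \<Phi>c clc]) auto
    have "compact (\<Phi> z ` {0..T})"
      by (intro compact_continuous_image continuous_on_subset[OF \<Phi>c]) auto
    then obtain M where "\<forall>v\<in>\<Phi> z ` {0..T}. norm v \<le> M"
      using compact_imp_bounded bounded_iff by metis
    then have "norm (\<Phi> z (cl t)) \<le> M" for t using clT by blast
    with c show ?thesis by (rule bcontfun_normI)
  qed
  define \<Psi> where "\<Psi> = (\<lambda>z. Bcontfun (\<lambda>t. \<Phi> z (cl t)))"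
  have \<Psi>: "apply_bcontfun (\<Psi> z) t = \<Phi> z (cl t)" for z t
    unfolding \<Psi>_def using bc by (simp add: Bcontfun_inverse)
  have "dist (\<Psi> z1) (\<Psi> z2) \<le> 1 / 2 * dist z1 z2" for z1 z2
  proof (rule dist_bound)
    fix t
    define \<tau> where "\<tau> = cl t"
    define d where "d = dist z1 z2"
    have "dist (\<Psi> z1 t) (\<Psi> z2 t) = norm ((1 / w \<tau>) *\<^sub>R (frac_int \<alpha> (\<lambda>x. F (w x *\<^sub>R z1 x)) \<tau> - frac_int \<alpha> (\<lambda>x. F (w x *\<^sub>R z2 x)) \<tau>))"
      by (simp add: \<Psi> \<Phi>_def \<tau>_def dist_norm flip: scaleR_diff_right)
    also have "\<dots> = (1 / w \<tau>) * norm (frac_int \<alpha> (\<lambda>x. F (w x *\<^sub>R z1 x) - F (w x *\<^sub>R z2 x)) \<tau>)"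
      using w0[of \<tau>] by (simp add: frac_int_diff Fzc)
    also have "\<dots> \<le> (1 / w \<tau>) * conv (pow_kernel \<alpha>) (\<lambda>x. norm (F (w x *\<^sub>R z1 x) - F (w x *\<^sub>R z2 x))) \<tau>"
      using w0[of \<tau>] by (intro mult_left_mono norm_frac_int_le continuous_intros Fzc) auto
    also have "\<dots> \<le> (1 / w \<tau>) * conv (pow_kernel \<alpha>) (\<lambda>x. (L * d) * w x) \<tau>"
    proof (intro mult_left_mono conv_mono loc_kernel_pow_kernel[OF \<alpha>] pow_kernel_nonneg[OF \<alpha>] continuous_intros Fzc wc)
      fix x
      have "norm (F (w x *\<^sub>R z1 x) - F (w x *\<^sub>R z2 x)) \<le> L * norm (w x *\<^sub>R z1 x - w x *\<^sub>R z2 x)"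
        by (rule F)
      also have "\<dots> = L * (w x * dist (z1 x) (z2 x))"
        using w0[of x] by (simp add: dist_norm flip: scaleR_diff_right)
      also have "\<dots> \<le> L * (w x * d)"
        unfolding d_def using w0[of x] L by (intro mult_left_mono dist_bounded) auto
      finally show "norm (F (w x *\<^sub>R z1 x) - F (w x *\<^sub>R z2 x)) \<le> (L * d) * w x" by (simp add: mult_ac)
    qed (use w0[of \<tau>] \<alpha> in auto)
    also have "\<dots> = (L * d) * ((w \<tau> - 1) / \<mu>) / w \<tau>"
    proof -
      have "conv (pow_kernel \<alpha>) w \<tau> = (w \<tau> - 1) / \<mu>"
        using weq[of \<tau>] \<mu> by (simp add: eq_divide_eq mult.commute)
      then show ?thesis by (simp add: conv_scale)
    qed
    also have "\<dots> \<le> 1 / 2 * d"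
    proof -
      have "(L * d) * ((w \<tau> - 1) / \<mu>) \<le> (L * d) * (w \<tau> / \<mu>)"
        using L \<mu> by (intro mult_left_mono divide_right_mono) (auto simp: d_def)
      also have "\<dots> = (L / \<mu>) * (d * w \<tau>)" by simp
      also have "\<dots> \<le> 1 / 2 * (d * w \<tau>)"
        using L \<mu> w0[of \<tau>] by (intro mult_right_mono) (auto simp: \<mu>_def d_def field_simps less_imp_le)
      finally have "(L * d) * ((w \<tau> - 1) / \<mu>) \<le> 1 / 2 * d * w \<tau>" by (simp only: mult.assoc)
      then show ?thesis unfolding pos_divide_le_eq[OF w0[of \<tau>]] .
    qed
    finally show "dist (\<Psi> z1 t) (\<Psi> z2 t) \<le> 1 / 2 * dist z1 z2" by (simp add: d_def)
  qed
  then have "\<exists>!z. \<Psi> z = z" by (intro banach_fix_type[of "1 / 2"]) auto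
  then obtain z where z: "\<Psi> z = z" by blast
  show ?thesis
  proof
    show "continuous_on UNIV (\<lambda>t. w t *\<^sub>R z t)" by (intro continuous_intros wc zc)
    fix t :: real assume t: "0 \<le> t" "t \<le> T"
    then have "z t = \<Phi> z t" using \<Psi>[of z t] z by (simp add: cl_def)
    then show "w t *\<^sub>R z t = y0 + frac_int \<alpha> (\<lambda>x. F (w x *\<^sub>R z x)) t"
      using w0[of t] by (simp add: \<Phi>_def)
  qed
qed

text \<open>For large \<open>\<kappa>\<close>, rewrite \<open>y = y0 + J g\<close> as \<open>y = s y0 + r * (g + \<kappa> y)\<close>. Dissipativity gives
  \<open>|g + \<kappa> y| \<le> \<kappa> |y| + O(1/\<kappa>)\<close>, hence an excess of size \<open>O(1/\<kappa>\<^sup>2)\<close> only, whereas \<open>s\<close> is at least of order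
  \<open>1/\<kappa>\<close>.\<close>
lemma dissipative_bound:
  fixes y g :: "real \<Rightarrow> 'a :: {real_inner, banach}"
  assumes y: "continuous_on UNIV y" and g: "continuous_on UNIV g"
    and eq: "\<And>t. 0 \<le> t \<Longrightarrow> t \<le> T \<Longrightarrow> y t = y0 + frac_int \<alpha> g t"
    and diss: "\<And>t. 0 \<le> t \<Longrightarrow> t \<le> T \<Longrightarrow> y t \<bullet> g t \<le> 0"
    and t: "0 \<le> t" "t \<le> T"
  shows "norm (y t) \<le> norm y0"
proof -
  have "\<exists>x\<in>{0..T}. \<forall>s\<in>{0..T}. norm (y s) \<le> norm (y x)"
    using t by (intro continuous_attains_sup) (auto intro!: continuous_intros continuous_on_subset[OF y])
  then obtain x where x: "0 \<le> x" "x \<le> T" and max: "\<And>s. 0 \<le> s \<Longrightarrow> s \<le> T \<Longrightarrow> norm (y s) \<le> norm (y x)"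
    by auto
  obtain M where M: "0 \<le> M" "\<And>s. 0 \<le> s \<Longrightarrow> s \<le> T \<Longrightarrow> \<bar>norm (g s)\<bar> \<le> M"
    by (rule continuous_bounded_Icc[of "\<lambda>s. norm (g s)" T]) (auto intro!: continuous_intros g)
  define m where "m = norm (y x)"
  have "m \<le> norm y0"
  proof (rule ccontr)
    assume "\<not> m \<le> norm y0"
    then have my0: "norm y0 < m" by simp
    then have m0: "0 < m" using norm_ge_zero[of y0] by linarith
    have "x \<noteq> 0"
    proof
      assume "x = 0"
      then have "y x = y0" using eq[of 0] x by (simp add: frac_int_def)
      then show False using my0 by (simp add: m_def)
    qed
    then have x0: "0 < x" using x by simp
    define b where "b = pow_kernel (1 - \<alpha>) x"
    have b: "0 < b" unfolding b_def using \<alpha> x0 by (intro pow_kernel_pos[OF \<alpha>]) auto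
    \<comment> \<open>With this c the final estimate reads s \<kappa>^2 c \<le> M^2.\<close>
    define c where "c = 2 * m * (m - norm y0)"
    have c: "0 < c" unfolding c_def using m0 my0 by simp
    \<comment> \<open>The first summand gives b \<le> \<kappa>, so that the lower bound for the
      relaxation function becomes s \<ge> b / (2 \<kappa>). The second makes b c \<kappa> exceed 2
      M^2, against the estimate.\<close>
    define \<kappa> where "\<kappa> = b + 2 * (M\<^sup>2 + 1) / (b * c)"
    have \<kappa>b: "b \<le> \<kappa>" using b c by (simp add: \<kappa>_def)
    then have \<kappa>: "0 < \<kappa>" using b by linarith
    \<comment> \<open>Testing with the fixed vector y(x) of maximal norm makes the equation scalar,
      and at time x the tested solution has the value m^2.\<close>
    define p where "p = (\<lambda>s. y x \<bullet> y s)"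
    define f where "f = (\<lambda>s. y x \<bullet> (g s + \<kappa> *\<^sub>R y s))"
    define s where "s = ml_relax \<alpha> \<kappa> x"
    have pc: "continuous_on UNIV p" unfolding p_def by (intro continuous_intros y)
    have fc: "continuous_on UNIV f" unfolding f_def by (intro continuous_intros y g)
    have "\<forall>t\<in>{0..x}. p t = y x \<bullet> y0 + conv (pow_kernel \<alpha>) (\<lambda>t. f t - \<kappa> * p t) t"
    proof
      fix t assume "t \<in> {0..x}"
      then have "y t = y0 + frac_int \<alpha> g t" using x by (intro eq) auto
      then have "p t = y x \<bullet> y0 + conv (pow_kernel \<alpha>) (\<lambda>t. y x \<bullet> g t) t"
        by (simp add: p_def inner_add_right frac_int_inner[OF g])
      moreover have "(\<lambda>t. y x \<bullet> g t) = (\<lambda>t. f t - \<kappa> * p t)"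
        by (simp add: f_def p_def inner_add_right fun_eq_iff)
      ultimately show "p t = y x \<bullet> y0 + conv (pow_kernel \<alpha>) (\<lambda>t. f t - \<kappa> * p t) t" by simp
    qed
    then have "\<forall>t\<in>{0..x}. p t = ml_relax \<alpha> \<kappa> t * (y x \<bullet> y0) + conv (ml_kernel \<alpha> \<kappa> \<alpha>) f t"
      using resolvent_equation_iff[OF \<alpha> fc pc] by blast
    then have px: "m\<^sup>2 = s * (y x \<bullet> y0) + conv (ml_kernel \<alpha> \<kappa> \<alpha>) f x"
      using x0 by (auto simp: p_def m_def s_def power2_norm_eq_inner)
    \<comment> \<open>The first-order expansion of sqrt(\<kappa>^2 m^2 + M^2) in M^2; its square
      dominates the sum under the root.\<close>
    define B where "B = \<kappa> * m + M\<^sup>2 / (2 * \<kappa> * m)"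
    have B0: "0 \<le> B" unfolding B_def using \<kappa> m0 by simp
    have fB: "f r \<le> m * B" if r: "0 \<le> r" "r \<le> x" for r
    proof -
      have rT: "0 \<le> r" "r \<le> T" using r x by auto
      have "(norm (g r + \<kappa> *\<^sub>R y r))\<^sup>2 = (norm (g r))\<^sup>2 + 2 * \<kappa> * (y r \<bullet> g r) + \<kappa>\<^sup>2 * (norm (y r))\<^sup>2"
        unfolding power2_norm_eq_inner inner_add_left inner_add_right
        by (simp add: inner_commute algebra_simps power2_eq_square)
      also have "\<dots> \<le> M\<^sup>2 + 2 * \<kappa> * 0 + \<kappa>\<^sup>2 * m\<^sup>2"
      proof (intro add_mono mult_left_mono power_mono)
        show "norm (g r) \<le> M" using M(2)[OF rT] by simp
        show "norm (y r) \<le> m" unfolding m_def by (rule max[OF rT])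
        show "y r \<bullet> g r \<le> 0" by (rule diss[OF rT])
      qed (use \<kappa> in auto)
      also have "\<dots> \<le> B\<^sup>2"
      proof -
        have "B\<^sup>2 = \<kappa>\<^sup>2 * m\<^sup>2 + M\<^sup>2 + (M\<^sup>2 / (2 * \<kappa> * m))\<^sup>2"
          unfolding B_def power2_sum using \<kappa> m0 by (simp add: power_mult_distrib field_simps)
        then show ?thesis by simp
      qed
      finally have "norm (g r + \<kappa> *\<^sub>R y r) \<le> B" using B0 by (rule power2_le_imp_le)
      moreover have "f r \<le> norm (y x) * norm (g r + \<kappa> *\<^sub>R y r)"
        unfolding f_def by (rule norm_cauchy_schwarz)
      ultimately show ?thesis using m0 by (auto simp: m_def intro: order_trans mult_left_mono)
    qed
    have rK: "loc_kernel (ml_kernel \<alpha> \<kappa> \<alpha>)" by (rule loc_kernel_ml_kernel[OF \<alpha> \<alpha>(1)])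
    have "conv (ml_kernel \<alpha> \<kappa> \<alpha>) f x \<le> conv (ml_kernel \<alpha> \<kappa> \<alpha>) (\<lambda>r. (m * B) * 1) x"
      by (rule conv_mono[OF rK _ fc]) (auto intro!: fB less_imp_le[OF ml_kernel_pos[OF \<alpha> \<kappa>]])
    also have "\<dots> = m * B * ((1 - s) / \<kappa>)"
      using ml_relax_eq_integral[OF \<alpha> x0, of \<kappa>] \<kappa>
      unfolding conv_scale by (simp add: conv_def s_def)
    finally have "m\<^sup>2 \<le> s * (y x \<bullet> y0) + m * B * ((1 - s) / \<kappa>)" using px by simp
    moreover have s_ge: "b / (\<kappa> + b) \<le> s" unfolding s_def b_def by (rule ml_relax_lower_bound[OF \<alpha> \<kappa> x0])
    then have s0: "0 < s" using b \<kappa> by (auto intro: less_le_trans[rotated])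
    moreover have "s * (y x \<bullet> y0) \<le> s * (m * norm y0)"
      unfolding m_def using s0 by (intro mult_left_mono norm_cauchy_schwarz) auto
    ultimately have "m\<^sup>2 \<le> s * (m * norm y0) + m * B * ((1 - s) / \<kappa>)" by linarith
    also have "\<dots> = m * (s * norm y0 + B * ((1 - s) / \<kappa>))" by (simp add: distrib_left mult_ac)
    finally have "m * m \<le> m * (s * norm y0 + B * ((1 - s) / \<kappa>))" by (simp only: power2_eq_square)
    then have "m \<le> s * norm y0 + B * ((1 - s) / \<kappa>)" using m0 by simp
    also have "B * ((1 - s) / \<kappa>) = (1 - s) * m + (1 - s) * (M\<^sup>2 / (2 * \<kappa>\<^sup>2 * m))"
      unfolding B_def using \<kappa> m0 by (simp add: field_simps power2_eq_square)
    also have "(1 - s) * (M\<^sup>2 / (2 * \<kappa>\<^sup>2 * m)) \<le> 1 * (M\<^sup>2 / (2 * \<kappa>\<^sup>2 * m))"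
      using s0 m0 by (intro mult_right_mono) auto
    finally have "s * (m - norm y0) \<le> M\<^sup>2 / (2 * \<kappa>\<^sup>2 * m)" by (simp add: algebra_simps)
    then have "s * (m - norm y0) * (2 * \<kappa>\<^sup>2 * m) \<le> M\<^sup>2"
      using \<kappa> m0 by (simp add: pos_le_divide_eq)
    moreover have "s * (m - norm y0) * (2 * \<kappa>\<^sup>2 * m) = s * \<kappa>\<^sup>2 * c" unfolding c_def by (simp only: mult_ac)
    ultimately have sM: "s * \<kappa>\<^sup>2 * c \<le> M\<^sup>2" by simp
    have "b / (2 * \<kappa>) \<le> b / (\<kappa> + b)" using b \<kappa> \<kappa>b by (intro divide_left_mono) auto
    then have bs: "b / (2 * \<kappa>) \<le> s" using s_ge by linarith
    have "b * c * \<kappa> / 2 = b / (2 * \<kappa>) * \<kappa>\<^sup>2 * c" using \<kappa> by (simp add: power2_eq_square)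
    also have "\<dots> \<le> s * \<kappa>\<^sup>2 * c" using c bs by (intro mult_right_mono) auto
    finally have "b * c * \<kappa> \<le> 2 * M\<^sup>2" using sM by linarith
    moreover have "b * c * \<kappa> = b * c * b + (b * c) * (2 * (M\<^sup>2 + 1) / (b * c))"
      by (simp only: \<kappa>_def distrib_left)
    then have "b * c * \<kappa> = b * c * b + 2 * (M\<^sup>2 + 1)" using b c by simp
    moreover have "0 < b * c * b" using b c by simp
    ultimately show False by (simp add: algebra_simps)
  qed
  then show ?thesis using max[OF t] by (simp add: m_def)
qed

theorem frac_equation_global_existence:
  fixes F :: "'a :: {real_inner, banach} \<Rightarrow> 'a"
  assumes lip: "\<And>R. \<exists>L\<ge>0. \<forall>x y. norm x \<le> R \<longrightarrow> norm y \<le> R \<longrightarrow> norm (F x - F y) \<le> L * norm (x - y)"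
    and diss: "\<And>x. x \<bullet> F x \<le> 0" and T: "0 \<le> T"
  obtains y where "continuous_on UNIV y" "\<And>t. 0 \<le> t \<Longrightarrow> t \<le> T \<Longrightarrow> y t = y0 + frac_int \<alpha> (\<lambda>x. F (y x)) t"
proof -
  \<comment> \<open>Strictly above the bound |y0| that the solution will satisfy, and positive even
    for y0 = 0.\<close>
  define R where "R = norm y0 + 1"
  have R: "0 < R" using norm_ge_zero[of y0] unfolding R_def by linarith
  define P where "P = (\<lambda>x::'a. (R / max R (norm x)) *\<^sub>R x)"
  have PR: "norm (P x) \<le> R" for x
  proof -
    have "norm (P x) = R * (norm x / max R (norm x))" using R by (simp add: P_def)
    also have "\<dots> \<le> R * 1" using R by (intro mult_left_mono) auto
    finally show ?thesis by simp
  qed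
  obtain L where L: "0 \<le> L" "\<And>x y. norm x \<le> R \<Longrightarrow> norm y \<le> R \<Longrightarrow> norm (F x - F y) \<le> L * norm (x - y)"
    using lip[of R] by metis
  have FP: "norm (F (P x) - F (P y)) \<le> (L * 2) * norm (x - y)" for x y
  proof -
    have "norm (F (P x) - F (P y)) \<le> L * norm (P x - P y)" by (intro L PR)
    also have "\<dots> \<le> L * (2 * norm (x - y))"
      unfolding P_def by (intro mult_left_mono L radial_projection_Lipschitz R)
    finally show ?thesis by (simp add: mult.assoc)
  qed
  obtain y where y: "continuous_on UNIV y"
    and eq: "\<And>t. 0 \<le> t \<Longrightarrow> t \<le> T \<Longrightarrow> y t = y0 + frac_int \<alpha> (\<lambda>x. F (P (y x))) t"
    by (rule frac_equation_exists_Lipschitz[of "L * 2" "\<lambda>x. F (P x)" T y0]) (use L FP T in auto)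
  have Fc: "continuous_on UNIV (\<lambda>x. F (P x))"
    by (rule locally_Lipschitz_continuous) (use L FP in \<open>meson mult_nonneg_nonneg zero_le_numeral\<close>)
  have bound: "norm (y t) \<le> norm y0" if "0 \<le> t" "t \<le> T" for t
  proof (rule dissipative_bound[OF y _ eq _ that])
    show "continuous_on UNIV (\<lambda>t. F (P (y t)))"
      by (rule continuous_on_compose2[OF Fc y]) auto
    fix s
    \<comment> \<open>Dissipativity holds at the point \<open>P (y s)\<close>, and
      \<open>P (y s)\<close> is a positive multiple of \<open>y s\<close>, so the sign carries
      over.\<close>
    have "P (y s) \<bullet> F (P (y s)) \<le> 0" by (rule diss)
    then have "(R / max R (norm (y s))) * (y s \<bullet> F (P (y s))) \<le> 0"
      by (simp only: P_def inner_scaleR_left)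
    moreover have "0 < R / max R (norm (y s))" using R by simp
    ultimately show "y s \<bullet> F (P (y s)) \<le> 0" by (meson mult_pos_pos not_le)
  qed
  have "P (y t) = y t" if "0 \<le> t" "t \<le> T" for t
  proof -
    have "norm (y t) \<le> R" using bound[OF that] by (simp add: R_def)
    then show ?thesis using R by (simp add: P_def max_absorb1)
  qed
  then have "y t = y0 + frac_int \<alpha> (\<lambda>x. F (y x)) t" if "0 \<le> t" "t \<le> T" for t
    using eq[OF that] frac_int_cong[of t "\<lambda>x. F (P (y x))" "\<lambda>x. F (y x)"] that by simp
  with y show ?thesis by (rule that)
qed

text \<open>Both solutions are continuous, hence bounded on [0, T]; with the Lipschitz constant of a
  ball containing them, Gronwall applies to the norm of the difference.\<close>

theorem frac_equation_unique:
  fixes F :: "'a :: banach \<Rightarrow> 'a"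
  assumes lip: "\<And>R. \<exists>L\<ge>0. \<forall>x y. norm x \<le> R \<longrightarrow> norm y \<le> R \<longrightarrow> norm (F x - F y) \<le> L * norm (x - y)"
    and y: "continuous_on UNIV y" "\<And>t. 0 \<le> t \<Longrightarrow> t \<le> T \<Longrightarrow> y t = y0 + frac_int \<alpha> (\<lambda>x. F (y x)) t"
    and v: "continuous_on UNIV v" "\<And>t. 0 \<le> t \<Longrightarrow> t \<le> T \<Longrightarrow> v t = y0 + frac_int \<alpha> (\<lambda>x. F (v x)) t"
    and t: "0 \<le> t" "t \<le> T"
  shows "y t = v t"
proof -
  have ny: "continuous_on UNIV (\<lambda>s. norm (y s) + norm (v s))" by (intro continuous_intros y v)
  obtain R where R: "0 \<le> R" "\<And>s. 0 \<le> s \<Longrightarrow> s \<le> T \<Longrightarrow> \<bar>norm (y s) + norm (v s)\<bar> \<le> R"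
    using continuous_bounded_Icc[OF ny] by blast
  have bd: "norm (y s) \<le> R" "norm (v s) \<le> R" if "0 \<le> s" "s \<le> T" for s
    using R(2)[OF that] norm_ge_zero[of "y s"] norm_ge_zero[of "v s"] by linarith+
  obtain L where L: "0 \<le> L" "\<And>x y. norm x \<le> R \<Longrightarrow> norm y \<le> R \<Longrightarrow> norm (F x - F y) \<le> L * norm (x - y)"
    using lip[of R] by metis
  have Fc: "continuous_on UNIV F" by (rule locally_Lipschitz_continuous[OF lip])
  have Fy: "continuous_on UNIV (\<lambda>x. F (y x))" "continuous_on UNIV (\<lambda>x. F (v x))"
    by (rule continuous_on_compose2[OF Fc y(1)] continuous_on_compose2[OF Fc v(1)]; simp)+
  have "norm (y t - v t) \<le> 0"
  proof (rule fractional_Gronwall[OF \<alpha>, where D="\<lambda>s. norm (y s - v s)" and L=L and T=T])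
    show "continuous_on UNIV (\<lambda>s. norm (y s - v s))" by (intro continuous_intros y v)
    fix s assume s: "0 \<le> s" "s \<le> T"
    have "y s - v s = frac_int \<alpha> (\<lambda>x. F (y x) - F (v x)) s"
      using y(2)[OF s] v(2)[OF s] frac_int_diff[OF Fy, of s] by (metis add_diff_cancel_left)
    then have "norm (y s - v s) \<le> conv (pow_kernel \<alpha>) (\<lambda>x. norm (F (y x) - F (v x))) s"
      using norm_frac_int_le[of "\<lambda>x. F (y x) - F (v x)" s] Fy by (simp add: continuous_on_diff)
    also have "\<dots> \<le> conv (pow_kernel \<alpha>) (\<lambda>x. L * norm (y x - v x)) s"
      using s by (intro conv_mono loc_kernel_pow_kernel[OF \<alpha>] pow_kernel_nonneg[OF \<alpha>] \<alpha> continuous_intros Fy y v L bd) auto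
    finally show "norm (y s - v s) \<le> L * conv (pow_kernel \<alpha>) (\<lambda>x. norm (y x - v x)) s"
      by (simp add: conv_scale)
  qed (use t L in auto)
  then show ?thesis by simp
qed

end

subsection \<open>Smooth bump functions\<close>

text \<open>The derivatives of \<open>exp (- 1 / x)\<close>, extended by zero to the left, are of this form.\<close>
definition flat_poly :: "real poly \<Rightarrow> real \<Rightarrow> real" where
  "flat_poly p x = (if 0 < x then poly p (1 / x) * exp (- (1 / x)) else 0)"

lemma poly_exp_tendsto_0: "((\<lambda>y. poly p y * exp (- y)) \<longlongrightarrow> (0 :: real)) at_top"
proof -
  have "((\<lambda>y. \<Sum>i\<le>degree p. coeff p i * (y ^ i / exp y)) \<longlongrightarrow> (\<Sum>i\<le>degree p. coeff p i * 0)) at_top"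
    by (intro tendsto_intros tendsto_power_div_exp_0)
  then show ?thesis
    by (simp add: poly_altdef sum_distrib_right exp_minus divide_inverse mult.assoc)
qed

lemma flat_poly_tendsto_0: "((\<lambda>x. flat_poly p x / x) \<longlongrightarrow> 0) (at 0)"
proof (rule filterlim_split_at)
  show "((\<lambda>x. flat_poly p x / x) \<longlongrightarrow> 0) (at_left 0)"
    by (rule tendsto_eventually) (auto simp: eventually_at_filter flat_poly_def)
  \<comment> \<open>With y = 1 / x the division by x becomes a multiplication by y, which
    \<open>pCons 0 p\<close> absorbs.\<close>
  have "((\<lambda>y. poly (pCons 0 p) y * exp (- y)) \<longlongrightarrow> 0) at_top" by (rule poly_exp_tendsto_0)
  then have "((\<lambda>x. poly (pCons 0 p) (inverse x) * exp (- inverse x)) \<longlongrightarrow> 0) (at_right 0)"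
    by (rule filterlim_compose[OF _ filterlim_inverse_at_top_right])
  moreover have "\<forall>\<^sub>F x in at_right 0. poly (pCons 0 p) (inverse x) * exp (- inverse x) = flat_poly p x / x"
    by (auto simp: eventually_at_filter flat_poly_def divide_inverse)
  ultimately show "((\<lambda>x. flat_poly p x / x) \<longlongrightarrow> 0) (at_right 0)"
    by (rule Lim_transform_eventually)
qed

text \<open>The derivative of p(1/x) e^(-1/x) is x^(-2) (p - p')(1/x) e^(-1/x), and
  \<open>[:0, 0, 1:]\<close> is the polynomial X^2. At 0 the difference quotient is
  \<open>flat_poly p x / x\<close>.\<close>

lemma flat_poly_has_derivative:
  "(flat_poly p has_real_derivative flat_poly ([:0, 0, 1:] * (p - pderiv p)) x) (at x)"
proof -
  let ?q = "[:0, 0, 1:] * (p - pderiv p)"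
  consider "x < 0" | "x = 0" | "0 < x" by linarith
  then show ?thesis
  proof cases
    case 1
    have "((\<lambda>_. 0) has_real_derivative 0) (at x)" by simp
    then have "(flat_poly p has_real_derivative 0) (at x)"
      by (rule has_field_derivative_transform_within_open[where S="{..<0}"]) (use 1 in \<open>auto simp: flat_poly_def\<close>)
    then show ?thesis using 1 by (simp add: flat_poly_def)
  next
    case 2
    then show ?thesis
      using flat_poly_tendsto_0[of p] by (simp add: has_field_derivative_iff flat_poly_def)
  next
    case 3
    have "((\<lambda>x. poly p (1 / x) * exp (- (1 / x))) has_real_derivative
        (poly (pderiv p) (1 / x) * (- 1 / x\<^sup>2)) * exp (- (1 / x)) + (exp (- (1 / x)) * (1 / x\<^sup>2)) * poly p (1 / x)) (at x)"
      using 3 by (auto intro!: derivative_eq_intros DERIV_chain2[OF poly_DERIV] simp: power2_eq_square)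
    also have "(poly (pderiv p) (1 / x) * (- 1 / x\<^sup>2)) * exp (- (1 / x)) + (exp (- (1 / x)) * (1 / x\<^sup>2)) * poly p (1 / x)
        = flat_poly ?q x"
      using 3 by (simp add: flat_poly_def power2_eq_square field_simps)
    finally have "((\<lambda>x. poly p (1 / x) * exp (- (1 / x))) has_real_derivative flat_poly ?q x) (at x)" .
    then show ?thesis
      by (rule has_field_derivative_transform_within_open[where S="{0<..}"]) (use 3 in \<open>auto simp: flat_poly_def\<close>)
  qed
qed

text \<open>A class that contains the bumps and is closed under partial derivatives. Membership
  yields every order of differentiability by induction, without formulas for higher
  derivatives.\<close>

inductive smooth_fn :: "(real ^ 'n \<Rightarrow> real) \<Rightarrow> bool" where
  flat: "smooth_fn (\<lambda>x. flat_poly p (c * x $ i + d))"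
| const: "smooth_fn (\<lambda>x. c)"
| add: "smooth_fn f \<Longrightarrow> smooth_fn g \<Longrightarrow> smooth_fn (\<lambda>x. f x + g x)"
| mult: "smooth_fn f \<Longrightarrow> smooth_fn g \<Longrightarrow> smooth_fn (\<lambda>x. f x * g x)"

section \<open>Gradient calculus and smoothness of the bumps\<close>

lemma gradient_eq:
  assumes "(f has_derivative f') (at x)"
  shows "gradient f x $ i = f' (axis i 1)"
  using frechet_derivative_at[OF assms] by (simp add: gradient_def)

lemma has_derivative_gradient:
  assumes "f differentiable (at x)"
  shows "(f has_derivative (\<lambda>h. gradient f x \<bullet> h)) (at x)"
proof -
  define f' where "f' = frechet_derivative f (at x)"
  have f': "(f has_derivative f') (at x)"
    unfolding f'_def using assms by (simp add: frechet_derivative_works)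
  then have lin: "linear f'" by (rule has_derivative_linear)
  have "f' h = gradient f x \<bullet> h" for h
  proof -
    have "f' h = f' (\<Sum>i\<in>UNIV. h $ i *\<^sub>R axis i 1)"
      by (simp add: basis_expansion scalar_mult_eq_scaleR[symmetric])
    also have "\<dots> = (\<Sum>i\<in>UNIV. h $ i * f' (axis i 1))"
      by (simp add: linear_sum[OF lin] linear_scale[OF lin])
    also have "\<dots> = gradient f x \<bullet> h"
      by (simp add: inner_vec_def gradient_eq[OF f'] mult.commute)
    finally show ?thesis .
  qed
  then show ?thesis using f' by (metis (no_types) ext)
qed

lemma gradient_add:
  assumes "f differentiable (at x)" "g differentiable (at x)"
  shows "gradient (\<lambda>x. f x + g x) x = gradient f x + gradient g x"
  using gradient_eq[OF has_derivative_add[OF assms[THEN has_derivative_gradient]]]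
  by (simp add: vec_eq_iff inner_axis)

lemma gradient_mult:
  assumes "f differentiable (at x)" "g differentiable (at x)"
  shows "gradient (\<lambda>x. f x * g x) x = f x *\<^sub>R gradient g x + g x *\<^sub>R gradient f x"
  using gradient_eq[OF has_derivative_mult[OF assms[THEN has_derivative_gradient]]]
  by (simp add: vec_eq_iff inner_axis mult.commute)

lemma gradient_const: "gradient (\<lambda>x. c) x = 0"
  using gradient_eq[OF has_derivative_const[of c "at x"]] by (simp add: vec_eq_iff)

lemma smooth_fn_gradient:
  fixes f :: "real ^ 'n \<Rightarrow> real"
  assumes "smooth_fn f"
  shows "(\<forall>x. f differentiable (at x)) \<and> (\<forall>i. smooth_fn (\<lambda>x. gradient f x $ i))"
  using assms
proof induction
  case (flat p c i d)
  let ?q = "[:0, 0, 1:] * (p - pderiv p)"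
  have D: "((\<lambda>x. flat_poly p (c * x $ i + d)) has_derivative (\<lambda>h. flat_poly ?q (c * x $ i + d) * (c * h $ i))) (at x)" for x :: "real ^ 'n"
  proof -
    have "((\<lambda>x :: real ^ 'n. c * x $ i + d) has_derivative (\<lambda>h. c * h $ i)) (at x)"
      by (auto intro!: derivative_eq_intros bounded_linear_imp_has_derivative[OF bounded_linear_vec_nth])
    from has_derivative_compose[OF this flat_poly_has_derivative[THEN has_field_derivative_imp_has_derivative]]
    show ?thesis by simp
  qed
  have "(\<lambda>x. gradient (\<lambda>x. flat_poly p (c * x $ i + d)) x $ j) = (\<lambda>x. flat_poly ?q (c * x $ i + d) * (c * axis j 1 $ i))" for j
    using gradient_eq[OF D] by (simp add: fun_eq_iff)
  moreover have "smooth_fn (\<lambda>x. flat_poly ?q (c * x $ i + d) * (c * axis j 1 $ i))" for j :: 'n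
    by (intro smooth_fn.intros)
  ultimately show ?case using D by (auto simp: differentiable_def)
next
  case (const c)
  then show ?case by (simp add: gradient_const smooth_fn.const)
next
  case (add f g)
  then show ?case by (auto simp: gradient_add intro!: smooth_fn.add)
next
  case (mult f g)
  then show ?case by (auto simp: gradient_mult intro!: smooth_fn.intros)
qed

lemma smooth_fn_C_k: "smooth_fn f \<Longrightarrow> C_k_on k UNIV f"
proof (induction k arbitrary: f)
  case 0
  then have "\<forall>x. f differentiable (at x)" using smooth_fn_gradient by blast
  then show ?case
    by (auto intro!: continuous_at_imp_continuous_on differentiable_imp_continuous_within)
next
  case (Suc k)
  then show ?case
    using smooth_fn_gradient[OF Suc.prems] by (auto simp: differentiable_on_def differentiable_at_withinI)
qed

lemma smooth_fn_prod: "finite A \<Longrightarrow> (\<And>i. i \<in> A \<Longrightarrow> smooth_fn (f i)) \<Longrightarrow> smooth_fn (\<lambda>x. \<Prod>i\<in>A. f i x)"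
  by (induction A rule: finite_induct) (auto intro: smooth_fn.intros)

text \<open>\<open>flat_poly 1\<close> is e^(-1/x) on the positive axis. The slope n + 1 sends each
  factor to 1 inside the box, so the bumps approach the indicator of the open box while staying
  between 0 and that indicator.\<close>

definition bump :: "real ^ 'n \<Rightarrow> real ^ 'n \<Rightarrow> nat \<Rightarrow> real ^ 'n \<Rightarrow> real" where
  "bump a b n x = (\<Prod>i\<in>UNIV. flat_poly 1 (real (Suc n) * x $ i + - real (Suc n) * a $ i) *
                              flat_poly 1 (- real (Suc n) * x $ i + real (Suc n) * b $ i))"

lemma flat_poly_1_bounds: "0 \<le> flat_poly 1 x" "flat_poly 1 x \<le> 1"
  by (auto simp: flat_poly_def)

lemma bump_bounds: "0 \<le> bump a b n x" "bump a b n x \<le> 1"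
  unfolding bump_def by (auto intro!: prod_nonneg prod_le_1 mult_nonneg_nonneg mult_le_one flat_poly_1_bounds)

lemma bump_eq_0:
  assumes "x \<notin> box a b"
  shows "bump a b n x = 0"
proof -
  obtain i where "\<not> (a $ i < x $ i \<and> x $ i < b $ i)"
    using assms by (auto simp: mem_box_cart)
  moreover have "real (Suc n) * x $ i + - real (Suc n) * a $ i = real (Suc n) * (x $ i - a $ i)"
     "- real (Suc n) * x $ i + real (Suc n) * b $ i = real (Suc n) * (b $ i - x $ i)"
    by (simp_all add: algebra_simps)
  ultimately have "flat_poly 1 (real (Suc n) * x $ i + - real (Suc n) * a $ i) * flat_poly 1 (- real (Suc n) * x $ i + real (Suc n) * b $ i) = 0"
    by (simp only:) (auto simp: flat_poly_def zero_less_mult_iff)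
  then show ?thesis unfolding bump_def by (intro prod_zero) auto
qed

lemma flat_poly_1_tendsto_1:
  assumes "0 < y"
  shows "(\<lambda>n. flat_poly 1 (real (Suc n) * y)) \<longlonglongrightarrow> 1"
proof -
  have "(\<lambda>n. exp (- (1 / y * inverse (real (Suc n))))) \<longlonglongrightarrow> exp (- (1 / y * 0))"
    by (intro tendsto_intros LIMSEQ_inverse_real_of_nat)
  moreover have "flat_poly 1 (real (Suc n) * y) = exp (- (1 / y * inverse (real (Suc n))))" for n
    using assms by (simp add: flat_poly_def divide_inverse mult.commute)
  ultimately show ?thesis by simp
qed

lemma bump_tendsto: "(\<lambda>n. bump a b n x) \<longlonglongrightarrow> indicator (box a b) x"
proof (cases "x \<in> box a b")
  case True
  then have i: "a $ i < x $ i" "x $ i < b $ i" for i by (auto simp: mem_box_cart)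
  have "(\<lambda>n. \<Prod>i\<in>UNIV. flat_poly 1 (real (Suc n) * (x $ i - a $ i)) * flat_poly 1 (real (Suc n) * (b $ i - x $ i))) \<longlonglongrightarrow> (\<Prod>i\<in>(UNIV :: 'a set). 1 * 1)"
    by (intro tendsto_intros flat_poly_1_tendsto_1) (use i in auto)
  moreover have "real (Suc n) * (x $ i - a $ i) = real (Suc n) * x $ i + - real (Suc n) * a $ i"
     "real (Suc n) * (b $ i - x $ i) = - real (Suc n) * x $ i + real (Suc n) * b $ i" for n i
    by (simp_all add: algebra_simps)
  ultimately show ?thesis using True by (simp add: bump_def)
qed (simp add: bump_eq_0)

lemma bump_test_function:
  assumes "cbox a b \<subseteq> \<Omega>"
  shows "bump a b n \<in> test_functions \<Omega>"
proof -
  have "smooth_fn (bump a b n)"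
    unfolding bump_def[abs_def] by (intro smooth_fn_prod smooth_fn.mult smooth_fn.flat) auto
  moreover have sub: "closure {x. bump a b n x \<noteq> 0} \<subseteq> cbox a b"
  proof (rule closure_minimal)
    show "{x. bump a b n x \<noteq> 0} \<subseteq> cbox a b" using bump_eq_0 box_subset_cbox by blast
  qed (rule closed_cbox)
  moreover have "compact (closure {x. bump a b n x \<noteq> 0})"
    using sub by (meson bounded_cbox bounded_subset closed_closure compact_eq_bounded_closed)
  ultimately show ?thesis using assms by (auto simp: test_functions_def smooth_fn_C_k)
qed

subsection \<open>The fundamental lemma of the calculus of variations\<close>

text \<open>Boxes form an intersection-stable generator of the Borel sets, so the signed measure
  with density f vanishes on every Borel set, in particular on {f > 0} and {f < 0}.\<close>

lemma AE_zero_if_box_integrals_zero: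
  fixes f :: "'a :: euclidean_space \<Rightarrow> real"
  assumes f: "integrable lborel f"
    and box: "\<And>a b. (LINT x|lborel. indicator (box a b) x * f x) = 0"
  shows "AE x in lborel. f x = 0"
proof -
  have m[measurable]: "f \<in> borel_measurable borel" using f by auto
  have int: "integrable lborel (\<lambda>x. indicator A x * f x)" if "A \<in> sets borel" for A
    using integrable_mult_indicator[OF _ f, of A] that by simp
  \<comment> \<open>The step for complements uses the integral over the whole space, which is
    exhausted by growing cubes.\<close>
  have UNIV: "(LINT x|lborel. f x) = 0"
  proof -
    let ?A = "\<lambda>n::nat. box (- (real n *\<^sub>R One)) (real n *\<^sub>R One) :: 'a set"
    have "(\<lambda>n. LINT x|lborel. indicator (?A n) x * f x) \<longlonglongrightarrow> (LINT x|lborel. f x)"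
    proof (rule integral_dominated_convergence[where w="\<lambda>x. \<bar>f x\<bar>"])
      show "AE x in lborel. (\<lambda>n. indicator (?A n) x * f x) \<longlonglongrightarrow> f x"
      proof (rule AE_I2)
        fix x :: 'a
        have "x \<in> (\<Union>n. ?A n)" unfolding UN_box_eq_UNIV by simp
        then obtain N where N: "x \<in> ?A N" by blast
        have "x \<in> ?A n" if "n \<ge> N" for n
          using N that by (fastforce simp: mem_box)
        then have "\<forall>\<^sub>F n in sequentially. indicator (?A n) x * f x = f x"
          unfolding eventually_sequentially by (intro exI[of _ N]) auto
        then show "(\<lambda>n. indicator (?A n) x * f x) \<longlonglongrightarrow> f x" by (rule tendsto_eventually)
      qed
    qed (use f in \<open>auto simp: indicator_def\<close>)
    then have "(\<lambda>n::nat. 0) \<longlonglongrightarrow> (LINT x|lborel. f x)" by (simp only: box)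
    then show ?thesis using LIMSEQ_unique tendsto_const by blast
  qed
  have all: "(LINT x|lborel. indicator A x * f x) = 0" if A: "A \<in> sets borel" for A
  proof -
    let ?G = "range (\<lambda>(a, b). box a b :: 'a set)"
    have st: "Int_stable ?G"
      by (auto simp: Int_stable_def box_Int_box)
    have sb: "sigma_sets UNIV ?G = sets borel" by (simp add: borel_eq_box)
    have A': "A \<in> sigma_sets UNIV ?G" using A sb by simp
    show ?thesis
    proof (rule sigma_sets_induct_disjoint[OF st _ A', where P="\<lambda>A. (LINT x|lborel. indicator A x * f x) = 0"])
      fix A assume "A \<in> sigma_sets UNIV ?G" and z: "(LINT x|lborel. indicator A x * f x) = 0"
      then have A: "A \<in> sets borel" using sb by simp
      have "(LINT x|lborel. indicator (UNIV - A) x * f x) = (LINT x|lborel. f x - indicator A x * f x)"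
        by (intro Bochner_Integration.integral_cong) (auto simp: indicator_def)
      also have "\<dots> = 0" using f int[OF A] by (simp add: UNIV z)
      finally show "(LINT x|lborel. indicator (UNIV - A) x * f x) = 0" .
    next
      fix A :: "nat \<Rightarrow> 'a set"
      assume dis: "disjoint_family A" and "range A \<subseteq> sigma_sets UNIV ?G"
        and z: "\<And>i. (LINT x|lborel. indicator (A i) x * f x) = 0"
      then have A: "\<And>i. A i \<in> sets lborel" using sb by auto
      have "(LINT x:(\<Union>i. A i)|lborel. f x) = (\<Sum>i. LINT x:A i|lborel. f x)"
      proof (rule lebesgue_integral_countable_add[OF A])
        show "set_integrable lborel (\<Union>i. A i) f"
          unfolding set_integrable_def using A by (intro integrable_mult_indicator f) auto
      qed (use dis in \<open>auto simp: disjoint_family_on_def\<close>)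
      then show "(LINT x|lborel. indicator (\<Union>i. A i) x * f x) = 0"
        by (simp add: set_lebesgue_integral_def z)
    qed (auto simp: box)
  qed
  have "AE x in lborel. indicator {x. 0 < f x} x * f x = 0"
    using all[of "{x. 0 < f x}"] int[of "{x. 0 < f x}"]
    by (subst integral_nonneg_eq_0_iff_AE[symmetric]) (auto simp: indicator_def)
  moreover have "AE x in lborel. - (indicator {x. f x < 0} x * f x) = 0"
    using all[of "{x. f x < 0}"] int[of "{x. f x < 0}"]
    by (subst integral_nonneg_eq_0_iff_AE[symmetric]) (auto simp: indicator_def)
  ultimately show ?thesis
    by eventually_elim (auto simp: indicator_def split: if_splits)
qed

text \<open>An almost everywhere equal Borel function reduces the claim to
  \<open>lborel\<close>.\<close>

lemma AE_zero_if_box_integrals_zero_lebesgue: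
  fixes f :: "'a :: euclidean_space \<Rightarrow> real"
  assumes f: "integrable lebesgue f"
    and box: "\<And>a b. (LINT x|lebesgue. indicator (box a b) x * f x) = 0"
  shows "AE x in lebesgue. f x = 0"
proof -
  obtain g where g[measurable]: "g \<in> borel_measurable lborel" and fg: "AE x in lborel. f x = g x"
    using completion_ex_borel_measurable_real[of f lborel] f by auto
  have fg': "AE x in lebesgue. f x = g x" using fg by (rule AE_completion)
  have gm: "g \<in> borel_measurable lebesgue" using g by (rule measurable_completion)
  have "integrable lebesgue g"
    using f gm fg' by (rule integrable_cong_AE_imp)
  then have ig: "integrable lborel g" using g by (simp add: integrable_completion)
  have "(LINT x|lborel. indicator (box a b) x * g x) = 0" for a b
  proof -
    have "(LINT x|lborel. indicator (box a b) x * g x) = (LINT x|lebesgue. indicator (box a b) x * g x)"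
      by (rule integral_completion[symmetric]) measurable
    also have "\<dots> = (LINT x|lebesgue. indicator (box a b) x * f x)"
    proof (rule integral_cong_AE)
      show "AE x in lebesgue. indicator (box a b) x * g x = indicator (box a b) x * f x"
        using fg' by eventually_elim simp
      show "(\<lambda>x. indicator (box a b) x * f x) \<in> borel_measurable lebesgue"
        using f by (intro borel_measurable_times borel_measurable_indicator) auto
      show "(\<lambda>x. indicator (box a b) x * g x) \<in> borel_measurable lebesgue"
        using gm by (intro borel_measurable_times borel_measurable_indicator) auto
    qed
    finally show ?thesis using box by simp
  qed
  then have "AE x in lborel. g x = 0" using ig by (intro AE_zero_if_box_integrals_zero) auto
  then have "AE x in lebesgue. g x = 0" by (rule AE_completion)
  then show ?thesis using fg' by eventually_elim simp
qed

text \<open>Bumps turn the hypothesis into vanishing integrals over boxes whose closed version lies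
  in \<Omega>, and countably many closed boxes cover \<Omega>. As f is only locally integrable, the
  argument runs on each of them separately.\<close>

theorem fundamental_lemma:
  fixes f :: "real ^ 'n \<Rightarrow> real"
  assumes \<Omega>: "open \<Omega>"
    and f: "\<And>K. compact K \<Longrightarrow> K \<subseteq> \<Omega> \<Longrightarrow> f absolutely_integrable_on K"
    and zero: "\<And>\<psi>. \<psi> \<in> test_functions \<Omega> \<Longrightarrow> (LINT x|lebesgue_on \<Omega>. \<psi> x * f x) = 0"
  shows "AE x in lebesgue_on \<Omega>. f x = 0"
proof -
  have \<Omega>s: "\<Omega> \<in> sets lebesgue" using \<Omega> by simp
  have fQ: "integrable lebesgue (\<lambda>x. indicator (cbox a b) x * f x)" if "cbox a b \<subseteq> \<Omega>" for a b
    using f[of "cbox a b"] that by (simp add: set_integrable_def)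
  have box0: "(LINT x|lebesgue. indicator (box a b) x * f x) = 0" if ab: "cbox a b \<subseteq> \<Omega>" for a b
  proof -
    have "(\<lambda>n. LINT x|lebesgue. bump a b n x * (indicator (cbox a b) x * f x))
        \<longlonglongrightarrow> (LINT x|lebesgue. indicator (box a b) x * (indicator (cbox a b) x * f x))"
    proof (rule integral_dominated_convergence[where w="\<lambda>x. \<bar>indicator (cbox a b) x * f x\<bar>"])
      show "integrable lebesgue (\<lambda>x. \<bar>indicator (cbox a b) x * f x\<bar>)"
        by (intro integrable_abs fQ ab)
      show "(\<lambda>x. indicator (box a b) x * (indicator (cbox a b) x * f x)) \<in> borel_measurable lebesgue"
        by (intro borel_measurable_times[OF borel_measurable_indicator] borel_measurable_integrable[OF fQ[OF ab]]) auto
      show "(\<lambda>x. bump a b n x * (indicator (cbox a b) x * f x)) \<in> borel_measurable lebesgue" for n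
      proof (rule borel_measurable_times)
        have "continuous_on UNIV (bump a b n)"
          using bump_test_function[OF ab, of n] unfolding test_functions_def by (metis (mono_tags, lifting) C_k_on.simps(1) mem_Collect_eq)
        then have "bump a b n \<in> borel_measurable lborel" by (simp add: borel_measurable_continuous_onI)
        then show "bump a b n \<in> borel_measurable lebesgue" by (rule measurable_completion)
      qed (use fQ[OF ab] in auto)
      show "AE x in lebesgue. norm (bump a b n x * (indicator (cbox a b) x * f x)) \<le> \<bar>indicator (cbox a b) x * f x\<bar>" for n
        using bump_bounds[of a b n] by (auto simp: abs_mult intro!: mult_left_le_one_le)
      show "AE x in lebesgue. (\<lambda>n. bump a b n x * (indicator (cbox a b) x * f x)) \<longlonglongrightarrow> indicator (box a b) x * (indicator (cbox a b) x * f x)"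
        by (intro AE_I2 tendsto_intros bump_tendsto)
    qed
    moreover have "(LINT x|lebesgue. bump a b n x * (indicator (cbox a b) x * f x)) = 0" for n
    proof -
      have "(\<lambda>x. bump a b n x * (indicator (cbox a b) x * f x)) = (\<lambda>x. indicator \<Omega> x *\<^sub>R (bump a b n x * f x))"
      proof
        fix x
        show "bump a b n x * (indicator (cbox a b) x * f x) = indicator \<Omega> x *\<^sub>R (bump a b n x * f x)"
        proof (cases "x \<in> box a b")
          case True
          then have "x \<in> cbox a b" using box_subset_cbox by blast
          then show ?thesis using ab by (auto simp: indicator_def)
        qed (simp add: bump_eq_0)
      qed
      then show ?thesis
        using zero[OF bump_test_function[OF ab, of n]] \<Omega>s by (simp add: integral_restrict_space)
    qed
    ultimately have "(\<lambda>n::nat. 0) \<longlonglongrightarrow> (LINT x|lebesgue. indicator (box a b) x * (indicator (cbox a b) x * f x))"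
      by simp
    then have "(LINT x|lebesgue. indicator (box a b) x * (indicator (cbox a b) x * f x)) = 0"
      using LIMSEQ_unique tendsto_const by blast
    moreover have "(\<lambda>x. indicator (box a b) x * (indicator (cbox a b) x * f x)) = (\<lambda>x. indicator (box a b) x * f x)"
      using box_subset_cbox[of a b] by (auto simp: fun_eq_iff indicator_def)
    ultimately show ?thesis by simp
  qed
  have cb: "AE x in lebesgue. x \<in> cbox a b \<longrightarrow> f x = 0" if ab: "cbox a b \<subseteq> \<Omega>" for a b
  proof -
    \<comment> \<open>A closed box intersected with an open one is an open box up to the faces of
      the closed box, which are null sets.\<close>
    have null: "AE x in lebesgue. x \<notin> cbox a b - box a b"
    proof (rule AE_not_in)
      show "cbox a b - box a b \<in> null_sets lebesgue"
        using negligible_frontier_interval[of a b] by (simp add: negligible_iff_null_sets)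
    qed
    have "AE x in lebesgue. indicator (cbox a b) x * f x = 0"
    proof (rule AE_zero_if_box_integrals_zero_lebesgue[OF fQ[OF ab]])
      fix c d :: "real ^ 'n"
      obtain p q where pq: "cbox a b \<inter> cbox c d = cbox p q" "box a b \<inter> box c d = box p q"
        by (rule that[OF Int_interval box_Int_box])
      have "(LINT x|lebesgue. indicator (box c d) x * (indicator (cbox a b) x * f x)) = (LINT x|lebesgue. indicator (box p q) x * f x)"
      proof (rule integral_cong_AE)
        show "AE x in lebesgue. indicator (box c d) x * (indicator (cbox a b) x * f x) = indicator (box p q) x * f x"
          using null
        proof eventually_elim
          fix x assume "x \<notin> cbox a b - box a b"
          then have "x \<in> cbox a b \<longleftrightarrow> x \<in> box a b" using box_subset_cbox[of a b] by blast
          then show "indicator (box c d) x * (indicator (cbox a b) x * f x) = indicator (box p q) x * f x"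
            by (auto simp: pq(2)[symmetric] indicator_def)
        qed
        show "(\<lambda>x. indicator (box c d) x * (indicator (cbox a b) x * f x)) \<in> borel_measurable lebesgue"
          by (intro borel_measurable_times[OF borel_measurable_indicator] borel_measurable_integrable[OF fQ[OF ab]]) auto
        have "(\<lambda>x. indicator (box p q) x * (indicator (cbox a b) x * f x)) \<in> borel_measurable lebesgue"
          by (intro borel_measurable_times[OF borel_measurable_indicator] borel_measurable_integrable[OF fQ[OF ab]]) auto
        moreover have "(\<lambda>x. indicator (box p q) x * (indicator (cbox a b) x * f x)) = (\<lambda>x. indicator (box p q) x * f x)"
          using box_subset_cbox[of a b] by (auto simp: fun_eq_iff indicator_def pq(2)[symmetric])
        ultimately show "(\<lambda>x. indicator (box p q) x * f x) \<in> borel_measurable lebesgue" by simp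
      qed
      also have "\<dots> = 0"
        by (rule box0) (use pq(1) ab in blast)
      finally show "(LINT x|lebesgue. indicator (box c d) x * (indicator (cbox a b) x * f x)) = 0" .
    qed
    then show ?thesis by eventually_elim (auto simp: indicator_def split: if_splits)
  qed
  obtain \<D> where D: "countable \<D>" "\<D> \<subseteq> Pow \<Omega>" "\<And>X. X \<in> \<D> \<Longrightarrow> \<exists>a b. X = cbox a b" "\<Union>\<D> = \<Omega>"
    using open_countable_Union_open_cbox[OF \<Omega>] by metis
  have "AE x in lebesgue. \<forall>X\<in>\<D>. x \<in> X \<longrightarrow> f x = 0"
  proof (rule AE_ball_countable[THEN iffD2, OF D(1)], rule ballI)
    fix X assume X: "X \<in> \<D>"
    then obtain a b where "X = cbox a b" using D(3) by blast
    then show "AE x in lebesgue. x \<in> X \<longrightarrow> f x = 0" using cb[of a b] D(2) X by auto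
  qed
  then have "AE x in lebesgue. x \<in> \<Omega> \<longrightarrow> f x = 0"
    by eventually_elim (use D(4) in blast)
  then show ?thesis using \<Omega>s by (simp add: AE_restrict_space_iff)
qed

subsection \<open>A Loomis-Whitney inequality\<close>

text \<open>A cube root on the extended half-line lets the inequalities of Hoelder and
  Loomis-Whitney be stated without finiteness assumptions.\<close>

definition ecbrt :: "ennreal \<Rightarrow> ennreal" where
  "ecbrt x = (if x = top then top else ennreal (root 3 (enn2real x)))"

lemma ecbrt_ennreal: "0 \<le> r \<Longrightarrow> ecbrt (ennreal r) = ennreal (root 3 r)"
  by (simp add: ecbrt_def)

lemma ecbrt_top [simp]: "ecbrt top = top"
  by (simp add: ecbrt_def)

lemma ecbrt_cube: "ecbrt x ^ 3 = x"
proof (cases x)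
  case (real r)
  then show ?thesis by (simp add: ecbrt_ennreal ennreal_power odd_real_root_pow)
qed (simp add: power_top_ennreal)

lemma ecbrt_mono: "x \<le> y \<Longrightarrow> ecbrt x \<le> ecbrt y"
  by (cases x; cases y) (auto simp: ecbrt_ennreal ennreal_leI top_unique)

lemma ecbrt_of_cube: "ecbrt (x ^ 3) = x"
proof (cases x)
  case (real r)
  then show ?thesis by (simp add: ecbrt_ennreal ennreal_power real_root_power_cancel)
qed (simp add: power_top_ennreal)

lemma borel_measurable_ecbrt [measurable]: "ecbrt \<in> borel_measurable borel"
  unfolding ecbrt_def[abs_def] by measurable

lemma arith_geo_mean_ennreal: "3 * (a * b * c) \<le> a ^ 3 + b ^ 3 + (c ^ 3 :: ennreal)"
proof (cases "a = top \<or> b = top \<or> c = top")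
  case True
  then show ?thesis by (auto simp: power_top_ennreal)
next
  case False
  then obtain x y z where xyz: "a = ennreal x" "b = ennreal y" "c = ennreal z" "0 \<le> x" "0 \<le> y" "0 \<le> z"
    by (metis ennreal_cases)
  have "x ^ 3 + y ^ 3 + z ^ 3 - 3 * (x * y * z) = (x + y + z) * ((x - y)\<^sup>2 + (y - z)\<^sup>2 + (z - x)\<^sup>2) / 2"
    by (simp add: power2_eq_square power3_eq_cube field_simps)
  moreover have "\<dots> \<ge> 0" using xyz by simp
  ultimately have "3 * (x * y * z) \<le> x ^ 3 + y ^ 3 + z ^ 3" by linarith
  then have "ennreal (3 * (x * y * z)) \<le> ennreal (x ^ 3 + y ^ 3 + z ^ 3)" by (rule ennreal_leI)
  then show ?thesis using xyz by (simp add: ennreal_mult ennreal_power)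
qed

text \<open>Each factor is normalised to unit L^3 norm, and the inequality of arithmetic and
  geometric means is integrated. Norms 0 and infinity cannot be normalised and are treated
  apart.\<close>

lemma Holder_three:
  fixes a b c :: "'a \<Rightarrow> ennreal"
  assumes [measurable]: "a \<in> borel_measurable M" "b \<in> borel_measurable M" "c \<in> borel_measurable M"
  shows "(\<integral>\<^sup>+x. a x * b x * c x \<partial>M)
     \<le> ecbrt (\<integral>\<^sup>+x. a x ^ 3 \<partial>M) * ecbrt (\<integral>\<^sup>+x. b x ^ 3 \<partial>M) * ecbrt (\<integral>\<^sup>+x. c x ^ 3 \<partial>M)"
proof -
  define A B C where "A = (\<integral>\<^sup>+x. a x ^ 3 \<partial>M)" and "B = (\<integral>\<^sup>+x. b x ^ 3 \<partial>M)" and "C = (\<integral>\<^sup>+x. c x ^ 3 \<partial>M)"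
  have zero: "(\<integral>\<^sup>+x. a x * b x * c x \<partial>M) = 0" if "A = 0 \<or> B = 0 \<or> C = 0"
  proof -
    have "AE x in M. a x * b x * c x = 0"
      using that unfolding A_def B_def C_def
      by (auto simp: nn_integral_0_iff_AE elim: eventually_mono)
    then show ?thesis by (simp add: nn_integral_0_iff_AE)
  qed
  have nz: "ecbrt z \<noteq> 0" if "z \<noteq> 0" for z
  proof
    assume "ecbrt z = 0"
    with ecbrt_cube[of z] that show False by simp
  qed
  have nt: "ecbrt z \<noteq> top" if "z \<noteq> top" for z
    using that by (simp add: ecbrt_def)
  show ?thesis
  proof (cases "A = 0 \<or> B = 0 \<or> C = 0")
    case True
    then show ?thesis using zero by simp
  next
    case False
    show ?thesis
    proof (cases "A = top \<or> B = top \<or> C = top")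
      case True
      \<comment> \<open>In \<open>ennreal\<close> the product of 0 and \<open>top\<close> is 0, so
        the right-hand side is infinite only because no factor vanishes.\<close>
      moreover have "ecbrt A \<noteq> 0" "ecbrt B \<noteq> 0" "ecbrt C \<noteq> 0"
        using False nz by blast+
      ultimately have "ecbrt A * ecbrt B * ecbrt C = top"
        by (elim disjE) (simp_all add: ennreal_mult_top ennreal_top_mult)
      then show ?thesis by (simp add: A_def B_def C_def)
    next
      case fin: False
      define p q r where "p = ecbrt A" and "q = ecbrt B" and "r = ecbrt C"
      have pqr: "p \<noteq> 0" "q \<noteq> 0" "r \<noteq> 0" "p \<noteq> top" "q \<noteq> top" "r \<noteq> top"
        using False fin nz nt unfolding p_def q_def r_def by blast+
      have d: "s * (w / s) = w" if "s \<noteq> 0" "s \<noteq> top" for s w :: ennreal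
        using mult_divide_eq_ennreal[OF that, of w] by (simp only: ennreal_times_divide mult.commute)
      have cube: "(\<integral>\<^sup>+x. (f x / s) ^ 3 \<partial>M) = 1" if "(\<integral>\<^sup>+x. f x ^ 3 \<partial>M) = s ^ 3" "s \<noteq> 0" "s \<noteq> top"
        "f \<in> borel_measurable M" for f s
      proof -
        have "(\<integral>\<^sup>+x. (f x / s) ^ 3 \<partial>M) = (\<integral>\<^sup>+x. f x ^ 3 / s ^ 3 \<partial>M)"
        proof (rule nn_integral_cong)
          fix x
          have "s < top" using that(3) less_top by blast
          then have "(inverse s) ^ 3 = inverse (s ^ 3)"
            by (simp add: power3_eq_cube ennreal_inverse_mult ennreal_mult_less_top)
          moreover have "(f x / s) ^ 3 = f x ^ 3 * (inverse s) ^ 3" by (simp add: divide_ennreal_def power_mult_distrib)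
          ultimately show "(f x / s) ^ 3 = f x ^ 3 / s ^ 3" by (simp only: divide_ennreal_def)
        qed
        also have "\<dots> = s ^ 3 / s ^ 3" using that by (simp add: nn_integral_divide)
        also have "\<dots> = 1" using that by (intro ennreal_divide_self) (auto simp: power3_eq_cube ennreal_mult_less_top less_top)
        finally show ?thesis .
      qed
      have "3 * (\<integral>\<^sup>+x. (a x / p) * (b x / q) * (c x / r) \<partial>M) = (\<integral>\<^sup>+x. 3 * ((a x / p) * (b x / q) * (c x / r)) \<partial>M)"
        by (rule nn_integral_cmult[symmetric]) measurable
      also have "\<dots> \<le> (\<integral>\<^sup>+x. (a x / p) ^ 3 + (b x / q) ^ 3 + (c x / r) ^ 3 \<partial>M)"
        by (intro nn_integral_mono arith_geo_mean_ennreal)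
      also have "\<dots> = (\<integral>\<^sup>+x. (a x / p) ^ 3 \<partial>M) + (\<integral>\<^sup>+x. (b x / q) ^ 3 \<partial>M) + (\<integral>\<^sup>+x. (c x / r) ^ 3 \<partial>M)"
        by (subst nn_integral_add; (subst nn_integral_add)?) (auto intro!: borel_measurable_add)
      also have "\<dots> = 1 + 1 + 1"
        using pqr by (simp add: cube p_def q_def r_def ecbrt_cube A_def B_def C_def)
      finally have "3 * (\<integral>\<^sup>+x. (a x / p) * (b x / q) * (c x / r) \<partial>M) \<le> 3 * 1" by simp
      then have one: "(\<integral>\<^sup>+x. (a x / p) * (b x / q) * (c x / r) \<partial>M) \<le> 1"
        by (subst (asm) ennreal_mult_le_mult_iff) auto
      have "(\<integral>\<^sup>+x. a x * b x * c x \<partial>M) = (\<integral>\<^sup>+x. (p * q * r) * ((a x / p) * (b x / q) * (c x / r)) \<partial>M)"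
      proof (rule nn_integral_cong)
        fix x
        have "(p * q * r) * ((a x / p) * (b x / q) * (c x / r)) = (p * (a x / p)) * (q * (b x / q)) * (r * (c x / r))"
          by (simp add: mult_ac)
        then show "a x * b x * c x = (p * q * r) * ((a x / p) * (b x / q) * (c x / r))"
          using pqr by (simp add: d)
      qed
      also have "\<dots> = (p * q * r) * (\<integral>\<^sup>+x. (a x / p) * (b x / q) * (c x / r) \<partial>M)"
        by (rule nn_integral_cmult) measurable
      also have "\<dots> \<le> (p * q * r) * 1" by (intro mult_left_mono one) simp
      finally show ?thesis by (simp add: p_def q_def r_def A_def B_def C_def)
    qed
  qed
qed

text \<open>The integrated variable stays on as a dummy: all partial integrals live on one function
  space, and independence of coordinate i is the equation
  \<open>p i (x(i := s)) = p i x\<close>.\<close>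

definition partial_int :: "'k \<Rightarrow> (('k \<Rightarrow> real) \<Rightarrow> ennreal) \<Rightarrow> ('k \<Rightarrow> real) \<Rightarrow> ennreal" where
  "partial_int j F x = (\<integral>\<^sup>+s. F (x(j := s)) \<partial>lborel)"

fun iter_int :: "'k list \<Rightarrow> (('k \<Rightarrow> real) \<Rightarrow> ennreal) \<Rightarrow> ('k \<Rightarrow> real) \<Rightarrow> ennreal" where
  "iter_int [] F = F"
| "iter_int (j # js) F = iter_int js (partial_int j F)"

lemma fun_upd_measurable:
  assumes "F \<in> borel_measurable (Pi\<^sub>M (insert j I) (\<lambda>_. lborel :: real measure))"
  shows "(\<lambda>(x, s). F (x(j := s))) \<in> borel_measurable (Pi\<^sub>M I (\<lambda>_. lborel) \<Otimes>\<^sub>M lborel)"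
  using measurable_compose[OF measurable_add_dim assms, of ] by (simp add: case_prod_beta')

lemma partial_int_measurable:
  assumes "F \<in> borel_measurable (Pi\<^sub>M (insert j I) (\<lambda>_. lborel :: real measure))"
  shows "partial_int j F \<in> borel_measurable (Pi\<^sub>M I (\<lambda>_. lborel))"
  unfolding partial_int_def[abs_def]
  using fun_upd_measurable[OF assms] by (intro lborel.borel_measurable_nn_integral) (simp add: case_prod_beta')

lemma partial_int_measurable_UNIV:
  "F \<in> borel_measurable (Pi\<^sub>M UNIV (\<lambda>_. lborel :: real measure)) \<Longrightarrow>
   partial_int j F \<in> borel_measurable (Pi\<^sub>M UNIV (\<lambda>_. lborel))"
  using partial_int_measurable[of F j UNIV] by simp

lemma slice_measurable:
  assumes "F \<in> borel_measurable (Pi\<^sub>M UNIV (\<lambda>_. lborel :: real measure))"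
  shows "(\<lambda>s. F (x(j := s))) \<in> borel_measurable lborel"
proof -
  have "(\<lambda>(x, s). F (x(j := s))) \<in> borel_measurable (Pi\<^sub>M UNIV (\<lambda>_. lborel) \<Otimes>\<^sub>M lborel)"
    using fun_upd_measurable[of F j UNIV] assms by simp
  from measurable_Pair2[OF this, of x] show ?thesis by (simp add: space_PiM)
qed

lemma partial_int_mono: "(\<And>x. F x \<le> G x) \<Longrightarrow> partial_int j F x \<le> partial_int j G x"
  unfolding partial_int_def by (intro nn_integral_mono) auto

lemma iter_int_mono: "(\<And>x. F x \<le> G x) \<Longrightarrow> iter_int js F x \<le> iter_int js G x"
proof (induction js arbitrary: F G x)
  case (Cons j js)
  have "iter_int js (partial_int j F) x \<le> iter_int js (partial_int j G) x"
    by (rule Cons.IH) (rule partial_int_mono[OF Cons.prems])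
  then show ?case by simp
qed simp

lemma partial_int_cmult:
  assumes "F \<in> borel_measurable (Pi\<^sub>M UNIV (\<lambda>_. lborel :: real measure))"
  shows "partial_int j (\<lambda>x. c * F x) = (\<lambda>x. c * partial_int j F x)"
  using slice_measurable[OF assms] by (simp add: fun_eq_iff partial_int_def nn_integral_cmult)

lemma iter_int_cmult:
  "F \<in> borel_measurable (Pi\<^sub>M UNIV (\<lambda>_. lborel :: real measure)) \<Longrightarrow>
   iter_int js (\<lambda>x. c * F x) = (\<lambda>x. c * iter_int js F x)"
  by (induction js arbitrary: F) (simp_all add: partial_int_cmult partial_int_measurable_UNIV)

text \<open>Tonelli's theorem. Points of a product space are undefined outside the index set, so the
  only point of the empty product is the constant \<open>undefined\<close>, at which the iterated
  integral is evaluated.\<close>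

lemma iter_int_eq_PiM:
  assumes "distinct js" "F \<in> borel_measurable (Pi\<^sub>M (set js) (\<lambda>_. lborel :: real measure))"
  shows "iter_int js F (\<lambda>_. undefined) = (\<integral>\<^sup>+x. F x \<partial>Pi\<^sub>M (set js) (\<lambda>_. lborel))"
  using assms
proof (induction js arbitrary: F)
  interpret product_sigma_finite "\<lambda>_ :: 'a. lborel :: real measure" ..
  case Nil
  then show ?case by (simp add: PiM_empty nn_integral_count_space_finite)
next
  interpret product_sigma_finite "\<lambda>_ :: 'a. lborel :: real measure" ..
  case (Cons j js)
  have "iter_int (j # js) F (\<lambda>_. undefined) = (\<integral>\<^sup>+x. partial_int j F x \<partial>Pi\<^sub>M (set js) (\<lambda>_. lborel))"
    using Cons by (simp add: partial_int_measurable)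
  also have "\<dots> = (\<integral>\<^sup>+x. F x \<partial>Pi\<^sub>M (set (j # js)) (\<lambda>_. lborel))"
    using Cons.prems product_nn_integral_insert[of "set js" j F] by (simp add: partial_int_def)
  finally show ?case .
qed

text \<open>Four functions, of which \<open>p i\<close> does not depend on the \<open>i\<close>-th variable; the index set may be larger
  than the set of variables that are integrated out.\<close>
lemma Loomis_Whitney_four:
  fixes p :: "'k \<Rightarrow> ('k \<Rightarrow> real) \<Rightarrow> ennreal"
  assumes K: "finite K" "card K = 4" and js: "set js \<subseteq> K"
    and p: "\<And>i. i \<in> K \<Longrightarrow> p i \<in> borel_measurable (Pi\<^sub>M UNIV (\<lambda>_. lborel))"
    and indep: "\<And>i x s. i \<in> set js \<Longrightarrow> p i (x(i := s)) = p i x"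
  shows "(iter_int js (\<lambda>x. \<Prod>i\<in>K. p i x) x) ^ 3 \<le> (\<Prod>i\<in>K. iter_int (filter (\<lambda>j. j \<noteq> i) js) (\<lambda>x. p i x ^ 3) x)"
  using js p indep
proof (induction js arbitrary: p x)
  case Nil
  then show ?case by (simp add: prod_power_distrib)
next
  case (Cons j js)
  then have jK: "j \<in> K" by simp
  have pj: "p j (y(j := r)) = p j y" for y r by (rule Cons.prems(3)) simp
  \<comment> \<open>When the variable j is integrated out, \<open>p j\<close> comes out unchanged,
    and Hoelder replaces each of the other three factors by the cube root of the integral of its
    cube. These functions satisfy the hypotheses for the remaining variables.\<close>
  define q where "q = (\<lambda>i. if i = j then p j else (\<lambda>x. ecbrt (partial_int j (\<lambda>x. p i x ^ 3) x)))"
  have m3: "(\<lambda>x. p i x ^ 3) \<in> borel_measurable (Pi\<^sub>M UNIV (\<lambda>_. lborel))" if "i \<in> K" for i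
    using Cons.prems(2)[OF that] by measurable
  have qm: "q i \<in> borel_measurable (Pi\<^sub>M UNIV (\<lambda>_. lborel))" if "i \<in> K" for i
    using that Cons.prems(2) partial_int_measurable_UNIV[OF m3[OF that], of j] by (auto simp: q_def)
  have q_indep: "q i (x(i := s)) = q i x" if i: "i \<in> set js" for i x s
  proof (cases "i = j")
    case False
    have "i \<in> set (j # js)" using i by simp
    then have "p i (x(i := s, j := r)) = p i (x(j := r))" for r
      unfolding fun_upd_twist[OF False, of x s r] by (rule Cons.prems(3))
    then show ?thesis using False by (simp add: q_def partial_int_def)
  next
    case True
    then show ?thesis by (simp add: q_def pj)
  qed
  have card3: "card (K - {j}) = 3" using K jK by simp
  then obtain i1 i2 i3 where i123: "K - {j} = {i1, i2, i3}" "i1 \<noteq> i2" "i1 \<noteq> i3" "i2 \<noteq> i3"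
    by (auto simp: card_3_iff)
  have iK: "i1 \<in> K" "i2 \<in> K" "i3 \<in> K" "i1 \<noteq> j" "i2 \<noteq> j" "i3 \<noteq> j" using i123(1) by auto
  have prodK: "(\<Prod>i\<in>K. f i) = f j * (f i1 * f i2 * f i3)" for f :: "'k \<Rightarrow> ennreal"
    using prod.remove[OF K(1) jK, of f] i123 by (simp add: mult.assoc)
  have le: "partial_int j (\<lambda>x. \<Prod>i\<in>K. p i x) y \<le> (\<Prod>i\<in>K. q i y)" for y
  proof -
    have "partial_int j (\<lambda>x. \<Prod>i\<in>K. p i x) y
        = (\<integral>\<^sup>+s. p j y * (p i1 (y(j := s)) * p i2 (y(j := s)) * p i3 (y(j := s))) \<partial>lborel)"
      unfolding partial_int_def prodK pj by (rule refl)
    also have "\<dots> = p j y * (\<integral>\<^sup>+s. p i1 (y(j := s)) * p i2 (y(j := s)) * p i3 (y(j := s)) \<partial>lborel)"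
      using iK by (intro nn_integral_cmult borel_measurable_times_ennreal slice_measurable Cons.prems(2))
    also have "\<dots> \<le> p j y * (q i1 y * q i2 y * q i3 y)"
    proof (rule mult_left_mono)
      have qi: "q i = (\<lambda>x. ecbrt (partial_int j (\<lambda>x. p i x ^ 3) x))" if "i \<noteq> j" for i
        using that by (simp add: q_def)
      show "(\<integral>\<^sup>+s. p i1 (y(j := s)) * p i2 (y(j := s)) * p i3 (y(j := s)) \<partial>lborel) \<le> q i1 y * q i2 y * q i3 y"
        unfolding qi[OF iK(4)] qi[OF iK(5)] qi[OF iK(6)] partial_int_def
        by (intro Holder_three slice_measurable Cons.prems(2) iK)
    qed simp
    also have "\<dots> = (\<Prod>i\<in>K. q i y)" unfolding prodK by (simp add: q_def)
    finally show ?thesis .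
  qed
  have "(iter_int (j # js) (\<lambda>x. \<Prod>i\<in>K. p i x) x) ^ 3 \<le> (iter_int js (\<lambda>x. \<Prod>i\<in>K. q i x) x) ^ 3"
    using le by (auto intro!: power_mono iter_int_mono)
  also have "\<dots> \<le> (\<Prod>i\<in>K. iter_int (filter (\<lambda>j. j \<noteq> i) js) (\<lambda>x. q i x ^ 3) x)"
    using Cons.prems(1) by (intro Cons.IH qm q_indep) auto
  also have "\<dots> = (\<Prod>i\<in>K. iter_int (filter (\<lambda>j. j \<noteq> i) (j # js)) (\<lambda>x. p i x ^ 3) x)"
    by (intro prod.cong refl) (auto simp: q_def ecbrt_cube)
  finally show ?case .
qed

subsection \<open>Compactly supported functions of class \<open>C\<^sup>1\<close>\<close>

text \<open>One derivative suffices for integration by parts and for the Sobolev inequality, and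
  closure under products then takes only the first-order product rule.\<close>

definition C1c :: "(real ^ 'n) set \<Rightarrow> (real ^ 'n \<Rightarrow> real) set" where
  "C1c \<Omega> = {\<psi>. (\<forall>x. \<psi> differentiable (at x)) \<and> (\<forall>i. continuous_on UNIV (\<lambda>x. gradient \<psi> x $ i)) \<and>
     (\<exists>K. compact K \<and> K \<subseteq> \<Omega> \<and> (\<forall>x. x \<notin> K \<longrightarrow> \<psi> x = 0))}"

lemma test_functions_C1c: "\<psi> \<in> test_functions \<Omega> \<Longrightarrow> \<psi> \<in> C1c \<Omega>"
proof -
  assume "\<psi> \<in> test_functions \<Omega>"
  then have k: "\<And>k. C_k_on k UNIV \<psi>" and K: "compact (closure {x. \<psi> x \<noteq> 0})" "closure {x. \<psi> x \<noteq> 0} \<subseteq> \<Omega>"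
    by (auto simp: test_functions_def)
  have "\<exists>K. compact K \<and> K \<subseteq> \<Omega> \<and> (\<forall>x. x \<notin> K \<longrightarrow> \<psi> x = 0)"
    using K closure_subset[of "{x. \<psi> x \<noteq> 0}"] by blast
  then show ?thesis using k[of "Suc 0"] by (auto simp: C1c_def differentiable_on_def)
qed

lemma C1c_D:
  assumes "\<psi> \<in> C1c \<Omega>"
  shows "\<psi> differentiable (at x)" "continuous_on UNIV \<psi>" "continuous_on UNIV (gradient \<psi>)"
proof -
  show d: "\<psi> differentiable (at x)" for x using assms by (simp add: C1c_def)
  show "continuous_on UNIV \<psi>"
    using d by (auto intro!: continuous_at_imp_continuous_on differentiable_imp_continuous_within)
  have "continuous_on UNIV (\<lambda>x. \<chi> i. gradient \<psi> x $ i)"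
    using assms by (intro continuous_on_vec_lambda) (simp add: C1c_def)
  then show "continuous_on UNIV (gradient \<psi>)" by simp
qed

lemma C1c_support:
  assumes "\<psi> \<in> C1c \<Omega>"
  obtains K where "compact K" "K \<subseteq> \<Omega>" "\<And>x. x \<notin> K \<Longrightarrow> \<psi> x = 0" "\<And>x. x \<notin> K \<Longrightarrow> gradient \<psi> x = 0"
proof -
  obtain K where K: "compact K" "K \<subseteq> \<Omega>" "\<And>x. x \<notin> K \<Longrightarrow> \<psi> x = 0"
    using assms by (auto simp: C1c_def)
  have "gradient \<psi> x = 0" if "x \<notin> K" for x
  proof -
    have "((\<lambda>_. 0) has_derivative (\<lambda>_. 0)) (at x)" by simp
    then have "(\<psi> has_derivative (\<lambda>_. 0)) (at x)"
      by (rule has_derivative_transform_within_open[where s="- K"])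
        (use K that in \<open>auto intro: compact_imp_closed\<close>)
    from gradient_eq[OF this] show ?thesis by (simp add: vec_eq_iff)
  qed
  with K that show ?thesis by blast
qed

lemma gradient_cmult:
  assumes "f differentiable (at x)"
  shows "gradient (\<lambda>x. c * f x) x = c *\<^sub>R gradient f x"
proof -
  have "(\<lambda>x. c) differentiable (at x)" by simp
  from gradient_mult[OF this assms] show ?thesis by (simp add: gradient_const)
qed

lemma C1c_add:
  assumes "f \<in> C1c \<Omega>" "g \<in> C1c \<Omega>"
  shows "(\<lambda>x. f x + g x) \<in> C1c \<Omega>"
proof -
  obtain K where K: "compact K" "K \<subseteq> \<Omega>" "\<And>x. x \<notin> K \<Longrightarrow> f x = 0" using C1c_support[OF assms(1)] by metis
  obtain L where L: "compact L" "L \<subseteq> \<Omega>" "\<And>x. x \<notin> L \<Longrightarrow> g x = 0" using C1c_support[OF assms(2)] by metis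
  have "\<exists>K. compact K \<and> K \<subseteq> \<Omega> \<and> (\<forall>x. x \<notin> K \<longrightarrow> f x + g x = 0)"
    using K L by (intro exI[of _ "K \<union> L"]) auto
  then show ?thesis
    using C1c_D[OF assms(1)] C1c_D[OF assms(2)]
    by (simp add: C1c_def gradient_add) (auto intro!: continuous_intros)
qed

lemma C1c_mult:
  assumes "f \<in> C1c \<Omega>" "g \<in> C1c \<Omega>"
  shows "(\<lambda>x. f x * g x) \<in> C1c \<Omega>"
proof -
  obtain K where K: "compact K" "K \<subseteq> \<Omega>" "\<And>x. x \<notin> K \<Longrightarrow> f x = 0" using C1c_support[OF assms(1)] by metis
  have "\<exists>K. compact K \<and> K \<subseteq> \<Omega> \<and> (\<forall>x. x \<notin> K \<longrightarrow> f x * g x = 0)"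
    using K by (intro exI[of _ "K"]) auto
  then show ?thesis
    using C1c_D[OF assms(1)] C1c_D[OF assms(2)]
    by (simp add: C1c_def gradient_mult) (auto intro!: continuous_intros)
qed

lemma C1c_zero: "(\<lambda>x. 0) \<in> C1c \<Omega>"
  by (auto simp: C1c_def gradient_const intro!: exI[of _ "{}"])

lemma C1c_cmult:
  assumes "f \<in> C1c \<Omega>"
  shows "(\<lambda>x. c * f x) \<in> C1c \<Omega>"
proof -
  obtain K where K: "compact K" "K \<subseteq> \<Omega>" "\<And>x. x \<notin> K \<Longrightarrow> f x = 0" using C1c_support[OF assms(1)] by metis
  have "\<exists>K. compact K \<and> K \<subseteq> \<Omega> \<and> (\<forall>x. x \<notin> K \<longrightarrow> c = 0 \<or> f x = 0)"
    using K by (intro exI[of _ "K"]) auto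
  then show ?thesis
    using C1c_D[OF assms(1)]
    by (simp add: C1c_def gradient_cmult) (auto intro!: continuous_intros)
qed

lemma compact_support_integrable:
  fixes f :: "real ^ 'n \<Rightarrow> real"
  assumes "continuous_on UNIV f" "compact K" "\<And>x. x \<notin> K \<Longrightarrow> f x = 0"
  shows "integrable lborel f"
proof -
  have "integrable lborel (\<lambda>x. indicator K x *\<^sub>R f x)"
    by (rule borel_integrable_compact) (use assms in \<open>auto intro: continuous_on_subset\<close>)
  moreover have "(\<lambda>x. indicator K x *\<^sub>R f x) = f" using assms(3) by (auto simp: fun_eq_iff indicator_def)
  ultimately show ?thesis by simp
qed

text \<open>Extension by zero identifies integrals over \<Omega> with integrals over the whole
  space, where translations are available.\<close>

lemma lebesgue_on_compact_support:
  fixes f :: "real ^ 'n \<Rightarrow> real"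
  assumes \<Omega>: "\<Omega> \<in> sets lebesgue"
    and f: "continuous_on UNIV f" "compact K" "K \<subseteq> \<Omega>" "\<And>x. x \<notin> K \<Longrightarrow> f x = 0"
  shows "f \<in> borel_measurable (lebesgue_on \<Omega>)" "integrable (lebesgue_on \<Omega>) f"
    "integral\<^sup>L (lebesgue_on \<Omega>) f = integral\<^sup>L lborel f"
proof -
  have m: "f \<in> borel_measurable lborel" using f(1) by (simp add: borel_measurable_continuous_onI)
  then have ml: "f \<in> borel_measurable lebesgue" by (rule measurable_completion)
  then show "f \<in> borel_measurable (lebesgue_on \<Omega>)" by (rule measurable_restrict_space1)
  have eq: "(\<lambda>x. indicator \<Omega> x *\<^sub>R f x) = f" using f(3,4) by (auto simp: fun_eq_iff indicator_def)
  show "integrable (lebesgue_on \<Omega>) f"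
    using compact_support_integrable[OF f(1,2,4)] \<Omega> m integrable_completion[OF m]
    by (subst integrable_restrict_space) (simp_all only: eq, simp_all)
  show "integral\<^sup>L (lebesgue_on \<Omega>) f = integral\<^sup>L lborel f"
    using \<Omega> integral_completion[OF m] by (subst integral_restrict_space) (simp_all only: eq, simp_all)
qed

lemma C1c_L2:
  assumes \<Omega>: "\<Omega> \<in> sets lebesgue" and \<psi>: "\<psi> \<in> C1c \<Omega>"
  shows "\<psi> \<in> L2 \<Omega>" "(\<lambda>x. gradient \<psi> x $ i) \<in> L2 \<Omega>"
proof -
  obtain K where K: "compact K" "K \<subseteq> \<Omega>" "\<And>x. x \<notin> K \<Longrightarrow> \<psi> x = 0" "\<And>x. x \<notin> K \<Longrightarrow> gradient \<psi> x = 0"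
    using C1c_support[OF \<psi>] by metis
  note c = C1c_D[OF \<psi>]
  show "\<psi> \<in> L2 \<Omega>"
    using lebesgue_on_compact_support[OF \<Omega> c(2) K(1-3)]
      lebesgue_on_compact_support(2)[OF \<Omega> _ K(1,2), of "\<lambda>x. (\<psi> x)\<^sup>2"] K c
    by (simp add: L2_def continuous_intros)
  have ci: "continuous_on UNIV (\<lambda>x. gradient \<psi> x $ i)" by (intro continuous_intros c)
  show "(\<lambda>x. gradient \<psi> x $ i) \<in> L2 \<Omega>"
    using lebesgue_on_compact_support[OF \<Omega> ci K(1,2)]
      lebesgue_on_compact_support(2)[OF \<Omega> _ K(1,2), of "\<lambda>x. (gradient \<psi> x $ i)\<^sup>2"] K ci
    by (simp add: L2_def continuous_intros)
qed

lemma C1c_line_derivative: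
  assumes "\<psi> \<in> C1c \<Omega>"
  shows "((\<lambda>s. \<psi> (x + s *\<^sub>R h)) has_real_derivative gradient \<psi> (x + s *\<^sub>R h) \<bullet> h) (at s)"
proof -
  have "((\<lambda>s. x + s *\<^sub>R h) has_derivative (\<lambda>s. s *\<^sub>R h)) (at s)"
    by (auto intro!: derivative_eq_intros)
  from has_derivative_compose[OF this has_derivative_gradient[OF C1c_D(1)[OF assms]]]
  show ?thesis by (simp add: has_field_derivative_def mult.commute[of _ "gradient _ _ \<bullet> _"])
qed

text \<open>Differentiate the translation invariant integral \<open>\<integral> \<psi>(x + t e\<^sub>i) dx\<close> with respect to \<open>t\<close>.\<close>
lemma integral_gradient_zero:
  assumes \<psi>: "\<psi> \<in> C1c (\<Omega> :: (real ^ 'n) set)"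
  shows "(LINT x|lborel. gradient \<psi> x $ i) = 0"
proof -
  obtain K where K: "compact K" "\<And>x. x \<notin> K \<Longrightarrow> \<psi> x = 0" "\<And>x. x \<notin> K \<Longrightarrow> gradient \<psi> x = 0"
    using C1c_support[OF \<psi>] by metis
  note c = C1c_D[OF \<psi>]
  define e where "e = (axis i 1 :: real ^ 'n)"
  have ne: "norm e = 1" by (simp add: e_def norm_axis_1)
  have comp: "gradient \<psi> x $ i = gradient \<psi> x \<bullet> e" for x by (simp add: e_def inner_axis)
  obtain R where R: "\<And>x. x \<in> K \<Longrightarrow> norm x \<le> R" using compact_imp_bounded[OF K(1)] by (auto simp: bounded_iff)
  have "compact (gradient \<psi> ` K)" by (intro compact_continuous_image continuous_on_subset[OF c(3)] K) auto
  then obtain M where M: "\<And>x. x \<in> K \<Longrightarrow> norm (gradient \<psi> x) \<le> M"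
    using compact_imp_bounded by (fastforce simp: bounded_iff)
  define M' where "M' = max M 0"
  have M': "norm (gradient \<psi> x) \<le> M'" for x using M[of x] K(3)[of x] by (cases "x \<in> K") (auto simp: M'_def)
  define d where "d = (\<lambda>n x. (\<psi> (x + (1 / real (Suc n)) *\<^sub>R e) - \<psi> x) * real (Suc n))"
  have int_\<psi>: "integrable lborel \<psi>" by (rule compact_support_integrable[OF c(2) K(1,2)])
  have m[measurable]: "\<psi> \<in> borel_measurable borel" using c(2) by (simp add: borel_measurable_continuous_onI)
  have mg: "(\<lambda>x. gradient \<psi> x $ i) \<in> borel_measurable borel"
    by (intro borel_measurable_continuous_onI continuous_intros c)
  have shift: "integrable lborel (\<lambda>x. \<psi> (x + h))" "(LINT x|lborel. \<psi> (x + h)) = (LINT x|lborel. \<psi> x)" for h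
  proof -
    have "integrable (distr lborel borel ((+) h)) \<psi>" using int_\<psi> by (simp add: lborel_distr_plus)
    then show "integrable lborel (\<lambda>x. \<psi> (x + h))" by (subst (asm) integrable_distr_eq) (auto simp: add.commute)
    have "(LINT x|lborel. \<psi> x) = (LINT x|distr lborel borel ((+) h). \<psi> x)" by (simp add: lborel_distr_plus)
    also have "\<dots> = (LINT x|lborel. \<psi> (x + h))" by (subst integral_distr) (auto simp: add.commute)
    finally show "(LINT x|lborel. \<psi> (x + h)) = (LINT x|lborel. \<psi> x)" by simp
  qed
  have "(\<lambda>n. LINT x|lborel. d n x) \<longlonglongrightarrow> (LINT x|lborel. gradient \<psi> x $ i)"
  \<comment> \<open>By the mean value theorem the difference quotients are bounded by M', and steps
    of length at most 1 keep them zero outside the ball of radius R + 1.\<close>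
  proof (rule integral_dominated_convergence[where w="\<lambda>x. M' * indicator (cball 0 (R + 1)) x"])
    show "integrable lborel (\<lambda>x::real ^ 'n. M' * indicator (cball 0 (R + 1)) x)"
      using emeasure_lborel_cball_finite[of "0 :: real ^ 'n" "R + 1"]
      by (intro integrable_mult_right integrable_real_indicator) (auto simp: less_top)
    show "AE x in lborel. (\<lambda>n. d n x) \<longlonglongrightarrow> gradient \<psi> x $ i"
    proof (rule AE_I2)
      fix x
      have "((\<lambda>h. (\<psi> (x + (0 + h) *\<^sub>R e) - \<psi> (x + 0 *\<^sub>R e)) / h) \<longlongrightarrow> gradient \<psi> (x + 0 *\<^sub>R e) \<bullet> e) (at 0)"
        using C1c_line_derivative[OF \<psi>, of x e 0] unfolding DERIV_def .
      then have "((\<lambda>h. (\<psi> (x + h *\<^sub>R e) - \<psi> x) / h) \<longlongrightarrow> gradient \<psi> x \<bullet> e) (at 0)" by simp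
      moreover have "filterlim (\<lambda>n. 1 / real (Suc n)) (at 0) sequentially"
        using LIMSEQ_inverse_real_of_nat by (auto simp: filterlim_at inverse_eq_divide)
      ultimately have "(\<lambda>n. (\<psi> (x + (1 / real (Suc n)) *\<^sub>R e) - \<psi> x) / (1 / real (Suc n))) \<longlonglongrightarrow> gradient \<psi> x \<bullet> e"
        by (rule filterlim_compose)
      then show "(\<lambda>n. d n x) \<longlonglongrightarrow> gradient \<psi> x $ i" by (simp add: d_def comp)
    qed
    show "AE x in lborel. norm (d n x) \<le> M' * indicator (cball 0 (R + 1)) x" for n
    proof (rule AE_I2)
      fix x
      define t where "t = 1 / real (Suc n)"
      have t: "0 < t" "t \<le> 1" by (auto simp: t_def)
      show "norm (d n x) \<le> M' * indicator (cball 0 (R + 1)) x"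
      proof (cases "norm x \<le> R + 1")
        case True
        have "\<exists>z>0. z < t \<and> \<psi> (x + t *\<^sub>R e) - \<psi> (x + 0 *\<^sub>R e) = (t - 0) * (gradient \<psi> (x + z *\<^sub>R e) \<bullet> e)"
          using t by (intro MVT2 C1c_line_derivative[OF \<psi>]) auto
        then obtain z where z: "\<psi> (x + t *\<^sub>R e) - \<psi> x = t * (gradient \<psi> (x + z *\<^sub>R e) \<bullet> e)" by auto
        have "\<bar>gradient \<psi> (x + z *\<^sub>R e) \<bullet> e\<bar> \<le> M'"
          using Cauchy_Schwarz_ineq2[of "gradient \<psi> (x + z *\<^sub>R e)" e] M'[of "x + z *\<^sub>R e"] ne by simp
        moreover have "d n x = gradient \<psi> (x + z *\<^sub>R e) \<bullet> e"
          using z t by (simp add: d_def t_def)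
        ultimately show ?thesis using True by simp
      next
        case False
        have "norm (t *\<^sub>R e) \<le> 1" using t ne by simp
        then have "norm (x + t *\<^sub>R e) > R" using False norm_triangle_ineq2[of x "- (t *\<^sub>R e)"] by simp
        then have "\<psi> (x + t *\<^sub>R e) = 0" "\<psi> x = 0" using R[of "x + t *\<^sub>R e"] R[of x] K(2) False by force+
        then show ?thesis by (simp add: d_def t_def M'_def)
      qed
    qed
  qed (use mg in \<open>auto simp: d_def[abs_def]\<close>)
  moreover have "(LINT x|lborel. d n x) = 0" for n
    unfolding d_def using shift int_\<psi> by simp
  ultimately have "(\<lambda>n::nat. 0) \<longlonglongrightarrow> (LINT x|lborel. gradient \<psi> x $ i)" by simp
  then show ?thesis using LIMSEQ_unique tendsto_const by blast
qed

text \<open>The product has compact support, so the integral of its gradient is zero and there is no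
  boundary term.\<close>

lemma integration_by_parts:
  assumes \<Omega>: "\<Omega> \<in> sets lebesgue" and f: "f \<in> C1c \<Omega>" and g: "g \<in> C1c \<Omega>"
  shows "L2_inner \<Omega> f (\<lambda>x. gradient g x $ i) = - L2_inner \<Omega> (\<lambda>x. gradient f x $ i) g"
proof -
  have fg: "(\<lambda>x. f x * g x) \<in> C1c \<Omega>" by (rule C1c_mult[OF f g])
  obtain K where K: "compact K" "K \<subseteq> \<Omega>" "\<And>x. x \<notin> K \<Longrightarrow> gradient (\<lambda>x. f x * g x) x = 0"
    using C1c_support[OF fg] by metis
  have "(LINT x|lebesgue_on \<Omega>. gradient (\<lambda>x. f x * g x) x $ i) = 0"
    using lebesgue_on_compact_support(3)[OF \<Omega> _ K(1,2), of "\<lambda>x. gradient (\<lambda>x. f x * g x) x $ i"]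
      integral_gradient_zero[OF fg, of i] C1c_D(3)[OF fg] K(3)
    by (simp add: continuous_on_component)
  moreover have "(\<lambda>x. gradient (\<lambda>x. f x * g x) x $ i) = (\<lambda>x. f x * gradient g x $ i + gradient f x $ i * g x)"
    using C1c_D(1)[OF f] C1c_D(1)[OF g] by (simp add: fun_eq_iff gradient_mult mult.commute)
  ultimately show ?thesis
    using L2_mult_integrable[OF C1c_L2(1)[OF \<Omega> f] C1c_L2(2)[OF \<Omega> g, of i]]
      L2_mult_integrable[OF C1c_L2(2)[OF \<Omega> f, of i] C1c_L2(1)[OF \<Omega> g]]
    by (simp add: L2_inner_def)
qed

subsection \<open>The Sobolev inequality in dimension at most four\<close>

lemma prod_mono_ennreal:
  fixes f g :: "'a \<Rightarrow> ennreal"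
  assumes "\<And>i. i \<in> A \<Longrightarrow> f i \<le> g i"
  shows "prod f A \<le> prod g A"
  using assms by (induction A rule: infinite_finite_induct) (auto intro: mult_mono)

text \<open>\<open>lborel\<close> is the image of the product of one-dimensional Lebesgue measures
  under this map. The indices are vectors, of which only those in \<open>Basis\<close> matter; the
  others are at hand as dummy variables.\<close>

definition coord_vec :: "(real ^ 'n \<Rightarrow> real) \<Rightarrow> real ^ 'n" where
  "coord_vec x = (\<Sum>b\<in>Basis. x b *\<^sub>R b)"

lemma coord_vec_measurable:
  fixes I :: "(real ^ 'n) set"
  assumes "Basis \<subseteq> I"
  shows "coord_vec \<in> borel_measurable (Pi\<^sub>M I (\<lambda>_. lborel))"
  unfolding coord_vec_def[abs_def]
proof (rule borel_measurable_sum)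
  fix b :: "real ^ 'n" assume "b \<in> Basis"
  then have "b \<in> I" using assms by blast
  from measurable_component_singleton[OF this, of "\<lambda>_. lborel"]
  have "(\<lambda>x. x b) \<in> borel_measurable (Pi\<^sub>M I (\<lambda>_. lborel))" by simp
  then show "(\<lambda>x. x b *\<^sub>R b) \<in> borel_measurable (Pi\<^sub>M I (\<lambda>_. lborel))" by measurable
qed

lemma coord_vec_upd:
  assumes "b \<in> Basis"
  shows "coord_vec (x(b := s)) = (coord_vec x - x b *\<^sub>R b) + s *\<^sub>R b"
proof -
  have eq: "coord_vec y = y b *\<^sub>R b + (\<Sum>c\<in>Basis - {b}. y c *\<^sub>R c)" for y
    unfolding coord_vec_def by (rule sum.remove[OF finite_Basis assms])
  have "(\<Sum>c\<in>Basis - {b}. (x(b := s)) c *\<^sub>R c) = (\<Sum>c\<in>Basis - {b}. x c *\<^sub>R c)"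
    by (rule sum.cong) auto
  then show ?thesis unfolding eq by simp
qed

lemma coord_vec_inner: "b \<in> Basis \<Longrightarrow> coord_vec x \<bullet> b = x b"
  by (simp add: coord_vec_def inner_sum_left_Basis)

lemma iter_int_coord_vec:
  fixes \<phi> :: "real ^ 'n \<Rightarrow> real"
  assumes "\<phi> \<in> borel_measurable borel" "distinct js" "set js = (Basis :: (real ^ 'n) set)"
  shows "iter_int js (\<lambda>x. ennreal (\<phi> (coord_vec x))) (\<lambda>_. undefined) = (\<integral>\<^sup>+y. ennreal (\<phi> y) \<partial>lborel)"
proof -
  note [measurable] = assms(1) coord_vec_measurable[of "Basis :: (real ^ 'n) set", OF order_refl]
  have "(\<integral>\<^sup>+y. ennreal (\<phi> y) \<partial>lborel) = (\<integral>\<^sup>+y. ennreal (\<phi> y) \<partial>distr (Pi\<^sub>M Basis (\<lambda>_. lborel)) borel coord_vec)"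
    unfolding coord_vec_def[abs_def] lborel_eq[symmetric] ..
  also have "\<dots> = (\<integral>\<^sup>+x. ennreal (\<phi> (coord_vec x)) \<partial>Pi\<^sub>M Basis (\<lambda>_. lborel))"
    by (rule nn_integral_distr) measurable
  also have "\<dots> = iter_int js (\<lambda>x. ennreal (\<phi> (coord_vec x))) (\<lambda>_. undefined)"
    using iter_int_eq_PiM[OF assms(2), of "\<lambda>x. ennreal (\<phi> (coord_vec x))"] by (simp add: assms(3))
  finally show ?thesis by simp
qed

text \<open>u^3 is the integral of its derivative 3 u^2 (\<nabla>u \<bullet> b) along the line in
  direction b, starting from a point outside \<Omega>, where u vanishes.\<close>

lemma cube_le_line_integral:
  fixes \<Omega> :: "(real ^ 'n) set"
  assumes u: "u \<in> C1c \<Omega>" and R: "\<And>x. x \<in> \<Omega> \<Longrightarrow> norm x \<le> R" and b: "b \<in> Basis"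
  shows "ennreal (\<bar>u (coord_vec x)\<bar> ^ 3)
    \<le> partial_int b (\<lambda>x. ennreal \<bar>3 * (u (coord_vec x))\<^sup>2 * (gradient u (coord_vec x) \<bullet> b)\<bar>) x"
proof -
  define y where "y = coord_vec x - x b *\<^sub>R b"
  have V: "coord_vec (x(b := s)) = y + s *\<^sub>R b" for s unfolding y_def by (rule coord_vec_upd[OF b])
  have Vx: "coord_vec x = y + x b *\<^sub>R b" by (simp add: y_def)
  have yb: "(y + s *\<^sub>R b) \<bullet> b = s" for s
    using V[of s] coord_vec_inner[OF b, of "x(b := s)"] by simp
  define q where "q = (\<lambda>s. 3 * (u (y + s *\<^sub>R b))\<^sup>2 * (gradient u (y + s *\<^sub>R b) \<bullet> b))"
  \<comment> \<open>Below \<open>x b\<close>, and so negative that the starting point has norm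
    larger than R.\<close>
  define L where "L = - (\<bar>x b\<bar> + \<bar>R\<bar> + 1)"
  note c = C1c_D[OF u]
  obtain K where K: "compact K" "K \<subseteq> \<Omega>" "\<And>x. x \<notin> K \<Longrightarrow> u x = 0" using C1c_support[OF u] by metis
  have "\<bar>L\<bar> \<le> norm (y + L *\<^sub>R b)"
    using Cauchy_Schwarz_ineq2[of "y + L *\<^sub>R b" b] b unfolding yb by simp
  then have "y + L *\<^sub>R b \<notin> \<Omega>" using R[of "y + L *\<^sub>R b"] by (auto simp: L_def)
  then have uL: "u (y + L *\<^sub>R b) = 0" using K by blast
  have D: "((\<lambda>s. u (y + s *\<^sub>R b) ^ 3) has_real_derivative q s) (at s)" for s
    using C1c_line_derivative[OF u, of y b s] unfolding q_def
    by (auto intro!: derivative_eq_intros)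
  have qc: "continuous_on UNIV q" unfolding q_def
    by (intro continuous_intros continuous_on_compose2[OF c(2)] continuous_on_compose2[OF c(3)]) auto
  have Lle: "L \<le> x b" by (simp add: L_def)
  have qi: "integrable lborel (\<lambda>s. indicator {L..x b} s *\<^sub>R q s)"
    by (rule borel_integrable_compact) (auto intro: continuous_on_subset[OF qc])
  have "(LINT s|lborel. q s * indicator {L..x b} s) = u (y + x b *\<^sub>R b) ^ 3 - u (y + L *\<^sub>R b) ^ 3"
    by (rule integral_FTC_Icc_real[OF Lle D]) (use qc in \<open>simp add: continuous_on_eq_continuous_at\<close>)
  then have "u (coord_vec x) ^ 3 = (LINT s|lborel. indicator {L..x b} s *\<^sub>R q s)"
    by (simp add: uL Vx mult.commute)
  then have "ennreal (\<bar>u (coord_vec x)\<bar> ^ 3) = ennreal (norm (LINT s|lborel. indicator {L..x b} s *\<^sub>R q s))"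
    by (simp only: power_abs[symmetric] real_norm_def)
  also have "\<dots> \<le> (\<integral>\<^sup>+s. ennreal (norm (indicator {L..x b} s *\<^sub>R q s)) \<partial>lborel)"
    by (rule integral_norm_bound_ennreal[OF qi])
  also have "\<dots> \<le> (\<integral>\<^sup>+s. ennreal \<bar>q s\<bar> \<partial>lborel)"
    by (intro nn_integral_mono ennreal_leI) (auto simp: indicator_def)
  finally show ?thesis by (simp add: partial_int_def V q_def)
qed

text \<open>With X the integral of u^4 and Y that of |\<nabla>u|^2: u^4 is a product of four factors
  |u|, the cube of |u| is bounded by line integrals, and Loomis-Whitney applies. Each resulting
  integral is at most a multiple of sqrt(X Y) by Cauchy-Schwarz, so X^3 is at most a multiple of X^2
  Y^2.\<close>

theorem C1c_Sobolev:
  fixes \<Omega> :: "(real ^ 'n) set"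
  assumes \<Omega>: "bounded \<Omega>" and card: "CARD('n) \<le> 4"
  obtains C where "0 \<le> C" "\<And>u. u \<in> C1c \<Omega> \<Longrightarrow>
    (LINT x|lborel. (u x) ^ 4) \<le> C * (LINT x|lborel. (norm (gradient u x))\<^sup>2)\<^sup>2"
proof -
  obtain R where R: "0 < R" "\<And>x. x \<in> \<Omega> \<Longrightarrow> norm x \<le> R"
    using \<Omega> by (auto simp: bounded_pos)
  \<comment> \<open>The 1 serves for the directions of the space, 2 R for the padding
    factors.\<close>
  define c where "c = max 1 (2 * R)"
  have c: "1 \<le> c" "2 * R \<le> c" "0 \<le> c" by (auto simp: c_def)
  let ?B = "Basis :: (real ^ 'n) set"
  have inf: "infinite (UNIV - ?B)"
  proof -
    have "infinite (UNIV :: (real ^ 'n) set)" using not_bounded_UNIV finite_imp_bounded by blast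
    then show ?thesis by (simp add: Diff_infinite_finite)
  qed
  \<comment> \<open>Loomis-Whitney is used with four factors in every dimension; indices outside the
    basis fill up the index set.\<close>
  obtain E where E: "finite E" "card E = 4 - CARD('n)" "E \<subseteq> UNIV - ?B"
    using infinite_arbitrarily_large[OF inf] by blast
  define K where "K = ?B \<union> E"
  have K: "finite K" "card K = 4" "?B \<subseteq> K"
    using E card by (auto simp: K_def card_Un_disjnt disjnt_def Int_commute subset_eq intro!: card_Un_disjoint[THEN trans])
  obtain js where js: "distinct js" "set js = ?B" using finite_distinct_list[OF finite_Basis] by metis
  obtain b0 where b0: "b0 \<in> ?B" using nonempty_Basis by blast
  have "(LINT x|lborel. (u x) ^ 4) \<le> (81 * c ^ 4) * (LINT x|lborel. (norm (gradient u x))\<^sup>2)\<^sup>2" if u: "u \<in> C1c \<Omega>" for u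
  proof -
    note uc = C1c_D[OF u]
    obtain Ks where Ks: "compact Ks" "Ks \<subseteq> \<Omega>" "\<And>x. x \<notin> Ks \<Longrightarrow> u x = 0" "\<And>x. x \<notin> Ks \<Longrightarrow> gradient u x = 0"
      using C1c_support[OF u] by metis
    define a where "a = (\<lambda>b y. \<bar>3 * (u y)\<^sup>2 * (gradient u y \<bullet> b)\<bar>)"
    define f3 where "f3 = (\<lambda>y. \<bar>u y\<bar> ^ 3)"
    have ac: "continuous_on UNIV (a b)" for b unfolding a_def by (intro continuous_intros uc)
    have fc: "continuous_on UNIV f3" unfolding f3_def by (intro continuous_intros uc)
    have am[measurable]: "a b \<in> borel_measurable borel" for b by (rule borel_measurable_continuous_onI[OF ac])
    have fm[measurable]: "f3 \<in> borel_measurable borel" by (rule borel_measurable_continuous_onI[OF fc])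
    have um[measurable]: "u \<in> borel_measurable borel" by (rule borel_measurable_continuous_onI[OF uc(2)])
    have gm[measurable]: "gradient u \<in> borel_measurable borel" by (rule borel_measurable_continuous_onI[OF uc(3)])
    have Vm[measurable]: "(coord_vec :: (real ^ 'n \<Rightarrow> real) \<Rightarrow> real ^ 'n) \<in> borel_measurable (Pi\<^sub>M UNIV (\<lambda>_. lborel))"
      using coord_vec_measurable[of "UNIV :: (real ^ 'n) set"] by auto
    define G where "G = (\<lambda>b x. ennreal (a b (coord_vec x)))"
    have Gm: "G b \<in> borel_measurable (Pi\<^sub>M UNIV (\<lambda>_. lborel))" for b unfolding G_def by measurable
    have cube: "ennreal (f3 (coord_vec x)) \<le> partial_int b (G b) x" if "b \<in> ?B" for b x
      using cube_le_line_integral[OF u R(2) that, of x] by (simp add: f3_def G_def a_def)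
    \<comment> \<open>For a basis direction the factor is a bound for |u| that does not depend on
      that variable; a padding factor is |u| itself.\<close>
    define p where "p = (\<lambda>i x. ecbrt (if i \<in> ?B then partial_int i (G i) x else ennreal (f3 (coord_vec x))))"
    define X Y where "X = (LINT x|lborel. (u x) ^ 4)" and "Y = (LINT x|lborel. (norm (gradient u x))\<^sup>2)"
    have XY0: "0 \<le> X" "0 \<le> Y" by (auto simp: X_def Y_def)
    have iX: "integrable lborel (\<lambda>x. (u x) ^ 4)"
      by (rule compact_support_integrable[OF _ Ks(1)]) (auto intro!: continuous_intros uc simp: Ks)
    have iY: "integrable lborel (\<lambda>x. (norm (gradient u x))\<^sup>2)"
      by (rule compact_support_integrable[OF _ Ks(1)]) (auto intro!: continuous_intros uc simp: Ks)
    have nX: "(\<integral>\<^sup>+x. ennreal ((u x) ^ 4) \<partial>lborel) = ennreal X"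
      unfolding X_def by (rule nn_integral_eq_integral[OF iX]) simp
    have nY: "(\<integral>\<^sup>+x. ennreal ((norm (gradient u x))\<^sup>2) \<partial>lborel) = ennreal Y"
      unfolding Y_def by (rule nn_integral_eq_integral[OF iY]) simp
    define z where "z = (\<lambda>b. LINT x|lborel. a b x)"
    have ia: "integrable lborel (a b)" for b
      by (rule compact_support_integrable[OF ac Ks(1)]) (simp add: a_def Ks)
    have z0: "0 \<le> z b" for b unfolding z_def by (rule Bochner_Integration.integral_nonneg) (simp add: a_def)
    have nz: "(\<integral>\<^sup>+x. ennreal (a b x) \<partial>lborel) = ennreal (z b)" for b
      unfolding z_def by (rule nn_integral_eq_integral[OF ia]) (simp add: a_def)
    have z_le: "z b \<le> 3 * sqrt (X * Y)" if b: "b \<in> ?B" for b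
    proof -
      have "ennreal (z b) \<le> (\<integral>\<^sup>+x. ennreal (3 * (u x)\<^sup>2) * ennreal (norm (gradient u x)) \<partial>lborel)"
        unfolding nz[symmetric]
      proof (rule nn_integral_mono)
        fix x
        have "\<bar>gradient u x \<bullet> b\<bar> \<le> norm (gradient u x)" using Cauchy_Schwarz_ineq2[of "gradient u x" b] b by simp
        then have "a b x \<le> 3 * (u x)\<^sup>2 * norm (gradient u x)"
          unfolding a_def abs_mult by (simp add: mult_left_mono)
        then show "ennreal (a b x) \<le> ennreal (3 * (u x)\<^sup>2) * ennreal (norm (gradient u x))"
          by (simp add: ennreal_leI flip: ennreal_mult)
      qed
      then have "(ennreal (z b))\<^sup>2 \<le> (\<integral>\<^sup>+x. ennreal (3 * (u x)\<^sup>2) * ennreal (norm (gradient u x)) \<partial>lborel)\<^sup>2"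
        by (intro power_mono) auto
      also have "\<dots> \<le> (\<integral>\<^sup>+x. (ennreal (3 * (u x)\<^sup>2))\<^sup>2 \<partial>lborel) * (\<integral>\<^sup>+x. (ennreal (norm (gradient u x)))\<^sup>2 \<partial>lborel)"
        by (rule Cauchy_Schwarz_nn_integral) measurable
      also have "(\<integral>\<^sup>+x. (ennreal (3 * (u x)\<^sup>2))\<^sup>2 \<partial>lborel) = (\<integral>\<^sup>+x. ennreal 9 * ennreal ((u x) ^ 4) \<partial>lborel)"
      proof (rule nn_integral_cong)
        fix x
        have "(3 * (u x)\<^sup>2)\<^sup>2 = 9 * (u x) ^ 4" by (simp add: power_mult_distrib)
        then show "(ennreal (3 * (u x)\<^sup>2))\<^sup>2 = ennreal 9 * ennreal ((u x) ^ 4)"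
          using ennreal_mult[of 9 "(u x) ^ 4"] by (simp add: ennreal_power)
      qed
      also have "\<dots> = ennreal 9 * ennreal X" by (subst nn_integral_cmult) (auto simp: nX)
      also have "(\<integral>\<^sup>+x. (ennreal (norm (gradient u x)))\<^sup>2 \<partial>lborel) = ennreal Y"
        using nY by (simp add: ennreal_power)
      finally have "ennreal ((z b)\<^sup>2) \<le> ennreal (9 * X * Y)"
        using XY0 z0 by (simp add: ennreal_power ennreal_mult)
      then have "(z b)\<^sup>2 \<le> 9 * X * Y" using XY0 by (simp add: ennreal_le_iff)
      also have "\<dots> = (3 * sqrt (X * Y))\<^sup>2" using XY0 by (simp add: power_mult_distrib)
      finally show ?thesis by (rule power2_le_imp_le) (use XY0 in simp)
    qed
    have pm: "p i \<in> borel_measurable (Pi\<^sub>M UNIV (\<lambda>_. lborel))" for i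
      using partial_int_measurable_UNIV[OF Gm] unfolding p_def by (cases "i \<in> ?B") simp_all
    have p_indep: "p i (x(i := s)) = p i x" if "i \<in> set js" for i x s
      using that js by (simp add: p_def partial_int_def)
    have p_ge: "ennreal \<bar>u (coord_vec x)\<bar> \<le> p i x" for i x
    proof -
      have "ennreal \<bar>u (coord_vec x)\<bar> = ecbrt (ennreal (f3 (coord_vec x)))"
        by (simp add: f3_def ecbrt_of_cube flip: ennreal_power)
      also have "\<dots> \<le> p i x" unfolding p_def using cube by (intro ecbrt_mono) auto
      finally show ?thesis .
    qed
    have int_p: "iter_int (filter (\<lambda>j. j \<noteq> i) js) (\<lambda>x. p i x ^ 3) (\<lambda>_. undefined) = ennreal (z i)" if "i \<in> ?B" for i
    proof -
      have "iter_int (filter (\<lambda>j. j \<noteq> i) js) (\<lambda>x. p i x ^ 3) (\<lambda>_. undefined)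
          = iter_int (i # filter (\<lambda>j. j \<noteq> i) js) (G i) (\<lambda>_. undefined)"
        using that by (simp add: p_def ecbrt_cube)
      also have "\<dots> = ennreal (z i)"
        unfolding G_def nz[symmetric] using js that by (intro iter_int_coord_vec am) auto
      finally show ?thesis .
    qed
    \<comment> \<open>The cube of a padding factor is integrated over all variables; compared with a
      line integral, the extra integration costs the length 2 R in direction
      \<open>b0\<close>.\<close>
    have int_f3: "iter_int js (\<lambda>x. ennreal (f3 (coord_vec x))) (\<lambda>_. undefined) \<le> ennreal (2 * R * z b0)"
    proof -
      define js' where "js' = filter (\<lambda>j. j \<noteq> b0) js"
      have js': "distinct (b0 # js')" "set (b0 # js') = ?B" using js b0 by (auto simp: js'_def)
      have "iter_int js (\<lambda>x. ennreal (f3 (coord_vec x))) (\<lambda>_. undefined)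
          = iter_int (b0 # js') (\<lambda>x. ennreal (f3 (coord_vec x))) (\<lambda>_. undefined)"
        by (simp only: iter_int_coord_vec[OF fm js] iter_int_coord_vec[OF fm js'])
      also have "\<dots> \<le> iter_int js' (\<lambda>x. ennreal (2 * R) * partial_int b0 (G b0) x) (\<lambda>_. undefined)"
        unfolding iter_int.simps
      proof (rule iter_int_mono)
        fix x
        have "partial_int b0 (\<lambda>x. ennreal (f3 (coord_vec x))) x \<le> (\<integral>\<^sup>+s. partial_int b0 (G b0) x * indicator {-R..R} s \<partial>lborel)"
          unfolding partial_int_def[of b0 "\<lambda>x. ennreal (f3 (coord_vec x))"]
        proof (rule nn_integral_mono)
          fix s :: real
          show "ennreal (f3 (coord_vec (x(b0 := s)))) \<le> partial_int b0 (G b0) x * indicator {-R..R} s"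
          proof (cases "s \<in> {-R..R}")
            case True
            have "partial_int b0 (G b0) (x(b0 := s)) = partial_int b0 (G b0) x" by (simp add: partial_int_def)
            then show ?thesis using cube[OF b0, of "x(b0 := s)"] True by simp
          next
            case False
            have "\<bar>s\<bar> \<le> norm (coord_vec (x(b0 := s)))"
              using Cauchy_Schwarz_ineq2[of "coord_vec (x(b0 := s))" b0] b0 coord_vec_inner[OF b0, of "x(b0 := s)"] by simp
            then have "coord_vec (x(b0 := s)) \<notin> \<Omega>" using R(2)[of "coord_vec (x(b0 := s))"] False by auto
            then have "u (coord_vec (x(b0 := s))) = 0" using Ks by blast
            then show ?thesis by (simp add: f3_def)
          qed
        qed
        also have "\<dots> = partial_int b0 (G b0) x * emeasure lborel {-R..R}"
          by (rule nn_integral_cmult_indicator) simp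
        also have "\<dots> = ennreal (2 * R) * partial_int b0 (G b0) x"
          using R(1) by (simp add: mult.commute)
        finally show "partial_int b0 (\<lambda>x. ennreal (f3 (coord_vec x))) x \<le> ennreal (2 * R) * partial_int b0 (G b0) x" .
      qed
      also have "\<dots> = ennreal (2 * R) * iter_int (b0 # js') (G b0) (\<lambda>_. undefined)"
        by (simp add: iter_int_cmult partial_int_measurable_UNIV Gm)
      also have "iter_int (b0 # js') (G b0) (\<lambda>_. undefined) = ennreal (z b0)"
        unfolding G_def nz[symmetric] by (rule iter_int_coord_vec[OF am js'])
      finally show ?thesis using R(1) z0 by (simp add: ennreal_mult)
    qed
    define W where "W = c * (3 * sqrt (X * Y))"
    have W0: "0 \<le> W" unfolding W_def using c XY0 by simp
    have factor: "iter_int (filter (\<lambda>j. j \<noteq> i) js) (\<lambda>x. p i x ^ 3) (\<lambda>_. undefined) \<le> ennreal W" for i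
    proof (cases "i \<in> ?B")
      case True
      have "z i \<le> 1 * (3 * sqrt (X * Y))" using z_le[OF True] by simp
      also have "\<dots> \<le> W" unfolding W_def using c XY0 by (intro mult_right_mono) auto
      finally show ?thesis unfolding int_p[OF True] by (rule ennreal_leI)
    next
      case False
      have "filter (\<lambda>j. j \<noteq> i) js = js" using False js by (auto simp: filter_id_conv)
      then have "iter_int (filter (\<lambda>j. j \<noteq> i) js) (\<lambda>x. p i x ^ 3) (\<lambda>_. undefined) \<le> ennreal (2 * R * z b0)"
        using int_f3 False by (simp add: p_def ecbrt_cube)
      also have "\<dots> \<le> ennreal W"
        unfolding W_def using z_le[OF b0] c z0[of b0] by (intro ennreal_leI mult_mono) auto
      finally show ?thesis .
    qed
    have "ennreal X = iter_int js (\<lambda>x. ennreal ((u (coord_vec x)) ^ 4)) (\<lambda>_. undefined)"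
      unfolding nX[symmetric] using js by (intro iter_int_coord_vec[symmetric]) measurable
    also have "\<dots> \<le> iter_int js (\<lambda>x. \<Prod>i\<in>K. p i x) (\<lambda>_. undefined)"
    proof (rule iter_int_mono)
      fix x
      have "ennreal ((u (coord_vec x)) ^ 4) = (\<Prod>i\<in>K. ennreal \<bar>u (coord_vec x)\<bar>)"
        using K by (simp add: ennreal_power)
      also have "\<dots> \<le> (\<Prod>i\<in>K. p i x)" by (intro prod_mono_ennreal p_ge)
      finally show "ennreal ((u (coord_vec x)) ^ 4) \<le> (\<Prod>i\<in>K. p i x)" .
    qed
    finally have "(ennreal X) ^ 3 \<le> (iter_int js (\<lambda>x. \<Prod>i\<in>K. p i x) (\<lambda>_. undefined)) ^ 3"
      by (intro power_mono) auto
    also have "\<dots> \<le> (\<Prod>i\<in>K. iter_int (filter (\<lambda>j. j \<noteq> i) js) (\<lambda>x. p i x ^ 3) (\<lambda>_. undefined))"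
      using K js by (intro Loomis_Whitney_four pm p_indep) auto
    also have "\<dots> \<le> (\<Prod>i\<in>K. ennreal W)" by (intro prod_mono_ennreal factor)
    also have "\<dots> = ennreal (W ^ 4)" using K W0 by (simp add: ennreal_power)
    finally have "ennreal (X ^ 3) \<le> ennreal (W ^ 4)" using XY0 by (simp add: ennreal_power)
    then have "X ^ 3 \<le> W ^ 4" using W0 by (simp add: ennreal_le_iff)
    also have "W ^ 4 = 81 * c ^ 4 * (X\<^sup>2 * Y\<^sup>2)"
    proof -
      have "sqrt (X * Y) ^ 4 = ((sqrt (X * Y))\<^sup>2)\<^sup>2" by simp
      also have "\<dots> = X\<^sup>2 * Y\<^sup>2" using XY0 by (simp add: power_mult_distrib)
      finally show ?thesis by (simp add: W_def power_mult_distrib)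
    qed
    finally have le: "X\<^sup>2 * X \<le> X\<^sup>2 * (81 * c ^ 4 * Y\<^sup>2)" by (simp add: power3_eq_cube power2_eq_square mult_ac)
    \<comment> \<open>X is a finite real as u has compact support, so X^2 can be cancelled. The 81
      is 3^4, the 3 stemming from the derivative of u^3.\<close>
    have "X \<le> 81 * c ^ 4 * Y\<^sup>2"
    proof (cases "X = 0")
      case False
      then have "0 < X\<^sup>2" by simp
      then show ?thesis using le by (simp only: mult_le_cancel_left_pos)
    qed (use c in simp)
    then show ?thesis by (simp add: X_def Y_def)
  qed
  then show ?thesis by (intro that[of "81 * c ^ 4"]) (use c in auto)
qed

lemma tendsto_zero_squeeze:
  fixes a b :: "nat \<Rightarrow> real"
  assumes "b \<longlonglongrightarrow> 0" "\<And>n. 0 \<le> a n" "\<And>n. a n \<le> b n"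
  shows "a \<longlonglongrightarrow> 0"
  by (rule tendsto_sandwich[OF _ _ tendsto_const assms(1)]) (simp_all add: assms)

subsection \<open>Functions with weak gradient approximable by \<open>C\<^sup>1\<^sub>c\<close>\<close>

text \<open>Membership of (u, g) in the L^2 closure of the graph of the gradient on
  \<open>C1c\<close>, that is, u in H^1_0 with gradient g. The gradient is carried along because
  \<open>weak_gradient\<close> is merely some representative.\<close>

definition sob_pair :: "(real ^ 'n) set \<Rightarrow> (real ^ 'n \<Rightarrow> real) \<Rightarrow> (real ^ 'n \<Rightarrow> real ^ 'n) \<Rightarrow> bool" where
  "sob_pair \<Omega> u g \<longleftrightarrow> u \<in> L2 \<Omega> \<and> (\<forall>i. (\<lambda>x. g x $ i) \<in> L2 \<Omega>) \<and>
     (\<forall>e>0. \<exists>\<psi>\<in>C1c \<Omega>. L2_norm \<Omega> (\<lambda>x. \<psi> x - u x) < e \<and>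
        (\<forall>i. L2_norm \<Omega> (\<lambda>x. gradient \<psi> x $ i - g x $ i) < e))"

definition grad_norm :: "(real ^ 'n) set \<Rightarrow> (real ^ 'n \<Rightarrow> real ^ 'n) \<Rightarrow> real" where
  "grad_norm \<Omega> g = sqrt (\<Sum>i\<in>UNIV. (L2_norm \<Omega> (\<lambda>x. g x $ i))\<^sup>2)"

lemma grad_norm_nonneg: "0 \<le> grad_norm \<Omega> g"
  by (simp add: grad_norm_def sum_nonneg)

lemma grad_norm_power2: "(grad_norm \<Omega> g)\<^sup>2 = (\<Sum>i\<in>UNIV. (L2_norm \<Omega> (\<lambda>x. g x $ i))\<^sup>2)"
  by (simp add: grad_norm_def sum_nonneg)

lemma L2_norm_le_grad_norm: "L2_norm \<Omega> (\<lambda>x. g x $ i) \<le> grad_norm \<Omega> g"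
proof (rule power2_le_imp_le)
  show "(L2_norm \<Omega> (\<lambda>x. g x $ i))\<^sup>2 \<le> (grad_norm \<Omega> g)\<^sup>2"
    unfolding grad_norm_power2 by (rule member_le_sum) auto
qed (rule grad_norm_nonneg)

lemma sob_pairD:
  assumes "sob_pair \<Omega> u g"
  shows "u \<in> L2 \<Omega>" "(\<lambda>x. g x $ i) \<in> L2 \<Omega>"
  using assms by (auto simp: sob_pair_def)

lemma sob_pair_sequence:
  assumes "sob_pair \<Omega> u g"
  obtains \<psi> where "\<And>n. \<psi> n \<in> C1c \<Omega>" "(\<lambda>n. L2_norm \<Omega> (\<lambda>x. \<psi> n x - u x)) \<longlonglongrightarrow> 0"
    "\<And>i. (\<lambda>n. L2_norm \<Omega> (\<lambda>x. gradient (\<psi> n) x $ i - g x $ i)) \<longlonglongrightarrow> 0"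
proof -
  have "\<exists>\<psi>. \<psi> \<in> C1c \<Omega> \<and> L2_norm \<Omega> (\<lambda>x. \<psi> x - u x) < inverse (real (Suc n)) \<and>
      (\<forall>i. L2_norm \<Omega> (\<lambda>x. gradient \<psi> x $ i - g x $ i) < inverse (real (Suc n)))" for n
  proof -
    have "0 < inverse (real (Suc n))" by simp
    with assms show ?thesis unfolding sob_pair_def by blast
  qed
  then have "\<exists>\<psi>. \<forall>n. \<psi> n \<in> C1c \<Omega> \<and> L2_norm \<Omega> (\<lambda>x. \<psi> n x - u x) < inverse (real (Suc n)) \<and>
      (\<forall>i. L2_norm \<Omega> (\<lambda>x. gradient (\<psi> n) x $ i - g x $ i) < inverse (real (Suc n)))"
    by (intro choice allI)
  then obtain \<psi> where \<psi>: "\<And>n. \<psi> n \<in> C1c \<Omega>" "\<And>n. L2_norm \<Omega> (\<lambda>x. \<psi> n x - u x) < inverse (real (Suc n))"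
    "\<And>n i. L2_norm \<Omega> (\<lambda>x. gradient (\<psi> n) x $ i - g x $ i) < inverse (real (Suc n))"
    by blast
  have "(\<lambda>n. L2_norm \<Omega> (\<lambda>x. \<psi> n x - u x)) \<longlonglongrightarrow> 0"
    by (rule tendsto_zero_squeeze[OF LIMSEQ_inverse_real_of_nat L2_norm_nonneg less_imp_le[OF \<psi>(2)]])
  moreover have "(\<lambda>n. L2_norm \<Omega> (\<lambda>x. gradient (\<psi> n) x $ i - g x $ i)) \<longlonglongrightarrow> 0" for i
    by (rule tendsto_zero_squeeze[OF LIMSEQ_inverse_real_of_nat L2_norm_nonneg less_imp_le[OF \<psi>(3)]])
  ultimately show ?thesis using that \<psi>(1) by blast
qed

text \<open>Closedness of the graph closure: a member of the sequence within e/2 of the limit is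
  itself approximated within e/2.\<close>

lemma sob_pairI_sequence:
  fixes u :: "real ^ 'n \<Rightarrow> real"
  assumes u: "u \<in> L2 \<Omega>" "\<And>i. (\<lambda>x. g x $ i) \<in> L2 \<Omega>"
    and \<psi>: "\<And>n. sob_pair \<Omega> (f n) (h n)" "(\<lambda>n. L2_norm \<Omega> (\<lambda>x. f n x - u x)) \<longlonglongrightarrow> 0"
    "\<And>i. (\<lambda>n. L2_norm \<Omega> (\<lambda>x. h n x $ i - g x $ i)) \<longlonglongrightarrow> 0"
    and \<Omega>: "\<Omega> \<in> sets lebesgue"
  shows "sob_pair \<Omega> u g"
  unfolding sob_pair_def
proof (intro conjI allI impI u)
  fix e :: real assume e: "0 < e"
  have "\<forall>\<^sub>F n in sequentially. L2_norm \<Omega> (\<lambda>x. f n x - u x) < e / 2"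
    using order_tendstoD(2)[OF \<psi>(2), of "e / 2"] e by simp
  moreover have "\<forall>\<^sub>F n in sequentially. \<forall>i. L2_norm \<Omega> (\<lambda>x. h n x $ i - g x $ i) < e / 2"
    using order_tendstoD(2)[OF \<psi>(3), of "e / 2"] e by (intro eventually_all_finite) simp
  ultimately have "\<forall>\<^sub>F n in sequentially. L2_norm \<Omega> (\<lambda>x. f n x - u x) < e / 2 \<and> (\<forall>i. L2_norm \<Omega> (\<lambda>x. h n x $ i - g x $ i) < e / 2)"
    by (rule eventually_conj)
  then obtain n where n: "L2_norm \<Omega> (\<lambda>x. f n x - u x) < e / 2" "\<And>i. L2_norm \<Omega> (\<lambda>x. h n x $ i - g x $ i) < e / 2"
    by (auto simp: eventually_sequentially)
  obtain \<phi> where \<phi>: "\<phi> \<in> C1c \<Omega>" "L2_norm \<Omega> (\<lambda>x. \<phi> x - f n x) < e / 2"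
    "\<And>i. L2_norm \<Omega> (\<lambda>x. gradient \<phi> x $ i - h n x $ i) < e / 2"
    using \<psi>(1)[of n] half_gt_zero[OF e] unfolding sob_pair_def by blast
  show "\<exists>\<psi>\<in>C1c \<Omega>. L2_norm \<Omega> (\<lambda>x. \<psi> x - u x) < e \<and> (\<forall>i. L2_norm \<Omega> (\<lambda>x. gradient \<psi> x $ i - g x $ i) < e)"
  proof (intro bexI[OF _ \<phi>(1)] conjI allI)
    show "L2_norm \<Omega> (\<lambda>x. \<phi> x - u x) < e"
      using L2_norm_triangle_diff[OF C1c_L2(1)[OF \<Omega> \<phi>(1)] sob_pairD(1)[OF \<psi>(1)[of n]] u(1)] n(1) \<phi>(2) by linarith
    fix i
    show "L2_norm \<Omega> (\<lambda>x. gradient \<phi> x $ i - g x $ i) < e"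
      using L2_norm_triangle_diff[OF C1c_L2(2)[OF \<Omega> \<phi>(1), of i] sob_pairD(2)[OF \<psi>(1)[of n], of i] u(2)[of i]] n(2)[of i] \<phi>(3)[of i] by linarith
  qed
qed

lemma L2_norm_zero: "L2_norm \<Omega> (\<lambda>x. 0) = 0"
  by (simp add: L2_norm_def L2_inner_def)

lemma sob_pair_C1c: "\<Omega> \<in> sets lebesgue \<Longrightarrow> \<psi> \<in> C1c \<Omega> \<Longrightarrow> sob_pair \<Omega> \<psi> (gradient \<psi>)"
  unfolding sob_pair_def by (intro conjI allI impI C1c_L2 bexI[of _ \<psi>]) (simp_all add: L2_norm_zero)

lemma sob_pair_lincomb2:
  assumes \<Omega>: "\<Omega> \<in> sets lebesgue" and u: "sob_pair \<Omega> u g" and v: "sob_pair \<Omega> v h"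
  shows "sob_pair \<Omega> (\<lambda>x. a * u x + b * v x) (\<lambda>x. a *\<^sub>R g x + b *\<^sub>R h x)"
proof -
  obtain f where f: "\<And>n. f n \<in> C1c \<Omega>" "(\<lambda>n. L2_norm \<Omega> (\<lambda>x. f n x - u x)) \<longlonglongrightarrow> 0"
    "\<And>i. (\<lambda>n. L2_norm \<Omega> (\<lambda>x. gradient (f n) x $ i - g x $ i)) \<longlonglongrightarrow> 0" using sob_pair_sequence[OF u] by blast
  obtain k where k: "\<And>n. k n \<in> C1c \<Omega>" "(\<lambda>n. L2_norm \<Omega> (\<lambda>x. k n x - v x)) \<longlonglongrightarrow> 0"
    "\<And>i. (\<lambda>n. L2_norm \<Omega> (\<lambda>x. gradient (k n) x $ i - h x $ i)) \<longlonglongrightarrow> 0" using sob_pair_sequence[OF v] by blast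
  have key: "(\<lambda>n. L2_norm \<Omega> (\<lambda>x. (a * p n x + b * q n x) - (a * r x + b * s x))) \<longlonglongrightarrow> 0"
    if "\<And>n. p n \<in> L2 \<Omega>" "\<And>n. q n \<in> L2 \<Omega>" "r \<in> L2 \<Omega>" "s \<in> L2 \<Omega>"
      "(\<lambda>n. L2_norm \<Omega> (\<lambda>x. p n x - r x)) \<longlonglongrightarrow> 0" "(\<lambda>n. L2_norm \<Omega> (\<lambda>x. q n x - s x)) \<longlonglongrightarrow> 0" for p q r s
  proof (rule tendsto_sandwich[OF _ _ tendsto_const])
    have "(\<lambda>n. \<bar>a\<bar> * L2_norm \<Omega> (\<lambda>x. p n x - r x) + \<bar>b\<bar> * L2_norm \<Omega> (\<lambda>x. q n x - s x)) \<longlonglongrightarrow> \<bar>a\<bar> * 0 + \<bar>b\<bar> * 0"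
      by (intro tendsto_intros that)
    then show "(\<lambda>n. \<bar>a\<bar> * L2_norm \<Omega> (\<lambda>x. p n x - r x) + \<bar>b\<bar> * L2_norm \<Omega> (\<lambda>x. q n x - s x)) \<longlonglongrightarrow> 0" by simp
    show "\<forall>\<^sub>F n in sequentially. L2_norm \<Omega> (\<lambda>x. (a * p n x + b * q n x) - (a * r x + b * s x))
       \<le> \<bar>a\<bar> * L2_norm \<Omega> (\<lambda>x. p n x - r x) + \<bar>b\<bar> * L2_norm \<Omega> (\<lambda>x. q n x - s x)"
    proof (rule always_eventually, rule allI)
      fix n
      have "(\<lambda>x. (a * p n x + b * q n x) - (a * r x + b * s x)) = (\<lambda>x. a * (p n x - r x) + b * (q n x - s x))"
        by (simp add: fun_eq_iff algebra_simps)
      then show "L2_norm \<Omega> (\<lambda>x. (a * p n x + b * q n x) - (a * r x + b * s x))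
         \<le> \<bar>a\<bar> * L2_norm \<Omega> (\<lambda>x. p n x - r x) + \<bar>b\<bar> * L2_norm \<Omega> (\<lambda>x. q n x - s x)"
        using L2_norm_triangle[OF L2_scale[OF L2_diff[OF that(1)[of n] that(3)], of a] L2_scale[OF L2_diff[OF that(2)[of n] that(4)], of b]]
        by (simp add: L2_norm_scale)
    qed
  qed (simp add: L2_norm_nonneg)
  note L = C1c_L2[OF \<Omega>]
  have grad: "gradient (\<lambda>x. a * f n x + b * k n x) = (\<lambda>x. a *\<^sub>R gradient (f n) x + b *\<^sub>R gradient (k n) x)" for n
  proof
    fix x
    have "(\<lambda>x. a * f n x) differentiable (at x)" "(\<lambda>x. b * k n x) differentiable (at x)"
      using C1c_D(1)[OF C1c_cmult[OF f(1)[of n]]] C1c_D(1)[OF C1c_cmult[OF k(1)[of n]]] by auto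
    then show "gradient (\<lambda>x. a * f n x + b * k n x) x = a *\<^sub>R gradient (f n) x + b *\<^sub>R gradient (k n) x"
      by (simp add: gradient_add gradient_cmult C1c_D(1)[OF f(1)] C1c_D(1)[OF k(1)])
  qed
  show ?thesis
  proof (rule sob_pairI_sequence[OF _ _ sob_pair_C1c[OF \<Omega>] _ _ \<Omega>])
    show "(\<lambda>x. a * u x + b * v x) \<in> L2 \<Omega>" by (intro L2_add L2_scale sob_pairD(1)[OF u] sob_pairD(1)[OF v])
    show "(\<lambda>x. (a *\<^sub>R g x + b *\<^sub>R h x) $ i) \<in> L2 \<Omega>" for i
      using L2_add[OF L2_scale[OF sob_pairD(2)[OF u, of i], of a] L2_scale[OF sob_pairD(2)[OF v, of i], of b]] by simp
    show "(\<lambda>x. a * f n x + b * k n x) \<in> C1c \<Omega>" for n by (intro C1c_add C1c_cmult f k)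
    show "(\<lambda>n. L2_norm \<Omega> (\<lambda>x. (a * f n x + b * k n x) - (a * u x + b * v x))) \<longlonglongrightarrow> 0"
      by (rule key[OF L(1)[OF f(1)] L(1)[OF k(1)] sob_pairD(1)[OF u] sob_pairD(1)[OF v] f(2) k(2)])
    show "(\<lambda>n. L2_norm \<Omega> (\<lambda>x. gradient (\<lambda>x. a * f n x + b * k n x) x $ i - (a *\<^sub>R g x + b *\<^sub>R h x) $ i)) \<longlonglongrightarrow> 0" for i
      using key[OF L(2)[OF f(1)] L(2)[OF k(1)] sob_pairD(2)[OF u] sob_pairD(2)[OF v] f(3) k(3), of i]
      by (simp add: grad)
  qed
qed

lemma sob_pair_lincomb:
  assumes \<Omega>: "\<Omega> \<in> sets lebesgue" and u: "\<And>k. sob_pair \<Omega> (f k) (g k)" and A: "finite A"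
  shows "sob_pair \<Omega> (\<lambda>x. \<Sum>k\<in>A. c k * f k x) (\<lambda>x. \<Sum>k\<in>A. c k *\<^sub>R g k x)"
  using A
proof (induction A rule: finite_induct)
  case empty
  have "gradient (\<lambda>x. 0) = (\<lambda>x. 0 :: real ^ 'a)" by (simp add: fun_eq_iff gradient_const)
  then show ?case using sob_pair_C1c[OF \<Omega> C1c_zero] by simp
next
  case (insert a A)
  then show ?case using sob_pair_lincomb2[OF \<Omega> u[of a] insert.IH, of "c a" 1] by simp
qed

lemma sob_pair_diff:
  assumes "\<Omega> \<in> sets lebesgue" "sob_pair \<Omega> u g" "sob_pair \<Omega> v h"
  shows "sob_pair \<Omega> (\<lambda>x. u x - v x) (\<lambda>x. g x - h x)"
  using sob_pair_lincomb2[OF assms, of 1 "-1"] by simp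

lemma sob_pair_add:
  assumes "\<Omega> \<in> sets lebesgue" "sob_pair \<Omega> u g" "sob_pair \<Omega> v h"
  shows "sob_pair \<Omega> (\<lambda>x. u x + v x) (\<lambda>x. g x + h x)"
  using sob_pair_lincomb2[OF assms, of 1 1] by simp

subsection \<open>Weak gradients\<close>

lemma integrable_vec:
  fixes g :: "'a \<Rightarrow> real ^ 'n"
  assumes "\<And>i. integrable M (\<lambda>x. g x $ i)"
  shows "integrable M g"
proof -
  have "integrable M (\<lambda>x. \<Sum>i\<in>UNIV. g x $ i *\<^sub>R axis i (1::real))"
    by (intro Bochner_Integration.integrable_sum integrable_scaleR_left assms)
  moreover have "(\<lambda>x. \<Sum>i\<in>UNIV. g x $ i *\<^sub>R axis i (1::real)) = g"
    by (simp add: fun_eq_iff basis_expansion scalar_mult_eq_scaleR[symmetric])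
  ultimately show ?thesis by simp
qed

lemma integral_vec_component:
  fixes g :: "'a \<Rightarrow> real ^ 'n"
  assumes "integrable M g"
  shows "(LINT x|M. g x) $ i = (LINT x|M. g x $ i)"
  by (rule integral_bounded_linear[OF bounded_linear_vec_nth assms, symmetric])

lemma integrable_imp_absolutely_integrable_on:
  fixes f :: "real ^ 'n \<Rightarrow> 'b :: {banach, second_countable_topology}"
  assumes \<Omega>: "\<Omega> \<in> sets lebesgue" and f: "integrable (lebesgue_on \<Omega>) f" and K: "compact K" "K \<subseteq> \<Omega>"
  shows "set_integrable lebesgue K f"
proof -
  have "set_integrable lebesgue \<Omega> f"
    using f \<Omega> by (simp add: set_integrable_def integrable_restrict_space)
  then show ?thesis
    by (rule set_integrable_subset) (use K in \<open>auto intro!: borel_compact\<close>)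
qed

text \<open>For L^2 data on a bounded domain the local integrability in the definition is automatic,
  and the vector identity splits into components.\<close>

lemma has_weak_gradient_iff:
  fixes \<Omega> :: "(real ^ 'n) set"
  assumes \<Omega>: "bounded_domain \<Omega>" and w: "w \<in> L2 \<Omega>" and g: "\<And>i. (\<lambda>x. g x $ i) \<in> L2 \<Omega>"
  shows "has_weak_gradient \<Omega> w g \<longleftrightarrow>
    (\<forall>\<psi>\<in>test_functions \<Omega>. \<forall>i. L2_inner \<Omega> w (\<lambda>x. gradient \<psi> x $ i) = - L2_inner \<Omega> \<psi> (\<lambda>x. g x $ i))"
proof -
  note \<Omega>s = bounded_domain_sets[OF \<Omega>]
  have loc: "w absolutely_integrable_on K \<and> g absolutely_integrable_on K" if "compact K \<and> K \<subseteq> \<Omega>" for K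
    using that integrable_imp_absolutely_integrable_on[OF \<Omega>s L2_integrable[OF \<Omega> w], of K]
      integrable_imp_absolutely_integrable_on[OF \<Omega>s integrable_vec[OF L2_integrable[OF \<Omega> g]], of K] by simp
  have "(LINT x|lebesgue_on \<Omega>. w x *\<^sub>R gradient \<psi> x) = - (LINT x|lebesgue_on \<Omega>. \<psi> x *\<^sub>R g x)
      \<longleftrightarrow> (\<forall>i. L2_inner \<Omega> w (\<lambda>x. gradient \<psi> x $ i) = - L2_inner \<Omega> \<psi> (\<lambda>x. g x $ i))"
    if "\<psi> \<in> test_functions \<Omega>" for \<psi>
  proof -
    note \<psi> = C1c_L2[OF \<Omega>s test_functions_C1c[OF that]]
    have 1: "integrable (lebesgue_on \<Omega>) (\<lambda>x. w x *\<^sub>R gradient \<psi> x)"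
      by (rule integrable_vec) (simp add: L2_mult_integrable w \<psi>)
    have 2: "integrable (lebesgue_on \<Omega>) (\<lambda>x. \<psi> x *\<^sub>R g x)"
      by (rule integrable_vec) (simp add: L2_mult_integrable g \<psi>)
    show ?thesis
      by (simp add: vec_eq_iff integral_vec_component[OF 1] integral_vec_component[OF 2] L2_inner_def)
  qed
  then show ?thesis unfolding has_weak_gradient_def using loc by blast
qed

text \<open>Integration by parts holds for the approximants, and both sides are continuous in the
  L^2 norm.\<close>

lemma sob_pair_weak_gradient:
  assumes \<Omega>: "bounded_domain \<Omega>" and u: "sob_pair \<Omega> u g"
  shows "has_weak_gradient \<Omega> u g"
proof (subst has_weak_gradient_iff[OF \<Omega> sob_pairD[OF u]], intro ballI allI)
  note \<Omega>s = bounded_domain_sets[OF \<Omega>]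
  fix \<xi> i assume "\<xi> \<in> test_functions \<Omega>"
  then have \<xi>: "\<xi> \<in> C1c \<Omega>" by (rule test_functions_C1c)
  obtain f where f: "\<And>n. f n \<in> C1c \<Omega>" "(\<lambda>n. L2_norm \<Omega> (\<lambda>x. f n x - u x)) \<longlonglongrightarrow> 0"
    "\<And>i. (\<lambda>n. L2_norm \<Omega> (\<lambda>x. gradient (f n) x $ i - g x $ i)) \<longlonglongrightarrow> 0" using sob_pair_sequence[OF u] by blast
  note L = C1c_L2[OF \<Omega>s]
  have c0: "(\<lambda>n::nat. L2_norm \<Omega> (\<lambda>x. h x - h x)) \<longlonglongrightarrow> 0" for h by (simp add: L2_norm_zero)
  have "(\<lambda>n. L2_inner \<Omega> (f n) (\<lambda>x. gradient \<xi> x $ i)) \<longlonglongrightarrow> L2_inner \<Omega> u (\<lambda>x. gradient \<xi> x $ i)"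
    by (rule L2_inner_tendsto[OF L(1)[OF f(1)] sob_pairD(1)[OF u] f(2) L(2)[OF \<xi>] L(2)[OF \<xi>] c0])
  moreover have "(\<lambda>n. - L2_inner \<Omega> (\<lambda>x. gradient (f n) x $ i) \<xi>) \<longlonglongrightarrow> - L2_inner \<Omega> (\<lambda>x. g x $ i) \<xi>"
    by (intro tendsto_minus L2_inner_tendsto[OF L(2)[OF f(1)] sob_pairD(2)[OF u] f(3) L(1)[OF \<xi>] L(1)[OF \<xi>] c0])
  ultimately show "L2_inner \<Omega> u (\<lambda>x. gradient \<xi> x $ i) = - L2_inner \<Omega> \<xi> (\<lambda>x. g x $ i)"
    using LIMSEQ_unique by (simp add: integration_by_parts[OF \<Omega>s f(1) \<xi>] L2_inner_commute[of \<Omega> \<xi>])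
qed

text \<open>Both gradients have the same integral against every test function; the fundamental lemma
  is applied to each component of their difference.\<close>

lemma weak_gradient_unique:
  fixes \<Omega> :: "(real ^ 'n) set"
  assumes \<Omega>: "open \<Omega>" and g: "has_weak_gradient \<Omega> w g" and h: "has_weak_gradient \<Omega> w h"
  shows "AE x in lebesgue_on \<Omega>. g x = h x"
proof -
  have \<Omega>s: "\<Omega> \<in> sets lebesgue" using \<Omega> by simp
  have comp: "(\<lambda>x. k x $ i) absolutely_integrable_on K"
    if "has_weak_gradient \<Omega> w k" "compact K" "K \<subseteq> \<Omega>" for k i K
  proof -
    have "k absolutely_integrable_on K" using that by (auto simp: has_weak_gradient_def)
    from integrable_bounded_linear[OF bounded_linear_vec_nth this[unfolded set_integrable_def], of i]
    show ?thesis by (simp add: set_integrable_def)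
  qed
  \<comment> \<open>Weak gradients are only locally integrable, so integrability of the product
    rests on the compact support of the test function.\<close>
  have prod: "integrable (lebesgue_on \<Omega>) (\<lambda>x. \<psi> x *\<^sub>R k x)"
    if k: "has_weak_gradient \<Omega> w k" and \<psi>: "\<psi> \<in> test_functions \<Omega>" for k \<psi>
  proof (rule integrable_vec)
    fix i
    note \<psi>1 = test_functions_C1c[OF \<psi>]
    obtain K where K: "compact K" "K \<subseteq> \<Omega>" "\<And>x. x \<notin> K \<Longrightarrow> \<psi> x = 0" using C1c_support[OF \<psi>1] by metis
    have "compact (\<psi> ` K)" by (intro compact_continuous_image continuous_on_subset[OF C1c_D(2)[OF \<psi>1]] K) auto
    then obtain M where M: "\<And>x. x \<in> K \<Longrightarrow> \<bar>\<psi> x\<bar> \<le> M"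
      using compact_imp_bounded by (fastforce simp: bounded_iff)
    have ik: "integrable lebesgue (\<lambda>x. indicator K x * k x $ i)"
      using comp[OF k K(1,2), of i] by (simp add: set_integrable_def)
    have \<psi>m: "\<psi> \<in> borel_measurable lebesgue"
      using C1c_D(2)[OF \<psi>1] by (intro measurable_completion) (simp add: borel_measurable_continuous_onI)
    have "integrable lebesgue (\<lambda>x. \<psi> x * (indicator K x * k x $ i))"
    proof (rule Bochner_Integration.integrable_bound[OF integrable_mult_right[OF ik, of M]])
      show "(\<lambda>x. \<psi> x * (indicator K x * k x $ i)) \<in> borel_measurable lebesgue"
        by (intro borel_measurable_times \<psi>m borel_measurable_integrable[OF ik])
      show "AE x in lebesgue. norm (\<psi> x * (indicator K x * k x $ i)) \<le> norm (M * (indicator K x * k x $ i))"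
      proof (rule AE_I2)
        fix x
        show "norm (\<psi> x * (indicator K x * k x $ i)) \<le> norm (M * (indicator K x * k x $ i))"
        proof (cases "x \<in> K")
          case True
          then have "\<bar>\<psi> x\<bar> \<le> \<bar>M\<bar>" using M[OF True] by linarith
          then show ?thesis by (simp add: abs_mult mult_right_mono)
        qed simp
      qed
    qed
    moreover have "(\<lambda>x. \<psi> x * (indicator K x * k x $ i)) = (\<lambda>x. indicator \<Omega> x *\<^sub>R (\<psi> x * k x $ i))"
      using K by (auto simp: fun_eq_iff indicator_def)
    ultimately show "integrable (lebesgue_on \<Omega>) (\<lambda>x. (\<psi> x *\<^sub>R k x) $ i)"
      using \<Omega>s by (simp add: integrable_restrict_space)
  qed
  have "AE x in lebesgue_on \<Omega>. g x $ i - h x $ i = 0" for i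
  proof (rule fundamental_lemma[OF \<Omega>])
    fix K assume "compact K" "K \<subseteq> \<Omega>"
    then show "(\<lambda>x. g x $ i - h x $ i) absolutely_integrable_on K"
      by (intro set_integral_diff(1) comp g h)
  next
    fix \<psi> assume \<psi>: "\<psi> \<in> test_functions \<Omega>"
    have "(LINT x|lebesgue_on \<Omega>. \<psi> x *\<^sub>R g x) = (LINT x|lebesgue_on \<Omega>. \<psi> x *\<^sub>R h x)"
    proof -
      have "(LINT x|lebesgue_on \<Omega>. w x *\<^sub>R gradient \<psi> x) = - (LINT x|lebesgue_on \<Omega>. \<psi> x *\<^sub>R g x)"
        "(LINT x|lebesgue_on \<Omega>. w x *\<^sub>R gradient \<psi> x) = - (LINT x|lebesgue_on \<Omega>. \<psi> x *\<^sub>R h x)"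
        using g h \<psi> unfolding has_weak_gradient_def by blast+
      then show ?thesis by simp
    qed
    then have "(LINT x|lebesgue_on \<Omega>. (\<psi> x *\<^sub>R g x) $ i) = (LINT x|lebesgue_on \<Omega>. (\<psi> x *\<^sub>R h x) $ i)"
      using integral_vec_component[OF prod[OF g \<psi>], of i] integral_vec_component[OF prod[OF h \<psi>], of i] by simp
    moreover have "integrable (lebesgue_on \<Omega>) (\<lambda>x. (\<psi> x *\<^sub>R k x) $ i)" if "has_weak_gradient \<Omega> w k" for k
      by (rule integrable_bounded_linear[OF bounded_linear_vec_nth prod[OF that \<psi>]])
    from this[OF g] this[OF h] have "integrable (lebesgue_on \<Omega>) (\<lambda>x. \<psi> x * g x $ i)" "integrable (lebesgue_on \<Omega>) (\<lambda>x. \<psi> x * h x $ i)" by simp_all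
    ultimately show "(LINT x|lebesgue_on \<Omega>. \<psi> x * (g x $ i - h x $ i)) = 0"
      by (simp add: right_diff_distrib)
  qed
  then have "AE x in lebesgue_on \<Omega>. \<forall>i. g x $ i - h x $ i = 0"
    by (simp add: AE_all_countable)
  then show ?thesis by eventually_elim (simp add: vec_eq_iff)
qed

lemma weak_gradient_AE:
  assumes \<Omega>: "open \<Omega>" and g: "has_weak_gradient \<Omega> w g"
  shows "has_weak_gradient \<Omega> w (weak_gradient \<Omega> w)" "AE x in lebesgue_on \<Omega>. weak_gradient \<Omega> w x = g x"
proof -
  show 1: "has_weak_gradient \<Omega> w (weak_gradient \<Omega> w)"
    unfolding weak_gradient_def using g by (rule someI[where P="has_weak_gradient \<Omega> w"])
  show "AE x in lebesgue_on \<Omega>. weak_gradient \<Omega> w x = g x"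
    by (rule weak_gradient_unique[OF \<Omega> 1 g])
qed

lemma weak_gradient_L2:
  assumes \<Omega>: "bounded_domain \<Omega>" and g: "has_weak_gradient \<Omega> w g" "\<And>i. (\<lambda>x. g x $ i) \<in> L2 \<Omega>"
  shows "(\<lambda>x. weak_gradient \<Omega> w x $ i) \<in> L2 \<Omega>"
proof (rule L2_cong_AE[OF bounded_domain_sets[OF \<Omega>] g(2)])
  have "open \<Omega>" using \<Omega> by (simp add: bounded_domain_def)
  from weak_gradient_AE(2)[OF this g(1)] show "AE x in lebesgue_on \<Omega>. g x $ i = weak_gradient \<Omega> w x $ i"
    by eventually_elim simp
qed

lemma L2_norm_le_H1_norm:
  assumes w: "w \<in> L2 \<Omega>" and g: "\<And>i. (\<lambda>x. weak_gradient \<Omega> w x $ i) \<in> L2 \<Omega>"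
  shows "L2_norm \<Omega> w \<le> H1_norm \<Omega> w" "L2_norm \<Omega> (\<lambda>x. weak_gradient \<Omega> w x $ i) \<le> H1_norm \<Omega> w"
proof -
  have "(LINT x|lebesgue_on \<Omega>. (norm (weak_gradient \<Omega> w x))\<^sup>2) = (\<Sum>i\<in>UNIV. LINT x|lebesgue_on \<Omega>. (weak_gradient \<Omega> w x $ i)\<^sup>2)"
    using L2_square_integrable[OF g]
    by (simp add: power2_norm_eq_inner inner_vec_def Bochner_Integration.integral_sum flip: power2_eq_square)
  then have "(LINT x|lebesgue_on \<Omega>. (norm (weak_gradient \<Omega> w x))\<^sup>2) = (grad_norm \<Omega> (weak_gradient \<Omega> w))\<^sup>2"
    by (simp add: grad_norm_power2 L2_norm_power2)
  then have H: "H1_norm \<Omega> w = sqrt ((L2_norm \<Omega> w)\<^sup>2 + (grad_norm \<Omega> (weak_gradient \<Omega> w))\<^sup>2)"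
    by (simp add: H1_norm_def L2_norm_power2)
  show "L2_norm \<Omega> w \<le> H1_norm \<Omega> w" unfolding H by (rule real_le_rsqrt) simp
  have "grad_norm \<Omega> (weak_gradient \<Omega> w) \<le> H1_norm \<Omega> w" unfolding H by (rule real_le_rsqrt) simp
  then show "L2_norm \<Omega> (\<lambda>x. weak_gradient \<Omega> w x $ i) \<le> H1_norm \<Omega> w"
    using L2_norm_le_grad_norm[of \<Omega> "weak_gradient \<Omega> w" i] by linarith
qed

text \<open>\<open>H1_norm\<close> of a difference refers to the chosen weak gradient of that
  difference. Uniqueness identifies it almost everywhere with the difference of the gradients, which
  turns convergence in \<open>H1_norm\<close> into the approximation that \<open>sob_pair\<close>
  asks for.\<close>

lemma H1_0_sob_pair:
  assumes \<Omega>: "bounded_domain \<Omega>" and w: "w \<in> H1_0 \<Omega>"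
  shows "sob_pair \<Omega> w (weak_gradient \<Omega> w)"
proof -
  note \<Omega>s = bounded_domain_sets[OF \<Omega>]
  have \<Omega>o: "open \<Omega>" using \<Omega> by (simp add: bounded_domain_def)
  obtain g where wL2: "w \<in> L2 \<Omega>" and g: "has_weak_gradient \<Omega> w g" "\<And>i. (\<lambda>x. g x $ i) \<in> L2 \<Omega>"
    using w by (auto simp: H1_0_def H1_def)
  obtain \<psi> where \<psi>: "\<And>n. \<psi> n \<in> test_functions \<Omega>" and lim: "(\<lambda>n. H1_norm \<Omega> (\<lambda>x. \<psi> n x - w x)) \<longlonglongrightarrow> 0"
    using w by (auto simp: H1_0_def)
  define G where "G = weak_gradient \<Omega> w"
  have G: "has_weak_gradient \<Omega> w G" unfolding G_def by (rule weak_gradient_AE[OF \<Omega>o g(1)])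
  have GL2: "(\<lambda>x. G x $ i) \<in> L2 \<Omega>" for i unfolding G_def by (rule weak_gradient_L2[OF \<Omega> g])
  note L = C1c_L2[OF \<Omega>s test_functions_C1c[OF \<psi>]]
  have d: "(\<lambda>x. \<psi> n x - w x) \<in> L2 \<Omega>" "(\<lambda>x. (gradient (\<psi> n) x - G x) $ i) \<in> L2 \<Omega>" for n i
    using L2_diff[OF L(1) wL2] L2_diff[OF L(2) GL2] by simp_all
  have wg: "has_weak_gradient \<Omega> (\<lambda>x. \<psi> n x - w x) (\<lambda>x. gradient (\<psi> n) x - G x)" for n
  proof (subst has_weak_gradient_iff[OF \<Omega> d], intro ballI allI)
    fix \<xi> i assume \<xi>: "\<xi> \<in> test_functions \<Omega>"
    note X = C1c_L2[OF \<Omega>s test_functions_C1c[OF \<xi>]]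
    have "L2_inner \<Omega> w (\<lambda>x. gradient \<xi> x $ i) = - L2_inner \<Omega> \<xi> (\<lambda>x. G x $ i)"
      using G \<xi> has_weak_gradient_iff[OF \<Omega> wL2 GL2] by blast
    moreover have "L2_inner \<Omega> (\<psi> n) (\<lambda>x. gradient \<xi> x $ i) = - L2_inner \<Omega> \<xi> (\<lambda>x. gradient (\<psi> n) x $ i)"
      using integration_by_parts[OF \<Omega>s test_functions_C1c[OF \<psi>] test_functions_C1c[OF \<xi>], of n i] L2_inner_commute by metis
    ultimately show "L2_inner \<Omega> (\<lambda>x. \<psi> n x - w x) (\<lambda>x. gradient \<xi> x $ i) = - L2_inner \<Omega> \<xi> (\<lambda>x. (gradient (\<psi> n) x - G x) $ i)"
      using L2_inner_diff_left[OF L(1)[of n] wL2 X(2)[of i]] L2_inner_diff_left[OF L(2)[of n i] GL2[of i] X(1)]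
      by (simp add: L2_inner_commute[of \<Omega> \<xi>])
  qed
  have wL2': "(\<lambda>x. weak_gradient \<Omega> (\<lambda>x. \<psi> n x - w x) x $ i) \<in> L2 \<Omega>" for n i
    by (rule weak_gradient_L2[OF \<Omega> wg d(2)])
  have le1: "L2_norm \<Omega> (\<lambda>x. \<psi> n x - w x) \<le> H1_norm \<Omega> (\<lambda>x. \<psi> n x - w x)" for n
    by (rule L2_norm_le_H1_norm(1)[OF d(1) wL2'])
  have le2: "L2_norm \<Omega> (\<lambda>x. gradient (\<psi> n) x $ i - G x $ i) \<le> H1_norm \<Omega> (\<lambda>x. \<psi> n x - w x)" for n i
  proof -
    have ae: "AE x in lebesgue_on \<Omega>. weak_gradient \<Omega> (\<lambda>x. \<psi> n x - w x) x $ i = gradient (\<psi> n) x $ i - G x $ i"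
      using weak_gradient_AE(2)[OF \<Omega>o wg[of n]] by eventually_elim simp
    have "L2_norm \<Omega> (\<lambda>x. gradient (\<psi> n) x $ i - G x $ i) = L2_norm \<Omega> (\<lambda>x. weak_gradient \<Omega> (\<lambda>x. \<psi> n x - w x) x $ i)"
      unfolding L2_norm_def using L2_inner_cong_AE[OF \<Omega>s wL2' wL2' ae ae] by simp
    then show ?thesis using L2_norm_le_H1_norm(2)[OF d(1) wL2'] by simp
  qed
  have "sob_pair \<Omega> w G"
  proof (rule sob_pairI_sequence[OF wL2 GL2 sob_pair_C1c[OF \<Omega>s test_functions_C1c[OF \<psi>]] _ _ \<Omega>s])
    show "(\<lambda>n. L2_norm \<Omega> (\<lambda>x. \<psi> n x - w x)) \<longlonglongrightarrow> 0"
      by (rule tendsto_zero_squeeze[OF lim L2_norm_nonneg le1])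
    show "(\<lambda>n. L2_norm \<Omega> (\<lambda>x. gradient (\<psi> n) x $ i - G x $ i)) \<longlonglongrightarrow> 0" for i
      by (rule tendsto_zero_squeeze[OF lim L2_norm_nonneg le2])
  qed
  then show ?thesis by (simp add: G_def)
qed

subsection \<open>The nonlinearity as a trilinear form\<close>

lemma grad_norm_tendsto:
  fixes h :: "nat \<Rightarrow> real ^ 'n \<Rightarrow> real ^ 'n"
  assumes "\<And>n i. (\<lambda>x. h n x $ i) \<in> L2 \<Omega>" "\<And>i. (\<lambda>x. g x $ i) \<in> L2 \<Omega>"
    "\<And>i. (\<lambda>n. L2_norm \<Omega> (\<lambda>x. h n x $ i - g x $ i)) \<longlonglongrightarrow> 0"
  shows "(\<lambda>n. grad_norm \<Omega> (h n)) \<longlonglongrightarrow> grad_norm \<Omega> g"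
  unfolding grad_norm_def by (intro tendsto_intros L2_norm_tendsto assms)

lemma L2_AE_subseq:
  fixes f :: "nat \<Rightarrow> real ^ 'n \<Rightarrow> real"
  assumes \<Omega>: "bounded_domain \<Omega>" and f: "\<And>n. f n \<in> L2 \<Omega>" and u: "u \<in> L2 \<Omega>"
    and lim: "(\<lambda>n. L2_norm \<Omega> (\<lambda>x. f n x - u x)) \<longlonglongrightarrow> 0"
  obtains r where "strict_mono r" "AE x in lebesgue_on \<Omega>. (\<lambda>n. f (r n) x) \<longlonglongrightarrow> u x"
proof -
  have d: "(\<lambda>x. f n x - u x) \<in> L2 \<Omega>" for n by (intro L2_diff f u)
  have "(\<lambda>n. LINT x|lebesgue_on \<Omega>. norm (f n x - u x)) \<longlonglongrightarrow> 0"
  proof (rule tendsto_zero_squeeze)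
    show "(\<lambda>n. L2_norm \<Omega> (\<lambda>x. f n x - u x) * L2_norm \<Omega> (\<lambda>x. 1)) \<longlonglongrightarrow> 0"
      using tendsto_mult_right[OF lim, of "L2_norm \<Omega> (\<lambda>x. 1)"] by simp
    show "(LINT x|lebesgue_on \<Omega>. norm (f n x - u x)) \<le> L2_norm \<Omega> (\<lambda>x. f n x - u x) * L2_norm \<Omega> (\<lambda>x. 1)" for n
      using L2_inner_bound[OF L2_abs[OF d[of n]] L2_const[OF \<Omega>, of 1]] by (simp add: L2_norm_abs L2_inner_def)
  qed simp
  then obtain r where r: "strict_mono r" "AE x in lebesgue_on \<Omega>. (\<lambda>n. f (r n) x - u x) \<longlonglongrightarrow> 0"
    using tendsto_L1_AE_subseq[of "lebesgue_on \<Omega>" "\<lambda>n x. f n x - u x"] L2_integrable[OF \<Omega> d] by blast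
  from r(2) have "AE x in lebesgue_on \<Omega>. (\<lambda>n. f (r n) x) \<longlonglongrightarrow> u x"
    by eventually_elim (rule LIM_zero_cancel)
  with r(1) show ?thesis by (rule that)
qed

text \<open>From \<open>C1c\<close> to the closure: a subsequence of the approximants converges
  almost everywhere, and Fatou carries the Sobolev bound to the limit.\<close>

theorem sob_pair_L4:
  fixes \<Omega> :: "(real ^ 'n) set"
  assumes \<Omega>: "bounded_domain \<Omega>" and card: "CARD('n) \<le> 4"
  obtains C where "0 \<le> C" "\<And>u g. sob_pair \<Omega> u g \<Longrightarrow>
    (\<lambda>x. (u x)\<^sup>2) \<in> L2 \<Omega> \<and> L2_norm \<Omega> (\<lambda>x. (u x)\<^sup>2) \<le> C * (grad_norm \<Omega> g)\<^sup>2"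
proof -
  note \<Omega>s = bounded_domain_sets[OF \<Omega>]
  have "bounded \<Omega>" using \<Omega> by (simp add: bounded_domain_def)
  then obtain C where C: "0 \<le> C" "\<And>u. u \<in> C1c \<Omega> \<Longrightarrow>
    (LINT x|lborel. (u x) ^ 4) \<le> C * (LINT x|lborel. (norm (gradient u x))\<^sup>2)\<^sup>2"
    using C1c_Sobolev[OF _ card] by blast
  have C1: "(\<lambda>x. (\<psi> x)\<^sup>2) \<in> L2 \<Omega>" "L2_norm \<Omega> (\<lambda>x. (\<psi> x)\<^sup>2) \<le> sqrt C * (grad_norm \<Omega> (gradient \<psi>))\<^sup>2"
    if \<psi>: "\<psi> \<in> C1c \<Omega>" for \<psi>
  proof -
    have "(\<lambda>x. (\<psi> x)\<^sup>2) \<in> C1c \<Omega>" using C1c_mult[OF \<psi> \<psi>] by (simp add: power2_eq_square)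
    then show "(\<lambda>x. (\<psi> x)\<^sup>2) \<in> L2 \<Omega>" by (rule C1c_L2[OF \<Omega>s])
    obtain K where K: "compact K" "K \<subseteq> \<Omega>" "\<And>x. x \<notin> K \<Longrightarrow> \<psi> x = 0" "\<And>x. x \<notin> K \<Longrightarrow> gradient \<psi> x = 0"
      using C1c_support[OF \<psi>] by blast
    note c = C1c_D[OF \<psi>]
    have 4: "(LINT x|lebesgue_on \<Omega>. (\<psi> x) ^ 4) = (LINT x|lborel. (\<psi> x) ^ 4)"
      by (rule lebesgue_on_compact_support(3)[OF \<Omega>s _ K(1,2)]) (auto intro!: continuous_intros c simp: K)
    have "(LINT x|lborel. (norm (gradient \<psi> x))\<^sup>2) = (LINT x|lebesgue_on \<Omega>. (norm (gradient \<psi> x))\<^sup>2)"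
      by (rule lebesgue_on_compact_support(3)[OF \<Omega>s _ K(1,2), symmetric]) (auto intro!: continuous_intros c simp: K)
    also have "\<dots> = (\<Sum>i\<in>UNIV. LINT x|lebesgue_on \<Omega>. (gradient \<psi> x $ i)\<^sup>2)"
      using L2_square_integrable[OF C1c_L2(2)[OF \<Omega>s \<psi>]]
      by (simp add: power2_norm_eq_inner inner_vec_def Bochner_Integration.integral_sum flip: power2_eq_square)
    finally have g: "(LINT x|lborel. (norm (gradient \<psi> x))\<^sup>2) = (grad_norm \<Omega> (gradient \<psi>))\<^sup>2"
      by (simp add: grad_norm_power2 L2_norm_power2)
    have "(L2_norm \<Omega> (\<lambda>x. (\<psi> x)\<^sup>2))\<^sup>2 = (LINT x|lborel. (\<psi> x) ^ 4)"
      unfolding L2_norm_power2 4[symmetric] by (simp flip: power_mult)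
    also have "\<dots> \<le> C * ((grad_norm \<Omega> (gradient \<psi>))\<^sup>2)\<^sup>2" using C(2)[OF \<psi>] unfolding g .
    also have "\<dots> = (sqrt C * (grad_norm \<Omega> (gradient \<psi>))\<^sup>2)\<^sup>2" using C(1) by (simp add: power_mult_distrib)
    finally show "L2_norm \<Omega> (\<lambda>x. (\<psi> x)\<^sup>2) \<le> sqrt C * (grad_norm \<Omega> (gradient \<psi>))\<^sup>2"
      by (rule power2_le_imp_le) (use C(1) in simp)
  qed
  show ?thesis
  proof (rule that[of "sqrt C"])
    show "0 \<le> sqrt C" using C by simp
    fix u g assume u: "sob_pair \<Omega> u g"
    obtain f where f: "\<And>n. f n \<in> C1c \<Omega>" "(\<lambda>n. L2_norm \<Omega> (\<lambda>x. f n x - u x)) \<longlonglongrightarrow> 0"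
      "\<And>i. (\<lambda>n. L2_norm \<Omega> (\<lambda>x. gradient (f n) x $ i - g x $ i)) \<longlonglongrightarrow> 0" using sob_pair_sequence[OF u] by blast
    obtain r where r: "strict_mono r" "AE x in lebesgue_on \<Omega>. (\<lambda>n. f (r n) x) \<longlonglongrightarrow> u x"
      by (rule L2_AE_subseq[OF \<Omega> C1c_L2(1)[OF \<Omega>s f(1)] sob_pairD(1)[OF u] f(2)])
    have "(\<lambda>n. sqrt C * (grad_norm \<Omega> (gradient (f n)))\<^sup>2) \<longlonglongrightarrow> sqrt C * (grad_norm \<Omega> g)\<^sup>2"
      by (intro tendsto_intros grad_norm_tendsto C1c_L2(2)[OF \<Omega>s f(1)] sob_pairD(2)[OF u] f(3))
    from LIMSEQ_subseq_LIMSEQ[OF this r(1)]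
    have lim: "(\<lambda>n. sqrt C * (grad_norm \<Omega> (gradient (f (r n))))\<^sup>2) \<longlonglongrightarrow> sqrt C * (grad_norm \<Omega> g)\<^sup>2"
      by (simp add: comp_def)
    \<comment> \<open>The bounds for the approximants converge to the claimed one but may exceed it,
      hence the slack e.\<close>
    have key: "(\<lambda>x. (u x)\<^sup>2) \<in> L2 \<Omega> \<and> L2_norm \<Omega> (\<lambda>x. (u x)\<^sup>2) \<le> sqrt C * (grad_norm \<Omega> g)\<^sup>2 + e" if e: "0 < e" for e
    proof (rule L2_Fatou[where f="\<lambda>n x. (f (r n) x)\<^sup>2"])
      show "(\<lambda>x. (f (r n) x)\<^sup>2) \<in> L2 \<Omega>" for n by (rule C1(1)[OF f(1)])
      show "(\<lambda>x. (u x)\<^sup>2) \<in> borel_measurable (lebesgue_on \<Omega>)"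
        by (intro borel_measurable_power L2_measurable sob_pairD(1)[OF u])
      show "AE x in lebesgue_on \<Omega>. (\<lambda>n. (f (r n) x)\<^sup>2) \<longlonglongrightarrow> (u x)\<^sup>2"
        using r(2) by eventually_elim (intro tendsto_intros)
      have "\<forall>\<^sub>F n in sequentially. sqrt C * (grad_norm \<Omega> (gradient (f (r n))))\<^sup>2 < sqrt C * (grad_norm \<Omega> g)\<^sup>2 + e"
        by (rule order_tendstoD(2)[OF lim]) (use e in simp)
      then show "\<forall>\<^sub>F n in sequentially. L2_norm \<Omega> (\<lambda>x. (f (r n) x)\<^sup>2) \<le> sqrt C * (grad_norm \<Omega> g)\<^sup>2 + e"
      proof eventually_elim
        case (elim n)
        then show ?case using C1(2)[OF f(1)[of "r n"]] by linarith
      qed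
    qed
    then show "(\<lambda>x. (u x)\<^sup>2) \<in> L2 \<Omega> \<and> L2_norm \<Omega> (\<lambda>x. (u x)\<^sup>2) \<le> sqrt C * (grad_norm \<Omega> g)\<^sup>2"
      using key[of 1] by (auto intro: field_le_epsilon)
  qed
qed

lemma L2_norm_mult_le:
  assumes a: "(\<lambda>x. (a x)\<^sup>2) \<in> L2 \<Omega>" "a \<in> L2 \<Omega>" and b: "(\<lambda>x. (b x)\<^sup>2) \<in> L2 \<Omega>" "b \<in> L2 \<Omega>"
  shows "(\<lambda>x. a x * b x) \<in> L2 \<Omega>"
    "(L2_norm \<Omega> (\<lambda>x. a x * b x))\<^sup>2 \<le> L2_norm \<Omega> (\<lambda>x. (a x)\<^sup>2) * L2_norm \<Omega> (\<lambda>x. (b x)\<^sup>2)"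
proof -
  have m: "(\<lambda>x. a x * b x) \<in> borel_measurable (lebesgue_on \<Omega>)"
    by (intro borel_measurable_times L2_measurable a b)
  have "integrable (lebesgue_on \<Omega>) (\<lambda>x. (a x * b x)\<^sup>2)"
    using L2_mult_integrable[OF a(1) b(1)] by (simp add: power_mult_distrib)
  then show "(\<lambda>x. a x * b x) \<in> L2 \<Omega>" using m by (simp add: L2_def)
  have "(L2_norm \<Omega> (\<lambda>x. a x * b x))\<^sup>2 = L2_inner \<Omega> (\<lambda>x. (a x)\<^sup>2) (\<lambda>x. (b x)\<^sup>2)"
    unfolding L2_norm_power2 L2_inner_def by (simp add: power_mult_distrib)
  also have "\<dots> \<le> L2_norm \<Omega> (\<lambda>x. (a x)\<^sup>2) * L2_norm \<Omega> (\<lambda>x. (b x)\<^sup>2)"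
    using L2_inner_bound[OF a(1) b(1)] by linarith
  finally show "(L2_norm \<Omega> (\<lambda>x. a x * b x))\<^sup>2 \<le> L2_norm \<Omega> (\<lambda>x. (a x)\<^sup>2) * L2_norm \<Omega> (\<lambda>x. (b x)\<^sup>2)" .
qed

text \<open>The pairing of \<open>\<eta> \<bullet> \<nabla>u + div (W, \<dots>, W)\<close> with \<open>v\<close>, where \<open>g = \<nabla>u\<close> and \<open>q = \<nabla>v\<close>; the case of
  interest is \<open>W = u\<^sup>2\<close>.\<close>
definition flow_form :: "(real ^ 'n) set \<Rightarrow> real ^ 'n \<Rightarrow> (real ^ 'n \<Rightarrow> real ^ 'n) \<Rightarrow> (real ^ 'n \<Rightarrow> real) \<Rightarrow>
    (real ^ 'n \<Rightarrow> real) \<Rightarrow> (real ^ 'n \<Rightarrow> real ^ 'n) \<Rightarrow> real" where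
  "flow_form \<Omega> \<eta> g W v q = (\<Sum>i\<in>UNIV. \<eta> $ i * L2_inner \<Omega> (\<lambda>x. g x $ i) v - L2_inner \<Omega> W (\<lambda>x. q x $ i))"

lemma flow_form_diff:
  assumes "\<And>i. (\<lambda>x. g x $ i) \<in> L2 \<Omega>" "\<And>i. (\<lambda>x. h x $ i) \<in> L2 \<Omega>" "W \<in> L2 \<Omega>" "Z \<in> L2 \<Omega>" "v \<in> L2 \<Omega>" "\<And>i. (\<lambda>x. q x $ i) \<in> L2 \<Omega>"
  shows "flow_form \<Omega> \<eta> (\<lambda>x. g x - h x) (\<lambda>x. W x - Z x) v q = flow_form \<Omega> \<eta> g W v q - flow_form \<Omega> \<eta> h Z v q"
  unfolding flow_form_def sum_subtractf[symmetric]
  using assms by (intro sum.cong) (simp_all add: L2_inner_diff_left algebra_simps)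

lemma flow_form_lincomb:
  assumes g: "\<And>i. (\<lambda>x. g x $ i) \<in> L2 \<Omega>" "W \<in> L2 \<Omega>" and v: "\<And>k. v k \<in> L2 \<Omega>" "\<And>k i. (\<lambda>x. q k x $ i) \<in> L2 \<Omega>" and A: "finite A"
  shows "flow_form \<Omega> \<eta> g W (\<lambda>x. \<Sum>k\<in>A. c k * v k x) (\<lambda>x. \<Sum>k\<in>A. c k *\<^sub>R q k x)
       = (\<Sum>k\<in>A. c k * flow_form \<Omega> \<eta> g W (v k) (q k))"
proof -
  have "flow_form \<Omega> \<eta> g W (\<lambda>x. \<Sum>k\<in>A. c k * v k x) (\<lambda>x. \<Sum>k\<in>A. c k *\<^sub>R q k x)
     = (\<Sum>i\<in>UNIV. \<Sum>k\<in>A. c k * (\<eta> $ i * L2_inner \<Omega> (\<lambda>x. g x $ i) (v k) - L2_inner \<Omega> W (\<lambda>x. q k x $ i)))"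
    unfolding flow_form_def
  proof (rule sum.cong[OF refl])
    fix i
    have 1: "L2_inner \<Omega> (\<lambda>x. g x $ i) (\<lambda>x. \<Sum>k\<in>A. c k * v k x) = (\<Sum>k\<in>A. c k * L2_inner \<Omega> (\<lambda>x. g x $ i) (v k))"
      by (rule L2_inner_lincomb_right[OF v(1) g(1) A])
    have 2: "L2_inner \<Omega> W (\<lambda>x. \<Sum>k\<in>A. c k * q k x $ i) = (\<Sum>k\<in>A. c k * L2_inner \<Omega> W (\<lambda>x. q k x $ i))"
      by (rule L2_inner_lincomb_right[OF v(2) g(2) A])
    show "\<eta> $ i * L2_inner \<Omega> (\<lambda>x. g x $ i) (\<lambda>x. \<Sum>k\<in>A. c k * v k x) - L2_inner \<Omega> W (\<lambda>x. (\<Sum>k\<in>A. c k *\<^sub>R q k x) $ i)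
       = (\<Sum>k\<in>A. c k * (\<eta> $ i * L2_inner \<Omega> (\<lambda>x. g x $ i) (v k) - L2_inner \<Omega> W (\<lambda>x. q k x $ i)))"
      using 1 2 by (simp add: sum_distrib_left sum_subtractf right_diff_distrib mult.left_commute)
  qed
  also have "\<dots> = (\<Sum>k\<in>A. c k * flow_form \<Omega> \<eta> g W (v k) (q k))"
    unfolding flow_form_def sum_distrib_left by (rule sum.swap)
  finally show ?thesis .
qed

text \<open>Cauchy-Schwarz in each term, with v and the components of q estimated by the H^1 norm of
  the pair. The bound is taken in terms of the norms of g and W, so that it can be applied to
  differences as well.\<close>

lemma flow_form_bound:
  fixes \<Omega> :: "(real ^ 'n) set"
  assumes "\<And>i. (\<lambda>x. g x $ i) \<in> L2 \<Omega>" "W \<in> L2 \<Omega>" "v \<in> L2 \<Omega>" "\<And>i. (\<lambda>x. q x $ i) \<in> L2 \<Omega>"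
  shows "\<bar>flow_form \<Omega> \<eta> g W v q\<bar>
    \<le> ((\<Sum>i\<in>UNIV. \<bar>\<eta> $ i\<bar>) * grad_norm \<Omega> g + real CARD('n) * L2_norm \<Omega> W) * sqrt ((L2_norm \<Omega> v)\<^sup>2 + (grad_norm \<Omega> q)\<^sup>2)"
proof -
  define S where "S = sqrt ((L2_norm \<Omega> v)\<^sup>2 + (grad_norm \<Omega> q)\<^sup>2)"
  have vS: "L2_norm \<Omega> v \<le> S" unfolding S_def by (rule real_le_rsqrt) simp
  have "grad_norm \<Omega> q \<le> S" unfolding S_def by (rule real_le_rsqrt) simp
  then have qS: "L2_norm \<Omega> (\<lambda>x. q x $ i) \<le> S" for i using L2_norm_le_grad_norm[of \<Omega> q i] by linarith
  have "\<bar>flow_form \<Omega> \<eta> g W v q\<bar> \<le> (\<Sum>i\<in>UNIV. \<bar>\<eta> $ i * L2_inner \<Omega> (\<lambda>x. g x $ i) v - L2_inner \<Omega> W (\<lambda>x. q x $ i)\<bar>)"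
    unfolding flow_form_def by (rule sum_abs)
  also have "\<dots> \<le> (\<Sum>i\<in>(UNIV :: 'n set). \<bar>\<eta> $ i\<bar> * (grad_norm \<Omega> g * S) + L2_norm \<Omega> W * S)"
  proof (rule sum_mono)
    fix i :: 'n
    have "\<bar>\<eta> $ i * L2_inner \<Omega> (\<lambda>x. g x $ i) v\<bar> \<le> \<bar>\<eta> $ i\<bar> * (grad_norm \<Omega> g * S)"
      unfolding abs_mult
      by (intro mult_left_mono order_trans[OF L2_inner_bound[OF assms(1,3)]] mult_mono L2_norm_le_grad_norm vS)
        (simp_all add: grad_norm_nonneg L2_norm_nonneg)
    moreover have "\<bar>L2_inner \<Omega> W (\<lambda>x. q x $ i)\<bar> \<le> L2_norm \<Omega> W * S"
      by (intro order_trans[OF L2_inner_bound[OF assms(2,4)]] mult_left_mono qS L2_norm_nonneg)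
    ultimately show "\<bar>\<eta> $ i * L2_inner \<Omega> (\<lambda>x. g x $ i) v - L2_inner \<Omega> W (\<lambda>x. q x $ i)\<bar>
       \<le> \<bar>\<eta> $ i\<bar> * (grad_norm \<Omega> g * S) + L2_norm \<Omega> W * S" by linarith
  qed
  also have "\<dots> = ((\<Sum>i\<in>UNIV. \<bar>\<eta> $ i\<bar>) * grad_norm \<Omega> g + real CARD('n) * L2_norm \<Omega> W) * S"
    by (simp add: sum.distrib sum_distrib_right distrib_right mult.assoc)
  finally show ?thesis by (simp add: S_def)
qed

text \<open>The factorisation (u - v) (u + v), together with Cauchy-Schwarz, reduces the L^2 norm of
  the product to the L^4 norms of the factors. This makes the quadratic term locally
  Lipschitz.\<close>

lemma L2_square_diff_le:
  fixes \<Omega> :: "(real ^ 'n) set"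
  assumes \<Omega>: "\<Omega> \<in> sets lebesgue" and C: "0 \<le> C"
    and L4: "\<And>u g. sob_pair \<Omega> u g \<Longrightarrow> (\<lambda>x. (u x)\<^sup>2) \<in> L2 \<Omega> \<and> L2_norm \<Omega> (\<lambda>x. (u x)\<^sup>2) \<le> C * (grad_norm \<Omega> g)\<^sup>2"
    and u: "sob_pair \<Omega> u g" and v: "sob_pair \<Omega> v h"
  shows "L2_norm \<Omega> (\<lambda>x. (u x)\<^sup>2 - (v x)\<^sup>2) \<le> C * grad_norm \<Omega> (\<lambda>x. g x - h x) * grad_norm \<Omega> (\<lambda>x. g x + h x)"
proof -
  note d = sob_pair_diff[OF \<Omega> u v] and s = sob_pair_add[OF \<Omega> u v]
  have eq: "(\<lambda>x. (u x)\<^sup>2 - (v x)\<^sup>2) = (\<lambda>x. (u x - v x) * (u x + v x))"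
    by (simp add: fun_eq_iff power2_eq_square algebra_simps)
  have "(L2_norm \<Omega> (\<lambda>x. (u x)\<^sup>2 - (v x)\<^sup>2))\<^sup>2 \<le> L2_norm \<Omega> (\<lambda>x. (u x - v x)\<^sup>2) * L2_norm \<Omega> (\<lambda>x. (u x + v x)\<^sup>2)"
    unfolding eq using L4[OF d] L4[OF s] sob_pairD(1)[OF d] sob_pairD(1)[OF s] by (intro L2_norm_mult_le(2)) auto
  also have "\<dots> \<le> (C * (grad_norm \<Omega> (\<lambda>x. g x - h x))\<^sup>2) * (C * (grad_norm \<Omega> (\<lambda>x. g x + h x))\<^sup>2)"
    using L4[OF d] L4[OF s] C by (intro mult_mono) (auto simp: L2_norm_nonneg)
  also have "\<dots> = (C * grad_norm \<Omega> (\<lambda>x. g x - h x) * grad_norm \<Omega> (\<lambda>x. g x + h x))\<^sup>2"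
    by (simp add: power2_eq_square mult_ac)
  finally show ?thesis
    by (rule power2_le_imp_le) (simp add: C grad_norm_nonneg)
qed

text \<open>Integration by parts shows that each linear term equals its own negative and each
  quadratic term equals -2 times itself.\<close>

lemma flow_form_C1c_zero:
  fixes \<Omega> :: "(real ^ 'n) set"
  assumes \<Omega>: "\<Omega> \<in> sets lebesgue" and \<psi>: "\<psi> \<in> C1c \<Omega>"
  shows "flow_form \<Omega> \<eta> (gradient \<psi>) (\<lambda>x. (\<psi> x)\<^sup>2) \<psi> (gradient \<psi>) = 0"
proof -
  have 1: "L2_inner \<Omega> (\<lambda>x. gradient \<psi> x $ i) \<psi> = 0" for i
    using integration_by_parts[OF \<Omega> \<psi> \<psi>, of i] L2_inner_commute[of \<Omega> \<psi>] by simp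
  have \<psi>2: "(\<lambda>x. (\<psi> x)\<^sup>2) \<in> C1c \<Omega>" using C1c_mult[OF \<psi> \<psi>] by (simp add: power2_eq_square)
  have grad: "gradient (\<lambda>x. (\<psi> x)\<^sup>2) x $ i = 2 * (\<psi> x * gradient \<psi> x $ i)" for x i
    using gradient_mult[OF C1c_D(1)[OF \<psi>] C1c_D(1)[OF \<psi>], of x] by (simp add: power2_eq_square)
  have 2: "L2_inner \<Omega> (\<lambda>x. (\<psi> x)\<^sup>2) (\<lambda>x. gradient \<psi> x $ i) = 0" for i
  proof -
    have "L2_inner \<Omega> (\<lambda>x. gradient (\<lambda>x. (\<psi> x)\<^sup>2) x $ i) \<psi> = (LINT x|lebesgue_on \<Omega>. 2 * ((\<psi> x)\<^sup>2 * gradient \<psi> x $ i))"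
      unfolding L2_inner_def grad by (rule Bochner_Integration.integral_cong) (simp_all add: power2_eq_square)
    also have "\<dots> = 2 * L2_inner \<Omega> (\<lambda>x. (\<psi> x)\<^sup>2) (\<lambda>x. gradient \<psi> x $ i)"
      unfolding L2_inner_def by (rule integral_mult_right_zero)
    finally show ?thesis using integration_by_parts[OF \<Omega> \<psi>2 \<psi>, of i] by simp
  qed
  show ?thesis by (simp add: flow_form_def 1 2)
qed

text \<open>Density: the form converges along the approximating sequence. The critical convergence,
  that of the squares in L^2, comes from \<open>L2_square_diff_le\<close>.\<close>

lemma flow_form_energy_zero:
  fixes \<Omega> :: "(real ^ 'n) set"
  assumes \<Omega>: "\<Omega> \<in> sets lebesgue" and C: "0 \<le> C"
    and L4: "\<And>u g. sob_pair \<Omega> u g \<Longrightarrow> (\<lambda>x. (u x)\<^sup>2) \<in> L2 \<Omega> \<and> L2_norm \<Omega> (\<lambda>x. (u x)\<^sup>2) \<le> C * (grad_norm \<Omega> g)\<^sup>2"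
    and u: "sob_pair \<Omega> u g"
  shows "flow_form \<Omega> \<eta> g (\<lambda>x. (u x)\<^sup>2) u g = 0"
proof -
  obtain f where f: "\<And>n. f n \<in> C1c \<Omega>" "(\<lambda>n. L2_norm \<Omega> (\<lambda>x. f n x - u x)) \<longlonglongrightarrow> 0"
    "\<And>i. (\<lambda>n. L2_norm \<Omega> (\<lambda>x. gradient (f n) x $ i - g x $ i)) \<longlonglongrightarrow> 0" using sob_pair_sequence[OF u] by blast
  note fp = sob_pair_C1c[OF \<Omega> f(1)]
  note fL = sob_pairD(1)[OF fp] and gL = sob_pairD(2)[OF fp]
  have lim0: "(\<lambda>n. grad_norm \<Omega> (\<lambda>x. gradient (f n) x - g x)) \<longlonglongrightarrow> grad_norm \<Omega> (\<lambda>x. (0 :: real ^ 'n))"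
  proof (rule grad_norm_tendsto)
    show "(\<lambda>x. (gradient (f n) x - g x) $ i) \<in> L2 \<Omega>" for n i
      using L2_diff[OF gL sob_pairD(2)[OF u]] by simp
    show "(\<lambda>x. (0 :: real ^ 'n) $ i) \<in> L2 \<Omega>" for i by (simp add: L2_zero)
    show "(\<lambda>n. L2_norm \<Omega> (\<lambda>x. (gradient (f n) x - g x) $ i - (0 :: real ^ 'n) $ i)) \<longlonglongrightarrow> 0" for i
      using f(3)[of i] by simp
  qed
  have z: "grad_norm \<Omega> (\<lambda>x. (0 :: real ^ 'n)) = 0" by (simp add: grad_norm_def L2_norm_zero)
  have lim2: "(\<lambda>n. grad_norm \<Omega> (\<lambda>x. gradient (f n) x + g x)) \<longlonglongrightarrow> grad_norm \<Omega> (\<lambda>x. g x + g x)"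
  proof (rule grad_norm_tendsto)
    show "(\<lambda>x. (gradient (f n) x + g x) $ i) \<in> L2 \<Omega>" for n i
      using L2_add[OF gL sob_pairD(2)[OF u]] by simp
    show "(\<lambda>x. (g x + g x) $ i) \<in> L2 \<Omega>" for i
      using L2_add[OF sob_pairD(2)[OF u, of i] sob_pairD(2)[OF u, of i]] by simp
    show "(\<lambda>n. L2_norm \<Omega> (\<lambda>x. (gradient (f n) x + g x) $ i - (g x + g x) $ i)) \<longlonglongrightarrow> 0" for i
      using f(3)[of i] by simp
  qed
  have sq: "(\<lambda>n. L2_norm \<Omega> (\<lambda>x. (f n x)\<^sup>2 - (u x)\<^sup>2)) \<longlonglongrightarrow> 0"
  proof (rule tendsto_zero_squeeze[OF _ L2_norm_nonneg L2_square_diff_le[OF \<Omega> C L4 fp u]])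
    have "(\<lambda>n. C * grad_norm \<Omega> (\<lambda>x. gradient (f n) x - g x) * grad_norm \<Omega> (\<lambda>x. gradient (f n) x + g x))
       \<longlonglongrightarrow> C * 0 * grad_norm \<Omega> (\<lambda>x. g x + g x)"
      by (intro tendsto_intros lim0[unfolded z] lim2)
    then show "(\<lambda>n. C * grad_norm \<Omega> (\<lambda>x. gradient (f n) x - g x) * grad_norm \<Omega> (\<lambda>x. gradient (f n) x + g x)) \<longlonglongrightarrow> 0" by simp
  qed
  have "(\<lambda>n. flow_form \<Omega> \<eta> (gradient (f n)) (\<lambda>x. (f n x)\<^sup>2) (f n) (gradient (f n))) \<longlonglongrightarrow> flow_form \<Omega> \<eta> g (\<lambda>x. (u x)\<^sup>2) u g"
    unfolding flow_form_def
  proof (intro tendsto_sum tendsto_diff tendsto_mult_left)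
    fix i :: 'n
    show "(\<lambda>n. L2_inner \<Omega> (\<lambda>x. gradient (f n) x $ i) (f n)) \<longlonglongrightarrow> L2_inner \<Omega> (\<lambda>x. g x $ i) u"
      by (rule L2_inner_tendsto[OF gL sob_pairD(2)[OF u] f(3) fL sob_pairD(1)[OF u] f(2)])
    show "(\<lambda>n. L2_inner \<Omega> (\<lambda>x. (f n x)\<^sup>2) (\<lambda>x. gradient (f n) x $ i)) \<longlonglongrightarrow> L2_inner \<Omega> (\<lambda>x. (u x)\<^sup>2) (\<lambda>x. g x $ i)"
      by (rule L2_inner_tendsto[OF _ _ sq gL sob_pairD(2)[OF u] f(3)]) (use L4[OF fp] L4[OF u] in auto)
  qed
  then have "(\<lambda>n::nat. 0) \<longlonglongrightarrow> flow_form \<Omega> \<eta> g (\<lambda>x. (u x)\<^sup>2) u g"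
    by (simp only: flow_form_C1c_zero[OF \<Omega> f(1)])
  then show ?thesis using LIMSEQ_unique tendsto_const by blast
qed

lemma H_op_eq_flow_form:
  fixes \<Omega> :: "(real ^ 'n) set"
  assumes \<Omega>: "bounded_domain \<Omega>" and u: "sob_pair \<Omega> u g" "(\<lambda>x. (u x)\<^sup>2) \<in> L2 \<Omega>"
    and v: "v \<in> L2 \<Omega>" "\<And>i. (\<lambda>x. weak_gradient \<Omega> v x $ i) \<in> L2 \<Omega>"
  shows "H_op \<Omega> \<eta> u v = flow_form \<Omega> \<eta> g (\<lambda>x. (u x)\<^sup>2) v (weak_gradient \<Omega> v)"
proof -
  note \<Omega>s = bounded_domain_sets[OF \<Omega>]
  have \<Omega>o: "open \<Omega>" using \<Omega> by (simp add: bounded_domain_def)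
  note wg = sob_pair_weak_gradient[OF \<Omega> u(1)]
  have wL: "(\<lambda>x. weak_gradient \<Omega> u x $ i) \<in> L2 \<Omega>" for i by (rule weak_gradient_L2[OF \<Omega> wg sob_pairD(2)[OF u(1)]])
  have "L2_inner \<Omega> (\<lambda>x. \<eta> \<bullet> weak_gradient \<Omega> u x) v = (\<Sum>i\<in>UNIV. \<eta> $ i * L2_inner \<Omega> (\<lambda>x. weak_gradient \<Omega> u x $ i) v)"
    unfolding L2_inner_def
    using L2_mult_integrable[OF wL v(1)]
    by (simp add: inner_vec_def sum_distrib_right mult.assoc Bochner_Integration.integral_sum)
  also have "\<dots> = (\<Sum>i\<in>UNIV. \<eta> $ i * L2_inner \<Omega> (\<lambda>x. g x $ i) v)"
  proof (rule sum.cong[OF refl])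
    fix i
    have "AE x in lebesgue_on \<Omega>. weak_gradient \<Omega> u x $ i = g x $ i"
      using weak_gradient_AE(2)[OF \<Omega>o wg] by eventually_elim simp
    then have "L2_inner \<Omega> (\<lambda>x. g x $ i) v = L2_inner \<Omega> (\<lambda>x. weak_gradient \<Omega> u x $ i) v"
      by (intro L2_inner_cong_AE[OF \<Omega>s wL v(1)]) auto
    then show "\<eta> $ i * L2_inner \<Omega> (\<lambda>x. weak_gradient \<Omega> u x $ i) v = \<eta> $ i * L2_inner \<Omega> (\<lambda>x. g x $ i) v" by simp
  qed
  finally have 1: "L2_inner \<Omega> (\<lambda>x. \<eta> \<bullet> weak_gradient \<Omega> u x) v = (\<Sum>i\<in>UNIV. \<eta> $ i * L2_inner \<Omega> (\<lambda>x. g x $ i) v)" .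
  have 2: "weak_divergence \<Omega> (flux u) v = - (\<Sum>i\<in>UNIV. L2_inner \<Omega> (\<lambda>x. (u x)\<^sup>2) (\<lambda>x. weak_gradient \<Omega> v x $ i))"
    unfolding weak_divergence_def L2_inner_def flux_def
    using L2_mult_integrable[OF u(2) v(2)]
    by (simp add: inner_vec_def Bochner_Integration.integral_sum)
  show ?thesis unfolding H_op_def 1 2 flow_form_def by (simp add: sum_subtractf)
qed

subsection \<open>Eigenfunction expansions\<close>

locale dirichlet_domain =
  fixes \<Omega> :: "(real ^ 'n) set" and \<theta> :: "nat \<Rightarrow> real" and \<phi> :: "nat \<Rightarrow> real ^ 'n \<Rightarrow> real"
  assumes dom: "bounded_domain \<Omega>" and card: "CARD('n) \<le> 4" and eig: "dirichlet_eigensystem \<Omega> \<theta> \<phi>"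
begin

abbreviation "D1 \<equiv> D_space \<Omega> \<theta> \<phi> 1"
abbreviation "N1 \<equiv> D_norm \<Omega> \<theta> \<phi> 1"
abbreviation cf :: "(real ^ 'n \<Rightarrow> real) \<Rightarrow> nat \<Rightarrow> real" where "cf u k \<equiv> L2_inner \<Omega> u (\<phi> k)"

lemma sets_dom: "\<Omega> \<in> sets lebesgue"
  by (rule bounded_domain_sets[OF dom])

lemma phi_L2: "\<phi> k \<in> L2 \<Omega>"
  using eig by (simp add: dirichlet_eigensystem_def complete_orthonormal_system_def)

lemma phi_orthonormal: "L2_inner \<Omega> (\<phi> j) (\<phi> k) = (if j = k then 1 else 0)"
  using eig by (simp add: dirichlet_eigensystem_def complete_orthonormal_system_def)

lemma phi_complete: "w \<in> L2 \<Omega> \<Longrightarrow> (\<And>k. cf w k = 0) \<Longrightarrow> AE x in lebesgue_on \<Omega>. w x = 0"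
  using eig by (simp add: dirichlet_eigensystem_def complete_orthonormal_system_def)

lemma theta_ge: "\<theta> 0 \<le> \<theta> k"
  using eig by (auto simp: dirichlet_eigensystem_def intro: monoD)

lemma theta_pos: "0 < \<theta> k"
  using eig theta_ge[of k] by (auto simp: dirichlet_eigensystem_def)

lemma theta_pos': "0 < 1 + \<theta> k"
  using theta_pos[of k] by simp

abbreviation G :: "nat \<Rightarrow> real ^ 'n \<Rightarrow> real ^ 'n" where "G k \<equiv> weak_gradient \<Omega> (\<phi> k)"

lemma phi_H1_0: "\<phi> k \<in> H1_0 \<Omega>"
  using eig by (simp add: dirichlet_eigensystem_def dirichlet_eigenfunction_def)

lemma phi_pair: "sob_pair \<Omega> (\<phi> k) (G k)"
  by (rule H1_0_sob_pair[OF dom phi_H1_0])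

lemmas G_L2 = sob_pairD(2)[OF phi_pair]

text \<open>The weak eigenvalue equation of one eigenfunction is tested with another.\<close>

lemma G_orthogonal: "(\<Sum>i\<in>UNIV. L2_inner \<Omega> (\<lambda>x. G j x $ i) (\<lambda>x. G k x $ i)) = (if j = k then \<theta> j else 0)"
proof -
  have "(\<Sum>i\<in>UNIV. L2_inner \<Omega> (\<lambda>x. G j x $ i) (\<lambda>x. G k x $ i)) = (LINT x|lebesgue_on \<Omega>. G j x \<bullet> G k x)"
    unfolding L2_inner_def inner_vec_def
    using L2_mult_integrable[OF G_L2 G_L2] by (simp add: Bochner_Integration.integral_sum)
  also have "\<dots> = \<theta> j * L2_inner \<Omega> (\<phi> j) (\<phi> k)"
    using eig phi_H1_0 by (simp add: dirichlet_eigensystem_def dirichlet_eigenfunction_def)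
  finally show ?thesis by (simp add: phi_orthonormal)
qed

lemma lincomb_norm:
  assumes "finite A"
  shows "(L2_norm \<Omega> (\<lambda>x. \<Sum>k\<in>A. c k * \<phi> k x))\<^sup>2 = (\<Sum>k\<in>A. (c k)\<^sup>2)"
proof -
  have "L2_inner \<Omega> (\<lambda>x. \<Sum>k\<in>A. c k * \<phi> k x) (\<lambda>x. \<Sum>k\<in>A. c k * \<phi> k x)
      = (\<Sum>k\<in>A. c k * (\<Sum>j\<in>A. c j * L2_inner \<Omega> (\<phi> k) (\<phi> j)))"
    by (simp add: L2_inner_lincomb_left[OF phi_L2 L2_lincomb[OF phi_L2] assms] L2_inner_lincomb_right[OF phi_L2 phi_L2 assms])
  also have "\<dots> = (\<Sum>k\<in>A. (c k)\<^sup>2)"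
    using assms by (simp add: phi_orthonormal if_distrib power2_eq_square cong: if_cong)
  finally show ?thesis by (simp add: L2_norm_square)
qed

lemma lincomb_grad_norm:
  assumes "finite A"
  shows "(grad_norm \<Omega> (\<lambda>x. \<Sum>k\<in>A. c k *\<^sub>R G k x))\<^sup>2 = (\<Sum>k\<in>A. \<theta> k * (c k)\<^sup>2)"
proof -
  have "(grad_norm \<Omega> (\<lambda>x. \<Sum>k\<in>A. c k *\<^sub>R G k x))\<^sup>2
     = (\<Sum>i\<in>UNIV. L2_inner \<Omega> (\<lambda>x. \<Sum>k\<in>A. c k * G k x $ i) (\<lambda>x. \<Sum>k\<in>A. c k * G k x $ i))"
    by (simp add: grad_norm_power2 L2_norm_square)
  also have "\<dots> = (\<Sum>i\<in>UNIV. \<Sum>k\<in>A. \<Sum>j\<in>A. c k * c j * L2_inner \<Omega> (\<lambda>x. G k x $ i) (\<lambda>x. G j x $ i))"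
    by (simp add: L2_inner_lincomb_left[OF G_L2 L2_lincomb[OF G_L2] assms] L2_inner_lincomb_right[OF G_L2 G_L2 assms] sum_distrib_left mult.assoc)
  also have "\<dots> = (\<Sum>k\<in>A. \<Sum>j\<in>A. \<Sum>i\<in>UNIV. c k * c j * L2_inner \<Omega> (\<lambda>x. G k x $ i) (\<lambda>x. G j x $ i))"
    by (subst sum.swap, rule sum.cong[OF refl], rule sum.swap)
  also have "\<dots> = (\<Sum>k\<in>A. \<Sum>j\<in>A. c k * c j * (if k = j then \<theta> k else 0))"
    by (simp only: sum_distrib_left[symmetric] G_orthogonal)
  also have "\<dots> = (\<Sum>k\<in>A. \<theta> k * (c k)\<^sup>2)"
    using assms by (simp add: if_distrib power2_eq_square mult.commute mult.left_commute cong: if_cong)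
  finally show ?thesis .
qed

lemma sum_lessThan_diff:
  fixes f :: "nat \<Rightarrow> 'b :: ab_group_add"
  assumes "n \<le> m"
  shows "(\<Sum>k<m. f k) - (\<Sum>k<n. f k) = (\<Sum>k\<in>{n..<m}. f k)"
proof -
  have "{..<m} = {..<n} \<union> {n..<m}" "{..<n} \<inter> {n..<m} = {}" using assms by auto
  then show ?thesis by (simp add: sum.union_disjoint)
qed

text \<open>Serves twice: with a_k = c_k^2 for a function and with a_k = \<theta>_k c_k^2 for the
  components of its gradient.\<close>

lemma partial_sums_Cauchy:
  fixes F :: "nat \<Rightarrow> real ^ 'n \<Rightarrow> real"
  assumes s: "summable a" "\<And>k. 0 \<le> a k"
    and le: "\<And>A. finite A \<Longrightarrow> (L2_norm \<Omega> (\<lambda>x. \<Sum>k\<in>A. F k x))\<^sup>2 \<le> (\<Sum>k\<in>A. a k)"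
    and e: "(0::real) < e"
  shows "\<exists>N. \<forall>m\<ge>N. \<forall>n\<ge>N. L2_norm \<Omega> (\<lambda>x. (\<Sum>k<m. F k x) - (\<Sum>k<n. F k x)) < e"
proof -
  obtain N where N: "\<And>m n. m \<ge> N \<Longrightarrow> norm (sum a {m..<n}) < e\<^sup>2"
    using s(1) e unfolding summable_Cauchy by (meson zero_less_power)
  have one: "L2_norm \<Omega> (\<lambda>x. (\<Sum>k<m. F k x) - (\<Sum>k<n. F k x)) < e" if "n \<ge> N" "n \<le> m" for m n
  proof -
    have "(L2_norm \<Omega> (\<lambda>x. (\<Sum>k<m. F k x) - (\<Sum>k<n. F k x)))\<^sup>2 \<le> sum a {n..<m}"
      using le[of "{n..<m}"] by (simp add: sum_lessThan_diff[OF that(2)])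
    also have "\<dots> < e\<^sup>2" using N[OF that(1), of m] by simp
    finally show ?thesis using e by (intro power2_less_imp_less[where y=e]) auto
  qed
  show ?thesis
  proof (intro exI allI impI)
    fix m n assume mn: "m \<ge> N" "n \<ge> N"
    show "L2_norm \<Omega> (\<lambda>x. (\<Sum>k<m. F k x) - (\<Sum>k<n. F k x)) < e"
    proof (cases "n \<le> m")
      case False
      then show ?thesis using one[of m n] mn L2_norm_minus_commute[of \<Omega> "\<lambda>x. \<Sum>k<m. F k x"] by simp
    qed (use one mn in simp)
  qed
qed

lemma expansion_limit:
  assumes c: "summable (\<lambda>k. (c k)\<^sup>2)"
  obtains u where "u \<in> L2 \<Omega>" "(\<lambda>n. L2_norm \<Omega> (\<lambda>x. (\<Sum>k<n. c k * \<phi> k x) - u x)) \<longlonglongrightarrow> 0"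
proof -
  have "\<exists>u\<in>L2 \<Omega>. (\<lambda>n. L2_norm \<Omega> (\<lambda>x. (\<Sum>k<n. c k * \<phi> k x) - u x)) \<longlonglongrightarrow> 0"
    by (rule L2_complete[OF dom L2_lincomb[OF phi_L2]])
      (rule partial_sums_Cauchy[OF c]; simp add: lincomb_norm)
  then show ?thesis using that by blast
qed

lemma expansion_coeff:
  assumes u: "u \<in> L2 \<Omega>" and lim: "(\<lambda>n. L2_norm \<Omega> (\<lambda>x. (\<Sum>k<n. c k * \<phi> k x) - u x)) \<longlonglongrightarrow> 0"
  shows "cf u j = c j"
proof -
  have "(\<lambda>n. L2_inner \<Omega> (\<lambda>x. \<Sum>k<n. c k * \<phi> k x) (\<phi> j)) \<longlonglongrightarrow> cf u j"
    by (rule L2_inner_tendsto[OF L2_lincomb[OF phi_L2] u lim phi_L2 phi_L2]) (simp add: L2_norm_zero)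
  moreover have "\<forall>\<^sub>F n in sequentially. L2_inner \<Omega> (\<lambda>x. \<Sum>k<n. c k * \<phi> k x) (\<phi> j) = c j"
    unfolding eventually_sequentially
  proof (intro exI[of _ "Suc j"] allI impI)
    fix n assume "Suc j \<le> n"
    then show "L2_inner \<Omega> (\<lambda>x. \<Sum>k<n. c k * \<phi> k x) (\<phi> j) = c j"
      by (simp add: L2_inner_lincomb_left[OF phi_L2 phi_L2] phi_orthonormal if_distrib cong: if_cong)
  qed
  then have "(\<lambda>n. L2_inner \<Omega> (\<lambda>x. \<Sum>k<n. c k * \<phi> k x) (\<phi> j)) \<longlonglongrightarrow> c j" by (rule tendsto_eventually)
  ultimately show ?thesis by (rule LIMSEQ_unique)
qed

lemma coeff_eq_imp_AE:
  assumes "u \<in> L2 \<Omega>" "v \<in> L2 \<Omega>" "\<And>k. cf u k = cf v k"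
  shows "AE x in lebesgue_on \<Omega>. u x = v x"
proof -
  have "AE x in lebesgue_on \<Omega>. u x - v x = 0"
    using assms by (intro phi_complete) (auto intro: L2_diff simp: L2_inner_diff_left phi_L2)
  then show ?thesis by simp
qed

lemma coeff_AE_cong:
  assumes "u \<in> L2 \<Omega>" "AE x in lebesgue_on \<Omega>. u x = v x"
  shows "cf v k = cf u k"
  by (rule L2_inner_cong_AE[OF sets_dom assms(1) phi_L2 assms(2)]) simp

lemma L2_suminf_props:
  assumes c: "summable (\<lambda>k. (c k)\<^sup>2)"
  shows "L2_suminf \<Omega> (\<lambda>k x. c k * \<phi> k x) \<in> L2 \<Omega>" "cf (L2_suminf \<Omega> (\<lambda>k x. c k * \<phi> k x)) k = c k"
proof -
  obtain u where "u \<in> L2 \<Omega>" "(\<lambda>n. L2_norm \<Omega> (\<lambda>x. (\<Sum>k<n. c k * \<phi> k x) - u x)) \<longlonglongrightarrow> 0"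
    by (rule expansion_limit[OF c])
  then have "\<exists>s. s \<in> L2 \<Omega> \<and> (\<lambda>n. L2_norm \<Omega> (\<lambda>x. (\<Sum>k<n. c k * \<phi> k x) - s x)) \<longlonglongrightarrow> 0" by blast
  from someI_ex[OF this] have "L2_suminf \<Omega> (\<lambda>k x. c k * \<phi> k x) \<in> L2 \<Omega> \<and>
     (\<lambda>n. L2_norm \<Omega> (\<lambda>x. (\<Sum>k<n. c k * \<phi> k x) - L2_suminf \<Omega> (\<lambda>k x. c k * \<phi> k x) x)) \<longlonglongrightarrow> 0"
    unfolding L2_suminf_def .
  then show "L2_suminf \<Omega> (\<lambda>k x. c k * \<phi> k x) \<in> L2 \<Omega>" "cf (L2_suminf \<Omega> (\<lambda>k x. c k * \<phi> k x)) k = c k"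
    using expansion_coeff by blast+
qed

subsection \<open>\<open>D\<^sup>1\<close> as a sequence space\<close>

lemma theta_powr: "\<theta> k powr 1 = \<theta> k"
  using theta_pos[of k] by simp

lemma D1_iff: "u \<in> D1 \<longleftrightarrow> u \<in> L2 \<Omega> \<and> summable (\<lambda>k. \<theta> k * (cf u k)\<^sup>2)"
  by (simp only: D_space_def theta_powr mem_Collect_eq)

lemma D1_L2: "u \<in> D1 \<Longrightarrow> u \<in> L2 \<Omega>"
  by (simp add: D1_iff)

lemma D1_summable:
  assumes "u \<in> D1"
  shows "summable (\<lambda>k. \<theta> k * (cf u k)\<^sup>2)" "summable (\<lambda>k. (cf u k)\<^sup>2)" "summable (\<lambda>k. (sqrt (1 + \<theta> k) * cf u k)\<^sup>2)"
proof -
  show 1: "summable (\<lambda>k. \<theta> k * (cf u k)\<^sup>2)" using assms by (simp add: D1_iff)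
  show 2: "summable (\<lambda>k. (cf u k)\<^sup>2)"
  proof (rule summable_comparison_test')
    show "summable (\<lambda>k. 1 / \<theta> 0 * (\<theta> k * (cf u k)\<^sup>2))" by (rule summable_mult[OF 1])
    fix k
    have "1 * (cf u k)\<^sup>2 \<le> \<theta> k / \<theta> 0 * (cf u k)\<^sup>2"
      using theta_ge[of k] theta_pos[of 0] by (intro mult_right_mono) auto
    then show "norm ((cf u k)\<^sup>2) \<le> 1 / \<theta> 0 * (\<theta> k * (cf u k)\<^sup>2)" by simp
  qed
  show "summable (\<lambda>k. (sqrt (1 + \<theta> k) * cf u k)\<^sup>2)"
    using summable_add[OF 1 2] theta_pos' by (simp add: power_mult_distrib distrib_right add.commute less_imp_le)
qed

text \<open>The weight turns the H^1 norm into the norm of the sequence space. The factor 1 / (1 +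
  \<theta>_k) of the mild formula then splits evenly, so that the duality pairing of D^-1 with D^1
  becomes the inner product.\<close>

definition enc :: "(real ^ 'n \<Rightarrow> real) \<Rightarrow> ell2" where
  "enc u = Abs_ell2 (\<lambda>k. sqrt (1 + \<theta> k) * cf u k)"

definition dec :: "ell2 \<Rightarrow> real ^ 'n \<Rightarrow> real" where
  "dec y = L2_suminf \<Omega> (\<lambda>k x. coord y k / sqrt (1 + \<theta> k) * \<phi> k x)"

lemma coord_enc: "u \<in> D1 \<Longrightarrow> coord (enc u) k = sqrt (1 + \<theta> k) * cf u k"
  unfolding enc_def by (rule coord_Abs_ell2[OF D1_summable(3)])

lemma cf_eq_coord_enc: "u \<in> D1 \<Longrightarrow> cf u k = coord (enc u) k / sqrt (1 + \<theta> k)"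
  using theta_pos'[of k] by (simp add: coord_enc)

lemma dec_props:
  shows "dec y \<in> D1" "cf (dec y) k = coord y k / sqrt (1 + \<theta> k)"
proof -
  have s: "summable (\<lambda>k. (coord y k / sqrt (1 + \<theta> k))\<^sup>2)"
  proof (rule summable_comparison_test'[OF summable_coord_square])
    fix k
    have "(coord y k)\<^sup>2 / (1 + \<theta> k) \<le> (coord y k)\<^sup>2 / 1"
      using theta_pos[of k] by (intro divide_left_mono) auto
    then show "norm ((coord y k / sqrt (1 + \<theta> k))\<^sup>2) \<le> (coord y k)\<^sup>2"
      using theta_pos'[of k] by (simp add: power_divide)
  qed
  show cf: "cf (dec y) k = coord y k / sqrt (1 + \<theta> k)" for k
    unfolding dec_def by (rule L2_suminf_props(2)[OF s])
  have "summable (\<lambda>k. \<theta> k * (cf (dec y) k)\<^sup>2)"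
  proof (rule summable_comparison_test'[OF summable_coord_square])
    fix k
    have "\<theta> k / (1 + \<theta> k) * (coord y k)\<^sup>2 \<le> 1 * (coord y k)\<^sup>2"
      using theta_pos[of k] by (intro mult_right_mono) auto
    then show "norm (\<theta> k * (cf (dec y) k)\<^sup>2) \<le> (coord y k)\<^sup>2"
      using theta_pos[of k] by (simp add: cf power_divide)
  qed
  then show "dec y \<in> D1" unfolding D1_iff dec_def using L2_suminf_props(1)[OF s] by (simp add: dec_def)
qed

lemma enc_dec: "enc (dec y) = y"
  by (rule ell2_eqI) (use theta_pos' in \<open>simp add: coord_enc dec_props less_imp_neq[symmetric] less_imp_le\<close>)

lemma enc_eq_imp_AE:
  assumes "u \<in> D1" "v \<in> D1" "enc u = enc v"
  shows "AE x in lebesgue_on \<Omega>. u x = v x"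
  using assms by (intro coeff_eq_imp_AE D1_L2) (simp_all add: cf_eq_coord_enc)

text \<open>The sum is indexed by functions, each with a weight, because
  \<open>simple_integral_fun\<close> sums over the values of a simple function.\<close>

lemma D1_sum:
  assumes A: "finite A" and y: "\<And>y. y \<in> A \<Longrightarrow> y \<in> D1"
  shows "(\<lambda>x. \<Sum>y\<in>A. m y * y x) \<in> D1 \<and> (\<forall>k. cf (\<lambda>x. \<Sum>y\<in>A. m y * y x) k = (\<Sum>y\<in>A. m y * cf y k))"
  using assms
proof (induction A rule: finite_induct)
  case empty
  then show ?case by (simp add: D1_iff L2_zero) (simp add: L2_inner_def)
next
  case (insert a A)
  define w where "w = (\<lambda>x. \<Sum>y\<in>A. m y * y x)"
  have a: "a \<in> D1" and w: "w \<in> D1" using insert by (auto simp: w_def)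
  have cf: "cf (\<lambda>x. m a * a x + w x) k = m a * cf a k + cf w k" for k
    using a w by (simp add: L2_inner_add_left L2_scale D1_L2 phi_L2 L2_inner_scale_left)
  have "summable (\<lambda>k. (sqrt (\<theta> k) * (m a * cf a k + cf w k))\<^sup>2)"
  proof -
    have "summable (\<lambda>k. (m a * (sqrt (\<theta> k) * cf a k) + sqrt (\<theta> k) * cf w k)\<^sup>2)"
      using summable_mult[OF D1_summable(1)[OF a], of "(m a)\<^sup>2"] D1_summable(1)[OF w] theta_pos
      by (intro summable_square_add) (simp_all add: power_mult_distrib less_imp_le)
    then show ?thesis by (simp add: algebra_simps)
  qed
  then have "summable (\<lambda>k. \<theta> k * (m a * cf a k + cf w k)\<^sup>2)"
    using theta_pos by (simp add: power_mult_distrib less_imp_le)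
  then have "(\<lambda>x. m a * a x + w x) \<in> D1"
    using a w unfolding D1_iff cf by (auto intro: L2_add L2_scale)
  then show ?case using insert cf by (simp add: w_def)
qed

lemma D1_lincomb2:
  assumes "u \<in> D1" "v \<in> D1"
  shows "(\<lambda>x. a * u x + b * v x) \<in> D1" "enc (\<lambda>x. a * u x + b * v x) = a *\<^sub>R enc u + b *\<^sub>R enc v"
proof -
  have cf: "cf (\<lambda>x. a * u x + b * v x) k = a * cf u k + b * cf v k" for k
    using assms by (simp add: L2_inner_add_left L2_scale D1_L2 phi_L2 L2_inner_scale_left)
  have L2: "(\<lambda>x. a * u x + b * v x) \<in> L2 \<Omega>" using assms by (intro L2_add L2_scale D1_L2)
  define y where "y = a *\<^sub>R enc u + b *\<^sub>R enc v"
  \<comment> \<open>For an L^2 function membership in \<open>D1\<close> depends only on the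
    coefficients, and these are the ones of a decoded sequence.\<close>
  have cfy: "cf (\<lambda>x. a * u x + b * v x) k = cf (dec y) k" for k
    using assms by (simp add: cf dec_props y_def cf_eq_coord_enc add_divide_distrib)
  show D: "(\<lambda>x. a * u x + b * v x) \<in> D1"
    using L2 dec_props(1)[of y] by (simp add: D1_iff cfy)
  show "enc (\<lambda>x. a * u x + b * v x) = a *\<^sub>R enc u + b *\<^sub>R enc v"
    by (rule ell2_eqI) (simp add: coord_enc D assms cf algebra_simps)
qed

lemma D1_diff:
  assumes "u \<in> D1" "v \<in> D1"
  shows "(\<lambda>x. u x - v x) \<in> D1" "enc (\<lambda>x. u x - v x) = enc u - enc v"
  using D1_lincomb2[OF assms, of 1 "-1"] by simp_all

section \<open>Comparison of the norm of \<open>D1\<close> with that of the sequence space\<close>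

lemma N1_eq: "N1 u = sqrt (\<Sum>k. \<theta> k * (cf u k)\<^sup>2)"
  by (simp only: D_norm_def theta_powr)

lemma N1_square_nonneg: "u \<in> D1 \<Longrightarrow> 0 \<le> (\<Sum>k. \<theta> k * (cf u k)\<^sup>2)"
  by (intro suminf_nonneg D1_summable mult_nonneg_nonneg less_imp_le[OF theta_pos]) simp_all

lemma N1_power2: "u \<in> D1 \<Longrightarrow> (N1 u)\<^sup>2 = (\<Sum>k. \<theta> k * (cf u k)\<^sup>2)"
  by (simp add: N1_eq N1_square_nonneg)

lemma N1_nonneg: "u \<in> D1 \<Longrightarrow> 0 \<le> N1 u"
  by (simp add: N1_eq N1_square_nonneg)

lemma N1_partial_le: "u \<in> D1 \<Longrightarrow> (\<Sum>k<n. \<theta> k * (cf u k)\<^sup>2) \<le> (N1 u)\<^sup>2"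
  unfolding N1_power2 using theta_pos by (intro sum_le_suminf D1_summable) (auto simp: less_imp_le)

lemma N1_leI:
  assumes u: "u \<in> D1" and B: "0 \<le> B" "\<And>n. (\<Sum>k<n. \<theta> k * (cf u k)\<^sup>2) \<le> B\<^sup>2"
  shows "N1 u \<le> B"
proof (rule power2_le_imp_le[OF _ B(1)])
  show "(N1 u)\<^sup>2 \<le> B\<^sup>2" unfolding N1_power2[OF u] by (intro suminf_le_const D1_summable u B)
qed

lemma N1_le_norm_enc:
  assumes u: "u \<in> D1"
  shows "N1 u \<le> norm (enc u)"
proof (rule N1_leI[OF u norm_ge_zero])
  fix n
  have "(\<Sum>k<n. \<theta> k * (cf u k)\<^sup>2) \<le> (\<Sum>k<n. (coord (enc u) k)\<^sup>2)"
    using theta_pos' by (intro sum_mono) (simp add: coord_enc u power_mult_distrib less_imp_le distrib_right)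
  also have "\<dots> \<le> (norm (enc u))\<^sup>2" by (rule sum_coord_square_le) simp
  finally show "(\<Sum>k<n. \<theta> k * (cf u k)\<^sup>2) \<le> (norm (enc u))\<^sup>2" .
qed

text \<open>From 1 + \<theta>_k \<le> (1 + 1/\<theta>_0) \<theta>_k: the price for leaving the L^2
  part out of the norm of D^1, as in the Poincare inequality.\<close>

definition Kn :: real where "Kn = sqrt (1 + 1 / \<theta> 0)"

lemma Kn_pos: "0 < Kn"
  using theta_pos[of 0] by (simp add: Kn_def add_pos_pos)

lemma norm_enc_le:
  assumes u: "u \<in> D1"
  shows "norm (enc u) \<le> Kn * N1 u"
proof (rule norm_ell2_le)
  fix n
  have "(\<Sum>k<n. (coord (enc u) k)\<^sup>2) \<le> (\<Sum>k<n. (1 + 1 / \<theta> 0) * (\<theta> k * (cf u k)\<^sup>2))"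
  proof (rule sum_mono)
    fix k
    have "1 \<le> \<theta> k / \<theta> 0" using theta_ge[of k] theta_pos[of 0] by simp
    then have "1 + \<theta> k \<le> (1 + 1 / \<theta> 0) * \<theta> k" by (simp add: distrib_right)
    then have "(1 + \<theta> k) * (cf u k)\<^sup>2 \<le> (1 + 1 / \<theta> 0) * \<theta> k * (cf u k)\<^sup>2" by (intro mult_right_mono) auto
    then show "(coord (enc u) k)\<^sup>2 \<le> (1 + 1 / \<theta> 0) * (\<theta> k * (cf u k)\<^sup>2)"
      using theta_pos'[of k] by (simp add: coord_enc u power_mult_distrib mult.assoc)
  qed
  also have "\<dots> = (1 + 1 / \<theta> 0) * (\<Sum>k<n. \<theta> k * (cf u k)\<^sup>2)" by (simp add: sum_distrib_left)
  also have "\<dots> \<le> (1 + 1 / \<theta> 0) * (N1 u)\<^sup>2"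
    using theta_pos[of 0] by (intro mult_left_mono N1_partial_le u) auto
  also have "\<dots> = (Kn * N1 u)\<^sup>2" using theta_pos[of 0] by (simp add: Kn_def power_mult_distrib)
  finally show "(\<Sum>k<n. (coord (enc u) k)\<^sup>2) \<le> (Kn * N1 u)\<^sup>2" .
qed (use Kn_pos N1_nonneg[OF u] in simp)

lemma abs_cf_le_N1:
  assumes u: "u \<in> D1"
  shows "\<bar>cf u k\<bar> \<le> N1 u / sqrt (\<theta> k)"
proof -
  have "\<theta> k * (cf u k)\<^sup>2 \<le> (\<Sum>j<Suc k. \<theta> j * (cf u j)\<^sup>2)"
    using theta_pos by (intro member_le_sum) (auto simp: less_imp_le)
  also have "\<dots> \<le> (N1 u)\<^sup>2" by (rule N1_partial_le[OF u])
  finally have "(sqrt (\<theta> k) * \<bar>cf u k\<bar>)\<^sup>2 \<le> (N1 u)\<^sup>2"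
    using theta_pos[of k] by (simp add: power_mult_distrib)
  then have "sqrt (\<theta> k) * \<bar>cf u k\<bar> \<le> N1 u" by (rule power2_le_imp_le) (rule N1_nonneg[OF u])
  then show ?thesis using theta_pos[of k] by (simp add: field_simps)
qed

text \<open>Partial sums of the expansion converge in L^2, and so do their gradients, whose
  increments are controlled by the series for \<open>N1\<close>. Closedness of the graph then yields
  the gradient of u.\<close>

lemma D1_gradient:
  assumes u: "u \<in> D1"
  shows "sob_pair \<Omega> u (weak_gradient \<Omega> u)"
    "(\<lambda>n. L2_norm \<Omega> (\<lambda>x. (\<Sum>k<n. cf u k * \<phi> k x) - u x)) \<longlonglongrightarrow> 0"
    "(\<lambda>n. L2_norm \<Omega> (\<lambda>x. (\<Sum>k<n. cf u k *\<^sub>R G k x) $ i - weak_gradient \<Omega> u x $ i)) \<longlonglongrightarrow> 0"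
proof -
  have \<Omega>o: "open \<Omega>" using dom by (simp add: bounded_domain_def)
  obtain v where v: "v \<in> L2 \<Omega>" "(\<lambda>n. L2_norm \<Omega> (\<lambda>x. (\<Sum>k<n. cf u k * \<phi> k x) - v x)) \<longlonglongrightarrow> 0"
    by (rule expansion_limit[OF D1_summable(2)[OF u]])
  have uv: "AE x in lebesgue_on \<Omega>. v x = u x"
    by (rule coeff_eq_imp_AE[OF v(1) D1_L2[OF u] expansion_coeff[OF v]])
  have cong: "L2_norm \<Omega> (\<lambda>x. p x - r x) = L2_norm \<Omega> (\<lambda>x. p x - q x)"
    if "p \<in> L2 \<Omega>" "q \<in> L2 \<Omega>" "AE x in lebesgue_on \<Omega>. q x = r x" for p q r :: "real ^ 'n \<Rightarrow> real"
  proof -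
    have ae: "AE x in lebesgue_on \<Omega>. p x - q x = p x - r x" using that(3) by eventually_elim simp
    show ?thesis unfolding L2_norm_def
      by (simp add: L2_inner_cong_AE[OF sets_dom L2_diff[OF that(1,2)] L2_diff[OF that(1,2)] ae ae])
  qed
  show S: "(\<lambda>n. L2_norm \<Omega> (\<lambda>x. (\<Sum>k<n. cf u k * \<phi> k x) - u x)) \<longlonglongrightarrow> 0"
    using v(2) by (simp add: cong[OF L2_lincomb[OF phi_L2] v(1) uv])
  have "\<exists>g\<in>L2 \<Omega>. (\<lambda>n. L2_norm \<Omega> (\<lambda>x. (\<Sum>k<n. cf u k * G k x $ i) - g x)) \<longlonglongrightarrow> 0" for i
  proof (rule L2_complete[OF dom L2_lincomb[OF G_L2]], rule partial_sums_Cauchy[OF D1_summable(1)[OF u]])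
    fix A :: "nat set" assume A: "finite A"
    have "L2_norm \<Omega> (\<lambda>x. (\<Sum>k\<in>A. cf u k *\<^sub>R G k x) $ i) \<le> grad_norm \<Omega> (\<lambda>x. \<Sum>k\<in>A. cf u k *\<^sub>R G k x)"
      by (rule L2_norm_le_grad_norm)
    then have "(L2_norm \<Omega> (\<lambda>x. \<Sum>k\<in>A. cf u k * G k x $ i))\<^sup>2 \<le> (grad_norm \<Omega> (\<lambda>x. \<Sum>k\<in>A. cf u k *\<^sub>R G k x))\<^sup>2"
      by (intro power_mono L2_norm_nonneg) simp
    then show "(L2_norm \<Omega> (\<lambda>x. \<Sum>k\<in>A. cf u k * G k x $ i))\<^sup>2 \<le> (\<Sum>k\<in>A. \<theta> k * (cf u k)\<^sup>2)"
      by (simp only: lincomb_grad_norm[OF A])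
  qed (use theta_pos in \<open>simp_all add: less_imp_le\<close>)
  then have "\<forall>i. \<exists>g. g \<in> L2 \<Omega> \<and> (\<lambda>n. L2_norm \<Omega> (\<lambda>x. (\<Sum>k<n. cf u k * G k x $ i) - g x)) \<longlonglongrightarrow> 0"
    by blast
  from choice[OF this] obtain gi where
    gi: "\<And>i. gi i \<in> L2 \<Omega>" "\<And>i. (\<lambda>n. L2_norm \<Omega> (\<lambda>x. (\<Sum>k<n. cf u k * G k x $ i) - gi i x)) \<longlonglongrightarrow> 0"
    by blast
  define g where "g = (\<lambda>x. \<chi> i. gi i x)"
  have g: "(\<lambda>x. g x $ i) \<in> L2 \<Omega>" "(\<lambda>n. L2_norm \<Omega> (\<lambda>x. (\<Sum>k<n. cf u k *\<^sub>R G k x) $ i - g x $ i)) \<longlonglongrightarrow> 0" for i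
    using gi by (simp_all add: g_def)
  have pair: "sob_pair \<Omega> u g"
    by (rule sob_pairI_sequence[OF D1_L2[OF u] g(1) sob_pair_lincomb[OF sets_dom phi_pair finite_lessThan] S g(2) sets_dom])
  have wg: "has_weak_gradient \<Omega> u g" by (rule sob_pair_weak_gradient[OF dom pair])
  have ae: "AE x in lebesgue_on \<Omega>. g x $ i = weak_gradient \<Omega> u x $ i" for i
    using weak_gradient_AE(2)[OF \<Omega>o wg] by eventually_elim simp
  have GL: "(\<lambda>x. (\<Sum>k<n. cf u k *\<^sub>R G k x) $ i) \<in> L2 \<Omega>" for n i
    using L2_lincomb[OF G_L2, of "\<lambda>k. cf u k"] by simp
  show W: "(\<lambda>n. L2_norm \<Omega> (\<lambda>x. (\<Sum>k<n. cf u k *\<^sub>R G k x) $ i - weak_gradient \<Omega> u x $ i)) \<longlonglongrightarrow> 0" for i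
    using g(2)[of i] by (simp only: cong[OF GL g(1) ae])
  show "sob_pair \<Omega> u (weak_gradient \<Omega> u)"
    by (rule sob_pairI_sequence[OF D1_L2[OF u] weak_gradient_L2[OF dom wg g(1)]
        sob_pair_lincomb[OF sets_dom phi_pair finite_lessThan] S W sets_dom])
qed

text \<open>The combined gradient is a weak gradient of the combined function, so its norm is the
  limit of the norms of the partial sums. The cases u - v and u + v enter the Lipschitz
  estimate.\<close>

lemma grad_norm_lincomb2_le:
  assumes u: "u \<in> D1" and v: "v \<in> D1"
  shows "grad_norm \<Omega> (\<lambda>x. a *\<^sub>R weak_gradient \<Omega> u x + b *\<^sub>R weak_gradient \<Omega> v x) \<le> norm (a *\<^sub>R enc u + b *\<^sub>R enc v)"
proof -
  define w where "w = (\<lambda>x. a * u x + b * v x)"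
  have w: "w \<in> D1" and ew: "enc w = a *\<^sub>R enc u + b *\<^sub>R enc v"
    unfolding w_def by (rule D1_lincomb2[OF u v])+
  have \<Omega>o: "open \<Omega>" using dom by (simp add: bounded_domain_def)
  have pair: "sob_pair \<Omega> w (\<lambda>x. a *\<^sub>R weak_gradient \<Omega> u x + b *\<^sub>R weak_gradient \<Omega> v x)"
    unfolding w_def by (rule sob_pair_lincomb2[OF sets_dom D1_gradient(1)[OF u] D1_gradient(1)[OF v]])
  have ae: "AE x in lebesgue_on \<Omega>. weak_gradient \<Omega> w x = a *\<^sub>R weak_gradient \<Omega> u x + b *\<^sub>R weak_gradient \<Omega> v x"
    by (rule weak_gradient_AE(2)[OF \<Omega>o sob_pair_weak_gradient[OF dom pair]])
  have eq: "L2_norm \<Omega> (\<lambda>x. (a *\<^sub>R weak_gradient \<Omega> u x + b *\<^sub>R weak_gradient \<Omega> v x) $ i) = L2_norm \<Omega> (\<lambda>x. weak_gradient \<Omega> w x $ i)" for i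
  proof -
    have ai: "AE x in lebesgue_on \<Omega>. weak_gradient \<Omega> w x $ i = (a *\<^sub>R weak_gradient \<Omega> u x + b *\<^sub>R weak_gradient \<Omega> v x) $ i"
      using ae by eventually_elim simp
    have L: "(\<lambda>x. weak_gradient \<Omega> w x $ i) \<in> L2 \<Omega>" by (rule sob_pairD(2)[OF D1_gradient(1)[OF w]])
    show ?thesis unfolding L2_norm_def by (simp only: L2_inner_cong_AE[OF sets_dom L L ai ai])
  qed
  have "grad_norm \<Omega> (\<lambda>x. a *\<^sub>R weak_gradient \<Omega> u x + b *\<^sub>R weak_gradient \<Omega> v x) = grad_norm \<Omega> (weak_gradient \<Omega> w)"
    unfolding grad_norm_def by (simp only: eq)
  also have "\<dots> \<le> norm (enc w)"
  proof (rule LIMSEQ_le_const2)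
    have GL: "(\<lambda>x. (\<Sum>k<n. cf w k *\<^sub>R G k x) $ i) \<in> L2 \<Omega>" for n i
      using L2_lincomb[OF G_L2, of "\<lambda>k. cf w k"] by simp
    show "(\<lambda>n. grad_norm \<Omega> (\<lambda>x. \<Sum>k<n. cf w k *\<^sub>R G k x)) \<longlonglongrightarrow> grad_norm \<Omega> (weak_gradient \<Omega> w)"
      by (rule grad_norm_tendsto[OF GL sob_pairD(2)[OF D1_gradient(1)[OF w]] D1_gradient(3)[OF w]])
    show "\<exists>N. \<forall>n\<ge>N. grad_norm \<Omega> (\<lambda>x. \<Sum>k<n. cf w k *\<^sub>R G k x) \<le> norm (enc w)"
    proof (intro exI allI impI)
      fix n
      have "(grad_norm \<Omega> (\<lambda>x. \<Sum>k<n. cf w k *\<^sub>R G k x))\<^sup>2 \<le> (N1 w)\<^sup>2"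
        using N1_partial_le[OF w, of n] by (simp add: lincomb_grad_norm)
      then have "grad_norm \<Omega> (\<lambda>x. \<Sum>k<n. cf w k *\<^sub>R G k x) \<le> N1 w"
        by (rule power2_le_imp_le) (rule N1_nonneg[OF w])
      then show "grad_norm \<Omega> (\<lambda>x. \<Sum>k<n. cf w k *\<^sub>R G k x) \<le> norm (enc w)"
        using N1_le_norm_enc[OF w] by linarith
    qed
  qed
  finally show ?thesis by (simp only: ew)
qed

end

subsection \<open>The equation as a vector field on the sequence space\<close>

definition ell2_mult :: "(nat \<Rightarrow> real) \<Rightarrow> ell2 \<Rightarrow> ell2" where
  "ell2_mult m y = Abs_ell2 (\<lambda>k. m k * coord y k)"

lemma ell2_mult_bounded:
  assumes "\<And>k. \<bar>m k\<bar> \<le> M"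
  shows "coord (ell2_mult m y) k = m k * coord y k" "norm (ell2_mult m y) \<le> M * norm y"
proof -
  have M: "0 \<le> M" using assms[of 0] by linarith
  have le: "(m k * coord y k)\<^sup>2 \<le> M\<^sup>2 * (coord y k)\<^sup>2" for k
  proof -
    have "(m k)\<^sup>2 \<le> M\<^sup>2" using power_mono[OF assms[of k], of 2] by simp
    then show ?thesis by (simp add: power_mult_distrib mult_right_mono)
  qed
  have s: "summable (\<lambda>k. (m k * coord y k)\<^sup>2)"
    by (rule summable_comparison_test'[OF summable_mult[OF summable_coord_square[of y], of "M\<^sup>2"]]) (simp add: le)
  show c: "coord (ell2_mult m y) k = m k * coord y k" for k
    unfolding ell2_mult_def by (rule coord_Abs_ell2[OF s])
  show "norm (ell2_mult m y) \<le> M * norm y"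
  proof (rule norm_ell2_le)
    fix n
    have "(\<Sum>k<n. (coord (ell2_mult m y) k)\<^sup>2) \<le> (\<Sum>k<n. M\<^sup>2 * (coord y k)\<^sup>2)"
      unfolding c by (intro sum_mono le)
    also have "\<dots> \<le> M\<^sup>2 * (norm y)\<^sup>2"
      unfolding sum_distrib_left[symmetric] by (intro mult_left_mono sum_coord_square_le) auto
    finally show "(\<Sum>k<n. (coord (ell2_mult m y) k)\<^sup>2) \<le> (M * norm y)\<^sup>2" by (simp add: power_mult_distrib)
  qed (use M in simp)
qed

context dirichlet_domain
begin

definition sob_const :: real where
  "sob_const = (SOME C. 0 \<le> C \<and> (\<forall>u g. sob_pair \<Omega> u g \<longrightarrow>
    (\<lambda>x. (u x)\<^sup>2) \<in> L2 \<Omega> \<and> L2_norm \<Omega> (\<lambda>x. (u x)\<^sup>2) \<le> C * (grad_norm \<Omega> g)\<^sup>2))"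

lemma sob_const:
  shows "0 \<le> sob_const"
    and "\<And>u g. sob_pair \<Omega> u g \<Longrightarrow> (\<lambda>x. (u x)\<^sup>2) \<in> L2 \<Omega> \<and> L2_norm \<Omega> (\<lambda>x. (u x)\<^sup>2) \<le> sob_const * (grad_norm \<Omega> g)\<^sup>2"
proof -
  obtain C where "0 \<le> C" "\<And>u g. sob_pair \<Omega> u g \<Longrightarrow>
    (\<lambda>x. (u x)\<^sup>2) \<in> L2 \<Omega> \<and> L2_norm \<Omega> (\<lambda>x. (u x)\<^sup>2) \<le> C * (grad_norm \<Omega> g)\<^sup>2"
    using sob_pair_L4[OF dom card] by blast
  then have "\<exists>C. 0 \<le> C \<and> (\<forall>u g. sob_pair \<Omega> u g \<longrightarrow>
    (\<lambda>x. (u x)\<^sup>2) \<in> L2 \<Omega> \<and> L2_norm \<Omega> (\<lambda>x. (u x)\<^sup>2) \<le> C * (grad_norm \<Omega> g)\<^sup>2)" by blast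
  from someI_ex[OF this, folded sob_const_def]
  show "0 \<le> sob_const"
    and "\<And>u g. sob_pair \<Omega> u g \<Longrightarrow> (\<lambda>x. (u x)\<^sup>2) \<in> L2 \<Omega> \<and> L2_norm \<Omega> (\<lambda>x. (u x)\<^sup>2) \<le> sob_const * (grad_norm \<Omega> g)\<^sup>2"
    by blast+
qed

lemma D1_square_L2: "u \<in> D1 \<Longrightarrow> (\<lambda>x. (u x)\<^sup>2) \<in> L2 \<Omega>"
  using sob_const(2)[OF D1_gradient(1)] by blast

lemmas D1_gradient_L2 = sob_pairD(2)[OF D1_gradient(1)]

text \<open>Testing with c_k = l_k / (1 + \<theta>_k), the Riesz representative of l, turns the
  hypothesis into S \<le> B sqrt(S) for the sum S in question.\<close>

lemma duality_bound:
  assumes B: "0 \<le> B"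
    and le: "\<And>c. \<bar>\<Sum>k<n. c k * l k\<bar> \<le> B * sqrt (\<Sum>k<n. (1 + \<theta> k) * (c k)\<^sup>2)"
  shows "(\<Sum>k<n. (l k / sqrt (1 + \<theta> k))\<^sup>2) \<le> B\<^sup>2"
proof -
  define S where "S = (\<Sum>k<n. (l k / sqrt (1 + \<theta> k))\<^sup>2)"
  have S0: "0 \<le> S" unfolding S_def by (intro sum_nonneg) simp
  have t1: "(l k / sqrt (1 + \<theta> k))\<^sup>2 = (l k / (1 + \<theta> k)) * l k" for k
    using theta_pos'[of k] by (simp add: power_divide power2_eq_square)
  have t2: "(l k / sqrt (1 + \<theta> k))\<^sup>2 = (1 + \<theta> k) * (l k / (1 + \<theta> k))\<^sup>2" for k
    using theta_pos'[of k] by (simp add: power_divide power2_eq_square)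
  have "S \<le> B * sqrt S"
    using le[of "\<lambda>k. l k / (1 + \<theta> k)"] S0 unfolding t1[symmetric] t2[symmetric] S_def[symmetric] by simp
  show ?thesis
  proof (cases "S = 0")
    case False
    then have "0 < sqrt S" using S0 by simp
    moreover have "sqrt S * sqrt S \<le> B * sqrt S" using \<open>S \<le> B * sqrt S\<close> S0 by simp
    ultimately have "sqrt S \<le> B" by (simp only: mult_le_cancel_right_pos)
    then have "(sqrt S)\<^sup>2 \<le> B\<^sup>2" using S0 by (intro power_mono) auto
    then show ?thesis using S0 by (simp add: S_def)
  qed (simp add: S_def[symmetric])
qed

text \<open>The form is tested with finite combinations of eigenfunctions, whose H^1 norm is
  explicit. Duality then gives a bound uniform in n, that is, one in a norm equivalent to that of
  D^-1.\<close>

lemma flow_form_coeff_bound: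
  assumes g: "\<And>i. (\<lambda>x. g x $ i) \<in> L2 \<Omega>" and W: "W \<in> L2 \<Omega>"
  shows "(\<Sum>k<n. (flow_form \<Omega> \<eta> g W (\<phi> k) (G k) / sqrt (1 + \<theta> k))\<^sup>2)
    \<le> ((\<Sum>i\<in>UNIV. \<bar>\<eta> $ i\<bar>) * grad_norm \<Omega> g + real CARD('n) * L2_norm \<Omega> W)\<^sup>2"
proof (rule duality_bound)
  show "0 \<le> (\<Sum>i\<in>UNIV. \<bar>\<eta> $ i\<bar>) * grad_norm \<Omega> g + real CARD('n) * L2_norm \<Omega> W"
    by (intro add_nonneg_nonneg mult_nonneg_nonneg sum_nonneg) (simp_all add: grad_norm_nonneg L2_norm_nonneg)
  fix c :: "nat \<Rightarrow> real"
  let ?v = "\<lambda>x. \<Sum>k<n. c k * \<phi> k x" and ?q = "\<lambda>x. \<Sum>k<n. c k *\<^sub>R G k x"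
  have q: "(\<lambda>x. ?q x $ i) \<in> L2 \<Omega>" for i using L2_lincomb[OF G_L2, where c=c and A="{..<n}"] by simp
  have v: "?v \<in> L2 \<Omega>" by (rule L2_lincomb[OF phi_L2])
  have "(L2_norm \<Omega> ?v)\<^sup>2 + (grad_norm \<Omega> ?q)\<^sup>2 = (\<Sum>k<n. (1 + \<theta> k) * (c k)\<^sup>2)"
    by (simp add: lincomb_norm lincomb_grad_norm distrib_right sum.distrib)
  then show "\<bar>\<Sum>k<n. c k * flow_form \<Omega> \<eta> g W (\<phi> k) (G k)\<bar>
    \<le> ((\<Sum>i\<in>UNIV. \<bar>\<eta> $ i\<bar>) * grad_norm \<Omega> g + real CARD('n) * L2_norm \<Omega> W) * sqrt (\<Sum>k<n. (1 + \<theta> k) * (c k)\<^sup>2)"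
    using flow_form_bound[OF g W v q, of \<eta>]
    by (simp add: flow_form_lincomb[OF g W phi_L2 G_L2, symmetric])
qed

lemma H_op_phi:
  assumes "u \<in> D1"
  shows "H_op \<Omega> \<eta> u (\<phi> k) = flow_form \<Omega> \<eta> (weak_gradient \<Omega> u) (\<lambda>x. (u x)\<^sup>2) (\<phi> k) (G k)"
  by (rule H_op_eq_flow_form[OF dom D1_gradient(1)[OF assms] D1_square_L2[OF assms] phi_L2 G_L2])

definition Hseq :: "real ^ 'n \<Rightarrow> (real ^ 'n \<Rightarrow> real) \<Rightarrow> ell2" where
  "Hseq \<eta> u = Abs_ell2 (\<lambda>k. H_op \<Omega> \<eta> u (\<phi> k) / sqrt (1 + \<theta> k))"

lemma coord_Hseq: "u \<in> D1 \<Longrightarrow> coord (Hseq \<eta> u) k = H_op \<Omega> \<eta> u (\<phi> k) / sqrt (1 + \<theta> k)"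
  unfolding Hseq_def
  by (rule coord_Abs_ell2, rule summable_square_bounded, simp only: H_op_phi)
    (rule flow_form_coeff_bound[OF D1_gradient_L2 D1_square_L2])

lemma grad_norm_diff_le:
  assumes "u \<in> D1" "v \<in> D1"
  shows "grad_norm \<Omega> (\<lambda>x. weak_gradient \<Omega> u x - weak_gradient \<Omega> v x) \<le> norm (enc u - enc v)"
    "grad_norm \<Omega> (\<lambda>x. weak_gradient \<Omega> u x + weak_gradient \<Omega> v x) \<le> norm (enc u + enc v)"
  using grad_norm_lincomb2_le[OF assms, of 1 "-1"] grad_norm_lincomb2_le[OF assms, of 1 1] by simp_all

text \<open>The form is linear in the pair of gradient and square, and the difference of the squares
  is controlled by the norms of difference and sum. The norm of the sum is what makes the Lipschitz
  constant only local.\<close>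

lemma Hseq_diff:
  assumes u: "u \<in> D1" and v: "v \<in> D1"
  shows "norm (Hseq \<eta> u - Hseq \<eta> v)
    \<le> ((\<Sum>i\<in>UNIV. \<bar>\<eta> $ i\<bar>) + real CARD('n) * sob_const * norm (enc u + enc v)) * norm (enc u - enc v)"
proof -
  let ?gu = "weak_gradient \<Omega> u" and ?gv = "weak_gradient \<Omega> v"
  define B where "B = (\<Sum>i\<in>UNIV. \<bar>\<eta> $ i\<bar>) * grad_norm \<Omega> (\<lambda>x. ?gu x - ?gv x) + real CARD('n) * L2_norm \<Omega> (\<lambda>x. (u x)\<^sup>2 - (v x)\<^sup>2)"
  have dg: "(\<lambda>x. (?gu x - ?gv x) $ i) \<in> L2 \<Omega>" for i
    using L2_diff[OF D1_gradient_L2[OF u] D1_gradient_L2[OF v]] by simp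
  have dW: "(\<lambda>x. (u x)\<^sup>2 - (v x)\<^sup>2) \<in> L2 \<Omega>" by (intro L2_diff D1_square_L2 u v)
  have B0: "0 \<le> B" unfolding B_def
    by (intro add_nonneg_nonneg mult_nonneg_nonneg sum_nonneg) (simp_all add: grad_norm_nonneg L2_norm_nonneg)
  have coord: "coord (Hseq \<eta> u - Hseq \<eta> v) k
      = flow_form \<Omega> \<eta> (\<lambda>x. ?gu x - ?gv x) (\<lambda>x. (u x)\<^sup>2 - (v x)\<^sup>2) (\<phi> k) (G k) / sqrt (1 + \<theta> k)" for k
    by (simp add: coord_Hseq u v H_op_phi diff_divide_distrib
        flow_form_diff[OF D1_gradient_L2[OF u] D1_gradient_L2[OF v] D1_square_L2[OF u] D1_square_L2[OF v] phi_L2 G_L2])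
  have "norm (Hseq \<eta> u - Hseq \<eta> v) \<le> B"
  proof (rule norm_ell2_le[OF _ B0])
    show "(\<Sum>k<n. (coord (Hseq \<eta> u - Hseq \<eta> v) k)\<^sup>2) \<le> B\<^sup>2" for n
      unfolding coord B_def by (rule flow_form_coeff_bound[OF dg dW])
  qed
  also have "B \<le> (\<Sum>i\<in>UNIV. \<bar>\<eta> $ i\<bar>) * norm (enc u - enc v)
      + real CARD('n) * (sob_const * norm (enc u - enc v) * norm (enc u + enc v))"
    unfolding B_def
  proof (intro add_mono mult_left_mono grad_norm_diff_le u v)
    have "L2_norm \<Omega> (\<lambda>x. (u x)\<^sup>2 - (v x)\<^sup>2)
      \<le> sob_const * grad_norm \<Omega> (\<lambda>x. ?gu x - ?gv x) * grad_norm \<Omega> (\<lambda>x. ?gu x + ?gv x)"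
      by (rule L2_square_diff_le[OF sets_dom sob_const D1_gradient(1)[OF u] D1_gradient(1)[OF v]])
    also have "\<dots> \<le> sob_const * norm (enc u - enc v) * norm (enc u + enc v)"
      by (intro mult_mono grad_norm_diff_le u v) (simp_all add: sob_const grad_norm_nonneg)
    finally show "L2_norm \<Omega> (\<lambda>x. (u x)\<^sup>2 - (v x)\<^sup>2) \<le> sob_const * norm (enc u - enc v) * norm (enc u + enc v)" .
  qed (simp_all add: sum_nonneg)
  finally show ?thesis by (simp add: algebra_simps)
qed

text \<open>The partial sums of the inner product are the form tested with partial sums of the
  expansion of u. These converge together with their gradients, so the limit is the form tested with
  u itself.\<close>

lemma Hseq_energy:
  assumes u: "u \<in> D1"
  shows "enc u \<bullet> Hseq \<eta> u = 0"
proof -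
  let ?g = "weak_gradient \<Omega> u" and ?W = "\<lambda>x. (u x)\<^sup>2"
  let ?v = "\<lambda>n x. \<Sum>k<n. cf u k * \<phi> k x" and ?q = "\<lambda>n x. \<Sum>k<n. cf u k *\<^sub>R G k x"
  note g = D1_gradient_L2[OF u] and W = D1_square_L2[OF u]
  have vL: "?v n \<in> L2 \<Omega>" for n by (rule L2_lincomb[OF phi_L2])
  have qL: "(\<lambda>x. ?q n x $ i) \<in> L2 \<Omega>" for n i using L2_lincomb[OF G_L2, where c="\<lambda>k. cf u k" and A="{..<n}"] by simp
  have "(\<lambda>n. \<Sum>k<n. coord (enc u) k * coord (Hseq \<eta> u) k) \<longlonglongrightarrow> enc u \<bullet> Hseq \<eta> u"
    using inner_ell2_sums[of "enc u" "Hseq \<eta> u"] by (simp add: sums_def)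
  moreover have "(\<Sum>k<n. coord (enc u) k * coord (Hseq \<eta> u) k) = flow_form \<Omega> \<eta> ?g ?W (?v n) (?q n)" for n
  proof -
    have "coord (enc u) k * coord (Hseq \<eta> u) k = cf u k * flow_form \<Omega> \<eta> ?g ?W (\<phi> k) (G k)" for k
      using theta_pos'[of k] by (simp add: coord_enc coord_Hseq u H_op_phi)
    then show ?thesis by (simp add: flow_form_lincomb[OF g W phi_L2 G_L2])
  qed
  moreover have "(\<lambda>n. flow_form \<Omega> \<eta> ?g ?W (?v n) (?q n)) \<longlonglongrightarrow> flow_form \<Omega> \<eta> ?g ?W u ?g"
    unfolding flow_form_def
  proof (intro tendsto_sum tendsto_diff tendsto_mult_left)
    have z: "(\<lambda>n::nat. L2_norm \<Omega> (\<lambda>x. f x - f x)) \<longlonglongrightarrow> 0" for f by (simp add: L2_norm_zero)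
    fix i :: 'n
    show "(\<lambda>n. L2_inner \<Omega> (\<lambda>x. ?g x $ i) (?v n)) \<longlonglongrightarrow> L2_inner \<Omega> (\<lambda>x. ?g x $ i) u"
      by (rule L2_inner_tendsto[OF g g z vL D1_L2[OF u] D1_gradient(2)[OF u]])
    show "(\<lambda>n. L2_inner \<Omega> ?W (\<lambda>x. ?q n x $ i)) \<longlonglongrightarrow> L2_inner \<Omega> ?W (\<lambda>x. ?g x $ i)"
      by (rule L2_inner_tendsto[OF W W z qL g D1_gradient(3)[OF u]])
  qed
  ultimately have "enc u \<bullet> Hseq \<eta> u = flow_form \<Omega> \<eta> ?g ?W u ?g"
    using LIMSEQ_unique by simp
  also have "\<dots> = 0" by (rule flow_form_energy_zero[OF sets_dom sob_const D1_gradient(1)[OF u]])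
  finally show ?thesis .
qed

text \<open>The eigenvalues of the bounded operator (1 - \<Delta>)^(-1) (-\<Delta>).\<close>

definition lam :: "nat \<Rightarrow> real" where "lam k = \<theta> k / (1 + \<theta> k)"

lemma lam_bounds: "0 \<le> lam k" "lam k \<le> 1" "\<bar>lam k\<bar> \<le> 1"
  using theta_pos[of k] by (auto simp: lam_def)

lemmas lam_mult = ell2_mult_bounded[of lam 1, OF lam_bounds(3)]

definition field :: "real ^ 'n \<Rightarrow> ell2 \<Rightarrow> ell2" where
  "field \<eta> y = Hseq \<eta> (dec y) - ell2_mult lam y"

lemma Hseq_dec_diff:
  "norm (Hseq \<eta> (dec x) - Hseq \<eta> (dec y))
    \<le> ((\<Sum>i\<in>UNIV. \<bar>\<eta> $ i\<bar>) + real CARD('n) * sob_const * norm (x + y)) * norm (x - y)"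
  using Hseq_diff[OF dec_props(1)[of x] dec_props(1)[of y], where \<eta>=\<eta>] by (simp add: enc_dec)

lemma Hseq_dec_Lipschitz:
  "\<exists>L\<ge>0. \<forall>x y. norm x \<le> R \<longrightarrow> norm y \<le> R \<longrightarrow> norm (Hseq \<eta> (dec x) - Hseq \<eta> (dec y)) \<le> L * norm (x - y)"
proof (intro exI conjI allI impI)
  let ?L = "(\<Sum>i\<in>UNIV. \<bar>\<eta> $ i\<bar>) + real CARD('n) * sob_const * (2 * \<bar>R\<bar>)"
  show "0 \<le> ?L" using sob_const(1) by (simp add: sum_nonneg)
  fix x y :: ell2 assume "norm x \<le> R" "norm y \<le> R"
  then have "norm (x + y) \<le> 2 * \<bar>R\<bar>" using norm_triangle_ineq[of x y] by linarith
  then show "norm (Hseq \<eta> (dec x) - Hseq \<eta> (dec y)) \<le> ?L * norm (x - y)"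
    using sob_const(1)
    by (intro order_trans[OF Hseq_dec_diff] mult_right_mono add_left_mono mult_left_mono) auto
qed

lemma Hseq_dec_continuous: "continuous_on UNIV (\<lambda>y. Hseq \<eta> (dec y))"
  by (rule locally_Lipschitz_continuous[OF Hseq_dec_Lipschitz])

lemma lam_mult_diff: "ell2_mult lam x - ell2_mult lam y = ell2_mult lam (x - y)"
  by (rule ell2_eqI) (simp add: lam_mult right_diff_distrib)

lemma field_Lipschitz:
  "\<exists>L\<ge>0. \<forall>x y. norm x \<le> R \<longrightarrow> norm y \<le> R \<longrightarrow> norm (field \<eta> x - field \<eta> y) \<le> L * norm (x - y)"
proof -
  obtain L where L: "0 \<le> L" "\<And>x y. norm x \<le> R \<Longrightarrow> norm y \<le> R \<Longrightarrow> norm (Hseq \<eta> (dec x) - Hseq \<eta> (dec y)) \<le> L * norm (x - y)"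
    using Hseq_dec_Lipschitz[of R \<eta>] by blast
  have "norm (field \<eta> x - field \<eta> y) \<le> (L + 1) * norm (x - y)" if "norm x \<le> R" "norm y \<le> R" for x y
  proof -
    have "field \<eta> x - field \<eta> y = (Hseq \<eta> (dec x) - Hseq \<eta> (dec y)) - (ell2_mult lam x - ell2_mult lam y)"
      by (simp add: field_def)
    then have "norm (field \<eta> x - field \<eta> y) \<le> norm (Hseq \<eta> (dec x) - Hseq \<eta> (dec y)) + norm (ell2_mult lam (x - y))"
      unfolding lam_mult_diff by (metis norm_triangle_ineq4)
    then show ?thesis using L(2)[OF that] lam_mult(2)[of "x - y"] by (simp add: distrib_right)
  qed
  then show ?thesis using L(1) by (intro exI[of _ "L + 1"]) auto
qed

lemma field_dissipative: "y \<bullet> field \<eta> y \<le> 0"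
proof -
  have "y \<bullet> Hseq \<eta> (dec y) = 0" using Hseq_energy[OF dec_props(1), of y \<eta>] by (simp add: enc_dec)
  moreover have "0 \<le> y \<bullet> ell2_mult lam y"
  proof -
    have "0 \<le> (\<Sum>k. coord y k * coord (ell2_mult lam y) k)"
    proof (intro suminf_nonneg summable_coord_mult)
      fix k
      have "0 \<le> lam k * (coord y k)\<^sup>2" using lam_bounds(1) by simp
      then show "0 \<le> coord y k * coord (ell2_mult lam y) k"
        by (simp add: lam_mult power2_eq_square mult.left_commute)
    qed
    then show ?thesis by (simp add: inner_ell2_def)
  qed
  ultimately show ?thesis by (simp add: field_def inner_diff_right)
qed

text \<open>\<open>dec (enc u)\<close> and u agree only almost everywhere; as both have the same
  image under \<open>enc\<close>, the Lipschitz estimate shows that the nonlinearity does not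
  distinguish them.\<close>

lemma Hseq_enc: "u \<in> D1 \<Longrightarrow> Hseq \<eta> (dec (enc u)) = Hseq \<eta> u"
  using Hseq_diff[OF dec_props(1)[of "enc u"], where v=u and \<eta>=\<eta>] by (simp add: enc_dec)

end

subsection \<open>Bochner integrals in \<open>D\<^sup>1\<close>\<close>

text \<open>f after s is a finite sum of constants times indicators of level sets of s. With f a
  coefficient functional this evaluates the coefficients of
  \<open>simple_integral_fun\<close>.\<close>

lemma integral_simple_composition:
  fixes f :: "'b \<Rightarrow> real"
  assumes "finite_measure M" and s: "simple_function M s"
  shows "integrable M (\<lambda>\<tau>. f (s \<tau>))"
    "(LINT \<tau>|M. f (s \<tau>)) = (\<Sum>y\<in>s ` space M. measure M (s -` {y} \<inter> space M) * f y)"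
proof -
  interpret finite_measure M by fact
  have fin: "finite (s ` space M)" and m: "\<And>y. s -` {y} \<inter> space M \<in> sets M"
    using simple_functionD[OF s] by auto
  have eq: "f (s \<tau>) = (\<Sum>y\<in>s ` space M. f y * indicator (s -` {y} \<inter> space M) \<tau>)" if "\<tau> \<in> space M" for \<tau>
  proof -
    have "(\<Sum>y\<in>s ` space M. f y * indicator (s -` {y} \<inter> space M) \<tau>) = (\<Sum>y\<in>s ` space M. if y = s \<tau> then f y else 0)"
      using that by (intro sum.cong) (auto simp: indicator_def)
    also have "\<dots> = f (s \<tau>)" using fin that by simp
    finally show ?thesis by simp
  qed
  have i: "integrable M (\<lambda>\<tau>. f y * indicator (s -` {y} \<inter> space M) \<tau>)" for y
    using m[of y] by (intro integrable_mult_right integrable_real_indicator) (auto simp: emeasure_eq_measure)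
  have "integrable M (\<lambda>\<tau>. \<Sum>y\<in>s ` space M. f y * indicator (s -` {y} \<inter> space M) \<tau>)"
    by (intro Bochner_Integration.integrable_sum i)
  then show "integrable M (\<lambda>\<tau>. f (s \<tau>))"
    by (subst Bochner_Integration.integrable_cong[OF refl eq]) auto
  have "(LINT \<tau>|M. f (s \<tau>)) = (LINT \<tau>|M. (\<Sum>y\<in>s ` space M. f y * indicator (s -` {y} \<inter> space M) \<tau>))"
    by (intro Bochner_Integration.integral_cong refl eq)
  also have "\<dots> = (\<Sum>y\<in>s ` space M. (LINT \<tau>|M. f y * indicator (s -` {y} \<inter> space M) \<tau>))"
    by (intro Bochner_Integration.integral_sum i)
  also have "\<dots> = (\<Sum>y\<in>s ` space M. measure M (s -` {y} \<inter> space M) * f y)"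
    using m by (intro sum.cong refl) (simp add: mult.commute)
  finally show "(LINT \<tau>|M. f (s \<tau>)) = (\<Sum>y\<in>s ` space M. measure M (s -` {y} \<inter> space M) * f y)" .
qed

text \<open>The vector of integrals is tested against itself.\<close>
lemma Minkowski_sequence:
  fixes e :: "nat \<Rightarrow> 'a \<Rightarrow> real" and w :: "nat \<Rightarrow> real"
  assumes w: "\<And>k. 0 \<le> w k" and e: "\<And>k. integrable M (e k)" and n: "integrable M n"
    and le: "\<And>\<tau>. \<tau> \<in> space M \<Longrightarrow> 0 \<le> n \<tau> \<and> (\<Sum>k<K. w k * (e k \<tau>)\<^sup>2) \<le> (n \<tau>)\<^sup>2"
  shows "(\<Sum>k<K. w k * (LINT \<tau>|M. e k \<tau>)\<^sup>2) \<le> (LINT \<tau>|M. n \<tau>)\<^sup>2"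
proof -
  define d where "d = (\<lambda>k. LINT \<tau>|M. e k \<tau>)"
  define Q where "Q = (\<Sum>k<K. w k * (d k)\<^sup>2)"
  have Q0: "0 \<le> Q" unfolding Q_def by (intro sum_nonneg mult_nonneg_nonneg w) simp
  have n0: "0 \<le> (LINT \<tau>|M. n \<tau>)" by (intro Bochner_Integration.integral_nonneg) (use le in auto)
  have "Q = (\<Sum>k<K. (LINT \<tau>|M. w k * d k * e k \<tau>))"
    unfolding Q_def by (intro sum.cong refl) (simp add: d_def power2_eq_square mult.assoc)
  also have "\<dots> = (LINT \<tau>|M. (\<Sum>k<K. w k * d k * e k \<tau>))"
    by (intro Bochner_Integration.integral_sum[symmetric] integrable_mult_right e)
  also have "\<dots> \<le> (LINT \<tau>|M. sqrt Q * n \<tau>)"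
  proof (rule integral_mono)
    show "integrable M (\<lambda>\<tau>. \<Sum>k<K. w k * d k * e k \<tau>)"
      by (intro Bochner_Integration.integrable_sum integrable_mult_right e)
    show "integrable M (\<lambda>\<tau>. sqrt Q * n \<tau>)" by (intro integrable_mult_right n)
    fix \<tau> assume \<tau>: "\<tau> \<in> space M"
    have "(\<Sum>k<K. w k * d k * e k \<tau>)\<^sup>2 = (\<Sum>k<K. (sqrt (w k) * d k) * (sqrt (w k) * e k \<tau>))\<^sup>2"
    proof (intro arg_cong[where f="\<lambda>x. x\<^sup>2"] sum.cong refl)
      fix k
      have "(sqrt (w k) * d k) * (sqrt (w k) * e k \<tau>) = (sqrt (w k) * sqrt (w k)) * d k * e k \<tau>"
        by (simp only: mult_ac)
      then show "w k * d k * e k \<tau> = (sqrt (w k) * d k) * (sqrt (w k) * e k \<tau>)" using w by simp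
    qed
    also have "\<dots> \<le> (\<Sum>k<K. (sqrt (w k) * d k)\<^sup>2) * (\<Sum>k<K. (sqrt (w k) * e k \<tau>)\<^sup>2)"
      by (rule Cauchy_Schwarz_ineq_sum)
    also have "\<dots> = Q * (\<Sum>k<K. w k * (e k \<tau>)\<^sup>2)"
      using w by (simp add: Q_def power_mult_distrib)
    also have "\<dots> \<le> Q * (n \<tau>)\<^sup>2" using le[OF \<tau>] by (intro mult_left_mono Q0) simp
    also have "\<dots> = (sqrt Q * n \<tau>)\<^sup>2" using Q0 by (simp add: power_mult_distrib)
    finally have "\<bar>\<Sum>k<K. w k * d k * e k \<tau>\<bar> \<le> \<bar>sqrt Q * n \<tau>\<bar>" by (simp only: abs_le_square_iff)
    then show "(\<Sum>k<K. w k * d k * e k \<tau>) \<le> sqrt Q * n \<tau>" using le[OF \<tau>] Q0 by simp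
  qed
  also have "\<dots> = sqrt Q * (LINT \<tau>|M. n \<tau>)" by simp
  finally have QQ: "Q \<le> sqrt Q * (LINT \<tau>|M. n \<tau>)" .
  have "sqrt Q \<le> (LINT \<tau>|M. n \<tau>)"
  proof (cases "Q = 0")
    case False
    then have "0 < sqrt Q" using Q0 by simp
    moreover have "sqrt Q * sqrt Q \<le> sqrt Q * (LINT \<tau>|M. n \<tau>)" using QQ Q0 by simp
    ultimately show ?thesis by (simp only: mult_le_cancel_left_pos)
  qed (use n0 in simp)
  then have "(sqrt Q)\<^sup>2 \<le> (LINT \<tau>|M. n \<tau>)\<^sup>2" using Q0 by (intro power_mono) auto
  then show ?thesis using Q0 by (simp add: Q_def d_def)
qed

lemma finite_measure_lebesgue_on_interval: "finite_measure (lebesgue_on {0<..<t::real})"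
  by (rule finite_measure_lebesgue_on) simp

lemma measurable_lebesgue_on_borel:
  "f \<in> borel \<rightarrow>\<^sub>M N \<Longrightarrow> f \<in> lebesgue_on S \<rightarrow>\<^sub>M N" for f :: "real \<Rightarrow> 'b"
proof -
  assume "f \<in> borel \<rightarrow>\<^sub>M N"
  then have "f \<in> lborel \<rightarrow>\<^sub>M N" by simp
  then have "f \<in> lebesgue \<rightarrow>\<^sub>M N" by (rule measurable_completion)
  then show ?thesis by (rule measurable_restrict_space1)
qed

lemma lebesgue_on_interval_integral:
  fixes f :: "real \<Rightarrow> real"
  assumes f: "f \<in> borel_measurable borel"
  shows "integrable (lebesgue_on {0<..<t}) f \<longleftrightarrow> integrable lborel (\<lambda>\<tau>. indicator {0<..<t} \<tau> * f \<tau>)"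
    "(LINT \<tau>|lebesgue_on {0<..<t}. f \<tau>) = (LINT \<tau>|lborel. indicator {0<..<t} \<tau> * f \<tau>)"
proof -
  have m: "(\<lambda>\<tau>. indicator {0<..<t} \<tau> * f \<tau>) \<in> borel_measurable lborel" using f by simp
  show "integrable (lebesgue_on {0<..<t}) f \<longleftrightarrow> integrable lborel (\<lambda>\<tau>. indicator {0<..<t} \<tau> * f \<tau>)"
    using integrable_completion[OF m] by (subst integrable_restrict_space) simp_all
  show "(LINT \<tau>|lebesgue_on {0<..<t}. f \<tau>) = (LINT \<tau>|lborel. indicator {0<..<t} \<tau> * f \<tau>)"
    using integral_completion[OF m] by (subst integral_restrict_space) simp_all
qed

context dirichlet_domain
begin

lemma simple_integral_coeff:
  assumes "finite_measure M" and s: "simple_function M s" "s ` space M \<subseteq> D1"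
  shows "simple_integral_fun M s \<in> D1" "integrable M (\<lambda>\<tau>. cf (s \<tau>) k)"
    "cf (simple_integral_fun M s) k = (LINT \<tau>|M. cf (s \<tau>) k)"
proof -
  have fin: "finite (s ` space M)" using simple_functionD[OF s(1)] by auto
  have "y \<in> D1" if "y \<in> s ` space M" for y using that s(2) by blast
  note D = D1_sum[OF fin this, of "\<lambda>y. measure M (s -` {y} \<inter> space M)"]
  show "simple_integral_fun M s \<in> D1" using D by (simp add: simple_integral_fun_def)
  show "integrable M (\<lambda>\<tau>. cf (s \<tau>) k)" by (rule integral_simple_composition(1)[OF assms(1) s(1)])
  show "cf (simple_integral_fun M s) k = (LINT \<tau>|M. cf (s \<tau>) k)"
    using D by (simp add: simple_integral_fun_def integral_simple_composition(2)[OF assms(1) s(1), of "\<lambda>y. cf y k"])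
qed

text \<open>Coefficient functionals are bounded on \<open>D1\<close>, so they pass through both
  limits of the definition: that of the simple integrals towards I and that of the integrands in
  mean.\<close>

lemma bochner_integral_coeff:
  assumes M: "finite_measure M" and I: "has_bochner_integral_in D1 N1 M F I"
    and int: "integrable M (\<lambda>\<tau>. cf (F \<tau>) k)"
  shows "cf I k = (LINT \<tau>|M. cf (F \<tau>) k)"
proof -
  obtain s where ID: "I \<in> D1" and FD: "\<And>\<tau>. \<tau> \<in> space M \<Longrightarrow> F \<tau> \<in> D1"
    and s: "\<And>i. simple_function M (s i)" "\<And>i. s i ` space M \<subseteq> D1"
    and m: "\<And>i. (\<lambda>\<tau>. N1 (\<lambda>x. F \<tau> x - s i \<tau> x)) \<in> borel_measurable M"
    and lim1: "(\<lambda>i. \<integral>\<^sup>+ \<tau>. ennreal (N1 (\<lambda>x. F \<tau> x - s i \<tau> x)) \<partial>M) \<longlonglongrightarrow> 0"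
    and lim2: "(\<lambda>i. N1 (\<lambda>x. simple_integral_fun M (s i) x - I x)) \<longlonglongrightarrow> 0"
    using I unfolding has_bochner_integral_in_def by blast
  note S = simple_integral_coeff[OF M s]
  define c where "c = 1 / sqrt (\<theta> k)"
  have c: "0 \<le> c" using theta_pos[of k] by (simp add: c_def)
  have "(\<lambda>i. cf (simple_integral_fun M (s i)) k - cf I k) \<longlonglongrightarrow> 0"
  proof (rule Lim_null_comparison)
    show "\<forall>\<^sub>F i in sequentially. norm (cf (simple_integral_fun M (s i)) k - cf I k) \<le> N1 (\<lambda>x. simple_integral_fun M (s i) x - I x) / sqrt (\<theta> k)"
    proof (rule always_eventually, rule allI)
      fix i
      show "norm (cf (simple_integral_fun M (s i)) k - cf I k) \<le> N1 (\<lambda>x. simple_integral_fun M (s i) x - I x) / sqrt (\<theta> k)"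
        using abs_cf_le_N1[OF D1_diff(1)[OF S(1)[of i] ID], of k]
        by (simp add: L2_inner_diff_left D1_L2 S(1) ID phi_L2)
    qed
    show "(\<lambda>i. N1 (\<lambda>x. simple_integral_fun M (s i) x - I x) / sqrt (\<theta> k)) \<longlonglongrightarrow> 0"
      using tendsto_divide_zero[OF lim2] .
  qed
  then have 1: "(\<lambda>i. cf (simple_integral_fun M (s i)) k) \<longlonglongrightarrow> cf I k" by (rule LIM_zero_cancel)
  have "(\<lambda>i. ennreal (norm ((LINT \<tau>|M. cf (F \<tau>) k) - cf (simple_integral_fun M (s i)) k))) \<longlonglongrightarrow> 0"
  proof (rule tendsto_sandwich[OF _ _ tendsto_const])
    have "(\<lambda>i. ennreal c * (\<integral>\<^sup>+ \<tau>. ennreal (N1 (\<lambda>x. F \<tau> x - s i \<tau> x)) \<partial>M)) \<longlonglongrightarrow> ennreal c * 0"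
      by (rule ennreal_tendsto_cmult[OF _ lim1]) simp
    then show "(\<lambda>i. ennreal c * (\<integral>\<^sup>+ \<tau>. ennreal (N1 (\<lambda>x. F \<tau> x - s i \<tau> x)) \<partial>M)) \<longlonglongrightarrow> 0" by simp
    show "\<forall>\<^sub>F i in sequentially. ennreal (norm ((LINT \<tau>|M. cf (F \<tau>) k) - cf (simple_integral_fun M (s i)) k))
       \<le> ennreal c * (\<integral>\<^sup>+ \<tau>. ennreal (N1 (\<lambda>x. F \<tau> x - s i \<tau> x)) \<partial>M)"
    proof (rule always_eventually, rule allI)
      fix i
      have "(LINT \<tau>|M. cf (F \<tau>) k) - cf (simple_integral_fun M (s i)) k = (LINT \<tau>|M. cf (F \<tau>) k - cf (s i \<tau>) k)"
        by (simp add: S int)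
      then have "ennreal (norm ((LINT \<tau>|M. cf (F \<tau>) k) - cf (simple_integral_fun M (s i)) k))
         \<le> (\<integral>\<^sup>+ \<tau>. ennreal (norm (cf (F \<tau>) k - cf (s i \<tau>) k)) \<partial>M)"
        using integral_norm_bound_ennreal[of M "\<lambda>\<tau>. cf (F \<tau>) k - cf (s i \<tau>) k"] S(2) int by simp
      also have "\<dots> \<le> (\<integral>\<^sup>+ \<tau>. ennreal c * ennreal (N1 (\<lambda>x. F \<tau> x - s i \<tau> x)) \<partial>M)"
      proof (rule nn_integral_mono)
        fix \<tau> assume \<tau>: "\<tau> \<in> space M"
        have sD: "s i \<tau> \<in> D1" using s(2)[of i] \<tau> by blast
        have "norm (cf (F \<tau>) k - cf (s i \<tau>) k) \<le> c * N1 (\<lambda>x. F \<tau> x - s i \<tau> x)"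
          using abs_cf_le_N1[OF D1_diff(1)[OF FD[OF \<tau>] sD], of k]
          by (simp add: L2_inner_diff_left D1_L2 FD[OF \<tau>] sD phi_L2 c_def)
        then show "ennreal (norm (cf (F \<tau>) k - cf (s i \<tau>) k)) \<le> ennreal c * ennreal (N1 (\<lambda>x. F \<tau> x - s i \<tau> x))"
          using c N1_nonneg[OF D1_diff(1)[OF FD[OF \<tau>] sD]] by (simp add: ennreal_leI flip: ennreal_mult)
      qed
      also have "\<dots> = ennreal c * (\<integral>\<^sup>+ \<tau>. ennreal (N1 (\<lambda>x. F \<tau> x - s i \<tau> x)) \<partial>M)"
        by (rule nn_integral_cmult) (use m in simp)
      finally show "ennreal (norm ((LINT \<tau>|M. cf (F \<tau>) k) - cf (simple_integral_fun M (s i)) k))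
         \<le> ennreal c * (\<integral>\<^sup>+ \<tau>. ennreal (N1 (\<lambda>x. F \<tau> x - s i \<tau> x)) \<partial>M)" .
    qed
  qed simp
  then have "(\<lambda>i. norm ((LINT \<tau>|M. cf (F \<tau>) k) - cf (simple_integral_fun M (s i)) k)) \<longlonglongrightarrow> 0"
    using tendsto_ennreal_iff[where F=sequentially and f="\<lambda>i. norm ((LINT \<tau>|M. cf (F \<tau>) k) - cf (simple_integral_fun M (s i)) k)" and x=0] by simp
  then have "(\<lambda>i. (LINT \<tau>|M. cf (F \<tau>) k) - cf (simple_integral_fun M (s i)) k) \<longlonglongrightarrow> 0"
    by (rule tendsto_norm_zero_cancel)
  then have "(\<lambda>i. (LINT \<tau>|M. cf (F \<tau>) k) - ((LINT \<tau>|M. cf (F \<tau>) k) - cf (simple_integral_fun M (s i)) k)) \<longlonglongrightarrow> (LINT \<tau>|M. cf (F \<tau>) k) - 0"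
    by (intro tendsto_diff tendsto_const)
  then have "(\<lambda>i. cf (simple_integral_fun M (s i)) k) \<longlonglongrightarrow> (LINT \<tau>|M. cf (F \<tau>) k)" by simp
  with 1 show ?thesis by (rule LIMSEQ_unique)
qed

end

context dirichlet_domain
begin

text \<open>A function that is continuous on \<open>[0, t)\<close> with an integrable singularity at \<open>t\<close> is approximated by
  step functions on a uniform grid that vanish near \<open>t\<close>; since they take values at earlier times, they
  are dominated by a multiple of the singularity.\<close>
lemma bochner_integral_exists:
  assumes \<alpha>: "0 < \<alpha>" "\<alpha> < 1" and t: "0 \<le> t" and M: "0 \<le> M"
    and z: "continuous_on {0..<t} z" "\<And>\<tau>. 0 \<le> \<tau> \<Longrightarrow> \<tau> < t \<Longrightarrow> norm (z \<tau>) \<le> M * (t - \<tau>) powr (\<alpha> - 1)"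
    and zm: "\<And>k. (\<lambda>\<tau>. coord (z \<tau>) k) \<in> borel_measurable borel"
    and F: "\<And>\<tau>. 0 < \<tau> \<Longrightarrow> \<tau> < t \<Longrightarrow> F \<tau> = dec (z \<tau>)"
    and I: "I \<in> D1" "\<And>k. coord (enc I) k = (LINT \<tau>|lebesgue_on {0<..<t}. coord (z \<tau>) k)"
  shows "has_bochner_integral_in D1 N1 (lebesgue_on {0<..<t}) F I"
proof -
  let ?L = "lebesgue_on {0<..<t}"
  have fm: "finite_measure ?L" by (rule finite_measure_lebesgue_on_interval)
  have sp: "space ?L = {0<..<t}" by simp
  \<comment> \<open>The index of the grid cell of \<tau>; -1 marks the times close to t and those
    outside (0, t), where the step function is 0. A finite integer range makes the step function
    simple, and its measurability is that of the floor function.\<close>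
  define j where "j = (\<lambda>(n::nat) \<tau>. if \<tau> < t - t / real (Suc n) \<and> 0 < \<tau> \<and> \<tau> < t then \<lfloor>\<tau> * real (Suc n) / t\<rfloor> else - 1)"
  define q where "q = (\<lambda>(n::nat) (i::int). if i < 0 then 0 else z (t / real (Suc n) * real_of_int i))"
  define s where "s = (\<lambda>n \<tau>. dec (q n (j n \<tau>)))"
  have jb: "j n \<tau> \<in> {- 1..int (Suc n)}" for n \<tau>
  proof (cases "\<tau> < t - t / real (Suc n) \<and> 0 < \<tau> \<and> \<tau> < t")
    case True
    then have "0 \<le> \<tau> * real (Suc n) / t" "\<tau> * real (Suc n) / t \<le> real (Suc n)"
      by (auto simp: divide_le_eq mult.commute)
    then have "0 \<le> \<lfloor>\<tau> * real (Suc n) / t\<rfloor>" "\<lfloor>\<tau> * real (Suc n) / t\<rfloor> \<le> int (Suc n)"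
      by linarith+
    then have "- 1 \<le> \<lfloor>\<tau> * real (Suc n) / t\<rfloor>" "\<lfloor>\<tau> * real (Suc n) / t\<rfloor> \<le> int (Suc n)"
      by linarith+
    moreover have "j n \<tau> = \<lfloor>\<tau> * real (Suc n) / t\<rfloor>" using True unfolding j_def by (rule if_P)
    ultimately show ?thesis by (simp only: atLeastAtMost_iff)
  qed (auto simp: j_def)
  have jm: "j n \<in> ?L \<rightarrow>\<^sub>M count_space UNIV" for n
    unfolding j_def by (rule measurable_lebesgue_on_borel) measurable
  have js: "simple_function ?L (j n)" for n
    unfolding simple_function_eq_measurable
    using jm jb by (auto intro: finite_subset[of _ "{- 1..int (Suc n)}"])
  have ss: "simple_function ?L (s n)" for n
    unfolding s_def using simple_function_compose1[OF js, of "\<lambda>i. dec (q n i)" n] .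
  have sD: "s n \<tau> \<in> D1" for n \<tau> unfolding s_def by (rule dec_props)
  have FD: "F \<tau> \<in> D1" if "\<tau> \<in> space ?L" for \<tau> using that by (simp add: F dec_props)
  define e where "e = (\<lambda>n \<tau>. z \<tau> - q n (j n \<tau>))"
  have enc_e: "enc (\<lambda>x. F \<tau> x - s n \<tau> x) = e n \<tau>" if "\<tau> \<in> space ?L" for n \<tau>
    using that D1_diff(2)[OF FD sD] by (simp add: F s_def e_def enc_dec)
  have dD: "(\<lambda>x. F \<tau> x - s n \<tau> x) \<in> D1" if "\<tau> \<in> space ?L" for n \<tau>
    by (rule D1_diff(1)[OF FD[OF that] sD])
  \<comment> \<open>The norm of the error as a formula in its coordinates, from which measurability
    can be read off.\<close>
  define nn where "nn = (\<lambda>n \<tau>. sqrt (\<Sum>k. \<theta> k * (coord (e n \<tau>) k / sqrt (1 + \<theta> k))\<^sup>2))"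
  have nn_eq: "N1 (\<lambda>x. F \<tau> x - s n \<tau> x) = nn n \<tau>" if "\<tau> \<in> space ?L" for n \<tau>
    unfolding N1_eq nn_def cf_eq_coord_enc[OF dD[OF that]] enc_e[OF that] ..
  have qm: "(\<lambda>\<tau>. coord (q n (j n \<tau>)) k) \<in> borel_measurable ?L" for n k
    using measurable_compose[OF jm[of n], of "\<lambda>i. coord (q n i) k" borel] by simp
  have em: "(\<lambda>\<tau>. coord (e n \<tau>) k) \<in> borel_measurable ?L" for n k
    unfolding e_def coord_minus
    by (intro borel_measurable_diff qm measurable_lebesgue_on_borel zm)
  have nnm: "nn n \<in> borel_measurable ?L" for n
    unfolding nn_def using em[of n, measurable] by measurable
  have Nm: "(\<lambda>\<tau>. N1 (\<lambda>x. F \<tau> x - s n \<tau> x)) \<in> borel_measurable ?L" for n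
    using nnm[of n] by (subst measurable_cong[OF nn_eq]) auto
  have nn_le: "nn n \<tau> \<le> norm (e n \<tau>)" if "\<tau> \<in> space ?L" for n \<tau>
    using N1_le_norm_enc[OF dD[OF that], of n] by (simp add: nn_eq[OF that] enc_e[OF that])
  have nn0: "0 \<le> nn n \<tau>" if "\<tau> \<in> space ?L" for n \<tau>
    using N1_nonneg[OF dD[OF that], of n] by (simp add: nn_eq[OF that])
  \<comment> \<open>One M is for z(\<tau>), the other for the value at a grid point \<rho> \<le>
    \<tau>, where the singularity is weaker.\<close>
  define W where "W = (\<lambda>\<tau>. 2 * M * (t - \<tau>) powr (\<alpha> - 1))"
  have qz: "\<exists>\<rho>. 0 \<le> \<rho> \<and> \<rho> \<le> \<tau> \<and> \<bar>\<rho> - \<tau>\<bar> \<le> t / real (Suc n) \<and> q n (j n \<tau>) = z \<rho>"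
    if \<tau>: "\<tau> \<in> space ?L" and le: "\<tau> < t - t / real (Suc n)" for n \<tau>
  proof -
    define \<rho> where "\<rho> = t / real (Suc n) * real_of_int \<lfloor>\<tau> * real (Suc n) / t\<rfloor>"
    have \<tau>': "0 < \<tau>" "\<tau> < t" "0 < t" using \<tau> by auto
    have x0: "0 \<le> \<lfloor>\<tau> * real (Suc n) / t\<rfloor>" using \<tau>' by simp
    have st: "0 < t / real (Suc n)" using \<tau>' by simp
    have "\<rho> \<le> t / real (Suc n) * (\<tau> * real (Suc n) / t)"
      unfolding \<rho>_def by (intro mult_left_mono) (use st in auto)
    then have le': "\<rho> \<le> \<tau>" using \<tau>' by simp
    have "t / real (Suc n) * (\<tau> * real (Suc n) / t - 1) \<le> \<rho>"
      unfolding \<rho>_def by (intro mult_left_mono) (use st in linarith)+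
    then have ge: "\<tau> - t / real (Suc n) \<le> \<rho>" using \<tau>' by (simp add: right_diff_distrib)
    have "0 \<le> \<rho>" unfolding \<rho>_def using st x0 by (intro mult_nonneg_nonneg) auto
    moreover have "j n \<tau> = \<lfloor>\<tau> * real (Suc n) / t\<rfloor>" unfolding j_def using le \<tau>' by (intro if_P) blast
    then have "q n (j n \<tau>) = z \<rho>" using x0 unfolding q_def \<rho>_def by (simp only: not_less[symmetric] if_False)
    moreover have "\<bar>\<rho> - \<tau>\<bar> \<le> t / real (Suc n)" using le' ge by linarith
    ultimately show ?thesis using le' by blast
  qed
  have q0: "q n (j n \<tau>) = 0" if "\<not> \<tau> < t - t / real (Suc n)" for n \<tau>
    using that by (simp add: q_def j_def)
  have e_le: "norm (e n \<tau>) \<le> W \<tau>" if \<tau>: "\<tau> \<in> space ?L" for n \<tau>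
  proof -
    have \<tau>': "0 < \<tau>" "\<tau> < t" using \<tau> by auto
    have zt: "norm (z \<tau>) \<le> M * (t - \<tau>) powr (\<alpha> - 1)" using \<tau>' by (intro z) auto
    have "norm (q n (j n \<tau>)) \<le> M * (t - \<tau>) powr (\<alpha> - 1)"
    proof (cases "\<tau> < t - t / real (Suc n)")
      case True
      then obtain \<rho> where \<rho>: "0 \<le> \<rho>" "\<rho> \<le> \<tau>" "q n (j n \<tau>) = z \<rho>" using qz[OF \<tau>] by blast
      have "norm (z \<rho>) \<le> M * (t - \<rho>) powr (\<alpha> - 1)" using \<rho> \<tau>' by (intro z) auto
      also have "\<dots> \<le> M * (t - \<tau>) powr (\<alpha> - 1)"
        using \<rho> \<tau>' \<alpha> by (intro mult_left_mono M powr_mono2') auto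
      finally show ?thesis by (simp add: \<rho>)
    qed (use M q0 in simp)
    then show ?thesis using zt norm_triangle_ineq4[of "z \<tau>" "q n (j n \<tau>)"] by (simp add: W_def e_def)
  qed
  have Wm: "W \<in> borel_measurable borel" unfolding W_def by measurable
  have Wint: "integrable ?L W"
  proof (cases "0 < t")
    case True
    have "integrable lborel (\<lambda>\<sigma>. indicator {0<..<t} \<sigma> * ml_kernel \<alpha> 0 \<alpha> (t - \<sigma>))"
      using has_bochner_integral_ml_kernel[OF \<alpha> \<alpha>(1) True] by (simp add: has_bochner_integral_iff)
    then have "integrable lborel (\<lambda>\<tau>. 2 * M * Gamma \<alpha> * (indicator {0<..<t} \<tau> * pow_kernel \<alpha> (t - \<tau>)))"
      unfolding pow_kernel_eq_ml_kernel[OF \<alpha> \<alpha>(1)] by (rule integrable_mult_right)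
    moreover have "(\<lambda>\<tau>. 2 * M * Gamma \<alpha> * (indicator {0<..<t} \<tau> * pow_kernel \<alpha> (t - \<tau>))) = (\<lambda>\<tau>. indicator {0<..<t} \<tau> * W \<tau>)"
      using less_imp_neq[OF Gamma_real_pos[OF \<alpha>(1)]] by (auto simp: fun_eq_iff W_def pow_kernel_def)
    ultimately show ?thesis using lebesgue_on_interval_integral(1)[OF Wm, of t] by simp
  next
    case False
    then show ?thesis using lebesgue_on_interval_integral(1)[OF Wm, of t] by simp
  qed
  have nn_int: "integrable ?L (nn n)" for n
    by (rule Bochner_Integration.integrable_bound[OF Wint nnm])
      (intro AE_I2, use nn_le e_le nn0 in \<open>fastforce intro: order_trans\<close>)
  have "(\<lambda>n. LINT \<tau>|?L. nn n \<tau>) \<longlonglongrightarrow> (LINT \<tau>|?L. 0)"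
  proof (rule integral_dominated_convergence[OF _ nnm Wint])
    show "AE \<tau> in ?L. norm (nn n \<tau>) \<le> W \<tau>" for n
    proof (rule AE_I2)
      fix \<tau> assume "\<tau> \<in> space ?L"
      then show "norm (nn n \<tau>) \<le> W \<tau>" using nn_le[of \<tau> n] e_le[of \<tau> n] nn0[of \<tau> n] by simp
    qed
    show "AE \<tau> in ?L. (\<lambda>n. nn n \<tau>) \<longlonglongrightarrow> 0"
    proof (rule AE_I2)
      fix \<tau> assume \<tau>: "\<tau> \<in> space ?L"
      then have \<tau>': "0 < \<tau>" "\<tau> < t" by auto
      show "(\<lambda>n. nn n \<tau>) \<longlonglongrightarrow> 0"
      proof (rule LIMSEQ_I)
        fix r :: real assume r: "0 < r"
        obtain d where d: "0 < d" "\<And>\<rho>. \<rho> \<in> {0..<t} \<Longrightarrow> dist \<rho> \<tau> < d \<Longrightarrow> dist (z \<rho>) (z \<tau>) < r"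
          using z(1) \<tau>' r unfolding continuous_on_iff by fastforce
        have "(\<lambda>n. t * inverse (real (Suc n))) \<longlonglongrightarrow> t * 0"
          by (intro tendsto_intros LIMSEQ_inverse_real_of_nat)
        then have "\<forall>\<^sub>F n in sequentially. t * inverse (real (Suc n)) < min d (t - \<tau>)"
          by (rule order_tendstoD) (use d \<tau>' in simp)
        then obtain N where N: "\<And>n. n \<ge> N \<Longrightarrow> t / real (Suc n) < d \<and> t / real (Suc n) < t - \<tau>"
          by (auto simp: eventually_sequentially divide_inverse)
        have "norm (nn n \<tau> - 0) < r" if "n \<ge> N" for n
        proof -
          have "norm (e n \<tau>) < r"
          proof -
            have "\<tau> < t - t / real (Suc n)" using N[OF that] by linarith
            then obtain \<rho> where \<rho>: "0 \<le> \<rho>" "\<rho> \<le> \<tau>" "\<bar>\<rho> - \<tau>\<bar> \<le> t / real (Suc n)" "q n (j n \<tau>) = z \<rho>"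
              using qz[OF \<tau>] by blast
            then have "dist (z \<rho>) (z \<tau>) < r" using N[OF that] \<tau>' by (intro d(2)) (auto simp: dist_real_def)
            then show ?thesis by (simp add: e_def \<rho>(4) dist_norm norm_minus_commute)
          qed
          then show ?thesis using nn_le[OF \<tau>, of n] nn0[OF \<tau>, of n] by simp
        qed
        then show "\<exists>no. \<forall>n\<ge>no. norm (nn n \<tau> - 0) < r" by blast
      qed
    qed
  qed simp
  then have nn_lim: "(\<lambda>n. LINT \<tau>|?L. nn n \<tau>) \<longlonglongrightarrow> 0" by simp
  show ?thesis
    unfolding has_bochner_integral_in_def
  proof (intro conjI ballI exI[of _ s] allI)
    show "I \<in> D1" by (rule I)
    show "F \<tau> \<in> D1" if "\<tau> \<in> space ?L" for \<tau> by (rule FD[OF that])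
    show "simple_function ?L (s n)" for n by (rule ss)
    show "s n ` space ?L \<subseteq> D1" for n using sD by blast
    show "(\<lambda>\<tau>. N1 (\<lambda>x. F \<tau> x - s n \<tau> x)) \<in> borel_measurable ?L" for n by (rule Nm)
    have "(\<integral>\<^sup>+ \<tau>. ennreal (N1 (\<lambda>x. F \<tau> x - s n \<tau> x)) \<partial>?L) = ennreal (LINT \<tau>|?L. nn n \<tau>)" for n
    proof -
      have "(\<integral>\<^sup>+ \<tau>. ennreal (N1 (\<lambda>x. F \<tau> x - s n \<tau> x)) \<partial>?L) = (\<integral>\<^sup>+ \<tau>. ennreal (nn n \<tau>) \<partial>?L)"
        by (intro nn_integral_cong) (simp only: nn_eq)
      also have "\<dots> = ennreal (LINT \<tau>|?L. nn n \<tau>)"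
        by (rule nn_integral_eq_integral[OF nn_int AE_I2]) (rule nn0)
      finally show ?thesis .
    qed
    then show "(\<lambda>n. \<integral>\<^sup>+ \<tau>. ennreal (N1 (\<lambda>x. F \<tau> x - s n \<tau> x)) \<partial>?L) \<longlonglongrightarrow> 0"
      using tendsto_ennrealI[OF nn_lim] by simp
    note S = simple_integral_coeff[OF fm ss, OF image_subsetI[OF sD]]
    have zint: "integrable ?L (\<lambda>\<tau>. coord (z \<tau>) k)" for k
    proof (rule Bochner_Integration.integrable_bound[OF Wint measurable_lebesgue_on_borel[OF zm]], rule AE_I2)
      fix \<tau> assume "\<tau> \<in> space ?L"
      then have \<tau>': "0 < \<tau>" "\<tau> < t" by auto
      have "\<bar>coord (z \<tau>) k\<bar> \<le> M * (t - \<tau>) powr (\<alpha> - 1)"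
        using abs_coord_le_norm[of "z \<tau>" k] z(2)[of \<tau>] \<tau>' by simp
      then show "norm (coord (z \<tau>) k) \<le> norm (W \<tau>)"
        using M by (simp add: W_def)
    qed
    show "(\<lambda>n. N1 (\<lambda>x. simple_integral_fun ?L (s n) x - I x)) \<longlonglongrightarrow> 0"
    proof (rule tendsto_zero_squeeze[OF nn_lim])
      fix n
      have D: "(\<lambda>x. simple_integral_fun ?L (s n) x - I x) \<in> D1" by (rule D1_diff(1)[OF S(1) I(1)])
      show "0 \<le> N1 (\<lambda>x. simple_integral_fun ?L (s n) x - I x)" by (rule N1_nonneg[OF D])
      define ek where "ek = (\<lambda>k \<tau>. cf (s n \<tau>) k - coord (z \<tau>) k / sqrt (1 + \<theta> k))"
      have ek_int: "integrable ?L (ek k)" for k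
        unfolding ek_def by (intro Bochner_Integration.integrable_diff S(2) integrable_divide_zero zint)
      have cfD: "cf (\<lambda>x. simple_integral_fun ?L (s n) x - I x) k = (LINT \<tau>|?L. ek k \<tau>)" for k
      proof -
        have "cf I k = (LINT \<tau>|?L. coord (z \<tau>) k / sqrt (1 + \<theta> k))"
          by (simp add: cf_eq_coord_enc I)
        then show ?thesis
          unfolding ek_def
          by (simp add: L2_inner_diff_left D1_L2 S(1) I(1) phi_L2 S(3) S(2) zint)
      qed
      \<comment> \<open>Minkowski: the norm of the integrated error is at most the integral of the
        norm of the error.\<close>
      show "N1 (\<lambda>x. simple_integral_fun ?L (s n) x - I x) \<le> (LINT \<tau>|?L. nn n \<tau>)"
      proof (rule N1_leI[OF D])
        show "0 \<le> (LINT \<tau>|?L. nn n \<tau>)" by (rule Bochner_Integration.integral_nonneg) (rule nn0)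
        fix K
        show "(\<Sum>k<K. \<theta> k * (cf (\<lambda>x. simple_integral_fun ?L (s n) x - I x) k)\<^sup>2) \<le> (LINT \<tau>|?L. nn n \<tau>)\<^sup>2"
          unfolding cfD
        proof (rule Minkowski_sequence[OF less_imp_le[OF theta_pos] ek_int nn_int])
          fix \<tau> assume \<tau>: "\<tau> \<in> space ?L"
          have "(ek k \<tau>)\<^sup>2 = (cf (\<lambda>x. F \<tau> x - s n \<tau> x) k)\<^sup>2" for k
          proof -
            have "cf (\<lambda>x. F \<tau> x - s n \<tau> x) k = - ek k \<tau>"
              using \<tau> by (simp add: L2_inner_diff_left D1_L2 FD sD phi_L2 ek_def F dec_props)
            then show ?thesis by simp
          qed
          then have "(\<Sum>k<K. \<theta> k * (ek k \<tau>)\<^sup>2) \<le> (N1 (\<lambda>x. F \<tau> x - s n \<tau> x))\<^sup>2"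
            using N1_partial_le[OF dD[OF \<tau>], of n K] by simp
          then show "0 \<le> nn n \<tau> \<and> (\<Sum>k<K. \<theta> k * (ek k \<tau>)\<^sup>2) \<le> (nn n \<tau>)\<^sup>2"
            using nn0[OF \<tau>] by (simp add: nn_eq[OF \<tau>])
        qed
      qed
    qed
  qed
qed

end

subsection \<open>Mild solutions as solutions of a fractional differential equation\<close>

text \<open>Coordinates are inner products with unit vectors, so \<open>frac_int_inner\<close>
  applies to them.\<close>

lemma ell2_unit_inner: "Abs_ell2 (\<lambda>j. if j = k then 1 else 0) \<bullet> y = coord y k"
proof -
  let ?e = "Abs_ell2 (\<lambda>j. if j = k then 1 else 0)"
  have "summable (\<lambda>j. (if j = k then 1 else 0 :: real)\<^sup>2)" by (rule summable_finite[of "{k}"]) auto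
  then have c: "coord ?e j = (if j = k then 1 else 0)" for j by (rule coord_Abs_ell2)
  have "(\<lambda>j. coord ?e j * coord y j) = (\<lambda>j. if j = k then coord y j else 0)" by (auto simp: c)
  then have "(\<lambda>j. coord ?e j * coord y j) sums coord y k" using sums_single[of k "\<lambda>j. coord y j"] by simp
  with inner_ell2_sums show ?thesis by (rule sums_unique2)
qed

lemma abs_mittag_leffler_le:
  assumes \<alpha>: "0 < \<alpha>" "\<alpha> < 1" and \<zeta>: "0 < \<zeta>" and z: "\<bar>z\<bar> \<le> x"
  shows "\<bar>mittag_leffler \<alpha> \<zeta> z\<bar> \<le> mittag_leffler \<alpha> \<zeta> x"
proof -
  have G: "0 < Gamma (\<alpha> * real k + \<zeta>)" for k using \<alpha> \<zeta> by (intro Gamma_real_pos add_nonneg_pos) auto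
  have n: "norm (z ^ k / Gamma (\<alpha> * real k + \<zeta>)) \<le> x ^ k / Gamma (\<alpha> * real k + \<zeta>)" for k
    using G[of k] power_mono[OF z, of k] by (simp add: power_abs divide_right_mono)
  show ?thesis
    unfolding mittag_leffler_def
    using norm_suminf_le[OF n summable_mittag_leffler[OF \<alpha> \<zeta>]] by simp
qed

text \<open>A crude bound, uniform in \<kappa> between 0 and 1: on a bounded time interval the
  Mittag-Leffler factor is dominated by its series with all signs positive.\<close>

lemma abs_ml_kernel_le:
  assumes \<alpha>: "0 < \<alpha>" "\<alpha> < 1" and \<kappa>: "0 \<le> \<kappa>" "\<kappa> \<le> 1" and s: "0 < s" "s \<le> T"
  shows "\<bar>ml_kernel \<alpha> \<kappa> \<alpha> s\<bar> \<le> s powr (\<alpha> - 1) * mittag_leffler \<alpha> \<alpha> (T powr \<alpha>)"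
proof -
  have "\<kappa> * s powr \<alpha> \<le> 1 * T powr \<alpha>" using \<alpha> \<kappa> s by (intro mult_mono powr_mono2) auto
  then have "\<bar>mittag_leffler \<alpha> \<alpha> (- \<kappa> * s powr \<alpha>)\<bar> \<le> mittag_leffler \<alpha> \<alpha> (T powr \<alpha>)"
    using \<kappa> by (intro abs_mittag_leffler_le \<alpha>) (simp add: abs_mult)
  then show ?thesis by (simp add: ml_kernel_def abs_mult mult_left_mono)
qed

text \<open>Uniform continuity on the compact set [s/2, 2s] x [0, 1] gives one modulus for all
  \<kappa>, hence for all modes, since \<open>lam\<close> takes values in [0, 1].\<close>

lemma ml_kernel_equicontinuous:
  assumes \<alpha>: "0 < \<alpha>" "\<alpha> < 1" and s: "0 < s" and \<epsilon>: "0 < \<epsilon>"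
  shows "\<exists>\<delta>>0. \<forall>s'. \<bar>s' - s\<bar> < \<delta> \<longrightarrow> (\<forall>\<kappa>\<in>{0..1}. \<bar>ml_kernel \<alpha> \<kappa> \<alpha> s' - ml_kernel \<alpha> \<kappa> \<alpha> s\<bar> \<le> \<epsilon>)"
proof -
  let ?K = "{s / 2..2 * s} \<times> {0..1::real}" and ?f = "\<lambda>p. ml_kernel \<alpha> (snd p) \<alpha> (fst p)"
  have "continuous_on ?K ?f"
    unfolding ml_kernel_def
    by (intro continuous_intros continuous_on_compose2[OF continuous_on_mittag_leffler[OF \<alpha> \<alpha>(1), of UNIV]])
      (use s \<alpha> in auto)
  then have "uniformly_continuous_on ?K ?f"
    by (intro compact_uniformly_continuous compact_Times) auto
  then obtain d where d: "0 < d"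
    "\<And>p q. p \<in> ?K \<Longrightarrow> q \<in> ?K \<Longrightarrow> dist q p < d \<Longrightarrow> dist (?f q) (?f p) < \<epsilon>"
    unfolding uniformly_continuous_on_def using \<epsilon> by meson
  show ?thesis
  proof (intro exI[of _ "min d (s / 2)"] conjI allI impI ballI)
    show "0 < min d (s / 2)" using d s by simp
    fix s' \<kappa> assume s': "\<bar>s' - s\<bar> < min d (s / 2)" and \<kappa>: "\<kappa> \<in> {0..1::real}"
    have "(s, \<kappa>) \<in> ?K" using s \<kappa> by auto
    moreover have "s / 2 \<le> s'" "s' \<le> 2 * s" using s s' by linarith+
    then have "(s', \<kappa>) \<in> ?K" using \<kappa> by simp
    moreover have "dist (s', \<kappa>) (s, \<kappa>) < d" using s' by (simp add: dist_Pair_Pair dist_real_def)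
    ultimately have "dist (?f (s', \<kappa>)) (?f (s, \<kappa>)) < \<epsilon>" by (rule d(2))
    then show "\<bar>ml_kernel \<alpha> \<kappa> \<alpha> s' - ml_kernel \<alpha> \<kappa> \<alpha> s\<bar> \<le> \<epsilon>" by (simp add: dist_real_def)
  qed
qed

text \<open>The multipliers are required to be continuous uniformly in the index, that is, in
  operator norm; applied to a continuous curve they then give a continuous curve.\<close>

lemma ell2_mult_continuous_on:
  fixes m :: "'a :: metric_space \<Rightarrow> nat \<Rightarrow> real"
  assumes m: "\<And>x \<epsilon>. x \<in> S \<Longrightarrow> 0 < \<epsilon> \<Longrightarrow> \<exists>\<delta>>0. \<forall>x'\<in>S. dist x' x < \<delta> \<longrightarrow> (\<forall>k. \<bar>m x' k - m x k\<bar> \<le> \<epsilon>)"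
    and b: "\<And>x k. x \<in> S \<Longrightarrow> \<bar>m x k\<bar> \<le> B x"
    and h: "continuous_on S h"
  shows "continuous_on S (\<lambda>x. ell2_mult (m x) (h x))"
  unfolding continuous_on_iff
proof (intro ballI allI impI)
  fix x and \<epsilon> :: real assume x: "x \<in> S" and \<epsilon>: "0 < \<epsilon>"
  have B: "0 \<le> B x" using b[OF x, of 0] by linarith
  define N where "N = norm (h x) + 1"
  have N: "0 < N" unfolding N_def by (intro add_nonneg_pos) auto
  \<comment> \<open>One third of \<epsilon> for each of two error terms. The bound 1 in \<epsilon>2
    keeps |h| below N near x, and B x + 1 avoids a division by zero.\<close>
  define \<epsilon>1 where "\<epsilon>1 = \<epsilon> / (3 * N)"
  define \<epsilon>2 where "\<epsilon>2 = min 1 (\<epsilon> / (3 * (B x + 1)))"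
  have e: "0 < \<epsilon>1" "0 < \<epsilon>2" using \<epsilon> N B by (auto simp: \<epsilon>1_def \<epsilon>2_def)
  obtain d1 where d1: "0 < d1" "\<And>x' k. x' \<in> S \<Longrightarrow> dist x' x < d1 \<Longrightarrow> \<bar>m x' k - m x k\<bar> \<le> \<epsilon>1"
    using m[OF x e(1)] by blast
  obtain d2 where d2: "0 < d2" "\<And>x'. x' \<in> S \<Longrightarrow> dist x' x < d2 \<Longrightarrow> dist (h x') (h x) < \<epsilon>2"
    using h x e(2) unfolding continuous_on_iff by blast
  show "\<exists>d>0. \<forall>x'\<in>S. dist x' x < d \<longrightarrow> dist (ell2_mult (m x') (h x')) (ell2_mult (m x) (h x)) < \<epsilon>"
  proof (intro exI[of _ "min d1 d2"] conjI ballI impI)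
    show "0 < min d1 d2" using d1 d2 by simp
    fix x' assume x': "x' \<in> S" "dist x' x < min d1 d2"
    have k1: "\<bar>m x' k - m x k\<bar> \<le> \<epsilon>1" for k using d1(2)[OF x'(1)] x'(2) by simp
    have k2: "norm (h x' - h x) < \<epsilon>2" using d2(2)[OF x'(1)] x'(2) by (simp add: dist_norm)
    have "ell2_mult (m x') (h x') - ell2_mult (m x) (h x)
        = ell2_mult (\<lambda>k. m x' k - m x k) (h x') + ell2_mult (m x) (h x' - h x)"
      by (rule ell2_eqI)
        (simp add: ell2_mult_bounded(1)[OF k1] ell2_mult_bounded(1)[OF b[OF x]]
          ell2_mult_bounded(1)[OF b[OF x'(1)]] algebra_simps)
    then have "dist (ell2_mult (m x') (h x')) (ell2_mult (m x) (h x))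
        \<le> norm (ell2_mult (\<lambda>k. m x' k - m x k) (h x')) + norm (ell2_mult (m x) (h x' - h x))"
      by (simp only: dist_norm norm_triangle_ineq)
    also have "\<dots> \<le> \<epsilon>1 * norm (h x') + B x * norm (h x' - h x)"
      by (intro add_mono ell2_mult_bounded(2) k1 b x)
    also have "\<dots> \<le> \<epsilon>1 * N + B x * (\<epsilon> / (3 * (B x + 1)))"
    proof (intro add_mono mult_left_mono B)
      have "norm (h x') \<le> norm (h x) + norm (h x' - h x)" using norm_triangle_ineq[of "h x" "h x' - h x"] by simp
      then show "norm (h x') \<le> N" using k2 by (simp add: N_def \<epsilon>2_def)
      show "norm (h x' - h x) \<le> \<epsilon> / (3 * (B x + 1))" using k2 by (simp add: \<epsilon>2_def)
    qed (use e in simp)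
    also have "\<epsilon>1 * N = \<epsilon> / 3" using N by (simp add: \<epsilon>1_def)
    also have "\<epsilon> / 3 + B x * (\<epsilon> / (3 * (B x + 1))) < \<epsilon>"
    proof -
      have "B x / (B x + 1) \<le> 1" using B by simp
      then have "B x / (B x + 1) * (\<epsilon> / 3) \<le> 1 * (\<epsilon> / 3)" using \<epsilon> by (intro mult_right_mono) auto
      moreover have "B x * (\<epsilon> / (3 * (B x + 1))) = B x / (B x + 1) * (\<epsilon> / 3)" by simp
      ultimately show ?thesis using \<epsilon> by linarith
    qed
    finally show "dist (ell2_mult (m x') (h x')) (ell2_mult (m x) (h x)) < \<epsilon>" .
  qed
qed

context dirichlet_domain
begin

section \<open>Continuity of curves under \<open>enc\<close> and \<open>dec\<close>\<close>

lemma continuous_into_enc: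
  assumes u: "continuous_into D1 N1 {0..T} u"
  shows "continuous_on {0..T} (\<lambda>t. enc (u t))"
  unfolding continuous_on_def
proof
  fix t assume t: "t \<in> {0..T}"
  have uD: "u s \<in> D1" if "s \<in> {0..T}" for s using u that by (auto simp: continuous_into_def)
  have lim: "((\<lambda>s. N1 (\<lambda>x. u s x - u t x)) \<longlongrightarrow> 0) (at t within {0..T})"
    using u t by (auto simp: continuous_into_def)
  have "((\<lambda>s. enc (u s) - enc (u t)) \<longlongrightarrow> 0) (at t within {0..T})"
  proof (rule Lim_null_comparison)
    show "((\<lambda>s. Kn * N1 (\<lambda>x. u s x - u t x)) \<longlongrightarrow> 0) (at t within {0..T})"
      using tendsto_mult_left[OF lim, of Kn] by simp
    show "\<forall>\<^sub>F s in at t within {0..T}. norm (enc (u s) - enc (u t)) \<le> Kn * N1 (\<lambda>x. u s x - u t x)"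
      unfolding eventually_at_filter
    proof (rule always_eventually, intro allI impI)
      fix s assume "s \<in> {0..T}"
      from D1_diff[OF uD[OF this] uD[OF t]]
      show "norm (enc (u s) - enc (u t)) \<le> Kn * N1 (\<lambda>x. u s x - u t x)"
        using norm_enc_le by metis
    qed
  qed
  then show "((\<lambda>s. enc (u s)) \<longlongrightarrow> enc (u t)) (at t within {0..T})" by (rule LIM_zero_cancel)
qed

lemma continuous_into_dec:
  assumes y: "continuous_on UNIV y"
  shows "continuous_into D1 N1 J (\<lambda>t. dec (y t))"
  unfolding continuous_into_def
proof (intro ballI conjI dec_props(1))
  fix t :: real
  have "continuous (at t within J) y" using continuous_on_subset[OF y subset_UNIV, of J] y
    by (simp add: continuous_on_eq_continuous_at continuous_at_imp_continuous_within)
  then have lim: "((\<lambda>s. norm (y s - y t)) \<longlongrightarrow> 0) (at t within J)"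
    unfolding continuous_within by (intro tendsto_norm_zero LIM_zero)
  show "((\<lambda>s. N1 (\<lambda>x. dec (y s) x - dec (y t) x)) \<longlongrightarrow> 0) (at t within J)"
  proof (rule tendsto_sandwich[OF _ _ tendsto_const lim])
    have D: "(\<lambda>x. dec (y s) x - dec (y t) x) \<in> D1" "enc (\<lambda>x. dec (y s) x - dec (y t) x) = y s - y t" for s
      using D1_diff[OF dec_props(1) dec_props(1)] by (simp_all add: enc_dec)
    show "\<forall>\<^sub>F s in at t within J. 0 \<le> N1 (\<lambda>x. dec (y s) x - dec (y t) x)"
      by (intro always_eventually allI N1_nonneg D)
    show "\<forall>\<^sub>F s in at t within J. N1 (\<lambda>x. dec (y s) x - dec (y t) x) \<le> norm (y s - y t)"
      using N1_le_norm_enc[OF D(1)] by (intro always_eventually allI) (simp add: D(2))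
  qed
qed

context
  fixes \<alpha> :: real
  assumes \<alpha>: "0 < \<alpha>" "\<alpha> < 1"
begin

lemma abs_ml_relax_lam_le: "\<bar>ml_relax \<alpha> (lam k) t\<bar> \<le> mittag_leffler \<alpha> 1 (max 0 t powr \<alpha>)"
  unfolding ml_relax_def[OF \<alpha>]
  using lam_bounds[of k] by (intro abs_mittag_leffler_le \<alpha>) (auto simp: abs_mult mult_left_le_one_le)

text \<open>Both sides are the chosen sum of literally the same series, so they are equal as
  functions and not merely almost everywhere.\<close>

lemma S_op_eq_dec:
  assumes w: "w \<in> D1" and t: "0 \<le> t"
  shows "S_op \<Omega> \<theta> \<phi> \<alpha> t w = dec (ell2_mult (\<lambda>k. ml_relax \<alpha> (lam k) t) (enc w))"
proof -
  have "mittag_leffler \<alpha> 1 (- \<theta> k * t powr \<alpha> / (1 + \<theta> k)) * cf w k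
      = coord (ell2_mult (\<lambda>k. ml_relax \<alpha> (lam k) t) (enc w)) k / sqrt (1 + \<theta> k)" for k
    unfolding ell2_mult_bounded(1)[OF abs_ml_relax_lam_le] coord_enc[OF w]
    using theta_pos'[of k] t by (simp add: ml_relax_def[OF \<alpha>] lam_def)
  then show ?thesis unfolding S_op_def dec_def by presburger
qed

text \<open>The factor 1 / (1 + \<theta>_k) is divided evenly between \<open>Hseq\<close> and
  \<open>dec\<close>; as for \<open>S_op\<close>, the two series coincide term by term.\<close>

lemma R_op_eq_dec:
  assumes u: "u \<in> D1" and s: "0 < s"
  shows "R_op \<Omega> \<theta> \<phi> \<alpha> s (H_op \<Omega> \<eta> u) = dec (ell2_mult (\<lambda>k. ml_kernel \<alpha> (lam k) \<alpha> s) (Hseq \<eta> u))"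
proof -
  have r: "sqrt (1 + \<theta> k) * sqrt (1 + \<theta> k) = 1 + \<theta> k" for k using theta_pos'[of k] by simp
  have "s powr (\<alpha> - 1) / (1 + \<theta> k) * mittag_leffler \<alpha> \<alpha> (- \<theta> k * s powr \<alpha> / (1 + \<theta> k)) * H_op \<Omega> \<eta> u (\<phi> k)
      = coord (ell2_mult (\<lambda>k. ml_kernel \<alpha> (lam k) \<alpha> s) (Hseq \<eta> u)) k / sqrt (1 + \<theta> k)" for k
  proof -
    have "coord (ell2_mult (\<lambda>k. ml_kernel \<alpha> (lam k) \<alpha> s) (Hseq \<eta> u)) k / sqrt (1 + \<theta> k)
        = ml_kernel \<alpha> (lam k) \<alpha> s * H_op \<Omega> \<eta> u (\<phi> k) / (1 + \<theta> k)"
      unfolding ell2_mult_bounded(1)[OF abs_ml_kernel_le[OF \<alpha> lam_bounds(1,2) s order_refl]] coord_Hseq[OF u]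
      by (simp only: times_divide_eq_right divide_divide_eq_left r)
    then show ?thesis by (simp add: ml_kernel_def lam_def)
  qed
  then show ?thesis unfolding R_op_def dec_def by presburger
qed

text \<open>From left to right, coefficients are taken inside the Bochner integral. From right to
  left, the integral is forced to be u(t) - S(t) u0, and what has to be shown is that the Bochner
  integral exists with this value.\<close>

lemma mild_solution_at_iff:
  assumes u\<^sub>0: "u\<^sub>0 \<in> D1" and t: "0 \<le> t"
    and u: "\<And>s. 0 \<le> s \<Longrightarrow> s \<le> t \<Longrightarrow> u s \<in> D1" and y: "continuous_on UNIV y"
    and yu: "\<And>s. 0 \<le> s \<Longrightarrow> s \<le> t \<Longrightarrow> y s = enc (u s)"
  shows "(\<exists>I. has_bochner_integral_in D1 N1 (lebesgue_on {0<..<t}) (\<lambda>\<tau>. R_op \<Omega> \<theta> \<phi> \<alpha> (t - \<tau>) (H_op \<Omega> \<eta> (u \<tau>))) I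
        \<and> (AE x in lebesgue_on \<Omega>. u t x = S_op \<Omega> \<theta> \<phi> \<alpha> t u\<^sub>0 x + I x))
    \<longleftrightarrow> (\<forall>k. coord (y t) k = ml_relax \<alpha> (lam k) t * coord (enc u\<^sub>0) k
              + conv (ml_kernel \<alpha> (lam k) \<alpha>) (\<lambda>x. coord (Hseq \<eta> (dec (y x))) k) t)"
    (is "?L \<longleftrightarrow> ?R")
proof -
  let ?M = "lebesgue_on {0<..<t}" and ?F = "\<lambda>\<tau>. R_op \<Omega> \<theta> \<phi> \<alpha> (t - \<tau>) (H_op \<Omega> \<eta> (u \<tau>))"
    and ?S = "S_op \<Omega> \<theta> \<phi> \<alpha> t u\<^sub>0"
  define h where "h = (\<lambda>x. Hseq \<eta> (dec (y x)))"
  \<comment> \<open>The integrand in the sequence space, set to 0 from time t on, where the argument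
    of the kernel is no longer positive.\<close>
  define z where "z = (\<lambda>\<tau>. if \<tau> < t then ell2_mult (\<lambda>k. ml_kernel \<alpha> (lam k) \<alpha> (t - \<tau>)) (h \<tau>) else 0)"
  have h: "continuous_on UNIV h"
    unfolding h_def by (rule continuous_on_compose2[OF Hseq_dec_continuous y]) simp
  have hk: "continuous_on UNIV (\<lambda>x. coord (h x) k)" for k by (rule coord_continuous_on[OF h])
  have kb: "\<bar>ml_kernel \<alpha> (lam k) \<alpha> (t - \<tau>)\<bar> \<le> (t - \<tau>) powr (\<alpha> - 1) * mittag_leffler \<alpha> \<alpha> (t powr \<alpha>)"
    if "0 \<le> \<tau>" "\<tau> < t" for \<tau> k
    using that by (intro abs_ml_kernel_le \<alpha> lam_bounds) auto
  have kb': "\<bar>ml_kernel \<alpha> (lam k) \<alpha> (t - \<tau>)\<bar> \<le> (t - \<tau>) powr (\<alpha> - 1) * mittag_leffler \<alpha> \<alpha> ((t - \<tau>) powr \<alpha>)"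
    if "\<tau> < t" for \<tau> k
    using that by (intro abs_ml_kernel_le \<alpha> lam_bounds) auto
  have zk: "coord (z \<tau>) k = (if \<tau> < t then ml_kernel \<alpha> (lam k) \<alpha> (t - \<tau>) * coord (h \<tau>) k else 0)" for \<tau> k
    using ell2_mult_bounded(1)[OF kb'] by (auto simp: z_def)
  have F: "?F \<tau> = dec (z \<tau>)" if "0 < \<tau>" "\<tau> < t" for \<tau>
  proof -
    have "h \<tau> = Hseq \<eta> (u \<tau>)" using that by (simp add: h_def yu Hseq_enc u)
    then show ?thesis using that by (simp add: z_def R_op_eq_dec u)
  qed
  have zm: "(\<lambda>\<tau>. coord (z \<tau>) k) \<in> borel_measurable borel" for k
  proof -
    note [measurable] = continuous_measurable_real[OF hk[of k]]
      loc_kernelD(1)[OF loc_kernel_ml_kernel[OF \<alpha> \<alpha>(1)], of "lam k"]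
    show ?thesis unfolding zk by measurable
  qed
  have zi: "integrable ?M (\<lambda>\<tau>. coord (z \<tau>) k)"
    and zI: "(LINT \<tau>|?M. coord (z \<tau>) k) = conv (ml_kernel \<alpha> (lam k) \<alpha>) (\<lambda>x. coord (h x) k) t" for k
  proof -
    let ?k = "\<lambda>\<sigma>. indicator {0<..<t} \<sigma> * (ml_kernel \<alpha> (lam k) \<alpha> \<sigma> * coord (h (t - \<sigma>)) k)"
    have "integrable lborel ?k" by (rule conv_integrable[OF loc_kernel_ml_kernel[OF \<alpha> \<alpha>(1)] hk])
    from lborel_integrable_real_affine[OF this, of "-1" t]
    have "integrable lborel (\<lambda>\<tau>. ?k (t - \<tau>))" by simp
    also have "(\<lambda>\<tau>. ?k (t - \<tau>)) = (\<lambda>\<tau>. indicator {0<..<t} \<tau> * coord (z \<tau>) k)"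
      by (auto simp: fun_eq_iff indicator_def zk)
    finally show "integrable ?M (\<lambda>\<tau>. coord (z \<tau>) k)" by (simp only: lebesgue_on_interval_integral(1)[OF zm])
    have "(LINT \<tau>|?M. coord (z \<tau>) k) = conv (\<lambda>x. coord (h x) k) (ml_kernel \<alpha> (lam k) \<alpha>) t"
      unfolding lebesgue_on_interval_integral(2)[OF zm] conv_def
      by (intro Bochner_Integration.integral_cong refl) (auto simp: indicator_def zk)
    then show "(LINT \<tau>|?M. coord (z \<tau>) k) = conv (ml_kernel \<alpha> (lam k) \<alpha>) (\<lambda>x. coord (h x) k) t"
      by (simp only: conv_commute)
  qed
  have SD: "?S \<in> D1" and Sk: "coord (enc ?S) k = ml_relax \<alpha> (lam k) t * coord (enc u\<^sub>0) k" for k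
    unfolding S_op_eq_dec[OF u\<^sub>0 t]
    by (simp_all add: dec_props enc_dec ell2_mult_bounded(1)[OF abs_ml_relax_lam_le])
  have utD: "u t \<in> D1" and yt: "y t = enc (u t)" using t by (auto intro: u yu)
  show ?thesis
    unfolding h_def[THEN fun_cong, symmetric]
  proof
    assume ?L
    then obtain I where I: "has_bochner_integral_in D1 N1 ?M ?F I"
      and ae: "AE x in lebesgue_on \<Omega>. u t x = ?S x + I x" by blast
    have ID: "I \<in> D1" using I by (simp add: has_bochner_integral_in_def)
    show "\<forall>k. coord (y t) k = ml_relax \<alpha> (lam k) t * coord (enc u\<^sub>0) k
        + conv (ml_kernel \<alpha> (lam k) \<alpha>) (\<lambda>x. coord (h x) k) t"
    proof
      fix k
      note SI = D1_lincomb2[OF SD ID, of 1 1]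
      have cF: "cf (?F \<tau>) k = coord (z \<tau>) k / sqrt (1 + \<theta> k)" if "\<tau> \<in> space ?M" for \<tau>
        using that by (simp add: F dec_props)
      have "integrable ?M (\<lambda>\<tau>. coord (z \<tau>) k / sqrt (1 + \<theta> k))" by (intro integrable_divide_zero zi)
      then have Fi: "integrable ?M (\<lambda>\<tau>. cf (?F \<tau>) k)"
        by (subst Bochner_Integration.integrable_cong[OF refl cF]) auto
      have "cf I k = (LINT \<tau>|?M. cf (?F \<tau>) k)"
        by (rule bochner_integral_coeff[OF finite_measure_lebesgue_on_interval I Fi])
      also have "\<dots> = (LINT \<tau>|?M. coord (z \<tau>) k / sqrt (1 + \<theta> k))"
        by (rule Bochner_Integration.integral_cong[OF refl cF])
      also have "\<dots> = (LINT \<tau>|?M. coord (z \<tau>) k) / sqrt (1 + \<theta> k)" by simp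
      finally have cI: "coord (enc I) k = (LINT \<tau>|?M. coord (z \<tau>) k)"
        using theta_pos'[of k] by (simp add: coord_enc[OF ID])
      have "cf (u t) k = cf (\<lambda>x. 1 * ?S x + 1 * I x) k"
        using coeff_AE_cong[OF D1_L2[OF utD], of "\<lambda>x. 1 * ?S x + 1 * I x" k] ae by simp
      then have "coord (enc (u t)) k = coord (enc (\<lambda>x. 1 * ?S x + 1 * I x)) k"
        by (simp only: coord_enc[OF utD] coord_enc[OF SI(1)])
      also have "\<dots> = coord (enc ?S) k + coord (enc I) k" unfolding SI(2) by simp
      finally show "coord (y t) k = ml_relax \<alpha> (lam k) t * coord (enc u\<^sub>0) k
        + conv (ml_kernel \<alpha> (lam k) \<alpha>) (\<lambda>x. coord (h x) k) t"
        by (simp only: yt Sk cI zI)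
    qed
  next
    assume R: "\<forall>k. coord (y t) k = ml_relax \<alpha> (lam k) t * coord (enc u\<^sub>0) k
        + conv (ml_kernel \<alpha> (lam k) \<alpha>) (\<lambda>x. coord (h x) k) t"
    define I where "I = (\<lambda>x. u t x - ?S x)"
    have I: "I \<in> D1" "enc I = enc (u t) - enc ?S" unfolding I_def by (rule D1_diff[OF utD SD])+
    have cI: "coord (enc I) k = (LINT \<tau>|?M. coord (z \<tau>) k)" for k
      using R[rule_format, of k] by (simp add: I(2) yt Sk zI)
    have "bounded (h ` {0..t})"
      by (intro compact_imp_bounded compact_continuous_image continuous_on_subset[OF h]) auto
    then obtain C where C: "\<And>\<tau>. 0 \<le> \<tau> \<Longrightarrow> \<tau> \<le> t \<Longrightarrow> norm (h \<tau>) \<le> C" unfolding bounded_iff by fastforce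
    have C0: "0 \<le> C" using order_trans[OF norm_ge_zero C[OF order_refl t]] .
    have m0: "0 \<le> mittag_leffler \<alpha> \<alpha> (t powr \<alpha>)"
      using abs_mittag_leffler_le[OF \<alpha> \<alpha>(1), of 0 "t powr \<alpha>"] by simp
    have "has_bochner_integral_in D1 N1 ?M ?F I"
    proof (rule bochner_integral_exists[OF \<alpha> t _ _ _ zm F I(1) cI])
      show "0 \<le> mittag_leffler \<alpha> \<alpha> (t powr \<alpha>) * C" using m0 C0 by simp
      fix \<tau> assume \<tau>: "0 \<le> \<tau>" "\<tau> < t"
      have "norm (z \<tau>) \<le> ((t - \<tau>) powr (\<alpha> - 1) * mittag_leffler \<alpha> \<alpha> (t powr \<alpha>)) * norm (h \<tau>)"
        unfolding z_def using \<tau> ell2_mult_bounded(2)[OF kb[OF \<tau>]] by simp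
      also have "\<dots> \<le> ((t - \<tau>) powr (\<alpha> - 1) * mittag_leffler \<alpha> \<alpha> (t powr \<alpha>)) * C"
        using \<tau> m0 by (intro mult_left_mono C) auto
      finally show "norm (z \<tau>) \<le> mittag_leffler \<alpha> \<alpha> (t powr \<alpha>) * C * (t - \<tau>) powr (\<alpha> - 1)"
        by (simp only: mult_ac)
    next
      have "continuous_on {0..<t} (\<lambda>\<tau>. ell2_mult (\<lambda>k. ml_kernel \<alpha> (lam k) \<alpha> (t - \<tau>)) (h \<tau>))"
      proof (rule ell2_mult_continuous_on)
        fix \<tau> and \<epsilon> :: real assume \<tau>: "\<tau> \<in> {0..<t}" and \<epsilon>: "0 < \<epsilon>"
        have "0 < t - \<tau>" using \<tau> by simp
        from ml_kernel_equicontinuous[OF \<alpha> this \<epsilon>] obtain \<delta> where \<delta>: "0 < \<delta>"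
          "\<And>s' \<kappa>. \<bar>s' - (t - \<tau>)\<bar> < \<delta> \<Longrightarrow> \<kappa> \<in> {0..1} \<Longrightarrow> \<bar>ml_kernel \<alpha> \<kappa> \<alpha> s' - ml_kernel \<alpha> \<kappa> \<alpha> (t - \<tau>)\<bar> \<le> \<epsilon>"
          by blast
        show "\<exists>\<delta>>0. \<forall>x'\<in>{0..<t}. dist x' \<tau> < \<delta> \<longrightarrow>
            (\<forall>k. \<bar>ml_kernel \<alpha> (lam k) \<alpha> (t - x') - ml_kernel \<alpha> (lam k) \<alpha> (t - \<tau>)\<bar> \<le> \<epsilon>)"
        proof (intro exI[of _ \<delta>] conjI ballI impI allI)
          fix x' k assume "dist x' \<tau> < \<delta>"
          then have "\<bar>(t - x') - (t - \<tau>)\<bar> < \<delta>" by (simp add: dist_real_def)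
          then show "\<bar>ml_kernel \<alpha> (lam k) \<alpha> (t - x') - ml_kernel \<alpha> (lam k) \<alpha> (t - \<tau>)\<bar> \<le> \<epsilon>"
            by (rule \<delta>(2)) (use lam_bounds[of k] in simp)
        qed (rule \<delta>(1))
      next
        fix \<tau> k assume "\<tau> \<in> {0..<t}"
        then show "\<bar>ml_kernel \<alpha> (lam k) \<alpha> (t - \<tau>)\<bar> \<le> (t - \<tau>) powr (\<alpha> - 1) * mittag_leffler \<alpha> \<alpha> (t powr \<alpha>)"
          by (intro kb) auto
      qed (rule continuous_on_subset[OF h subset_UNIV])
      then show "continuous_on {0..<t} z"
        by (rule continuous_on_eq) (simp add: z_def)
    qed
    then show ?L by (intro exI[of _ I] conjI) (auto simp: I_def)
  qed
qed

text \<open>\<open>resolvent_equation_iff\<close> for each coordinate with \<kappa> =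
  \<open>lam k\<close>. It is an equivalence on whole intervals and not at single times, hence the
  exchange of the quantifiers over t and k.\<close>

lemma mild_solution_iff:
  assumes u\<^sub>0: "u\<^sub>0 \<in> D1" and u: "continuous_into D1 N1 {0..T} u" and y: "continuous_on UNIV y"
    and yu: "\<And>s. 0 \<le> s \<Longrightarrow> s \<le> T \<Longrightarrow> y s = enc (u s)"
  shows "mild_solution \<Omega> \<theta> \<phi> \<alpha> \<eta> u\<^sub>0 T u
    \<longleftrightarrow> (\<forall>t\<in>{0..T}. y t = enc u\<^sub>0 + frac_int \<alpha> (\<lambda>x. field \<eta> (y x)) t)"
proof -
  have uD: "u s \<in> D1" if "0 \<le> s" "s \<le> T" for s using u that by (auto simp: continuous_into_def)
  have h: "continuous_on UNIV (\<lambda>x. Hseq \<eta> (dec (y x)))"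
    by (rule continuous_on_compose2[OF Hseq_dec_continuous y]) simp
  have f: "continuous_on UNIV (\<lambda>x. field \<eta> (y x))"
    by (rule continuous_on_compose2[OF locally_Lipschitz_continuous[OF field_Lipschitz] y]) simp
  have "mild_solution \<Omega> \<theta> \<phi> \<alpha> \<eta> u\<^sub>0 T u \<longleftrightarrow> (\<forall>t\<in>{0..T}. \<forall>k.
      coord (y t) k = ml_relax \<alpha> (lam k) t * coord (enc u\<^sub>0) k
              + conv (ml_kernel \<alpha> (lam k) \<alpha>) (\<lambda>x. coord (Hseq \<eta> (dec (y x))) k) t)"
    unfolding mild_solution_def
    using u by (auto simp: mild_solution_at_iff[OF u\<^sub>0 _ uD y yu])
  also have "\<dots> \<longleftrightarrow> (\<forall>k. \<forall>t\<in>{0..T}. coord (y t) k = coord (enc u\<^sub>0) k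
      + conv (pow_kernel \<alpha>) (\<lambda>x. coord (Hseq \<eta> (dec (y x))) k - lam k * coord (y x) k) t)"
    unfolding resolvent_equation_iff[OF \<alpha> coord_continuous_on[OF h] coord_continuous_on[OF y], symmetric] by blast
  also have "\<dots> \<longleftrightarrow> (\<forall>k. \<forall>t\<in>{0..T}. coord (y t) k = coord (enc u\<^sub>0 + frac_int \<alpha> (\<lambda>x. field \<eta> (y x)) t) k)"
  proof -
    have "coord (frac_int \<alpha> (\<lambda>x. field \<eta> (y x)) t) k
        = conv (pow_kernel \<alpha>) (\<lambda>x. coord (Hseq \<eta> (dec (y x))) k - lam k * coord (y x) k) t" for k t
      using frac_int_inner[OF \<alpha> f, of "Abs_ell2 (\<lambda>j. if j = k then 1 else 0)" t]
      by (simp add: ell2_unit_inner field_def lam_mult)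
    then show ?thesis by simp
  qed
  also have "\<dots> \<longleftrightarrow> (\<forall>t\<in>{0..T}. y t = enc u\<^sub>0 + frac_int \<alpha> (\<lambda>x. field \<eta> (y x)) t)"
    by (auto intro: ell2_eqI)
  finally show ?thesis .
qed

theorem unique_mild_solution_global:
  assumes u\<^sub>0: "u\<^sub>0 \<in> D1" and T: "0 < T"
  shows "unique_mild_solution_exists \<Omega> \<theta> \<phi> \<alpha> \<eta> u\<^sub>0 T"
proof -
  have T0: "0 \<le> T" using T by simp
  obtain y where y: "continuous_on UNIV y"
    and eq: "\<And>t. 0 \<le> t \<Longrightarrow> t \<le> T \<Longrightarrow> y t = enc u\<^sub>0 + frac_int \<alpha> (\<lambda>x. field \<eta> (y x)) t"
    using frac_equation_global_existence[OF \<alpha> field_Lipschitz field_dissipative T0] by blast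
  define u where "u = (\<lambda>t. dec (y t))"
  have "mild_solution \<Omega> \<theta> \<phi> \<alpha> \<eta> u\<^sub>0 T u"
    using mild_solution_iff[OF u\<^sub>0 continuous_into_dec[OF y, of "{0..T}"] y, of \<eta>] eq
    by (simp add: u_def enc_dec)
  moreover have "AE x in lebesgue_on \<Omega>. v t x = u t x"
    if v: "mild_solution \<Omega> \<theta> \<phi> \<alpha> \<eta> u\<^sub>0 T v" and t: "t \<in> {0..T}" for v t
  proof -
    have vc: "continuous_into D1 N1 {0..T} v" using v by (simp add: mild_solution_def)
    \<comment> \<open>A competitor is controlled on [0, T] only; freezing time outside extends its
      image under \<open>enc\<close> continuously to the line.\<close>
    define c where "c = (\<lambda>s. max 0 (min s T))"
    define w where "w = (\<lambda>s. enc (v (c s)))"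
    have "continuous_on UNIV c" unfolding c_def by (intro continuous_intros)
    then have w: "continuous_on UNIV w"
      unfolding w_def by (rule continuous_on_compose2[OF continuous_into_enc[OF vc]]) (use T in \<open>auto simp: c_def\<close>)
    have wv: "w s = enc (v s)" if "0 \<le> s" "s \<le> T" for s using that by (simp add: w_def c_def)
    have "w s = enc u\<^sub>0 + frac_int \<alpha> (\<lambda>x. field \<eta> (w x)) s" if "0 \<le> s" "s \<le> T" for s
      using mild_solution_iff[OF u\<^sub>0 vc w wv, of \<eta>] v that by simp
    then have "y t = w t"
      using t by (intro frac_equation_unique[OF \<alpha> field_Lipschitz y eq w]) auto
    then have "enc (v t) = enc (u t)" using t by (simp add: wv u_def enc_dec)
    moreover have "v t \<in> D1" using vc t by (simp add: continuous_into_def)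
    moreover have "u t \<in> D1" unfolding u_def by (rule dec_props)
    ultimately show ?thesis by (intro enc_eq_imp_AE)
  qed
  ultimately show ?thesis unfolding unique_mild_solution_exists_def by blast
qed

end

end

theorem theorem3p7:
  fixes \<Omega> :: "(real ^ 'n) set"
    and \<alpha> :: real
    and \<eta> :: "real ^ 'n"
    and \<theta> :: "nat \<Rightarrow> real"
    and \<phi> :: "nat \<Rightarrow> real ^ 'n \<Rightarrow> real"
    and u\<^sub>0 :: "real ^ 'n \<Rightarrow> real"
    and u :: "real \<Rightarrow> real ^ 'n \<Rightarrow> real"
  assumes "0 < \<alpha>" and "\<alpha> < 1"
    and "CARD('n) \<in> {2, 3, 4}"
    and "bounded_domain \<Omega>" and "has_C_k_boundary 2 \<Omega>"
    and "dirichlet_eigensystem \<Omega> \<theta> \<phi>"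
    and "u\<^sub>0 \<in> D_space \<Omega> \<theta> \<phi> 1"
    and "\<And>T. 0 < T \<Longrightarrow> unique_mild_solution_exists \<Omega> \<theta> \<phi> \<alpha> \<eta> u\<^sub>0 T \<Longrightarrow>
              mild_solution \<Omega> \<theta> \<phi> \<alpha> \<eta> u\<^sub>0 T u"
  shows "T_max \<Omega> \<theta> \<phi> \<alpha> \<eta> u\<^sub>0 = \<infinity> \<or>
         (\<exists>T. T_max \<Omega> \<theta> \<phi> \<alpha> \<eta> u\<^sub>0 = ereal T \<and>
              filterlim (\<lambda>t. D_norm \<Omega> \<theta> \<phi> 1 (u t)) at_top (at_left T))"
proof -
  interpret dirichlet_domain \<Omega> \<theta> \<phi>
    using assms(3,4,6) by unfold_locales auto
  have "{T. 0 < T \<and> unique_mild_solution_exists \<Omega> \<theta> \<phi> \<alpha> \<eta> u\<^sub>0 T} = {0<..}"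
    using unique_mild_solution_global[OF assms(1,2,7)] by auto
  \<comment> \<open>\<open>max 1 B\<close> is an admissible time: positive and at least B.\<close>
  moreover have "ereal B \<le> (SUP T\<in>{0<..}. ereal T)" for B
    by (rule SUP_upper2[of "max 1 B"]) auto
  then have "(SUP T\<in>{0<..}. ereal T) = \<infinity>"
    using ereal_top by blast
  ultimately show ?thesis by (simp add: T_max_def)
qed

end
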